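(* Let $R$ be an irreducible reduced crystallographic root system of rank $n$, with Weyl group $(W,S)$, affine Weyl group $(\tilde W,\tilde S)$, positive roots $R^+$ and Coxeter number $h$. Then $$\mathrm{Alt}(W)(u)=\prod_{a\in R^+,\ I(a)=S}\frac{1-u^{ht(a)+1}}{1-u^{ht(a)}}$$ and $$\mathrm{Alt}(\tilde W)(u)=\frac{1}{(1-u^h)^n}\prod_{a\in R^+,\ I(1-a)=\tilde S}\frac{1-u^{h-ht(a)+1}}{1-u^{h-ht(a)}}.$$
   Context: Let $B=\{a_1,\dots,a_n\}$ be the simple roots of $R$, $\theta$ the highest root, and $a_0=1-\theta$ the additional simple affine root, so $\tilde B=B\cup\{a_0\}$ is a base of the affine root system $\tilde R$. The simple reflections $S$ (resp. $\tilde S$) are identified with $B$ (resp. $\tilde B$). For an affine root $a=\sum_{i=0}^nc_ia_i$ (all $c_i$ integers of the same sign), $ht(a)=\sum_ic_i$ and $I(a)=\{a_i\in\tilde B: c_i\ne0\}$; the constant function $1=a_0+\theta$ has height $h$. For a Coxeter system $(X,Y)$ with length $\ell$, $X_I$ denotes the subgroup generated by $I\subseteq Y$, $X_I(u)=\sum_{x\in X_I}u^{\ell(x)}$, and $\mathrm{Alt}(X)(u)=\prod_{I\subseteq Y}X_I(u)^{(-1)^{|I|+|Y|}}$. *)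

theory Defs
  imports "HOL-Analysis.Analysis" "HOL-Computational_Algebra.Formal_Power_Series"
begin

section \<open>Root systems (roots realised in a Euclidean space V, V* identified with V)\<close>

definition root_refl :: "'a::euclidean_space \<Rightarrow> 'a \<Rightarrow> 'a" where
  "root_refl a x = x - ((2 * (x \<bullet> a)) / (a \<bullet> a)) *\<^sub>R a"

text \<open>Reduced crystallographic root system spanning V (so the rank is DIM('a)).\<close>
definition root_system :: "'a::euclidean_space set \<Rightarrow> bool" where
  "root_system R \<longleftrightarrow> finite R \<and> 0 \<notin> R \<and> span R = UNIV \<and>
     (\<forall>a\<in>R. root_refl a ` R = R) \<and>
     (\<forall>a\<in>R. \<forall>b\<in>R. (2 * (b \<bullet> a)) / (a \<bullet> a) \<in> \<int>)"

definition reduced :: "'a::euclidean_space set \<Rightarrow> bool" where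
  "reduced R \<longleftrightarrow> (\<forall>a\<in>R. \<forall>c::real. c *\<^sub>R a \<in> R \<longrightarrow> c = 1 \<or> c = -1)"

definition irreducible_rs :: "'a::euclidean_space set \<Rightarrow> bool" where
  "irreducible_rs R \<longleftrightarrow> \<not> (\<exists>R1 R2. R1 \<noteq> {} \<and> R2 \<noteq> {} \<and> R = R1 \<union> R2 \<and> R1 \<inter> R2 = {} \<and>
       (\<forall>a\<in>R1. \<forall>b\<in>R2. a \<bullet> b = 0))"

definition is_base :: "'a::euclidean_space set \<Rightarrow> 'a set \<Rightarrow> bool" where
  "is_base R B \<longleftrightarrow> B \<subseteq> R \<and> independent B \<and>
     (\<forall>a\<in>R. \<exists>c::'a \<Rightarrow> int. a = (\<Sum>b\<in>B. of_int (c b) *\<^sub>R b) \<and>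
         ((\<forall>b\<in>B. c b \<ge> 0) \<or> (\<forall>b\<in>B. c b \<le> 0)))"

text \<open>Coefficient of the simple root b in a (an integer for roots, by the base property).\<close>
definition coeff :: "'a::euclidean_space set \<Rightarrow> 'a \<Rightarrow> 'a \<Rightarrow> int" where
  "coeff B a b = \<lfloor>real_vector.representation B a b\<rfloor>"

definition ht :: "'a::euclidean_space set \<Rightarrow> 'a \<Rightarrow> int" where
  "ht B a = (\<Sum>b\<in>B. coeff B a b)"

definition supp :: "'a::euclidean_space set \<Rightarrow> 'a \<Rightarrow> 'a set" where
  "supp B a = {b\<in>B. coeff B a b \<noteq> 0}"

definition pos_roots :: "'a::euclidean_space set \<Rightarrow> 'a set \<Rightarrow> 'a set" where
  "pos_roots R B = {a\<in>R. \<forall>b\<in>B. coeff B a b \<ge> 0}"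

definition highest_root :: "'a::euclidean_space set \<Rightarrow> 'a set \<Rightarrow> 'a" where
  "highest_root R B = (SOME t. t \<in> R \<and> (\<forall>a\<in>R. \<forall>b\<in>B. coeff B a b \<le> coeff B t b))"

definition word_elt :: "('g \<Rightarrow> 'v \<Rightarrow> 'v) \<Rightarrow> 'g list \<Rightarrow> 'v \<Rightarrow> 'v" where
  "word_elt s ws = foldr (\<lambda>g f. s g \<circ> f) ws id"

definition gen_subgroup :: "('g \<Rightarrow> 'v \<Rightarrow> 'v) \<Rightarrow> 'g set \<Rightarrow> ('v \<Rightarrow> 'v) set" where
  "gen_subgroup s I = {word_elt s ws | ws. set ws \<subseteq> I}"

definition cox_len :: "('g \<Rightarrow> 'v \<Rightarrow> 'v) \<Rightarrow> 'g set \<Rightarrow> ('v \<Rightarrow> 'v) \<Rightarrow> nat" where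
  "cox_len s S w = (LEAST k. \<exists>ws. set ws \<subseteq> S \<and> length ws = k \<and> word_elt s ws = w)"

definition poincare :: "('g \<Rightarrow> 'v \<Rightarrow> 'v) \<Rightarrow> 'g set \<Rightarrow> 'g set \<Rightarrow> real fps" where
  "poincare s S I = Abs_fps (\<lambda>k. real (card {x \<in> gen_subgroup s I. cox_len s S x = k}))"

definition Alt :: "('g \<Rightarrow> 'v \<Rightarrow> 'v) \<Rightarrow> 'g set \<Rightarrow> real fps" where
  "Alt s S = (\<Prod>I\<in>Pow S. if even (card I + card S) then poincare s S I
                            else inverse (poincare s S I))"

definition weyl_gen :: "'a::euclidean_space \<Rightarrow> 'a \<Rightarrow> 'a" where
  "weyl_gen b = root_refl b"

text \<open>Affine root (alpha, k) is the affine function x |-> alpha . x + k on V;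
  its reflection is the orthogonal reflection in its zero set.\<close>
definition aff_refl :: "'a::euclidean_space \<times> int \<Rightarrow> 'a \<Rightarrow> 'a" where
  "aff_refl ak x = (let (a, k) = ak in x - (((a \<bullet> x) + of_int k) * 2 / (a \<bullet> a)) *\<^sub>R a)"

text \<open>Affine simple reflections indexed by B-tilde = {None} (for a_0 = 1 - theta) plus Some ` B.\<close>
definition aff_gen :: "'a::euclidean_space set \<Rightarrow> 'a set \<Rightarrow> 'a option \<Rightarrow> 'a \<Rightarrow> 'a" where
  "aff_gen R B i = (case i of None \<Rightarrow> aff_refl (- highest_root R B, 1)
                            | Some b \<Rightarrow> aff_refl (b, 0))"

definition aff_simple :: "'a set \<Rightarrow> 'a option set" where
  "aff_simple B = insert None (Some ` B)"

text \<open>Coefficients of the affine root alpha + k = k a_0 + (k theta + alpha) in the base B-tilde.\<close>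
definition aff_coeff :: "'a::euclidean_space set \<Rightarrow> 'a set \<Rightarrow> 'a \<times> int \<Rightarrow> 'a option \<Rightarrow> int" where
  "aff_coeff R B ak i = (let (a, k) = ak in
     case i of None \<Rightarrow> k | Some b \<Rightarrow> k * coeff B (highest_root R B) b + coeff B a b)"

definition aff_supp :: "'a::euclidean_space set \<Rightarrow> 'a set \<Rightarrow> 'a \<times> int \<Rightarrow> 'a option set" where
  "aff_supp R B ak = {i \<in> aff_simple B. aff_coeff R B ak i \<noteq> 0}"

definition coxeter_number :: "'a::euclidean_space set \<Rightarrow> nat" where
  "coxeter_number B = (let c = word_elt weyl_gen (SOME bs. distinct bs \<and> set bs = B)
                       in LEAST m. m > 0 \<and> (c ^^ m) = id)"

end

theory Submission
  imports Defs "HOL-Computational_Algebra.Polynomial_FPS"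
begin

text \<open>Length generating functions are computed from the action on positive roots. Macdonald's identity, which follows from the
  Weyl denominator formula, evaluates at the height grading to \<open>W(u) = \<Prod>(1 - u\<^sup>h\<^sup>+\<^sup>1)/(1 - u\<^sup>h)\<close> over positive roots of
  height \<open>h\<close>; the alternating product over parabolic subgroups is then a Moebius inversion over supports. In the affine case only
  proper parabolics are finite, and the full group needs Bott's formula: writing affine elements as translations times \<open>W\<close> turns the
  length generating function into \<open>W(u)\<close> times a sum over dominant elements of the coroot lattice, which is summed by a
  Hall--Littlewood expansion of a Weyl-invariant product. Comparing Macdonald's identity for \<open>R\<close> and its dual shows that both have
  the same height statistics, and the vanishing at roots of unity of orbit generating functions gives the duality
  \<open>n(g - m) + n(m + 1) = rank\<close> for the number \<open>n(j)\<close> of positive roots of height \<open>j\<close>, where \<open>g - 1\<close> is the height of the highest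
  root. Counting orbits of a Coxeter element on roots identifies \<open>g\<close> with the Coxeter number.\<close>

text \<open>Exponentials are evaluated at a real point \<open>z\<close> and lengths at a real
  \<open>0 < u < 1\<close>, instead of being formal; polynomials, and series of radius at least one,
  are determined by such values, which is the way back to power series. All counting is by heights
  of roots, so Bott's formula appears in an unusual shape: for the coroot system, with numerator
  factors \<open>1 - u^(m - 1)\<close> over nonsimple roots of height \<open>m\<close>. The equality
  of height statistics and the height duality exist in order to bring it to the form in which the
  affine series times \<open>(1 - u^h)^n\<close> is a product over all affine roots \<open>a\<close>
  and \<open>1 - a\<close> with \<open>a\<close> positive. Those without full support are exactly
  the ones that occur in proper parabolic subgroups, and the others are the claimed factors. In the
  vanishing at roots of unity long and short roots may need different weights, and the affine length
  weighs roots orthogonal to the translation differently from the rest; hence Macdonald's identity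
  and the coset sums carry a parameter for each root.\<close>

lemma word_elt_Nil [simp]: "word_elt s [] = id"
 and word_elt_Cons [simp]: "word_elt s (i # ws) = s i \<circ> word_elt s ws"
 by (simp_all add: word_elt_def)

lemma word_elt_append: "word_elt s (xs @ ys) = word_elt s xs \<circ> word_elt s ys"
 by (induction xs) (auto simp: comp_assoc)

lemma word_elt_in_gen [intro]: "set ws \<subseteq> I \<Longrightarrow> word_elt s ws \<in> gen_subgroup s I"
 by (auto simp: gen_subgroup_def)

lemma gen_subgroupE:
 assumes "w \<in> gen_subgroup s I"
 obtains ws where "set ws \<subseteq> I" "w = word_elt s ws"
 using assms by (auto simp: gen_subgroup_def)

lemma gen_subgroup_id [simp, intro]: "id \<in> gen_subgroup s I"
 using word_elt_in_gen[of "[]" I s] by simp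

lemma gen_subgroup_gen: "i \<in> I \<Longrightarrow> s i \<in> gen_subgroup s I"
 using word_elt_in_gen[of "[i]" I s] by simp

lemma gen_subgroup_comp: "v \<in> gen_subgroup s I \<Longrightarrow> w \<in> gen_subgroup s I \<Longrightarrow> v \<circ> w \<in> gen_subgroup s I"
proof (elim gen_subgroupE)
 fix a b assume "set a \<subseteq> I" "v = word_elt s a" "set b \<subseteq> I" "w = word_elt s b"
 then show ?thesis using word_elt_in_gen[of "a @ b" I s] by (auto simp: word_elt_append)
qed

lemma gen_subgroup_mono: "I \<subseteq> J \<Longrightarrow> gen_subgroup s I \<subseteq> gen_subgroup s J"
 by (auto simp: gen_subgroup_def)

lemma gen_subgroup_induct [consumes 1, case_names id step]:
 assumes "w \<in> gen_subgroup s I"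
  and "Q id" and "\<And>i w. i \<in> I \<Longrightarrow> w \<in> gen_subgroup s I \<Longrightarrow> Q w \<Longrightarrow> Q (s i \<circ> w)"
 shows "Q w"
proof -
 obtain ws where ws: "set ws \<subseteq> I" "w = word_elt s ws" using assms(1) by (rule gen_subgroupE)
 have "set ws \<subseteq> I \<Longrightarrow> Q (word_elt s ws)"
  by (induction ws) (auto intro!: assms(2,3))
 with ws show ?thesis by simp
qed

section \<open>Length as a number of inversions\<close>

text \<open>\<open>P\<close> holds functions on the space rather than vectors, and the group acts on
  them by composition. Linear forms then give the finite groups and affine forms the affine one,
  with a single proof of the length theory for both. The assumption \<open>conj\<close> is the
  relation between conjugate reflections in the form that the exchange argument uses.\<close>

locale reflection_system =
 fixes s :: "'g \<Rightarrow> 'v \<Rightarrow> 'v" and S :: "'g set" and P :: "('v \<Rightarrow> real) set"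
  and r :: "'g \<Rightarrow> 'v \<Rightarrow> real"
 assumes neg_notin: "f \<in> P \<Longrightarrow> (\<lambda>x. - f x) \<notin> P"
  and simple_pos: "i \<in> S \<Longrightarrow> r i \<in> P"
  and simple_refl: "i \<in> S \<Longrightarrow> r i \<circ> s i = (\<lambda>x. - r i x)"
  and perm: "i \<in> S \<Longrightarrow> f \<in> P \<Longrightarrow> f \<noteq> r i \<Longrightarrow> f \<circ> s i \<in> P"
  and conj: "i \<in> S \<Longrightarrow> j \<in> S \<Longrightarrow> w \<in> gen_subgroup s S \<Longrightarrow> r i \<circ> w = r j \<Longrightarrow> s i \<circ> w = w \<circ> s j"
  and invol: "i \<in> S \<Longrightarrow> s i \<circ> s i = id"
begin

abbreviation "G \<equiv> gen_subgroup s S"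

definition inversions :: "('v \<Rightarrow> 'v) \<Rightarrow> ('v \<Rightarrow> real) set" where
 "inversions w = {f \<in> P. f \<circ> w \<notin> P}"

lemma sign:
 assumes "w \<in> G" "f \<in> P"
 shows "f \<circ> w \<in> P \<or> (\<lambda>x. - (f (w x))) \<in> P"
 using assms
proof (induction arbitrary: f rule: gen_subgroup_induct)
 case id
 then show ?case by simp
next
 case (step i w)
 show ?case
 proof (cases "f = r i")
  case True
  have "f (s i x) = - f x" for x using simple_refl[OF step(1)] True by (metis comp_apply)
  moreover have "f \<circ> w \<in> P \<or> (\<lambda>x. - (f (w x))) \<in> P" using step by blast
  ultimately show ?thesis by (auto simp: comp_def)
 next
  case False
  with perm step have "f \<circ> s i \<in> P" by blast
  from step(3)[OF this] show ?thesis by (auto simp: comp_def)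
 qed
qed

lemma invol_app: "i \<in> S \<Longrightarrow> s i (s i x) = x"
 using invol by (metis comp_apply id_apply)

text \<open>Composition with \<open>s i\<close> permutes \<open>P\<close> without
  \<open>r i\<close>, so the inversions of \<open>w\<close> are carried over one to one, and
  \<open>r i\<close> is the only new one. A generator that keeps its own form positive therefore
  raises the count by exactly one.\<close>

lemma inversions_step:
 assumes i: "i \<in> S" and w: "w \<in> G" and pos: "r i \<circ> w \<in> P"
 shows "inversions (s i \<circ> w) = insert (r i) ((\<lambda>f. f \<circ> s i) ` inversions w)"
  and "r i \<notin> (\<lambda>f. f \<circ> s i) ` inversions w"
proof -
 have ri: "r i (s i x) = - r i x" for x using simple_refl[OF i] by (metis comp_apply)
 show n: "r i \<notin> (\<lambda>f. f \<circ> s i) ` inversions w"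
 proof
  assume "r i \<in> (\<lambda>f. f \<circ> s i) ` inversions w"
  then obtain f where f: "f \<in> inversions w" "r i = f \<circ> s i" by blast
  have "f x = - r i x" for x using ri[of x] invol_app[OF i] f(2) by (metis comp_apply)
  then have "f = (\<lambda>x. - r i x)" by auto
  with f(1) neg_notin[OF simple_pos[OF i]] show False by (simp add: inversions_def)
 qed
 show "inversions (s i \<circ> w) = insert (r i) ((\<lambda>f. f \<circ> s i) ` inversions w)"
 proof (intro set_eqI iffI)
  fix g assume g: "g \<in> inversions (s i \<circ> w)"
  show "g \<in> insert (r i) ((\<lambda>f. f \<circ> s i) ` inversions w)"
  proof (cases "g = r i")
   case False
   have "g \<circ> s i \<in> P" using perm[OF i] g False by (auto simp: inversions_def)
   moreover have "(g \<circ> s i) \<circ> w \<notin> P" using g by (auto simp: inversions_def comp_assoc)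
   moreover have "g = (g \<circ> s i) \<circ> s i" using invol_app[OF i] by (auto simp: comp_def)
   ultimately show ?thesis unfolding inversions_def by blast
  qed simp
 next
  fix g assume "g \<in> insert (r i) ((\<lambda>f. f \<circ> s i) ` inversions w)"
  then consider "g = r i" | f where "f \<in> inversions w" "g = f \<circ> s i" by blast
  then show "g \<in> inversions (s i \<circ> w)"
  proof cases
   case 1
   have "r i \<circ> (s i \<circ> w) = (\<lambda>x. - (r i \<circ> w) x)" using ri by auto
   with neg_notin[OF pos] show ?thesis using 1 simple_pos[OF i] by (simp add: inversions_def)
  next
   case (2 f)
   have "f \<noteq> r i" using 2 pos by (auto simp: inversions_def)
   then have "g \<in> P" using perm[OF i] 2 by (auto simp: inversions_def)
   moreover have "g \<circ> (s i \<circ> w) = f \<circ> w" using 2 invol_app[OF i] by (auto simp: comp_def)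
   ultimately show ?thesis using 2 by (auto simp: inversions_def)
  qed
 qed
qed

lemma inj_comp_s: "i \<in> S \<Longrightarrow> inj_on (\<lambda>f. f \<circ> s i) A"
 by (rule inj_onI) (metis comp_assoc invol comp_id)

lemma inversions_id [simp]: "inversions id = {}"
 by (auto simp: inversions_def)

lemma finite_inversions_step:
 assumes i: "i \<in> S" and w: "w \<in> G" and pos: "r i \<circ> w \<in> P"
 shows "finite (inversions (s i \<circ> w)) \<longleftrightarrow> finite (inversions w)"
  and "finite (inversions w) \<Longrightarrow> card (inversions (s i \<circ> w)) = Suc (card (inversions w))"
 unfolding inversions_step(1)[OF assms] using inversions_step(2)[OF assms]
 by (auto simp: finite_image_iff[OF inj_comp_s[OF i]] card_image[OF inj_comp_s[OF i]])

text \<open>The exchange condition. Letters are peeled off from the right until the form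
  \<open>r i\<close>, carried along the word, first leaves \<open>P\<close>; the letter responsible
  is the one whose own form it has become, and this letter is the one that \<open>s i\<close>
  cancels.\<close>

lemma deletion:
 assumes "i \<in> S" "set ws \<subseteq> S" "r i \<circ> word_elt s ws \<notin> P"
 shows "\<exists>ws'. set ws' \<subseteq> set ws \<and> Suc (length ws') = length ws \<and> s i \<circ> word_elt s ws = word_elt s ws'"
 using assms
proof (induction ws rule: rev_induct)
 case Nil
 then show ?case using simple_pos by simp
next
 case (snoc j ws)
 show ?case
 proof (cases "r i \<circ> word_elt s ws \<in> P")
  case False
  then obtain ws' where "set ws' \<subseteq> set ws" "Suc (length ws') = length ws"
   "s i \<circ> word_elt s ws = word_elt s ws'" using snoc(1)[OF snoc(2) _ False] snoc(3) unfolding set_append by blast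
  moreover from this have "s i \<circ> word_elt s (ws @ [j]) = word_elt s (ws' @ [j])"
   unfolding word_elt_append by (metis comp_assoc)
  ultimately show ?thesis by (intro exI[of _ "ws' @ [j]"] conjI) auto
 next
  case True
  have j: "j \<in> S" using snoc by auto
  have "(r i \<circ> word_elt s ws) \<circ> s j \<notin> P" using snoc(4) unfolding word_elt_append by (simp only: comp_assoc word_elt_Cons word_elt_Nil comp_id not_False_eq_True)
  \<comment> \<open>Among the forms in \<open>P\<close> only \<open>r j\<close> is sent out of
    \<open>P\<close> by \<open>s j\<close>. The assumption \<open>conj\<close> then carries
    \<open>s i\<close> through the word until it meets \<open>s j\<close>.\<close>
  then have "r i \<circ> word_elt s ws = r j" using perm[OF j True] by blast
  then have "s i \<circ> word_elt s ws = word_elt s ws \<circ> s j"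
   using conj[OF snoc(2) j] word_elt_in_gen[of ws S s] snoc(3) by auto
  then have "s i \<circ> word_elt s (ws @ [j]) = word_elt s ws"
   using invol[OF j] unfolding word_elt_append word_elt_Cons word_elt_Nil by (metis comp_assoc comp_id)
  then show ?thesis by (intro exI[of _ ws]) auto
 qed
qed

lemma cox_len_word:
 assumes "w \<in> gen_subgroup s I"
 obtains ws where "set ws \<subseteq> I" "word_elt s ws = w" "length ws = cox_len s I w"
proof -
 have "\<exists>k ws. set ws \<subseteq> I \<and> length ws = k \<and> word_elt s ws = w"
  using assms by (auto elim: gen_subgroupE)
 from LeastI_ex[OF this] show ?thesis using that unfolding cox_len_def by blast
qed

lemma cox_len_le: "set ws \<subseteq> I \<Longrightarrow> cox_len s I (word_elt s ws) \<le> length ws"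
 unfolding cox_len_def by (rule Least_le) auto

text \<open>A letter that does not raise the count could be removed by \<open>deletion\<close>, so
  in a shortest word every letter adds one inversion. Shortness is measured inside \<open>I\<close>
  while inversions refer to all of \<open>P\<close>; this is why the length in a parabolic subgroup
  agrees with the ambient length.\<close>

lemma reduced_card:
 assumes "I \<subseteq> S" "set ws \<subseteq> I" "length ws = cox_len s I (word_elt s ws)"
 shows "finite (inversions (word_elt s ws)) \<and> card (inversions (word_elt s ws)) = length ws"
 using assms(2,3)
proof (induction ws)
 case Nil
 then show ?case unfolding word_elt_Nil inversions_id by simp
next
 case (Cons i ws)
 let ?w = "word_elt s ws"
 have i: "i \<in> S" and I: "set ws \<subseteq> I" "set ws \<subseteq> S" "i \<in> I" using Cons assms by auto
 have "length ws \<le> cox_len s I ?w"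
 proof -
  obtain vs where vs: "set vs \<subseteq> I" "word_elt s vs = ?w" "length vs = cox_len s I ?w"
   using cox_len_word word_elt_in_gen[OF I(1)] by metis
  have "cox_len s I (word_elt s (i # vs)) \<le> length (i # vs)"
   by (rule cox_len_le) (use vs I in auto)
  then have "cox_len s I (s i \<circ> ?w) \<le> Suc (cox_len s I ?w)"
   unfolding word_elt_Cons vs(2) list.size vs(3) by linarith
  moreover have "Suc (length ws) = cox_len s I (s i \<circ> ?w)"
   using Cons(3) unfolding word_elt_Cons list.size by linarith
  ultimately show ?thesis by linarith
 qed
 then have min: "length ws = cox_len s I ?w" using cox_len_le[OF I(1)] by (simp add: le_antisym)
 note IH = Cons(1)[OF I(1) min]
 have "r i \<circ> ?w \<in> P"
 proof (rule ccontr)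
  assume "r i \<circ> ?w \<notin> P"
  from deletion[OF i I(2) this] obtain ws' where
   ws': "set ws' \<subseteq> set ws" "Suc (length ws') = length ws" "s i \<circ> ?w = word_elt s ws'" by blast
  have "cox_len s I (word_elt s ws') \<le> length ws'" by (rule cox_len_le) (use ws' I in auto)
  then show False using ws' Cons(3) by simp
 qed
 note fin = finite_inversions_step[OF i word_elt_in_gen[OF I(2)] this]
 have "finite (inversions (s i \<circ> ?w)) \<and> card (inversions (s i \<circ> ?w)) = Suc (length ws)"
  using fin IH by metis
 then show ?case unfolding word_elt_Cons list.size by (metis add_0_right add_Suc_right)
qed

lemma cox_len_eq:
 assumes "I \<subseteq> S" "w \<in> gen_subgroup s I"
 shows "cox_len s I w = card (inversions w)" "finite (inversions w)"
proof -
 obtain ws where "set ws \<subseteq> I" "word_elt s ws = w" "length ws = cox_len s I w"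
  using cox_len_word[OF assms(2)] .
 with reduced_card[OF assms(1), of ws] show "cox_len s I w = card (inversions w)" "finite (inversions w)"
  by auto
qed

lemma exists_descent:
 assumes "w \<in> G" "w \<noteq> id"
 shows "\<exists>i\<in>S. r i \<circ> w \<notin> P"
proof -
 obtain ws where ws: "set ws \<subseteq> S" "word_elt s ws = w" "length ws = cox_len s S w"
  using cox_len_word[OF assms(1)] .
 with assms obtain i vs where v: "ws = i # vs" by (cases ws) auto
 have i: "i \<in> S" and vs: "set vs \<subseteq> S" using ws v by auto
 have vG: "word_elt s vs \<in> G" using vs by auto
 have "r i \<circ> w \<notin> P"
 proof
  assume p: "r i \<circ> w \<in> P"
  have "s i \<circ> w = word_elt s vs" using ws(2) invol[OF i] unfolding v word_elt_Cons by (metis comp_assoc comp_id id_comp)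
  moreover have "card (inversions (s i \<circ> w)) = Suc (card (inversions w))"
   by (rule finite_inversions_step(2)[OF i assms(1) p]) (rule cox_len_eq(2)[OF _ assms(1)], simp)
  ultimately have "cox_len s S (word_elt s vs) = Suc (length ws)"
   using cox_len_eq(1)[OF _ vG] cox_len_eq(1)[OF _ assms(1)] ws by simp
  then show False using cox_len_le[OF vs] v by simp
 qed
 with i show ?thesis by blast
qed

lemma poincare_eq:
 assumes "I \<subseteq> S"
 shows "poincare s S I = Abs_fps (\<lambda>k. real (card {x \<in> gen_subgroup s I. card (inversions x) = k}))"
proof -
 have "{x \<in> gen_subgroup s I. cox_len s S x = k} = {x \<in> gen_subgroup s I. card (inversions x) = k}" for k
  using cox_len_eq(1)[of S] gen_subgroup_mono[OF assms, of s] by auto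
 then show ?thesis by (simp add: poincare_def)
qed

lemma finite_length_le:
 assumes "finite S"
 shows "finite {x \<in> G. card (inversions x) = k}"
proof (rule finite_subset)
 show "{x \<in> G. card (inversions x) = k} \<subseteq> word_elt s ` {ws. set ws \<subseteq> S \<and> length ws = k}"
 proof
  fix x assume x: "x \<in> {x \<in> G. card (inversions x) = k}"
  then obtain ws where "set ws \<subseteq> S" "word_elt s ws = x" "length ws = cox_len s S x"
   using cox_len_word by blast
  with x cox_len_eq(1)[of S x] show "x \<in> word_elt s ` {ws. set ws \<subseteq> S \<and> length ws = k}" by auto
 qed
 show "finite (word_elt s ` {ws. set ws \<subseteq> S \<and> length ws = k})"
  using finite_lists_length_eq[OF assms] by blast
qed

end

section \<open>Reflections, Cartan numbers and coroots\<close>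

definition cartan :: "'a::euclidean_space \<Rightarrow> 'a \<Rightarrow> real" where
 "cartan x a = 2 * (x \<bullet> a) / (a \<bullet> a)"

definition coroot :: "'a::euclidean_space \<Rightarrow> 'a" where
 "coroot a = (2 / (a \<bullet> a)) *\<^sub>R a"

lemma root_refl_cartan: "root_refl a x = x - cartan x a *\<^sub>R a"
 by (simp add: root_refl_def cartan_def)

lemma inner_coroot: "x \<bullet> coroot a = cartan x a"
 by (simp add: coroot_def cartan_def)

lemma cartan_add: "cartan (x + y) a = cartan x a + cartan y a"
 and cartan_diff: "cartan (x - y) a = cartan x a - cartan y a"
 and cartan_minus: "cartan (- x) a = - cartan x a"
 and cartan_scaleR: "cartan (c *\<^sub>R x) a = c * cartan x a"
 and cartan_minus_right: "cartan x (- a) = - cartan x a"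
 by (simp_all add: cartan_def inner_left_distrib inner_diff_left add_divide_distrib diff_divide_distrib distrib_left
   right_diff_distrib)

lemma cartan_sum: "cartan (sum f A) a = (\<Sum>x\<in>A. cartan (f x) a)"
 by (simp add: cartan_def inner_sum_left sum_distrib_left sum_divide_distrib)

lemma cartan_self: "a \<noteq> 0 \<Longrightarrow> cartan a a = 2"
 by (simp add: cartan_def)

lemma linear_root_refl: "linear (root_refl a)"
 by (rule linearI) (simp_all add: root_refl_cartan cartan_add cartan_scaleR algebra_simps)

lemma root_refl_0 [simp]: "root_refl 0 = id"
 by (auto simp: root_refl_def fun_eq_iff)

lemma root_refl_refl [simp]: "root_refl a (root_refl a x) = x"
 by (cases "a = 0") (simp_all add: root_refl_cartan cartan_diff cartan_scaleR cartan_self algebra_simps)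

lemma root_refl_self [simp]: "root_refl a a = - a"
 by (cases "a = 0") (simp_all add: root_refl_cartan cartan_self scaleR_2)

lemma root_refl_inner: "root_refl a x \<bullet> root_refl a y = x \<bullet> y"
proof (cases "a = 0")
 case False
 then have "a \<bullet> a \<noteq> 0" by simp
 then show ?thesis
  by (simp add: root_refl_def inner_diff_left inner_diff_right inner_commute field_simps)
qed simp

lemma root_refl_scale: "c \<noteq> 0 \<Longrightarrow> root_refl (c *\<^sub>R a) = root_refl a"
 by (rule ext) (simp add: root_refl_def)

lemma root_refl_coroot: "root_refl (coroot a) = root_refl a"
 by (cases "a = 0") (simp_all add: coroot_def root_refl_scale)

lemma coroot_0_iff [simp]: "coroot a = 0 \<longleftrightarrow> a = 0"
 by (simp add: coroot_def)

lemma coroot_minus: "coroot (- a) = - coroot a"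
 by (simp add: coroot_def)

lemma coroot_scale:
 assumes "c \<noteq> 0" shows "coroot (c *\<^sub>R a) = (1/c) *\<^sub>R coroot a"
proof -
 have "2 / (c * (c * (a \<bullet> a))) * c = 1 / c * (2 / (a \<bullet> a))" using assms by simp
 then show ?thesis by (simp only: coroot_def inner_scaleR_left inner_scaleR_right scaleR_scaleR)
qed

lemma coroot_norm: "coroot a \<bullet> coroot a = 4 / (a \<bullet> a)"
 by (simp add: coroot_def)

lemma coroot_coroot [simp]: "coroot (coroot a) = a"
proof (cases "a = 0")
 case False
 then have "a \<bullet> a \<noteq> 0" by simp
 have "coroot (coroot a) = (2 / (4 / (a \<bullet> a))) *\<^sub>R coroot a"
  by (simp only: coroot_def[of "coroot a"] coroot_norm)
 then show ?thesis using \<open>a \<bullet> a \<noteq> 0\<close> by (simp add: coroot_def)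
qed (simp add: coroot_def)

lemma inj_coroot: "inj_on coroot A"
 by (rule inj_on_inverseI[of _ coroot]) simp

lemma cartan_coroot: "cartan (coroot a) (coroot b) = cartan b a"
proof (cases "b = 0")
 case False
 then have "b \<bullet> b \<noteq> 0" by simp
 have "cartan (coroot a) (coroot b) = coroot a \<bullet> coroot (coroot b)" by (simp only: inner_coroot)
 also have "\<dots> = cartan b a" by (simp add: inner_commute inner_coroot)
 finally show ?thesis .
qed (simp add: cartan_def coroot_def)

lemma root_refl_coroot_coroot: "root_refl a (coroot b) = coroot (root_refl a b)"
proof -
 have "root_refl a b \<bullet> root_refl a b = b \<bullet> b" by (rule root_refl_inner)
 then show ?thesis unfolding coroot_def
  by (simp add: linear_cmul[OF linear_root_refl])
qed

definition orth_iso :: "('a::euclidean_space \<Rightarrow> 'a) \<Rightarrow> bool" where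
 "orth_iso w \<longleftrightarrow> linear w \<and> (\<forall>x y. w x \<bullet> w y = x \<bullet> y) \<and> surj w"

lemma gen_orth_iso: "w \<in> gen_subgroup root_refl B \<Longrightarrow> orth_iso w"
proof (induction rule: gen_subgroup_induct)
 case id
 then show ?case unfolding orth_iso_def using linear_id surj_id by (metis id_apply)
next
 case (step i w)
 have "surj (root_refl i)" by (rule surjI[of _ "root_refl i"]) simp
 with step(3) show ?case
  unfolding orth_iso_def using linear_compose[OF _ linear_root_refl] comp_surj
  by (metis comp_apply root_refl_inner)
qed

lemma gen_root_refl_inverse:
 assumes "w \<in> gen_subgroup root_refl B"
 shows "inv w \<in> gen_subgroup root_refl B" "inv w (w x) = x" "w (inv w x) = x" "bij w"
proof -
 have "\<exists>v\<in>gen_subgroup root_refl B. v \<circ> w = id \<and> w \<circ> v = id" using assms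
 proof (induction rule: gen_subgroup_induct)
  case id
  then show ?case by (intro bexI[of _ id]) auto
 next
  case (step i w)
  then obtain v where v: "v \<in> gen_subgroup root_refl B" "v \<circ> w = id" "w \<circ> v = id" by blast
  have vw: "v (w x) = x" "w (v x) = x" for x using v by (metis comp_apply id_apply)+
  show ?case
   by (intro bexI[of _ "v \<circ> root_refl i"] gen_subgroup_comp v gen_subgroup_gen step)
    (auto simp: fun_eq_iff vw)
 qed
 then obtain v where v: "v \<in> gen_subgroup root_refl B" "v \<circ> w = id" "w \<circ> v = id" by blast
 then have "inv w = v" using inv_unique_comp by blast
 with v show "inv w \<in> gen_subgroup root_refl B" by metis
 show "bij w" using o_bij v by blast
 then show "inv w (w x) = x" "w (inv w x) = x"
  by (simp_all add: bij_is_inj bij_is_surj surj_f_inv_f)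
qed

section \<open>Finite root systems with a chosen base\<close>

text \<open>\<open>R \<subseteq> span B\<close> stands in place of spanning the whole space, so that
  the locale also covers the roots orthogonal to a vector and the gradients belonging to a proper
  set of affine simple roots. Coefficients are real with a common sign, a condition that passes to
  coroots directly; their integrality is recovered in \<open>rep_R_int\<close>.\<close>

locale based_roots =
 fixes R B :: "'a::euclidean_space set"
 assumes finite_R: "finite R"
  and B_sub: "B \<subseteq> R"
  and indep: "independent B"
  and refl_closed: "a \<in> R \<Longrightarrow> x \<in> R \<Longrightarrow> root_refl a x \<in> R"
  and cartan_int: "a \<in> R \<Longrightarrow> b \<in> R \<Longrightarrow> cartan a b \<in> \<int>"
  and red: "a \<in> R \<Longrightarrow> c *\<^sub>R a \<in> R \<Longrightarrow> c = 1 \<or> c = -1"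
  and zero_notin: "0 \<notin> R"
  and R_span: "R \<subseteq> span B"
  and same_sign: "a \<in> R \<Longrightarrow> (\<forall>b\<in>B. 0 \<le> representation B a b) \<or> (\<forall>b\<in>B. representation B a b \<le> 0)"
begin

definition pos :: "'a set" where "pos = {a \<in> R. \<forall>b\<in>B. 0 \<le> representation B a b}"

abbreviation "W \<equiv> gen_subgroup root_refl B"

text \<open>The convention is opposite to that of \<open>inversions\<close>: composing a form with
  \<open>w\<close> is the action of \<open>inv w\<close> on roots, so the length of \<open>w\<close>
  is \<open>card (Inv (inv w))\<close>.\<close>

definition Inv :: "('a \<Rightarrow> 'a) \<Rightarrow> 'a set" where "Inv w = {a \<in> pos. w a \<notin> pos}"

lemma finite_B: "finite B" using finite_subset[OF B_sub finite_R] .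

lemma finite_pos [simp, intro]: "finite pos" using finite_R by (auto simp: pos_def)
lemma finite_Inv [simp, intro]: "finite (Inv w)" by (rule finite_subset[OF _ finite_pos]) (auto simp: Inv_def)

lemma pos_R: "a \<in> pos \<Longrightarrow> a \<in> R" by (simp add: pos_def)

lemma neg_R: "a \<in> R \<Longrightarrow> - a \<in> R" using refl_closed[of a a] by simp

lemma expand: "x \<in> span B \<Longrightarrow> (\<Sum>b\<in>B. representation B x b *\<^sub>R b) = x"
 by (rule real_vector.sum_representation_eq[OF indep _ finite_B]) auto

lemma expand_inner: "x \<in> span B \<Longrightarrow> x \<bullet> z = (\<Sum>b\<in>B. representation B x b * (b \<bullet> z))"
 by (subst expand[symmetric]) (auto simp: inner_sum_left)

lemma rep_minus: "x \<in> span B \<Longrightarrow> representation B (- x) b = - representation B x b"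
 using real_vector.representation_neg[OF indep] by simp

lemma rep_B: "b \<in> B \<Longrightarrow> representation B b b' = (if b' = b then 1 else 0)"
 by (simp add: real_vector.representation_basis[OF indep])

lemma rep_zero_imp: "x \<in> span B \<Longrightarrow> (\<And>b. b \<in> B \<Longrightarrow> representation B x b = 0) \<Longrightarrow> x = 0"
 using expand[of x] by auto

lemma B_pos: "b \<in> B \<Longrightarrow> b \<in> pos"
 using B_sub by (auto simp: pos_def rep_B)

lemma pos_or_neg: "a \<in> R \<Longrightarrow> a \<in> pos \<or> - a \<in> pos"
proof -
 assume a: "a \<in> R"
 then have "a \<in> span B" using R_span by blast
 then show ?thesis using same_sign[OF a] neg_R[OF a] a unfolding pos_def by (simp add: rep_minus)
qed

lemma neg_notin_pos: "a \<in> pos \<Longrightarrow> - a \<notin> pos"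
proof
 assume a: "a \<in> pos" "- a \<in> pos"
 then have s: "a \<in> span B" using R_span by (auto simp: pos_def)
 have "representation B a b = 0" if "b \<in> B" for b
 proof -
  have "0 \<le> representation B a b" "0 \<le> - representation B a b"
   using a that rep_minus[OF s, of b] unfolding pos_def by fastforce+
  then show ?thesis by simp
 qed
 then have "a = 0" using rep_zero_imp[OF s] by blast
 then show False using a zero_notin by (auto simp: pos_def)
qed

lemma notin_pos: "a \<in> R \<Longrightarrow> a \<notin> pos \<longleftrightarrow> - a \<in> pos"
 using pos_or_neg neg_notin_pos by (metis add.inverse_inverse)

lemma pos_inner_pos:
 assumes "a \<in> pos" "\<And>b. b \<in> B \<Longrightarrow> 0 < b \<bullet> z"
 shows "0 < a \<bullet> z"
proof -
 have s: "a \<in> span B" using assms(1) R_span by (auto simp: pos_def)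
 have nn: "0 \<le> representation B a b * (b \<bullet> z)" if "b \<in> B" for b
  using assms that by (auto simp: pos_def intro!: mult_nonneg_nonneg dest: less_imp_le)
 then have "0 \<le> a \<bullet> z" unfolding expand_inner[OF s] by (rule sum_nonneg)
 moreover have "a \<bullet> z \<noteq> 0"
 proof
  assume "a \<bullet> z = 0"
  then have "\<forall>b\<in>B. representation B a b * (b \<bullet> z) = 0"
   using sum_nonneg_eq_0_iff[OF finite_B, of "\<lambda>b. representation B a b * (b \<bullet> z)"] nn
   unfolding expand_inner[OF s] by blast
  then have "representation B a b = 0" if "b \<in> B" for b
   using assms(2)[OF that] that by (metis less_irrefl mult_eq_0_iff)
  then have "a = 0" using rep_zero_imp[OF s] by blast
  with assms(1) zero_notin show False by (auto simp: pos_def)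
 qed
 ultimately show ?thesis by simp
qed

lemma pos_inner_nonneg:
 assumes "a \<in> pos" "\<And>b. b \<in> B \<Longrightarrow> 0 \<le> b \<bullet> z"
 shows "0 \<le> a \<bullet> z"
proof -
 have s: "a \<in> span B" using assms(1) R_span by (auto simp: pos_def)
 show ?thesis unfolding expand_inner[OF s]
  using assms by (intro sum_nonneg mult_nonneg_nonneg) (auto simp: pos_def)
qed

lemma rep_refl:
 assumes "b \<in> B" "x \<in> span B" "b' \<noteq> b"
 shows "representation B (root_refl b x) b' = representation B x b'"
proof -
 have b: "b \<in> span B" using assms by (simp add: span_base)
 have "representation B (root_refl b x) b' = representation B x b' - representation B (cartan x b *\<^sub>R b) b'"
  unfolding root_refl_cartan using b assms
  by (simp add: real_vector.representation_diff[OF indep] span_mul)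
 also have "representation B (cartan x b *\<^sub>R b) b' = 0"
  using real_vector.representation_scale[OF indep b] assms rep_B by simp
 finally show ?thesis by simp
qed

text \<open>By reducedness a positive root other than \<open>b\<close> has a positive coefficient at
  some further simple root. The reflection in \<open>b\<close> does not touch that coefficient, and
  the common sign makes the image positive.\<close>

lemma refl_pos:
 assumes "b \<in> B" "a \<in> pos" "a \<noteq> b"
 shows "root_refl b a \<in> pos"
proof -
 have aR: "a \<in> R" and bR: "b \<in> R" and s: "a \<in> span B" using assms B_sub R_span by (auto simp: pos_def)
 have "\<exists>b'\<in>B. b' \<noteq> b \<and> representation B a b' > 0"
 proof (rule ccontr)
  assume "\<not> ?thesis"
  then have z: "\<And>b'. b' \<in> B \<Longrightarrow> b' \<noteq> b \<Longrightarrow> representation B a b' = 0" using assms(2) by (force simp: pos_def)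
  have "a = (\<Sum>b'\<in>B. if b' = b then representation B a b *\<^sub>R b else 0)"
   by (subst expand[OF s, symmetric], rule sum.cong) (auto simp: z)
  also have "\<dots> = representation B a b *\<^sub>R b" using assms finite_B by simp
  finally have eq: "a = representation B a b *\<^sub>R b" .
  then have "representation B a b = 1 \<or> representation B a b = -1" using red[OF bR] aR by metis
  moreover have "representation B a b \<ge> 0" using assms by (auto simp: pos_def)
  ultimately show False using eq assms(3) by auto
 qed
 then obtain b' where b': "b' \<in> B" "b' \<noteq> b" "representation B a b' > 0" by blast
 then have "representation B (root_refl b a) b' > 0" using rep_refl[OF assms(1) s] by simp
 moreover have R: "root_refl b a \<in> R" using refl_closed aR bR by blast
 ultimately show ?thesis using same_sign[OF R] b'(1) by (force simp: pos_def)
qed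

lemma W_linear: "w \<in> W \<Longrightarrow> linear w"
 and W_inner: "w \<in> W \<Longrightarrow> w x \<bullet> w y = x \<bullet> y"
 using gen_orth_iso by (auto simp: orth_iso_def)

lemmas W_inv = gen_root_refl_inverse[of _ B]

lemma W_inner_inv: "w \<in> W \<Longrightarrow> w x \<bullet> y = x \<bullet> inv w y"
 using W_inner[of w x "inv w y"] W_inv(3)[of w y] by simp

lemma W_R: "w \<in> W \<Longrightarrow> a \<in> R \<Longrightarrow> w a \<in> R"
proof (induction arbitrary: a rule: gen_subgroup_induct)
 case (step b w)
 then show ?case using refl_closed[of b "w a"] B_sub by auto
qed auto

lemma W_minus: "w \<in> W \<Longrightarrow> w (- x) = - w x" by (simp add: W_linear linear_neg)

lemma W_cartan: "w \<in> W \<Longrightarrow> cartan (w x) (w y) = cartan x y"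
 by (simp add: cartan_def W_inner)

lemma W_coroot: "w \<in> W \<Longrightarrow> coroot (w x) = w (coroot x)"
 by (simp add: coroot_def W_inner linear_cmul[OF W_linear])

lemma W_refl_conj: "w \<in> W \<Longrightarrow> root_refl (w a) (w x) = w (root_refl a x)"
 by (simp add: root_refl_cartan W_cartan linear_diff[OF W_linear] linear_cmul[OF W_linear])

definition fn :: "'a \<Rightarrow> 'a \<Rightarrow> real" where "fn a = (\<lambda>x. a \<bullet> x)"

lemma fn_inj: "fn a = fn b \<longleftrightarrow> a = b"
 unfolding fn_def by (metis inner_commute vector_eq_ldot)

lemma fn_comp: "w \<in> W \<Longrightarrow> fn a \<circ> w = fn (inv w a)"
 using W_inner_inv[of w _ a] by (auto simp: fn_def fun_eq_iff inner_commute)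

lemma fn_minus: "(\<lambda>x. - fn a x) = fn (- a)" by (auto simp: fn_def)

lemma fn_in [simp]: "fn a \<in> fn ` X \<longleftrightarrow> a \<in> X" by (auto simp: fn_inj)

lemma B_W: "b \<in> B \<Longrightarrow> root_refl b \<in> W" by (rule gen_subgroup_gen)

lemma inv_refl [simp]: "inv (root_refl b) = root_refl b"
 by (rule inv_unique_comp) (auto simp: fun_eq_iff)

sublocale reflection_system root_refl B "fn ` pos" fn
proof
 fix f assume "f \<in> fn ` pos"
 then show "(\<lambda>x. - f x) \<notin> fn ` pos" using neg_notin_pos fn_in by (metis fn_minus imageE)
next
 fix i assume i: "i \<in> B"
 then show "fn i \<in> fn ` pos" by (simp add: B_pos)
 show "fn i \<circ> root_refl i = (\<lambda>x. - fn i x)" using i by (simp add: fn_comp B_W fn_minus)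
 show "root_refl i \<circ> root_refl i = id" by auto
next
 fix i f assume "i \<in> B" "f \<in> fn ` pos" "f \<noteq> fn i"
 then show "f \<circ> root_refl i \<in> fn ` pos" using refl_pos by (auto simp: fn_comp B_W fn_inj)
next
 fix i j w assume i: "i \<in> B" "j \<in> B" "w \<in> W" "fn i \<circ> w = fn j"
 then have "w j = i" using W_inv(3) by (auto simp: fn_comp fn_inj)
 with W_refl_conj[OF i(3), of j] show "root_refl i \<circ> w = w \<circ> root_refl j" by auto
qed

lemma inversions_eq: "w \<in> W \<Longrightarrow> inversions w = fn ` Inv (inv w)"
proof -
 assume "w \<in> W"
 then have "f \<circ> w \<notin> fn ` pos \<longleftrightarrow> inv w a \<notin> pos" if "f = fn a" for f a
  using that by (simp add: fn_comp)
 then show ?thesis by (auto simp: inversions_def Inv_def)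
qed

lemma inv_inv: "w \<in> W \<Longrightarrow> inv (inv w) = w" using W_inv(4) inv_inv_eq by blast

lemma W_descent:
 assumes "w \<in> W" "w \<noteq> id" shows "\<exists>b\<in>B. w b \<notin> pos"
proof -
 have "inv w \<noteq> id" using assms inv_inv inv_id by metis
 from exists_descent[OF W_inv(1)[OF assms(1)] this] show ?thesis
  using fn_comp[OF W_inv(1)[OF assms(1)]] inv_inv[OF assms(1)] by auto
qed

lemma Inv_empty_iff: "w \<in> W \<Longrightarrow> Inv w = {} \<longleftrightarrow> w = id"
 using W_descent[of w] B_pos by (auto simp: Inv_def)

lemma Inv_comp_refl:
 assumes w: "w \<in> W" and b: "b \<in> B" and nb: "w b \<notin> pos"
 shows "Inv w = insert b (root_refl b ` Inv (w \<circ> root_refl b))" "b \<notin> root_refl b ` Inv (w \<circ> root_refl b)"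
proof -
 have m: "- b \<notin> pos" using B_pos b neg_notin_pos by blast
 show n: "b \<notin> root_refl b ` Inv (w \<circ> root_refl b)"
 proof
  assume "b \<in> root_refl b ` Inv (w \<circ> root_refl b)"
  then obtain a where "b = root_refl b a" "a \<in> Inv (w \<circ> root_refl b)" by blast
  then have "a = - b" "a \<in> pos" using root_refl_refl[of b a] by (auto simp: Inv_def)
  then show False using m by simp
 qed
 show "Inv w = insert b (root_refl b ` Inv (w \<circ> root_refl b))"
 proof (intro set_eqI iffI)
  fix a assume a: "a \<in> Inv w"
  show "a \<in> insert b (root_refl b ` Inv (w \<circ> root_refl b))"
  proof (cases "a = b")
   case False
   then have "root_refl b a \<in> Inv (w \<circ> root_refl b)" using a b refl_pos by (auto simp: Inv_def)
   then show ?thesis using root_refl_refl[of b a] by (metis imageI insertCI)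
  qed simp
 next
  fix a assume "a \<in> insert b (root_refl b ` Inv (w \<circ> root_refl b))"
  then consider "a = b" | c where "c \<in> Inv (w \<circ> root_refl b)" "a = root_refl b c" by blast
  then show "a \<in> Inv w"
  proof cases
   case 1
   then show ?thesis using b nb B_pos by (auto simp: Inv_def)
  next
   case (2 c)
   have "c \<noteq> b"
   proof
    assume "c = b"
    then have "w (- b) \<notin> pos" using 2 by (auto simp: Inv_def)
    moreover have "- w b \<in> pos" using nb notin_pos[OF W_R[OF w]] b B_sub by blast
    ultimately show False using W_minus[OF w] by metis
   qed
   then show ?thesis using 2 refl_pos[OF b, of c] by (auto simp: Inv_def)
  qed
 qed
qed

lemma card_Inv_comp_refl:
 assumes w: "w \<in> W" and b: "b \<in> B" and nb: "w b \<notin> pos"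
 shows "card (Inv w) = Suc (card (Inv (w \<circ> root_refl b)))"
proof -
 have "inj_on (root_refl b) X" for X by (rule inj_on_inverseI[of _ "root_refl b"]) simp
 then have "card (root_refl b ` Inv (w \<circ> root_refl b)) = card (Inv (w \<circ> root_refl b))" by (rule card_image)
 then show ?thesis using Inv_comp_refl[OF assms] by simp
qed

lemma W_comp: "v \<in> W \<Longrightarrow> w \<in> W \<Longrightarrow> v \<circ> w \<in> W" by (rule gen_subgroup_comp)

text \<open>If two elements make the same roots negative, then \<open>w \<circ> inv v\<close>
  preserves positivity, and an element without a descent is the identity. Finiteness of
  \<open>W\<close> comes from here, since \<open>Inv\<close> takes values in the subsets of
  \<open>pos\<close>.\<close>

lemma Inv_inj: assumes "v \<in> W" "w \<in> W" "Inv v = Inv w" shows "v = w"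
proof -
 have *: "v a \<in> pos \<longleftrightarrow> w a \<in> pos" if "a \<in> R" for a
 proof (cases "a \<in> pos")
  case True
  then show ?thesis using assms(3) by (auto simp: Inv_def)
 next
  case False
  then have "- a \<in> pos" using that notin_pos by blast
  then have "v (- a) \<in> pos \<longleftrightarrow> w (- a) \<in> pos" using assms(3) by (auto simp: Inv_def)
  then show ?thesis using assms that notin_pos W_R W_minus by metis
 qed
 let ?u = "w \<circ> inv v"
 have u: "?u \<in> W" using assms W_inv by (intro W_comp) auto
 have "?u a \<in> pos" if "a \<in> pos" for a
  using *[of "inv v a"] that W_inv[OF assms(1)] W_R[OF W_inv(1)[OF assms(1)]] pos_R by auto
 then have "?u = id" using W_descent[OF u] B_pos by blast
 then show ?thesis using W_inv(2)[OF assms(1)] by (metis comp_apply id_apply ext)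
qed

lemma finite_W [simp, intro]: "finite W"
 using finite_imageD[of Inv W] finite_subset[of "Inv ` W" "Pow pos"] Inv_inj
 by (auto simp: inj_on_def Inv_def)

text \<open>Removing a right descent takes one root out of \<open>Inv\<close>, up to a reflection of
  the others, so the number of inversions serves as the measure.\<close>

lemma W_induct_right [consumes 1, case_names id step]:
 assumes w: "w \<in> W" and "Q id"
  and "\<And>w b. w \<in> W \<Longrightarrow> b \<in> B \<Longrightarrow> w b \<notin> pos \<Longrightarrow> Q (w \<circ> root_refl b) \<Longrightarrow> Q w"
 shows "Q w"
 using w
proof (induction "card (Inv w)" arbitrary: w rule: less_induct)
 case less
 show ?case
 proof (cases "w = id")
  case False
  then obtain b where b: "b \<in> B" "w b \<notin> pos" using W_descent less by blast
  then show ?thesis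
   using assms(3)[OF less(2) b] less(1)[of "w \<circ> root_refl b"] card_Inv_comp_refl[OF less(2) b]
    W_comp[OF less(2) B_W[OF b(1)]] by simp
 qed (use assms in simp)
qed

text \<open>The sign character, introduced through the parity of the length; its multiplicativity is
  \<open>eps_mult\<close>.\<close>

definition eps :: "('a \<Rightarrow> 'a) \<Rightarrow> real" where "eps w = (-1) ^ card (Inv w)"

lemma eps_id [simp]: "eps id = 1" by (simp add: eps_def Inv_def)

lemma eps_comp_refl: assumes w: "w \<in> W" and b: "b \<in> B" shows "eps (w \<circ> root_refl b) = - eps w"
proof (cases "w b \<in> pos")
 case False
 then show ?thesis using card_Inv_comp_refl[OF w b] by (simp add: eps_def)
next
 case True
 let ?v = "w \<circ> root_refl b"
 have v: "?v \<in> W" by (intro W_comp w B_W b)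
 have "?v b \<notin> pos" using True neg_notin_pos W_minus[OF w] by simp
 moreover have "?v \<circ> root_refl b = w" by auto
 ultimately have "card (Inv ?v) = Suc (card (Inv w))" using card_Inv_comp_refl[OF v b] by metis
 then show ?thesis unfolding eps_def by simp
qed

lemma eps_refl: "b \<in> B \<Longrightarrow> eps (root_refl b) = -1"
 using eps_comp_refl[of id b] by simp

lemma eps_mult: assumes "v \<in> W" "w \<in> W" shows "eps (v \<circ> w) = eps v * eps w"
 using assms(2)
proof (induction rule: W_induct_right)
 case (step w b)
 have "eps (v \<circ> w \<circ> root_refl b) = - eps (v \<circ> w)" by (intro eps_comp_refl W_comp assms step)
 moreover have "eps (w \<circ> root_refl b) = - eps w" by (intro eps_comp_refl step)
 moreover have "eps (v \<circ> w \<circ> root_refl b) = eps v * eps (w \<circ> root_refl b)" using step(4) by (simp only: comp_assoc)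
 ultimately show ?case by (metis minus_mult_right minus_minus)
qed (simp only: comp_id eps_id mult_1_right)

lemma eps_sq [simp]: "eps w * eps w = 1" by (simp add: eps_def power_mult_distrib[symmetric])

lemma eps_inv: assumes "w \<in> W" shows "eps (inv w) = eps w"
proof -
 have "w \<circ> inv w = id" using W_inv[OF assms] by auto
 then have "eps w * eps (inv w) = 1" using eps_mult[OF assms W_inv(1)[OF assms]] by simp
 then show ?thesis by (metis eps_sq mult_cancel_left mult_zero_left zero_neq_one)
qed

text \<open>The change of variables for sums and products over \<open>pos\<close>: an element of
  \<open>W\<close> permutes the positive roots up to sign.\<close>

lemma W_pos_image:
 assumes "w \<in> W"
 shows "bij_betw (\<lambda>a. if w a \<in> pos then w a else - w a) pos pos"
proof -
 let ?h = "\<lambda>a. if w a \<in> pos then w a else - w a"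
 have inj: "inj_on ?h pos"
 proof (rule inj_onI)
  fix a b assume ab: "a \<in> pos" "b \<in> pos" "?h a = ?h b"
  then have "w a = w b \<or> w a = w (- b)" using W_minus[OF assms]
   by (auto split: if_splits) (metis minus_minus)+
  then have "a = b \<or> a = - b" using W_inv(2)[OF assms] by metis
  then show "a = b" using ab neg_notin_pos by auto
 qed
 have "?h ` pos \<subseteq> pos" using notin_pos W_R[OF assms] pos_R by auto
 then have "?h ` pos = pos" by (rule endo_inj_surj[OF finite_pos _ inj])
 with inj show ?thesis by (simp add: bij_betw_def)
qed

text \<open>For odd \<open>F\<close> this is the sign rule behind \<open>w\<rho> = \<rho> - \<Sum>(Inv (inv w))\<close>, for its coroot analogue, and for
 the Weyl denominator.\<close>

lemma sum_W_pos:
 fixes F :: "'a \<Rightarrow> 'b::real_vector"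
 assumes "w \<in> W" "\<And>a. a \<in> R \<Longrightarrow> F (- a) = - F a"
 shows "(\<Sum>a\<in>pos. F (w a)) = (\<Sum>a\<in>pos. F a) - 2 *\<^sub>R (\<Sum>a\<in>Inv (inv w). F a)"
proof -
 let ?h = "\<lambda>a. if w a \<in> pos then w a else - w a"
 let ?g = "\<lambda>a. if inv w a \<in> pos then F a else - F a"
 have "(\<Sum>a\<in>pos. F (w a)) = (\<Sum>a\<in>pos. ?g (?h a))"
 proof (rule sum.cong)
  fix a assume a: "a \<in> pos"
  have "- a \<notin> pos" "w a \<in> R" using a neg_notin_pos W_R[OF assms(1)] pos_R by auto
  then show "F (w a) = ?g (?h a)" using a assms(2)[of "w a"] W_inv(2)[OF assms(1)]
    W_minus[OF W_inv(1)[OF assms(1)]] by auto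
 qed simp
 also have "\<dots> = (\<Sum>a\<in>pos. ?g a)" by (rule sum.reindex_bij_betw[OF W_pos_image[OF assms(1)]])
 also have "\<dots> = (\<Sum>a\<in>pos. F a - (if a \<in> Inv (inv w) then 2 *\<^sub>R F a else 0))"
  by (rule sum.cong) (auto simp: Inv_def scaleR_2)
 also have "\<dots> = (\<Sum>a\<in>pos. F a) - (\<Sum>a\<in>pos. if a \<in> Inv (inv w) then 2 *\<^sub>R F a else 0)"
  by (rule sum_subtractf)
 also have "(\<Sum>a\<in>pos. if a \<in> Inv (inv w) then 2 *\<^sub>R F a else 0) = (\<Sum>a\<in>Inv (inv w). 2 *\<^sub>R F a)"
  by (rule sum.inter_restrict[OF finite_pos, symmetric, THEN trans]) (rule sum.cong, auto simp: Inv_def)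
 finally show ?thesis by (simp add: scaleR_sum_right)
qed

text \<open>The source of points at which exponentials are evaluated, of the fundamental weights and
  of the fixed points of parabolic subgroups.\<close>

lemma dual_functional: "\<exists>z. \<forall>b\<in>B. b \<bullet> z = k b" for k :: "'a \<Rightarrow> real"
proof -
 obtain f where f: "linear f" "\<forall>b\<in>B. f b = k b" using linear_independent_extend[OF indep, of k] by blast
 have "f x = x \<bullet> (\<Sum>e\<in>Basis. f e *\<^sub>R e)" for x
 proof -
  have "f x = f (\<Sum>e\<in>Basis. (x \<bullet> e) *\<^sub>R e)" by (simp add: euclidean_representation)
  also have "\<dots> = (\<Sum>e\<in>Basis. (x \<bullet> e) * f e)" using f(1) by (simp add: linear_sum linear_cmul)
  finally show ?thesis by (simp add: inner_sum_right mult.commute)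
 qed
 with f(2) show ?thesis by (metis inner_commute)
qed

definition rho :: 'a where "rho = (1/2) *\<^sub>R (\<Sum>a\<in>pos. a)"
definition corho :: 'a where "corho = (1/2) *\<^sub>R (\<Sum>a\<in>pos. coroot a)"
text \<open>Height as the pairing with the half sum of positive coroots. It agrees with the sum of
  coefficients on \<open>span B\<close> by \<open>ht_rep\<close>, and in this form its change under
  \<open>W\<close> can be computed from that of \<open>corho\<close>.\<close>

definition ht :: "'a \<Rightarrow> real" where "ht x = x \<bullet> corho"

lemma W_sum: "w \<in> W \<Longrightarrow> w (\<Sum>x\<in>X. f x) = (\<Sum>x\<in>X. w (f x))"
 by (rule linear_sum[OF W_linear])

lemma W_rho: assumes "w \<in> W" shows "w rho = rho - (\<Sum>a\<in>Inv (inv w). a)"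
 unfolding rho_def linear_cmul[OF W_linear[OF assms]] W_sum[OF assms]
 using sum_W_pos[OF assms, of "\<lambda>a. a"] by (simp add: scaleR_diff_right)

lemma W_corho: assumes "w \<in> W" shows "w corho = corho - (\<Sum>a\<in>Inv (inv w). coroot a)"
 unfolding corho_def linear_cmul[OF W_linear[OF assms]] W_sum[OF assms] W_coroot[OF assms, symmetric]
 using sum_W_pos[OF assms, of coroot] by (simp add: scaleR_diff_right coroot_minus)

lemma Inv_refl: "b \<in> B \<Longrightarrow> Inv (root_refl b) = {b}"
 using refl_pos[of b] B_pos neg_notin_pos by (fastforce simp: Inv_def)

lemma cartan_rho: assumes "b \<in> B" shows "cartan rho b = 1"
proof -
 have "root_refl b rho = rho - b" using W_rho[OF B_W[OF assms]] Inv_refl[OF assms] by simp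
 then have "cartan rho b *\<^sub>R b = 1 *\<^sub>R b" by (simp add: root_refl_cartan)
 moreover have "b \<noteq> 0" using assms B_sub zero_notin by blast
 ultimately show ?thesis by (metis scaleR_cancel_right)
qed

lemma ht_B: assumes "b \<in> B" shows "ht b = 1"
proof -
 have "root_refl b corho = corho - coroot b" using W_corho[OF B_W[OF assms]] Inv_refl[OF assms] by simp
 then have "cartan corho b *\<^sub>R b = coroot b" by (simp add: root_refl_cartan)
 moreover have "b \<noteq> 0" using assms B_sub zero_notin by blast
 ultimately have "cartan corho b = 2 / (b \<bullet> b)" unfolding coroot_def by (metis scaleR_cancel_right)
 then show ?thesis using \<open>b \<noteq> 0\<close> by (simp add: cartan_def ht_def inner_commute)
qed

lemma ht_add: "ht (x + y) = ht x + ht y" and ht_diff: "ht (x - y) = ht x - ht y"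
 and ht_minus: "ht (- x) = - ht x" and ht_scaleR: "ht (c *\<^sub>R x) = c * ht x" and ht_0 [simp]: "ht 0 = 0"
 by (simp_all add: ht_def inner_left_distrib inner_diff_left)

lemma ht_sum: "ht (sum f X) = (\<Sum>x\<in>X. ht (f x))" by (simp add: ht_def inner_sum_left)

lemma ht_pos: "a \<in> pos \<Longrightarrow> 0 < ht a"
 unfolding ht_def by (erule pos_inner_pos) (use ht_B in \<open>auto simp: ht_def\<close>)

lemma ht_rep: "x \<in> span B \<Longrightarrow> ht x = (\<Sum>b\<in>B. representation B x b)"
 unfolding ht_def by (subst expand_inner) (auto simp: ht_B[unfolded ht_def])

text \<open>Descent on the height: a positive root has positive inner product with some simple root,
  since otherwise its square norm would not be positive, and the reflection in that simple root
  lowers the height.\<close>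

lemma W_root: assumes "a \<in> R" shows "\<exists>w\<in>W. \<exists>b\<in>B. a = w b"
proof -
 \<comment> \<open>Heights are only known to be real here, so the induction counts the positive
   roots of smaller height.\<close>
 have *: "\<exists>w\<in>W. \<exists>b\<in>B. a = w b" if "a \<in> pos" for a
  using that
 proof (induction "card {c \<in> pos. ht c < ht a}" arbitrary: a rule: less_induct)
  case less
  show ?case
  proof (cases "a \<in> B")
   case True
   then show ?thesis by (metis gen_subgroup_id id_apply)
  next
   case False
   have s: "a \<in> span B" using less R_span by (auto simp: pos_def)
   have "\<exists>b\<in>B. b \<bullet> a > 0"
   proof (rule ccontr)
    assume "\<not> ?thesis"
    then have "representation B a b * (b \<bullet> a) \<le> 0" if "b \<in> B" for b
     using less(2) that by (auto simp: pos_def intro!: mult_nonneg_nonpos)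
    then have "a \<bullet> a \<le> 0" unfolding expand_inner[OF s] by (rule sum_nonpos)
    then have "a = 0" using inner_gt_zero_iff[of a] by (meson not_less)
    then show False using less(2) zero_notin by (auto simp: pos_def)
   qed
   then obtain b where b: "b \<in> B" "b \<bullet> a > 0" by blast
   have bb: "b \<bullet> b > 0" using b by (metis inner_gt_zero_iff inner_zero_left less_irrefl)
   let ?a = "root_refl b a"
   have p: "?a \<in> pos" using refl_pos[OF b(1) less(2)] False b by auto
   have "ht ?a = ht a - cartan a b" by (simp add: root_refl_cartan ht_diff ht_scaleR ht_B b)
   then have lt: "ht ?a < ht a" using b bb by (simp add: cartan_def inner_commute)
   have "{c \<in> pos. ht c < ht ?a} \<subset> {c \<in> pos. ht c < ht a}" using lt p by force
   then have "card {c \<in> pos. ht c < ht ?a} < card {c \<in> pos. ht c < ht a}" by (intro psubset_card_mono) auto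
   from less(1)[OF this p] obtain w c where w: "w \<in> W" "c \<in> B" "?a = w c" by blast
   have "a = (root_refl b \<circ> w) c" using w(3) root_refl_refl[of b a] by simp
   then show ?thesis using W_comp[OF B_W[OF b(1)] w(1)] w(2) by blast
  qed
 qed
 show ?thesis
 proof (cases "a \<in> pos")
  case False
  then obtain w b where w: "w \<in> W" "b \<in> B" "- a = w b" using *[of "- a"] notin_pos assms by blast
  then have "a = (w \<circ> root_refl b) b" using W_minus[OF w(1), of b] by (metis comp_apply minus_minus root_refl_self)
  then show ?thesis using W_comp[OF w(1) B_W[OF w(2)]] w(2) by blast
 qed (use * in blast)
qed

lemma refl_W: assumes "a \<in> R" shows "root_refl a \<in> W"
proof -
 obtain w b where w: "w \<in> W" "b \<in> B" "a = w b" using W_root[OF assms] by blast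
 have "root_refl a = w \<circ> (root_refl b \<circ> inv w)"
 proof
  fix x show "root_refl a x = (w \<circ> (root_refl b \<circ> inv w)) x"
   using W_refl_conj[OF w(1), of b "inv w x"] W_inv(3)[OF w(1)] w(3) by simp
 qed
 then show ?thesis using W_comp[OF w(1) W_comp[OF B_W[OF w(2)] W_inv(1)[OF w(1)]]] by simp
qed

definition dominant :: "'a \<Rightarrow> bool" where "dominant x \<longleftrightarrow> (\<forall>b\<in>B. 0 \<le> x \<bullet> b)"

lemma dominant_pos: "dominant x \<Longrightarrow> a \<in> pos \<Longrightarrow> 0 \<le> x \<bullet> a"
 using pos_inner_nonneg[of a x] by (auto simp: dominant_def inner_commute)

lemma dominant_cartan: "dominant x \<Longrightarrow> a \<in> pos \<Longrightarrow> 0 \<le> cartan x a"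
 using dominant_pos[of x a] by (simp add: cartan_def)

lemma ht_W: assumes "w \<in> W" shows "ht (w x) = ht x - (\<Sum>a\<in>Inv w. cartan x a)"
proof -
 have "ht (w x) = x \<bullet> inv w corho" unfolding ht_def by (rule W_inner_inv[OF assms])
 also have "inv w corho = corho - (\<Sum>a\<in>Inv w. coroot a)"
  using W_corho[OF W_inv(1)[OF assms]] inv_inv[OF assms] by simp
 finally show ?thesis by (simp add: inner_diff_right ht_def inner_sum_right inner_coroot)
qed

lemma ht_W_le: "w \<in> W \<Longrightarrow> dominant x \<Longrightarrow> ht (w x) \<le> ht x"
 using ht_W[of w x] sum_nonneg[of "Inv w" "cartan x"] dominant_cartan[of x] by (auto simp: Inv_def)

text \<open>A right descent \<open>b\<close> lies in \<open>Inv w\<close>, so its reflection fixes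
  \<open>x\<close>. The inversions of the shorter element are reflected back into
  \<open>Inv w\<close> by it and are therefore orthogonal to \<open>x\<close> as well.\<close>

lemma fixed_of_orth:
 assumes "w \<in> W" "\<And>a. a \<in> Inv w \<Longrightarrow> x \<bullet> a = 0"
 shows "w x = x"
 using assms
proof (induction rule: W_induct_right)
 case (step w b)
 have b: "b \<in> Inv w" using step B_pos by (auto simp: Inv_def)
 then have xb: "root_refl b x = x" using step(5) by (simp add: root_refl_def)
 have "x \<bullet> a = 0" if "a \<in> Inv (w \<circ> root_refl b)" for a
 proof -
  have "root_refl b a \<in> Inv w" using Inv_comp_refl(1)[OF step(1-3)] that by blast
  then have "x \<bullet> root_refl b a = 0" using step(5) by blast
  then show ?thesis using xb root_refl_inner[of b x a] by simp
 qed
 then have "(w \<circ> root_refl b) x = x" using step(4) by blast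
 then show ?case using xb by simp
qed simp

lemma ht_W_eq: assumes "w \<in> W" "dominant x" "ht (w x) = ht x" shows "w x = x"
proof (rule fixed_of_orth[OF assms(1)])
 have 0: "(\<Sum>a\<in>Inv w. cartan x a) = 0" using ht_W[OF assms(1), of x] assms(3) by simp
 have nn: "0 \<le> cartan x a" if "a \<in> Inv w" for a
  using dominant_cartan[OF assms(2), of a] that by (auto simp: Inv_def)
 have "\<forall>a\<in>Inv w. cartan x a = 0"
  using sum_nonneg_eq_0_iff[OF finite_Inv[of w], of "cartan x"] 0 nn by blast
 then show "x \<bullet> a = 0" if "a \<in> Inv w" for a
  using that zero_notin by (auto simp: cartan_def Inv_def pos_def)
qed

text \<open>By \<open>ht_W_le\<close> each of two dominant points in an orbit bounds the height of
  the other, so the heights agree and \<open>ht_W_eq\<close> applies.\<close>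

lemma dominant_unique: assumes "w \<in> W" "dominant x" "dominant (w x)" shows "w x = x"
proof -
 have "ht (inv w (w x)) \<le> ht (w x)" by (rule ht_W_le[OF W_inv(1)[OF assms(1)] assms(3)])
 then show ?thesis using ht_W_le[OF assms(1,2)] W_inv(2)[OF assms(1)] by (intro ht_W_eq assms) auto
qed

text \<open>A point of greatest height in the orbit qualifies, since a simple reflection lowers the
  height by the Cartan number.\<close>

lemma dominant_exists: "\<exists>w\<in>W. dominant (w x)"
proof -
 obtain w where w: "w \<in> W" "\<And>v. v \<in> W \<Longrightarrow> ht (v x) \<le> ht (w x)"
 proof -
  let ?m = "Max ((\<lambda>v. ht (v x)) ` W)"
  have ne: "(\<lambda>v. ht (v x)) ` W \<noteq> {}" using gen_subgroup_id by blast
  have "?m \<in> (\<lambda>v. ht (v x)) ` W" by (rule Max_in[OF _ ne]) simp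
  then obtain w where "w \<in> W" "?m = ht (w x)" by blast
  moreover have "ht (v x) \<le> ?m" if "v \<in> W" for v using that by (intro Max_ge) auto
  ultimately show ?thesis using that by metis
 qed
 have "0 \<le> w x \<bullet> b" if b: "b \<in> B" for b
 proof -
  have "b \<noteq> 0" using b B_sub zero_notin by blast
  have "ht ((root_refl b \<circ> w) x) \<le> ht (w x)" by (intro w(2) W_comp B_W b w(1))
  then have "0 \<le> cartan (w x) b" by (simp add: root_refl_cartan ht_diff ht_scaleR ht_B b)
  moreover have "0 < b \<bullet> b" using \<open>b \<noteq> 0\<close> by simp
  ultimately show ?thesis by (auto simp: cartan_def zero_le_divide_iff zero_le_mult_iff simp del: inner_gt_zero_iff)
 qed
 with w(1) show ?thesis by (auto simp: dominant_def)
qed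

text \<open>The coefficient of \<open>coroot b\<close> in \<open>coroot x\<close> is that of
  \<open>b\<close> in \<open>x\<close> times the positive factor
  \<open>(b \<bullet> b) / (x \<bullet> x)\<close>, so all signs agree. The group is the same
  because a root and its coroot have the same reflection.\<close>

lemma dual: "based_roots (coroot ` R) (coroot ` B)"
 and dual_W: "gen_subgroup root_refl (coroot ` B) = W"
 and dual_pos: "based_roots.pos (coroot ` R) (coroot ` B) = coroot ` pos"
proof -
 have nz: "b \<noteq> 0" if "b \<in> R" for b using that zero_notin by blast
 have ind: "independent (coroot ` B)"
 proof (rule real_vector.independent_if_scalars_zero)
  fix g a assume s: "(\<Sum>x\<in>coroot ` B. g x *\<^sub>R x) = 0" and "a \<in> coroot ` B"
  then obtain b where b: "b \<in> B" "a = coroot b" by blast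
  have "(\<Sum>v\<in>B. (g (coroot v) * 2 / (v \<bullet> v)) *\<^sub>R v) = 0"
   using s by (simp add: sum.reindex inj_coroot) (simp add: coroot_def)
  then have "g (coroot b) * 2 / (b \<bullet> b) = 0"
   using real_vector.independentD[OF indep finite_B subset_refl _ b(1), of "\<lambda>v. g (coroot v) * 2 / (v \<bullet> v)"]
   by blast
  then show "g a = 0" using nz B_sub b by auto
 qed (simp add: finite_B)
 have sp: "coroot x \<in> span (coroot ` B)"
  and rep: "b \<in> B \<Longrightarrow> representation (coroot ` B) (coroot x) (coroot b) = representation B x b * (b \<bullet> b) / (x \<bullet> x)"
  if x: "x \<in> R" for x b
 proof -
  let ?k = "\<lambda>c. representation B x (coroot c) * (coroot c \<bullet> coroot c) / (x \<bullet> x)"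
  have xs: "x \<in> span B" using x R_span by blast
  have "(\<Sum>c\<in>coroot ` B. ?k c *\<^sub>R c) = (\<Sum>b\<in>B. (representation B x b * (b \<bullet> b) / (x \<bullet> x)) *\<^sub>R coroot b)"
   by (simp add: sum.reindex inj_coroot)
  also have "\<dots> = (\<Sum>b\<in>B. (2 / (x \<bullet> x)) *\<^sub>R (representation B x b *\<^sub>R b))"
  proof (rule sum.cong)
   fix b assume "b \<in> B"
   then have "b \<bullet> b \<noteq> 0" using nz B_sub by auto
   then show "(representation B x b * (b \<bullet> b) / (x \<bullet> x)) *\<^sub>R coroot b = (2 / (x \<bullet> x)) *\<^sub>R (representation B x b *\<^sub>R b)"
    by (simp add: coroot_def)
  qed simp
  also have "\<dots> = coroot x" unfolding scaleR_sum_right[symmetric] expand[OF xs] by (simp add: coroot_def)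
  finally have eq: "(\<Sum>c\<in>coroot ` B. ?k c *\<^sub>R c) = coroot x" .
  have "(\<Sum>c\<in>coroot ` B. ?k c *\<^sub>R c) \<in> span (coroot ` B)"
   by (intro span_sum span_mul span_base)
  then show sp: "coroot x \<in> span (coroot ` B)" unfolding eq .
  show "representation (coroot ` B) (coroot x) (coroot b) = representation B x b * (b \<bullet> b) / (x \<bullet> x)" if b: "b \<in> B"
  proof -
   have "representation (coroot ` B) (\<Sum>c\<in>coroot ` B. ?k c *\<^sub>R c) (coroot b)
    = (\<Sum>c\<in>coroot ` B. representation (coroot ` B) (?k c *\<^sub>R c) (coroot b))"
    by (subst real_vector.representation_sum[OF ind]) (auto intro: span_mul span_base)
   also have "\<dots> = (\<Sum>c\<in>coroot ` B. if c = coroot b then ?k c else 0)"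
    by (rule sum.cong) (auto simp: real_vector.representation_scale[OF ind] real_vector.representation_basis[OF ind] span_base)
   also have "\<dots> = ?k (coroot b)" using b finite_B by simp
   finally show ?thesis unfolding eq by simp
  qed
 qed
 show br: "based_roots (coroot ` R) (coroot ` B)"
 proof
  fix a assume "a \<in> coroot ` R"
  then obtain x where x: "x \<in> R" "a = coroot x" by blast
  then have xx: "0 < x \<bullet> x" using nz by simp
  have bb: "0 \<le> (b::'a) \<bullet> b" for b by simp
  show "(\<forall>b\<in>coroot ` B. 0 \<le> representation (coroot ` B) a b) \<or> (\<forall>b\<in>coroot ` B. representation (coroot ` B) a b \<le> 0)"
  proof (rule disjE[OF same_sign[OF x(1)]])
   assume *: "\<forall>b\<in>B. 0 \<le> representation B x b"
   have "0 \<le> representation (coroot ` B) a (coroot b)" if "b \<in> B" for b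
    unfolding x(2) rep[OF x(1) that] by (intro divide_nonneg_pos mult_nonneg_nonneg xx bb *[rule_format, OF that])
   then show ?thesis by blast
  next
   assume *: "\<forall>b\<in>B. representation B x b \<le> 0"
   have "representation (coroot ` B) a (coroot b) \<le> 0" if "b \<in> B" for b
    unfolding x(2) rep[OF x(1) that] by (intro divide_nonpos_pos mult_nonpos_nonneg xx bb *[rule_format, OF that])
   then show ?thesis by blast
  qed
 next
  fix a c assume a: "a \<in> coroot ` R" "c *\<^sub>R a \<in> coroot ` R"
  then obtain x y where xy: "x \<in> R" "y \<in> R" "a = coroot x" "c *\<^sub>R coroot x = coroot y" by blast
  have c0: "c \<noteq> 0"
  proof
   assume "c = 0"
   then have "coroot y = 0" using xy by simp
   then show False using nz xy by simp
  qed
  have xx: "x \<bullet> x \<noteq> 0" using nz xy by simp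
  have "y = coroot (c *\<^sub>R coroot x)" using xy(4) by simp
  also have "\<dots> = (1/c) *\<^sub>R coroot (coroot x)" by (rule coroot_scale[OF c0])
  finally have "(1/c) *\<^sub>R x \<in> R" using xy(2) by simp
  then have "1/c = 1 \<or> 1/c = -1" using red xy(1) by blast
  then show "c = 1 \<or> c = -1" using c0 by (auto simp: field_simps)
 next
  show "coroot ` B \<subseteq> coroot ` R" using B_sub by blast
  show "coroot ` R \<subseteq> span (coroot ` B)" using sp by blast
 next
  show "finite (coroot ` R)" using finite_R by simp
  show "independent (coroot ` B)" by (rule ind)
  show "0 \<notin> coroot ` R" using nz by force
  show "root_refl a x \<in> coroot ` R" if "a \<in> coroot ` R" "x \<in> coroot ` R" for a x
  proof -
   obtain c y where "c \<in> R" "y \<in> R" "a = coroot c" "x = coroot y" using \<open>a \<in> coroot ` R\<close> \<open>x \<in> coroot ` R\<close> by blast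
   then show ?thesis using refl_closed[of c y] root_refl_coroot[of c] root_refl_coroot_coroot[of c y] by (metis image_eqI)
  qed
  show "cartan a b \<in> \<int>" if "a \<in> coroot ` R" "b \<in> coroot ` R" for a b
  proof -
   obtain c y where "c \<in> R" "y \<in> R" "a = coroot c" "b = coroot y" using \<open>a \<in> coroot ` R\<close> \<open>b \<in> coroot ` R\<close> by blast
   then show ?thesis using cartan_int[of y c] cartan_coroot[of c y] by metis
  qed
 qed
 have word: "word_elt root_refl (map coroot ws) = word_elt root_refl ws" for ws :: "'a list"
  by (induction ws) (simp_all only: list.map word_elt_Nil word_elt_Cons root_refl_coroot)
 show "gen_subgroup root_refl (coroot ` B) = W"
 proof (intro set_eqI iffI)
  fix w assume "w \<in> gen_subgroup root_refl (coroot ` B)"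
  then obtain ws where ws: "set ws \<subseteq> coroot ` B" "w = word_elt root_refl ws" by (rule gen_subgroupE)
  have "set (map coroot ws) \<subseteq> B" using ws(1) by auto
  from word_elt_in_gen[OF this, of root_refl] show "w \<in> W" using word ws(2) by metis
 next
  fix w assume "w \<in> W"
  then obtain ws where ws: "set ws \<subseteq> B" "w = word_elt root_refl ws" by (rule gen_subgroupE)
  have "set (map coroot ws) \<subseteq> coroot ` B" using ws(1) by auto
  from word_elt_in_gen[OF this, of root_refl] show "w \<in> gen_subgroup root_refl (coroot ` B)"
   using word ws(2) by metis
 qed
 show "based_roots.pos (coroot ` R) (coroot ` B) = coroot ` pos"
 proof -
  have iff: "0 \<le> representation (coroot ` B) (coroot x) (coroot b) \<longleftrightarrow> 0 \<le> representation B x b"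
   if "b \<in> B" "x \<in> R" for x b
  proof -
   have "b \<noteq> 0" "x \<noteq> 0" using that nz B_sub by auto
   then have "0 < (b \<bullet> b) / (x \<bullet> x)" by simp
   then have "0 \<le> representation B x b * ((b \<bullet> b) / (x \<bullet> x)) \<longleftrightarrow> 0 \<le> representation B x b"
    by (simp only: zero_le_mult_iff) linarith
   then show ?thesis unfolding rep[OF that(2,1)] by simp
  qed
  show ?thesis
  proof (intro set_eqI iffI)
   fix y assume "y \<in> based_roots.pos (coroot ` R) (coroot ` B)"
   then obtain x where x: "x \<in> R" "y = coroot x" "\<forall>b\<in>coroot ` B. 0 \<le> representation (coroot ` B) y b"
    unfolding based_roots.pos_def[OF br] by blast
   then have "x \<in> pos" unfolding pos_def using iff by blast
   with x show "y \<in> coroot ` pos" by blast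
  next
   fix y assume "y \<in> coroot ` pos"
   then obtain x where x: "x \<in> R" "y = coroot x" "\<forall>b\<in>B. 0 \<le> representation B x b"
    unfolding pos_def by blast
   then show "y \<in> based_roots.pos (coroot ` R) (coroot ` B)"
    unfolding based_roots.pos_def[OF br] using iff by blast
  qed
 qed
qed

end

section \<open>The Weyl denominator and Macdonald's identity\<close>

context based_roots
begin

lemma pos_nonzero: "a \<in> pos \<Longrightarrow> a \<noteq> 0" using zero_notin by (auto simp: pos_def)

lemma prod_W_pos:
 fixes F :: "'a \<Rightarrow> real"
 assumes "w \<in> W" "\<And>a. a \<in> R \<Longrightarrow> F (- a) = - F a"
 shows "(\<Prod>a\<in>pos. F (w a)) = eps w * (\<Prod>a\<in>pos. F a)"
proof -
 let ?h = "\<lambda>a. if w a \<in> pos then w a else - w a"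
 have "(\<Prod>a\<in>pos. F (w a)) = (\<Prod>a\<in>pos. (if a \<in> Inv w then -1 else 1) * F (?h a))"
 proof (rule prod.cong)
  fix a assume a: "a \<in> pos"
  then have "w a \<in> R" using W_R[OF assms(1)] pos_R by auto
  then show "F (w a) = (if a \<in> Inv w then -1 else 1) * F (?h a)" using a assms(2)[of "w a"] by (auto simp: Inv_def)
 qed simp
 also have "\<dots> = (\<Prod>a\<in>pos. if a \<in> Inv w then -1 else 1) * (\<Prod>a\<in>pos. F (?h a))" by (rule prod.distrib)
 also have "(\<Prod>a\<in>pos. if a \<in> Inv w then -1 else 1) = eps w"
 proof -
  have "(\<Prod>a\<in>pos. if a \<in> Inv w then -1 else (1::real)) = (\<Prod>a\<in>Inv w. -1)"
   by (rule prod.inter_restrict[OF finite_pos, symmetric, THEN trans]) (rule prod.cong, auto simp: Inv_def)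
  then show ?thesis by (simp add: eps_def)
 qed
 also have "(\<Prod>a\<in>pos. F (?h a)) = (\<Prod>a\<in>pos. F a)" by (rule prod.reindex_bij_betw[OF W_pos_image[OF assms(1)]])
 finally show ?thesis .
qed

text \<open>The vectors \<open>rho - \<Sum>Y\<close> are the half sums of positive roots with a
  choice of signs, minus on \<open>Y\<close>. Elements of \<open>W\<close> permute these sign
  patterns, and \<open>flip w Y\<close> is the image of the pattern \<open>Y\<close>.\<close>

definition flip :: "('a \<Rightarrow> 'a) \<Rightarrow> 'a set \<Rightarrow> 'a set" where
 "flip w Y = {b \<in> pos. if inv w b \<in> pos then inv w b \<in> Y else - inv w b \<notin> Y}"

lemma flip_sub: "flip w Y \<subseteq> pos" by (auto simp: flip_def)

lemma rho_minus_sum: "Y \<subseteq> pos \<Longrightarrow> rho - \<Sum>Y = (1/2) *\<^sub>R (\<Sum>a\<in>pos. (if a \<in> Y then -1 else 1) *\<^sub>R a)"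
proof -
 assume Y: "Y \<subseteq> pos"
 have "\<Sum>Y = (\<Sum>a\<in>pos. if a \<in> Y then a else 0)"
  by (subst sum.inter_restrict[OF finite_pos, symmetric]) (rule sum.cong, use Y in auto)
 then have "rho - \<Sum>Y = (\<Sum>a\<in>pos. (1/2) *\<^sub>R a - (if a \<in> Y then a else 0))"
  by (simp add: rho_def scaleR_sum_right sum_subtractf)
 also have "\<dots> = (\<Sum>a\<in>pos. (1/2) *\<^sub>R ((if a \<in> Y then -1 else 1) *\<^sub>R a))"
 proof (rule sum.cong)
  fix a :: 'a
  have "(1/2) *\<^sub>R a - 1 *\<^sub>R a = (1/2 - 1) *\<^sub>R a" by (rule scaleR_diff_left[symmetric])
  then have "(1/2) *\<^sub>R a - a = (1/2) *\<^sub>R ((-1) *\<^sub>R a)" by simp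
  then show "(1/2) *\<^sub>R a - (if a \<in> Y then a else 0) = (1/2) *\<^sub>R ((if a \<in> Y then -1 else 1) *\<^sub>R a)"
   by (cases "a \<in> Y") simp_all
 qed simp
 finally show ?thesis by (simp only: scaleR_sum_right)
qed

lemma flip_rho:
 assumes w: "w \<in> W" and Y: "Y \<subseteq> pos"
 shows "w (rho - \<Sum>Y) = rho - \<Sum>(flip w Y)"
proof -
 let ?h = "\<lambda>a. if w a \<in> pos then w a else - w a"
 have "w (rho - \<Sum>Y) = (1/2) *\<^sub>R (\<Sum>a\<in>pos. (if a \<in> Y then -1 else 1) *\<^sub>R w a)"
  unfolding rho_minus_sum[OF Y] by (simp only: linear_cmul[OF W_linear[OF w]] W_sum[OF w])
 also have "(\<Sum>a\<in>pos. (if a \<in> Y then -1 else 1) *\<^sub>R w a)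
  = (\<Sum>a\<in>pos. (if ?h a \<in> flip w Y then -1 else 1) *\<^sub>R ?h a)"
 proof (rule sum.cong)
  fix a assume a: "a \<in> pos"
  have m: "- a \<notin> pos" and h: "w a \<notin> pos \<Longrightarrow> - w a \<in> pos"
   using a neg_notin_pos W_R[OF w] pos_R notin_pos by auto
  have inv: "inv w (w a) = a" "inv w (- w a) = - a"
   using W_inv[OF w] W_minus[OF W_inv(1)[OF w]] by auto
  show "(if a \<in> Y then -1 else 1) *\<^sub>R w a = (if ?h a \<in> flip w Y then -1 else 1) *\<^sub>R ?h a"
   using a m h by (auto simp: flip_def inv)
 qed simp
 also have "\<dots> = (\<Sum>a\<in>pos. (if a \<in> flip w Y then -1 else 1) *\<^sub>R a)"
  by (rule sum.reindex_bij_betw[OF W_pos_image[OF w]])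
 finally show ?thesis unfolding rho_minus_sum[OF flip_sub] .
qed

lemma flip_flip:
 assumes w: "w \<in> W" and Y: "Y \<subseteq> pos"
 shows "flip (inv w) (flip w Y) = Y"
proof -
 have ii: "inv (inv w) = w" using inv_inv[OF w] .
 have "a \<in> flip (inv w) (flip w Y) \<longleftrightarrow> a \<in> Y" if a: "a \<in> pos" for a
 proof -
  have m: "- a \<notin> pos" and h: "w a \<notin> pos \<Longrightarrow> - w a \<in> pos"
   using a neg_notin_pos W_R[OF w] pos_R notin_pos by auto
  have inv: "inv w (w a) = a" "inv w (- w a) = - a"
   using W_inv[OF w] W_minus[OF W_inv(1)[OF w]] by auto
  have 1: "w a \<in> flip w Y \<longleftrightarrow> a \<in> Y" if "w a \<in> pos"
   using that a inv unfolding flip_def by simp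
  have 2: "- w a \<in> flip w Y \<longleftrightarrow> a \<notin> Y" if "w a \<notin> pos"
   using h[OF that] m inv unfolding flip_def by simp
  show ?thesis unfolding flip_def[of "inv w" "flip w Y"] ii using a 1 2 by simp
 qed
 then show ?thesis using Y flip_sub[of "inv w"] by blast
qed

lemma flip_bij: "w \<in> W \<Longrightarrow> bij_betw (flip w) (Pow pos) (Pow pos)"
proof (rule bij_betw_byWitness[where f' = "flip (inv w)"])
 assume w: "w \<in> W"
 show "\<forall>Y\<in>Pow pos. flip (inv w) (flip w Y) = Y" using flip_flip[OF w] by blast
 show "\<forall>Y\<in>Pow pos. flip w (flip (inv w) Y) = Y"
  using flip_flip[OF W_inv(1)[OF w]] unfolding inv_inv[OF w] by blast
 show "flip w ` Pow pos \<subseteq> Pow pos" "flip (inv w) ` Pow pos \<subseteq> Pow pos"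
  using flip_sub by blast+
qed

lemma flip_empty: "flip w {} = Inv (inv w)"
 by (auto simp: flip_def Inv_def)

lemma sum_pos_zero: assumes "Y \<subseteq> pos" "\<Sum>Y = 0" shows "Y = {}"
proof (rule ccontr)
 assume "Y \<noteq> {}"
 then have "0 < (\<Sum>a\<in>Y. ht a)" using assms(1) ht_pos
  by (intro sum_pos) (auto intro: finite_subset)
 then show False using assms(2) ht_sum[of "\<lambda>a. a" Y] by simp
qed

text \<open>After pulling back by \<open>inv w\<close> the pattern has sum \<open>rho\<close>, so
  its set is a collection of positive roots with sum zero, hence empty.\<close>

lemma rho_flip_eq:
 assumes w: "w \<in> W" and Y: "Y \<subseteq> pos" and eq: "rho - \<Sum>Y = w rho"
 shows "Y = Inv (inv w)"
proof -
 have "rho - \<Sum>(flip (inv w) Y) = inv w (w rho)" using flip_rho[OF W_inv(1)[OF w] Y] eq by simp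
 then have "flip (inv w) Y = {}" using sum_pos_zero[OF flip_sub] W_inv(2)[OF w] by simp
 then show ?thesis using flip_flip[OF W_inv(1)[OF w] Y] inv_inv[OF w] flip_empty by metis
qed

text \<open>Move the vector into the dominant chamber, where it has the form
  \<open>rho - \<Sum>Z\<close>. If it lies on no wall, its Cartan numbers are positive integers,
  hence at least those of \<open>rho\<close>, so \<open>\<Sum>Z\<close> is antidominant. Being also
  a sum of positive roots it has square norm at most zero, and the vector is
  \<open>rho\<close>.\<close>

lemma singular_or_rho:
 assumes Y: "Y \<subseteq> pos"
 shows "(\<exists>y\<in>W. \<exists>b\<in>B. root_refl b (y (rho - \<Sum>Y)) = y (rho - \<Sum>Y)) \<or> (\<exists>w\<in>W. rho - \<Sum>Y = w rho)"
proof -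
 obtain y where y: "y \<in> W" "dominant (y (rho - \<Sum>Y))" using dominant_exists by blast
 let ?Z = "flip y Y"
 have eq: "y (rho - \<Sum>Y) = rho - \<Sum>?Z" by (rule flip_rho[OF y(1) Y])
 show ?thesis
 proof (cases "\<exists>b\<in>B. (rho - \<Sum>?Z) \<bullet> b = 0")
  case True
  then obtain b where "b \<in> B" "(rho - \<Sum>?Z) \<bullet> b = 0" by blast
  then have "root_refl b (y (rho - \<Sum>Y)) = y (rho - \<Sum>Y)" unfolding eq by (simp add: root_refl_def)
  with y(1) \<open>b \<in> B\<close> show ?thesis by blast
 next
  case False
  have "\<Sum>?Z \<bullet> b \<le> 0" if b: "b \<in> B" for b
  proof -
   have bb: "0 < b \<bullet> b" using b B_pos pos_nonzero by simp
   have "0 \<le> (rho - \<Sum>?Z) \<bullet> b" using y(2) b unfolding eq dominant_def by blast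
   moreover have "(rho - \<Sum>?Z) \<bullet> b \<noteq> 0" using False b by blast
   ultimately have p: "0 < cartan (rho - \<Sum>?Z) b" using bb by (simp add: cartan_def)
   have "cartan (\<Sum>?Z) b \<in> \<int>" unfolding cartan_sum using flip_sub[of y Y] b B_sub pos_R
    by (intro Ints_sum cartan_int) blast+
   moreover have "cartan (rho - \<Sum>?Z) b = 1 - cartan (\<Sum>?Z) b" by (simp add: cartan_diff cartan_rho b)
   ultimately have "cartan (\<Sum>?Z) b \<le> 0" using p by (auto elim!: Ints_cases)
   then show ?thesis using bb by (simp add: cartan_def divide_le_0_iff mult_le_0_iff)
  qed
  then have "0 \<le> a \<bullet> - \<Sum>?Z" if "a \<in> ?Z" for a
   using that flip_sub by (intro pos_inner_nonneg[of a]) (auto simp: inner_commute)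
  then have "(\<Sum>a\<in>?Z. a \<bullet> \<Sum>?Z) \<le> 0" by (intro sum_nonpos) auto
  then have "\<Sum>?Z \<bullet> \<Sum>?Z \<le> 0" by (simp only: inner_sum_left)
  then have "\<Sum>?Z = 0" using inner_gt_zero_iff[of "\<Sum>?Z"] by (meson not_less)
  then have "y (rho - \<Sum>Y) = rho" using eq by simp
  then have "rho - \<Sum>Y = inv y rho" using W_inv(2)[OF y(1)] by metis
  then show ?thesis using W_inv(1)[OF y(1)] by blast
 qed
qed

text \<open>The value at \<open>z\<close> of the alternating sum over the orbit of \<open>x\<close>,
  with real exponentials in place of formal ones.\<close>

definition alt_exp :: "'a \<Rightarrow> 'a \<Rightarrow> real" where
 "alt_exp z x = (\<Sum>w\<in>W. eps w * exp (w x \<bullet> z))"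

lemma W_reindex_right: assumes "y \<in> W" shows "bij_betw (\<lambda>w. w \<circ> y) W W"
proof (rule bij_betw_byWitness[where f' = "\<lambda>w. w \<circ> inv y"])
 have 1: "y \<circ> inv y = id" "inv y \<circ> y = id" using W_inv[OF assms] by auto
 show "\<forall>w\<in>W. w \<circ> y \<circ> inv y = w" "\<forall>w\<in>W. w \<circ> inv y \<circ> y = w" by (simp_all add: comp_assoc 1)
 show "(\<lambda>w. w \<circ> y) ` W \<subseteq> W" "(\<lambda>w. w \<circ> inv y) ` W \<subseteq> W" using assms W_inv(1)[OF assms] W_comp by blast+
qed

lemma alt_exp_W: assumes "y \<in> W" shows "alt_exp z (y x) = eps y * alt_exp z x"
proof -
 have "eps y * alt_exp z (y x) = (\<Sum>w\<in>W. eps (w \<circ> y) * exp ((w \<circ> y) x \<bullet> z))"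
  unfolding alt_exp_def sum_distrib_left by (rule sum.cong) (simp_all add: eps_mult assms)
 also have "\<dots> = alt_exp z x" unfolding alt_exp_def
  by (rule sum.reindex_bij_betw[OF W_reindex_right[OF assms]])
 finally show ?thesis by (metis eps_sq mult.assoc mult_1)
qed

definition weyl_den :: "'a \<Rightarrow> real" where
 "weyl_den z = (\<Prod>a\<in>pos. exp (a \<bullet> z / 2) - exp (- (a \<bullet> z) / 2))"

lemma weyl_den_nz: "(\<And>a. a \<in> pos \<Longrightarrow> a \<bullet> z \<noteq> 0) \<Longrightarrow> weyl_den z \<noteq> 0"
 by (auto simp: weyl_den_def)

lemma alt_exp_singular:
 assumes "b \<in> B" "root_refl b x = x" shows "alt_exp z x = 0"
 using alt_exp_W[OF B_W[OF assms(1)], of z x] assms eps_refl by simp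

lemma expand_numerator:
 assumes "w \<in> W"
 shows "(\<Prod>a\<in>pos. exp (w a \<bullet> z / 2) - t a * exp (- (w a \<bullet> z) / 2))
  = (\<Sum>Y\<in>Pow pos. (\<Prod>a\<in>Y. - t a) * exp (w (rho - \<Sum>Y) \<bullet> z))"
proof -
 have "(\<Prod>a\<in>pos. exp (w a \<bullet> z / 2) - t a * exp (- (w a \<bullet> z) / 2))
  = (\<Prod>a\<in>pos. - t a * exp (- (w a \<bullet> z) / 2) + exp (w a \<bullet> z / 2))" by simp
 also have "\<dots> = (\<Sum>Y\<in>Pow pos. (\<Prod>a\<in>Y. - t a * exp (- (w a \<bullet> z) / 2)) * (\<Prod>a\<in>pos - Y. exp (w a \<bullet> z / 2)))"
  by (rule prod_add[OF finite_pos])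
 also have "\<dots> = (\<Sum>Y\<in>Pow pos. (\<Prod>a\<in>Y. - t a) * exp (w (rho - \<Sum>Y) \<bullet> z))"
 proof (rule sum.cong)
  fix Y assume "Y \<in> Pow pos"
  then have Y: "Y \<subseteq> pos" "finite Y" by (auto intro: finite_subset)
  have "w (rho - \<Sum>Y) = (1/2) *\<^sub>R (\<Sum>a\<in>pos. w a) - (\<Sum>a\<in>Y. w a)"
   by (simp add: linear_diff[OF W_linear[OF assms]] rho_def linear_cmul[OF W_linear[OF assms]] W_sum[OF assms])
  then have "w (rho - \<Sum>Y) \<bullet> z = (\<Sum>a\<in>pos. w a \<bullet> z / 2) - (\<Sum>a\<in>Y. w a \<bullet> z)"
   by (simp add: inner_diff_left inner_sum_left sum_divide_distrib)
  also have "\<dots> = (\<Sum>a\<in>pos - Y. w a \<bullet> z / 2) + (\<Sum>a\<in>Y. w a \<bullet> z / 2) - (\<Sum>a\<in>Y. w a \<bullet> z)"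
   using sum.subset_diff[OF Y(1) finite_pos] by metis
  also have "\<dots> = (\<Sum>a\<in>pos - Y. w a \<bullet> z / 2) + (\<Sum>a\<in>Y. - (w a \<bullet> z) / 2)"
   by (simp add: sum_divide_distrib[symmetric] sum_negf)
  finally show "(\<Prod>a\<in>Y. - t a * exp (- (w a \<bullet> z) / 2)) * (\<Prod>a\<in>pos - Y. exp (w a \<bullet> z / 2))
    = (\<Prod>a\<in>Y. - t a) * exp (w (rho - \<Sum>Y) \<bullet> z)"
   using Y by (simp only: prod.distrib exp_add exp_sum finite_Diff finite_pos) (simp only: mult_ac)
 qed simp
 finally show ?thesis .
qed

text \<open>Expanding over subsets \<open>Y\<close> leaves alternating sums at
  \<open>rho - \<Sum>Y\<close>. Such a sum is zero unless the vector lies in the orbit of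
  \<open>rho\<close>, and then \<open>Y = Inv w\<close> for exactly one \<open>w\<close>; the sign
  of the alternating sum and the signs of the factors \<open>- t a\<close> cancel.\<close>

lemma alternating_numerator:
 "(\<Sum>w\<in>W. eps w * (\<Prod>a\<in>pos. exp (w a \<bullet> z / 2) - t a * exp (- (w a \<bullet> z) / 2)))
  = alt_exp z rho * (\<Sum>w\<in>W. \<Prod>a\<in>Inv w. t a)"
proof -
 have "(\<Sum>w\<in>W. eps w * (\<Prod>a\<in>pos. exp (w a \<bullet> z / 2) - t a * exp (- (w a \<bullet> z) / 2)))
  = (\<Sum>w\<in>W. \<Sum>Y\<in>Pow pos. (\<Prod>a\<in>Y. - t a) * (eps w * exp (w (rho - \<Sum>Y) \<bullet> z)))"
  by (rule sum.cong) (simp_all only: expand_numerator sum_distrib_left mult_ac)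
 also have "\<dots> = (\<Sum>Y\<in>Pow pos. (\<Prod>a\<in>Y. - t a) * alt_exp z (rho - \<Sum>Y))"
  unfolding alt_exp_def sum_distrib_left by (rule sum.swap)
 also have "\<dots> = (\<Sum>Y\<in>Inv ` W. (\<Prod>a\<in>Y. - t a) * alt_exp z (rho - \<Sum>Y))"
 proof (rule sum.mono_neutral_right)
  show "\<forall>Y\<in>Pow pos - Inv ` W. (\<Prod>a\<in>Y. - t a) * alt_exp z (rho - \<Sum>Y) = 0"
  proof
   fix Y assume Y: "Y \<in> Pow pos - Inv ` W"
   then have "\<not> (\<exists>w\<in>W. rho - \<Sum>Y = w rho)" using rho_flip_eq W_inv(1) by blast
   then obtain y b where yb: "y \<in> W" "b \<in> B" "root_refl b (y (rho - \<Sum>Y)) = y (rho - \<Sum>Y)"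
    using singular_or_rho[of Y] Y by blast
   have "eps y * alt_exp z (rho - \<Sum>Y) = 0"
    using alt_exp_singular[OF yb(2,3)] alt_exp_W[OF yb(1)] by metis
   then show "(\<Prod>a\<in>Y. - t a) * alt_exp z (rho - \<Sum>Y) = 0" by (simp add: eps_def)
  qed
 qed (auto simp: Inv_def)
 also have "\<dots> = (\<Sum>w\<in>W. (\<Prod>a\<in>Inv w. - t a) * alt_exp z (rho - \<Sum>(Inv w)))"
  using Inv_inj by (subst sum.reindex) (auto simp: inj_on_def)
 also have "\<dots> = (\<Sum>w\<in>W. alt_exp z rho * (\<Prod>a\<in>Inv w. t a))"
 proof (rule sum.cong)
  fix w assume w: "w \<in> W"
  have "rho - \<Sum>(Inv w) = inv w rho" using W_rho[OF W_inv(1)[OF w]] inv_inv[OF w] by simp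
  then have "alt_exp z (rho - \<Sum>(Inv w)) = eps w * alt_exp z rho"
   using alt_exp_W[OF W_inv(1)[OF w]] eps_inv[OF w] by simp
  moreover have "(\<Prod>a\<in>Inv w. - t a) = eps w * (\<Prod>a\<in>Inv w. t a)" by (simp add: eps_def prod_uminus)
  moreover have "(e * p) * (e * x) = (e * e) * (x * p)" for e p x :: real by (simp add: algebra_simps)
  ultimately show "(\<Prod>a\<in>Inv w. - t a) * alt_exp z (rho - \<Sum>(Inv w)) = alt_exp z rho * (\<Prod>a\<in>Inv w. t a)"
   by (simp only: eps_sq mult_1)
 qed simp
 finally show ?thesis by (simp only: sum_distrib_left)
qed

lemma weyl_den_W: "w \<in> W \<Longrightarrow> (\<Prod>a\<in>pos. exp (w a \<bullet> z / 2) - exp (- (w a \<bullet> z) / 2)) = eps w * weyl_den z"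
 unfolding weyl_den_def by (rule prod_W_pos) auto

text \<open>Taking all \<open>t a = 1\<close> in the previous identity turns its left side into \<open>card W\<close> copies of the denominator.\<close>

theorem weyl_denominator: "alt_exp z rho = weyl_den z"
proof -
 have "(\<Sum>w\<in>W. eps w * (\<Prod>a\<in>pos. exp (w a \<bullet> z / 2) - 1 * exp (- (w a \<bullet> z) / 2)))
  = (\<Sum>w\<in>W. weyl_den z)"
  by (rule sum.cong) (simp_all only: mult_1 weyl_den_W mult.assoc[symmetric] eps_sq)
 moreover have "W \<noteq> {}" using gen_subgroup_id by blast
 ultimately show ?thesis using alternating_numerator[of z "\<lambda>_. 1"] by simp
qed

text \<open>Multiplying numerator and denominator by \<open>exp (x / 2)\<close> makes each factor
  symmetric, so the denominators of all summands are \<open>weyl_den z\<close> up to the sign of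
  \<open>w\<close>, and the numerators are those of \<open>alternating_numerator\<close>.\<close>

theorem macdonald_identity:
 assumes reg: "\<And>a. a \<in> pos \<Longrightarrow> a \<bullet> z \<noteq> 0"
 shows "(\<Sum>w\<in>W. \<Prod>a\<in>pos. (1 - t a * exp (- (w a \<bullet> z))) / (1 - exp (- (w a \<bullet> z)))) = (\<Sum>w\<in>W. \<Prod>a\<in>Inv w. t a)"
proof -
 have "(\<Prod>a\<in>pos. (1 - t a * exp (- (w a \<bullet> z))) / (1 - exp (- (w a \<bullet> z))))
  = eps w * (\<Prod>a\<in>pos. exp (w a \<bullet> z / 2) - t a * exp (- (w a \<bullet> z) / 2)) / weyl_den z" if w: "w \<in> W" for w
 proof -
  have e: "exp (- x) = exp (- x / 2) / exp (x / 2)" for x :: real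
   by (simp add: exp_minus field_simps flip: exp_add)
  have "(1 - s * exp (- x)) / (1 - exp (- x)) = (exp (x/2) - s * exp (- x / 2)) / (exp (x/2) - exp (- x / 2))" for s x :: real
  proof -
   have "1 - s * exp (- x) = (exp (x/2) - s * exp (- x / 2)) / exp (x/2)" for s
    unfolding e[of x] by (simp add: diff_divide_distrib)
   from this[of s] this[of 1] show ?thesis by simp
  qed
  then have "(\<Prod>a\<in>pos. (1 - t a * exp (- (w a \<bullet> z))) / (1 - exp (- (w a \<bullet> z))))
   = (\<Prod>a\<in>pos. exp (w a \<bullet> z / 2) - t a * exp (- (w a \<bullet> z) / 2)) / (eps w * weyl_den z)"
   by (simp add: prod_dividef weyl_den_W[OF w, symmetric])
  also have "\<dots> = eps w * (\<Prod>a\<in>pos. exp (w a \<bullet> z / 2) - t a * exp (- (w a \<bullet> z) / 2)) / weyl_den z"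
  proof -
   have "eps w = 1 \<or> eps w = -1" by (simp add: eps_def power_minus_even) (metis neg_one_even_power neg_one_odd_power)
   then show ?thesis by auto
  qed
  finally show ?thesis .
 qed
 then have "(\<Sum>w\<in>W. \<Prod>a\<in>pos. (1 - t a * exp (- (w a \<bullet> z))) / (1 - exp (- (w a \<bullet> z))))
  = (\<Sum>w\<in>W. eps w * (\<Prod>a\<in>pos. exp (w a \<bullet> z / 2) - t a * exp (- (w a \<bullet> z) / 2))) / weyl_den z"
  by (simp add: sum_divide_distrib)
 also have "\<dots> = (\<Sum>w\<in>W. \<Prod>a\<in>Inv w. t a)"
  unfolding alternating_numerator weyl_denominator using weyl_den_nz[OF reg] by simp
 finally show ?thesis .
qed

lemma W_maps_to_neg_simple:
 assumes "w \<in> W" "w \<noteq> id" shows "\<exists>a\<in>pos. \<exists>b\<in>B. w a = - b"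
proof -
 have "inv w \<noteq> id" using assms inv_inv inv_id by metis
 then obtain b where b: "b \<in> B" "inv w b \<notin> pos" using W_descent[OF W_inv(1)[OF assms(1)]] by blast
 then have "- inv w b \<in> pos" using notin_pos W_R[OF W_inv(1)[OF assms(1)]] B_sub by blast
 moreover have "w (- inv w b) = - b" using W_minus[OF assms(1)] W_inv(3)[OF assms(1)] by simp
 ultimately show ?thesis using b by blast
qed

text \<open>An element other than the identity sends some positive root to \<open>- b\<close> with
  \<open>b\<close> simple. Invariance of \<open>t\<close> turns the corresponding numerator into
  \<open>1 - t b * exp (b \<bullet> z)\<close>, which is zero at the chosen points, so a single
  summand survives.\<close>

theorem macdonald_product:
 assumes reg: "\<And>a. a \<in> pos \<Longrightarrow> a \<bullet> z \<noteq> 0"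
  and inv: "\<And>w a. w \<in> W \<Longrightarrow> a \<in> R \<Longrightarrow> t (w a) = t a"
  and spec: "\<And>b. b \<in> B \<Longrightarrow> t b * exp (b \<bullet> z) = 1"
 shows "(\<Sum>w\<in>W. \<Prod>a\<in>Inv w. t a) = (\<Prod>a\<in>pos. (1 - t a * exp (- (a \<bullet> z))) / (1 - exp (- (a \<bullet> z))))"
proof -
 let ?f = "\<lambda>w. \<Prod>a\<in>pos. (1 - t a * exp (- (w a \<bullet> z))) / (1 - exp (- (w a \<bullet> z)))"
 have "?f w = 0" if w: "w \<in> W" "w \<noteq> id" for w
 proof -
  obtain a b where ab: "a \<in> pos" "b \<in> B" "w a = - b" using W_maps_to_neg_simple[OF w] by blast
  have "t a = t (- b)" using inv[OF w(1), of a] ab pos_R by metis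
  also have "\<dots> = t b" using inv[OF B_W[OF ab(2)], of b] ab(2) B_sub by auto
  finally have "1 - t a * exp (- (w a \<bullet> z)) = 0" using spec[OF ab(2)] ab(3) by simp
  then show ?thesis using ab(1) by (intro prod_zero) auto
 qed
 then have "(\<Sum>w\<in>W. ?f w) = (\<Sum>w\<in>{id}. ?f w)"
  by (intro sum.mono_neutral_right) auto
 then show ?thesis using macdonald_identity[OF reg, of t] by simp
qed

section \<open>Stabilizers and minimal coset representatives\<close>

definition stab :: "'a \<Rightarrow> ('a \<Rightarrow> 'a) set" where "stab x = {w \<in> W. w x = x}"
text \<open>For dominant \<open>x\<close> these are the shortest elements of the left cosets of
  \<open>stab x\<close>, described by the roots that they keep positive.\<close>

definition min_reps :: "'a \<Rightarrow> ('a \<Rightarrow> 'a) set" where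
 "min_reps x = {w \<in> W. \<forall>a\<in>pos. a \<bullet> x = 0 \<longrightarrow> w a \<in> pos}"

lemma stab_W: "w \<in> stab x \<Longrightarrow> w \<in> W" and min_reps_W: "w \<in> min_reps x \<Longrightarrow> w \<in> W"
 by (auto simp: stab_def min_reps_def)

lemma stab_inv: assumes "w \<in> stab x" shows "inv w \<in> stab x"
 using assms W_inv(1,2)[of w] unfolding stab_def by (metis (mono_tags, lifting) mem_Collect_eq)

lemma stab_comp: "v \<in> stab x \<Longrightarrow> w \<in> stab x \<Longrightarrow> v \<circ> w \<in> stab x"
 using W_comp by (auto simp: stab_def)

lemma stab_inner: assumes "w \<in> stab x" shows "w a \<bullet> x = a \<bullet> x"
 using assms W_inner[of w a x] by (auto simp: stab_def)

lemma finite_stab [simp, intro]: "finite (stab x)" and finite_min_reps [simp, intro]: "finite (min_reps x)"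
 by (auto simp: stab_def min_reps_def)

lemma stab_pos:
 assumes x: "dominant x" and "w \<in> stab x" "a \<in> pos" "a \<bullet> x \<noteq> 0" shows "w a \<in> pos"
proof (rule ccontr)
 assume "w a \<notin> pos"
 then have "- w a \<in> pos" using notin_pos W_R pos_R assms stab_W by metis
 then have "0 \<le> - w a \<bullet> x" using dominant_pos[OF x] by (metis inner_commute)
 moreover have "0 \<le> a \<bullet> x" using dominant_pos[OF x assms(3)] by (simp add: inner_commute)
 ultimately show False using stab_inner[OF assms(2), of a] assms(4) by simp
qed

text \<open>All terms of \<open>a \<bullet> x\<close> in the base are nonnegative, so a zero sum
  leaves \<open>a\<close> supported on the simple roots orthogonal to \<open>x\<close>.\<close>

lemma orth_expand:
 assumes x: "dominant x" and a: "a \<in> pos" "a \<bullet> x = 0" and b: "b \<in> B" "b \<bullet> x \<noteq> 0"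
 shows "representation B a b = 0"
proof -
 have s: "a \<in> span B" using a R_span pos_R by blast
 have nn: "0 \<le> representation B a c * (c \<bullet> x)" if "c \<in> B" for c
  using a x that by (auto simp: pos_def dominant_def inner_commute intro!: mult_nonneg_nonneg)
 have "(\<Sum>c\<in>B. representation B a c * (c \<bullet> x)) = 0" using a(2) expand_inner[OF s] by simp
 then have "representation B a b * (b \<bullet> x) = 0"
  using sum_nonneg_eq_0_iff[OF finite_B, of "\<lambda>c. representation B a c * (c \<bullet> x)"] nn b(1) by blast
 with b show ?thesis by simp
qed

text \<open>A simple descent of an element of \<open>stab x\<close> is orthogonal to
  \<open>x\<close> by \<open>stab_pos\<close>, so induction on descents only ever removes simple
  reflections that fix \<open>x\<close>. Coefficients over \<open>Bx\<close> and over
  \<open>B\<close> coincide, which settles positivity.\<close>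

lemma orth_roots:
 assumes x: "dominant x"
 defines "Rx \<equiv> {a \<in> R. a \<bullet> x = 0}" and "Bx \<equiv> {b \<in> B. b \<bullet> x = 0}"
 shows "based_roots Rx Bx" "based_roots.pos Rx Bx = {a \<in> pos. a \<bullet> x = 0}"
  "gen_subgroup root_refl Bx = stab x"
proof -
 have BxB: "Bx \<subseteq> B" and fB: "finite Bx" using finite_B by (auto simp: Bx_def)
 have ind: "independent Bx" using real_vector.independent_mono[OF indep BxB] .
 have spos: "a \<in> span Bx" if a: "a \<in> pos" "a \<bullet> x = 0" for a
 proof -
  have s: "a \<in> span B" using a R_span pos_R by blast
  have "a = (\<Sum>b\<in>B. representation B a b *\<^sub>R b)" using expand[OF s] by simp
  also have "\<dots> = (\<Sum>b\<in>Bx. representation B a b *\<^sub>R b)"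
   using orth_expand[OF x a] finite_B by (intro sum.mono_neutral_right) (auto simp: Bx_def)
  also have "\<dots> \<in> span Bx" by (intro span_sum span_mul span_base)
  finally show ?thesis .
 qed
 have sp: "a \<in> span Bx" if "a \<in> Rx" for a
 proof (cases "a \<in> pos")
  case False
  then have "- a \<in> pos" using that notin_pos by (auto simp: Rx_def)
  then have "- a \<in> span Bx" using that by (intro spos) (auto simp: Rx_def)
  then show ?thesis using span_neg by fastforce
 qed (use that spos in \<open>auto simp: Rx_def\<close>)
 have rep: "representation Bx a = representation B a" if "a \<in> Rx" for a
  using real_vector.representation_extend[OF indep sp[OF that] BxB] by simp
 show br: "based_roots Rx Bx"
 proof
  show "finite Rx" "Bx \<subseteq> Rx" "independent Bx" "0 \<notin> Rx" "Rx \<subseteq> span Bx"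
   using finite_R B_sub zero_notin sp ind by (auto simp: Rx_def Bx_def)
  show "root_refl a y \<in> Rx" if "a \<in> Rx" "y \<in> Rx" for a y
   using that refl_closed by (auto simp: Rx_def root_refl_cartan inner_diff_left)
  show "cartan a b \<in> \<int>" if "a \<in> Rx" "b \<in> Rx" for a b using that cartan_int by (auto simp: Rx_def)
  show "c = 1 \<or> c = -1" if "a \<in> Rx" "c *\<^sub>R a \<in> Rx" for a c using that red by (auto simp: Rx_def)
  show "(\<forall>b\<in>Bx. 0 \<le> representation Bx a b) \<or> (\<forall>b\<in>Bx. representation Bx a b \<le> 0)" if "a \<in> Rx" for a
   using rep[OF that] same_sign[of a] that BxB by (auto simp: Rx_def)
 qed
 show "based_roots.pos Rx Bx = {a \<in> pos. a \<bullet> x = 0}"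
 proof -
  have "(\<forall>b\<in>Bx. 0 \<le> representation Bx a b) \<longleftrightarrow> a \<in> pos" if a: "a \<in> Rx" for a
  proof
   assume *: "\<forall>b\<in>Bx. 0 \<le> representation Bx a b"
   show "a \<in> pos"
   proof (rule ccontr)
    assume "a \<notin> pos"
    then have n: "- a \<in> pos" using a notin_pos by (auto simp: Rx_def)
    have "representation B a b = 0" if "b \<in> Bx" for b
    proof -
     have "a \<in> span B" using a R_span by (auto simp: Rx_def)
     then have "0 \<le> - representation B a b" using n that BxB rep_minus by (auto simp: pos_def)
     then show ?thesis using * that rep[OF a] by fastforce
    qed
    then have "a = 0" using real_vector.sum_representation_eq[OF ind sp[OF a] fB subset_refl] rep[OF a] by simp
    then show False using a zero_notin by (auto simp: Rx_def)
   qed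
  next
   assume "a \<in> pos"
   then show "\<forall>b\<in>Bx. 0 \<le> representation Bx a b" using BxB unfolding rep[OF a] by (auto simp: pos_def)
  qed
  then show ?thesis unfolding based_roots.pos_def[OF br] using pos_R by (auto simp: Rx_def)
 qed
 show "gen_subgroup root_refl Bx = stab x"
 proof (intro set_eqI iffI)
  fix w assume "w \<in> gen_subgroup root_refl Bx"
  then show "w \<in> stab x"
  proof (induction rule: gen_subgroup_induct)
   case (step b w)
   have "root_refl b \<in> stab x" using step(1) B_W by (auto simp: stab_def Bx_def root_refl_def inner_commute)
   then show ?case using stab_comp step by blast
  next
   case id
   have "id \<in> W" "id x = x" by (rule gen_subgroup_id) simp
   then show ?case unfolding stab_def by blast
  qed
 next
  fix w assume "w \<in> stab x"
  then have "w \<in> W" "w \<in> stab x" using stab_W by auto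
  then show "w \<in> gen_subgroup root_refl Bx"
  proof (induction rule: W_induct_right)
   case (step w b)
   have b: "b \<bullet> x = 0" using stab_pos[OF x step(5), of b] step(2,3) B_pos by blast
   then have bs: "root_refl b \<in> stab x" using B_W[OF step(2)] by (auto simp: stab_def root_refl_def inner_commute)
   have bg: "root_refl b \<in> gen_subgroup root_refl Bx"
    using b step(2) by (intro gen_subgroup_gen) (auto simp: Bx_def)
   have "w \<circ> root_refl b \<in> gen_subgroup root_refl Bx" using step(4) stab_comp[OF step(5) bs] by blast
   from gen_subgroup_comp[OF this bg] show ?case by (simp add: comp_assoc invol step(2))
  qed (rule gen_subgroup_id)
 qed
qed

lemma Inv_stab: assumes "dominant x" "w \<in> stab x" shows "a \<in> Inv w \<Longrightarrow> a \<bullet> x = 0"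
 using stab_pos[OF assms, of a] by (auto simp: Inv_def)

text \<open>Uniqueness: if two factorisations differed, a simple descent \<open>b\<close> of
  \<open>y' \<circ> inv y\<close> would be orthogonal to \<open>x\<close>, and comparing both
  representatives would make \<open>u b\<close> and \<open>- u b\<close> positive. Existence: simple
  roots orthogonal to \<open>x\<close> that are made negative are stripped off from the
  right.\<close>

lemma coset_bij:
 assumes x: "dominant x"
 shows "bij_betw (\<lambda>(u, y). u \<circ> y) (min_reps x \<times> stab x) W"
proof -
 let ?c = "\<lambda>(u, y). u \<circ> y"
 have inj: "inj_on ?c (min_reps x \<times> stab x)"
 proof (rule inj_onI, clarify)
  fix u y u' y' assume u: "u \<in> min_reps x" "y \<in> stab x" "u' \<in> min_reps x" "y' \<in> stab x" and e: "u \<circ> y = u' \<circ> y'"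
  let ?v = "y' \<circ> inv y"
  have v: "?v \<in> stab x" using u stab_inv stab_comp by blast
  have uv: "u a = u' (?v a)" for a
   using fun_cong[OF e, of "inv y a"] W_inv(3)[OF stab_W[OF u(2)]] by simp
  have "?v = id"
  proof (rule ccontr)
   assume "?v \<noteq> id"
   then obtain b where b: "b \<in> B" "?v b \<notin> pos" using W_descent[OF stab_W[OF v]] by blast
   have b0: "b \<bullet> x = 0" using stab_pos[OF x v B_pos[OF b(1)]] b by blast
   have n: "- ?v b \<in> pos" using b notin_pos W_R[OF stab_W[OF v]] B_sub by blast
   have "- ?v b \<bullet> x = 0" using stab_inner[OF v, of b] b0 by simp
   then have "u' (- ?v b) \<in> pos" using n u(3) by (auto simp: min_reps_def)
   then have "- u b \<in> pos" using uv[of b] W_minus[OF min_reps_W[OF u(3)]] by metis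
   moreover have "u b \<in> pos" using u(1) b0 B_pos[OF b(1)] by (auto simp: min_reps_def)
   ultimately show False using neg_notin_pos by blast
  qed
  then have yy: "y' (inv y a) = a" for a by (metis comp_apply id_apply)
  have "u = u'" using uv by (auto simp: yy)
  moreover have "y = y'" using yy[of "y a" for a] W_inv(2)[OF stab_W[OF u(2)]] by (auto simp: fun_eq_iff)
  ultimately show "u = u' \<and> y = y'" by blast
 qed
 have surj: "\<exists>u\<in>min_reps x. \<exists>y\<in>stab x. w = u \<circ> y" if "w \<in> W" for w
  using that
 proof (induction "card (Inv w)" arbitrary: w rule: less_induct)
  case less
  show ?case
  proof (cases "w \<in> min_reps x")
   case True
   moreover have "id \<in> stab x" by (simp add: stab_def)
   ultimately show ?thesis by (intro bexI[of _ w] bexI[of _ id]) auto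
  next
   case False
   then obtain a where a: "a \<in> pos" "a \<bullet> x = 0" "w a \<notin> pos" using less(2) by (auto simp: min_reps_def)
   \<comment> \<open>The root \<open>a\<close> is supported on simple roots orthogonal to
     \<open>x\<close>. If all of these stayed positive, \<open>w a\<close> would have nonnegative
     height.\<close>
   have "\<exists>b\<in>B. b \<bullet> x = 0 \<and> w b \<notin> pos"
   proof (rule ccontr)
    assume n: "\<not> ?thesis"
    have s: "a \<in> span B" using a R_span pos_R by blast
    have "0 \<le> representation B a b * ht (w b)" if b: "b \<in> B" for b
    proof (cases "b \<bullet> x = 0")
     case True
     then have "w b \<in> pos" using n b by blast
     then show ?thesis using a(1) b ht_pos[of "w b"] by (auto simp: pos_def intro!: mult_nonneg_nonneg)
    next
     case False
     then show ?thesis using orth_expand[OF x a(1,2) b] by simp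
    qed
    then have "0 \<le> (\<Sum>b\<in>B. representation B a b * ht (w b))" by (rule sum_nonneg)
    also have "\<dots> = ht (w (\<Sum>b\<in>B. representation B a b *\<^sub>R b))"
     by (simp add: W_sum[OF less(2)] linear_cmul[OF W_linear[OF less(2)]] ht_sum ht_scaleR)
    also have "\<dots> = ht (w a)" by (simp add: expand[OF s])
    finally have "0 \<le> ht (w a)" .
    moreover have "- w a \<in> pos" using a notin_pos W_R[OF less(2)] pos_R by blast
    ultimately show False using ht_pos[of "- w a"] by (simp add: ht_minus)
   qed
   then obtain b where b: "b \<in> B" "b \<bullet> x = 0" "w b \<notin> pos" by blast
   let ?v = "w \<circ> root_refl b"
   have v: "?v \<in> W" using W_comp[OF less(2) B_W[OF b(1)]] .
   obtain u y where uy: "u \<in> min_reps x" "y \<in> stab x" "?v = u \<circ> y"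
    using less(1)[OF _ v] card_Inv_comp_refl[OF less(2) b(1,3)] by auto
   have bs: "root_refl b \<in> stab x" using b B_W[OF b(1)] by (auto simp: stab_def root_refl_def inner_commute)
   have "w = u \<circ> (y \<circ> root_refl b)"
    using arg_cong[OF uy(3), of "\<lambda>f. f \<circ> root_refl b"] by (simp add: comp_assoc invol b(1))
   then show ?thesis using uy stab_comp[OF uy(2) bs] by blast
  qed
 qed
 have "?c ` (min_reps x \<times> stab x) = W"
 proof (intro set_eqI iffI)
  fix w assume "w \<in> ?c ` (min_reps x \<times> stab x)"
  then obtain u y where "u \<in> min_reps x" "y \<in> stab x" "w = u \<circ> y" by (auto simp only: image_iff mem_Sigma_iff case_prod_conv bex_simps)
  then show "w \<in> W" using W_comp stab_W min_reps_W by blast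
 next
  fix w assume "w \<in> W"
  then obtain u y where "u \<in> min_reps x" "y \<in> stab x" "w = u \<circ> y" using surj by blast
  then show "w \<in> ?c ` (min_reps x \<times> stab x)" by (intro image_eqI[of _ _ "(u, y)"]) simp_all
 qed
 with inj show ?thesis by (simp add: bij_betw_def)
qed

text \<open>The inversions of \<open>u \<circ> y\<close> orthogonal to \<open>x\<close> are those of
  \<open>y\<close>; the others are the images under \<open>inv y\<close> of those of
  \<open>u\<close>, and invariance of \<open>t'\<close> removes this shift. Two weights are kept
  apart because the affine length counts orthogonal roots with \<open>u\<close> and the others with
  \<open>1 / u\<close>.\<close>

theorem coset_sum:
 fixes t t' :: "'a \<Rightarrow> real"
 assumes x: "dominant x" and inv: "\<And>w a. w \<in> W \<Longrightarrow> a \<in> R \<Longrightarrow> t' (w a) = t' a"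
 shows "(\<Sum>w\<in>W. \<Prod>a\<in>Inv w. if a \<bullet> x = 0 then t a else t' a)
  = (\<Sum>w\<in>stab x. \<Prod>a\<in>Inv w. t a) * (\<Sum>w\<in>min_reps x. \<Prod>a\<in>Inv w. t' a)"
proof -
 have *: "(\<Prod>a\<in>Inv (u \<circ> y). if a \<bullet> x = 0 then t a else t' a) = (\<Prod>a\<in>Inv y. t a) * (\<Prod>a\<in>Inv u. t' a)"
  if u: "u \<in> min_reps x" and y: "y \<in> stab x" for u y
 proof -
  have yW: "y \<in> W" and uW: "u \<in> W" using u y by (auto intro: stab_W min_reps_W)
  have 1: "{a \<in> Inv (u \<circ> y). a \<bullet> x = 0} = Inv y"
  proof (intro set_eqI iffI)
   fix a assume a: "a \<in> {a \<in> Inv (u \<circ> y). a \<bullet> x = 0}"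
   then have "y a \<notin> pos" using u stab_inner[OF y, of a] by (auto simp: Inv_def min_reps_def)
   then show "a \<in> Inv y" using a by (simp add: Inv_def)
  next
   fix a assume a: "a \<in> Inv y"
   then have a0: "a \<bullet> x = 0" using Inv_stab[OF x y] by blast
   have "- y a \<in> pos" using a notin_pos W_R[OF yW] pos_R by (auto simp: Inv_def)
   moreover have "- y a \<bullet> x = 0" using stab_inner[OF y, of a] a0 by simp
   ultimately have "u (- y a) \<in> pos" using u by (auto simp: min_reps_def)
   then have "u (y a) \<notin> pos" using W_minus[OF uW] neg_notin_pos by metis
   with a a0 show "a \<in> {a \<in> Inv (u \<circ> y). a \<bullet> x = 0}" by (simp add: Inv_def)
  qed
  have uI: "a \<bullet> x \<noteq> 0" if "a \<in> Inv u" for a using u that by (auto simp: Inv_def min_reps_def)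
  have 2: "{a \<in> Inv (u \<circ> y). a \<bullet> x \<noteq> 0} = inv y ` Inv u"
  proof (intro set_eqI iffI)
   fix a assume a: "a \<in> {a \<in> Inv (u \<circ> y). a \<bullet> x \<noteq> 0}"
   then have "y a \<in> Inv u" using stab_pos[OF x y, of a] by (auto simp: Inv_def)
   then show "a \<in> inv y ` Inv u" using W_inv(2)[OF yW, of a] by (metis imageI)
  next
   fix a assume "a \<in> inv y ` Inv u"
   then obtain c where c: "c \<in> Inv u" "a = inv y c" by blast
   have "a \<in> pos" using stab_pos[OF x stab_inv[OF y], of c] c uI by (auto simp: Inv_def)
   moreover have "a \<bullet> x \<noteq> 0" using uI[OF c(1)] stab_inner[OF stab_inv[OF y], of c] c by simp
   ultimately show "a \<in> {a \<in> Inv (u \<circ> y). a \<bullet> x \<noteq> 0}" using c W_inv(3)[OF yW] by (auto simp: Inv_def)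
  qed
  have "(\<Prod>a\<in>Inv (u \<circ> y). if a \<bullet> x = 0 then t a else t' a)
   = (\<Prod>a\<in>{a \<in> Inv (u \<circ> y). a \<bullet> x = 0}. t a) * (\<Prod>a\<in>{a \<in> Inv (u \<circ> y). a \<bullet> x \<noteq> 0}. t' a)"
   by (subst prod.If_cases) (auto simp: Collect_neg_eq Int_def intro!: arg_cong2[where f = "(*)"] prod.cong)
  also have "(\<Prod>a\<in>{a \<in> Inv (u \<circ> y). a \<bullet> x \<noteq> 0}. t' a) = (\<Prod>a\<in>Inv u. t' (inv y a))"
  proof -
   have "inj (inv y)" using W_inv(4)[OF W_inv(1)[OF yW]] bij_is_inj by blast
   then show ?thesis unfolding 2 by (subst prod.reindex) (auto intro: inj_on_subset)
  qed
  also have "\<dots> = (\<Prod>a\<in>Inv u. t' a)"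
   using inv[OF W_inv(1)[OF yW]] pos_R by (intro prod.cong) (auto simp: Inv_def)
  finally show ?thesis unfolding 1 .
 qed
 have "(\<Sum>w\<in>W. \<Prod>a\<in>Inv w. if a \<bullet> x = 0 then t a else t' a)
  = (\<Sum>(u, y)\<in>min_reps x \<times> stab x. \<Prod>a\<in>Inv (u \<circ> y). if a \<bullet> x = 0 then t a else t' a)"
  by (subst sum.reindex_bij_betw[OF coset_bij[OF x], symmetric]) (simp add: case_prod_unfold)
 also have "\<dots> = (\<Sum>(u, y)\<in>min_reps x \<times> stab x. (\<Prod>a\<in>Inv y. t a) * (\<Prod>a\<in>Inv u. t' a))"
  by (rule sum.cong) (auto simp: *)
 also have "\<dots> = (\<Sum>w\<in>stab x. \<Prod>a\<in>Inv w. t a) * (\<Sum>w\<in>min_reps x. \<Prod>a\<in>Inv w. t' a)"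
  by (simp add: sum.cartesian_product[symmetric] sum_product sum.swap[of _ "stab x"])
 finally show ?thesis .
qed

end

text \<open>Dominated convergence for the counting measure, phrased for \<open>has_sum\<close>. It
  passes to the limit in the finite expansions that lead to \<open>bott_sum\<close>.\<close>

lemma has_sum_dominated:
 fixes f :: "nat \<Rightarrow> 'b \<Rightarrow> real"
 assumes lim: "\<And>x. x \<in> A \<Longrightarrow> (\<lambda>n. f n x) \<longlonglongrightarrow> g x"
  and bound: "\<And>n x. x \<in> A \<Longrightarrow> \<bar>f n x\<bar> \<le> h x"
  and h: "h summable_on A"
  and s: "\<And>n. (f n has_sum s n) A" and L: "s \<longlonglongrightarrow> L"
 shows "(g has_sum L) A"
proof -
 have hn: "0 \<le> h x" if "x \<in> A" for x using bound[OF that, of 0] by simp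
 have "(\<lambda>x. norm (h x)) summable_on A" using h hn by (subst summable_on_cong[where g = h]) auto
 then have hi: "integrable (count_space A) h"
  using abs_summable_equivalent unfolding Infinite_Set_Sum.abs_summable_on_def by blast
 have AE: "AE x in count_space A. P x" if "\<And>x. x \<in> A \<Longrightarrow> P x" for P using that by (simp add: AE_count_space)
 have bd: "\<And>i. AE x in count_space A. norm (f i x) \<le> h x" using bound by (simp add: AE_count_space)
 have lm: "AE x in count_space A. (\<lambda>i. f i x) \<longlonglongrightarrow> g x" using lim by (simp add: AE_count_space)
 have gi: "integrable (count_space A) g" and fi: "\<And>i. integrable (count_space A) (f i)"
  and cv: "(\<lambda>i. integral\<^sup>L (count_space A) (f i)) \<longlonglongrightarrow> integral\<^sup>L (count_space A) g"
  by (rule integrable_dominated_convergence[OF _ _ hi lm bd] integrable_dominated_convergence2[OF _ _ hi lm bd]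
    integral_dominated_convergence[OF _ _ hi lm bd]; simp)+
 have fe: "integral\<^sup>L (count_space A) (f i) = s i" for i
  using infsetsum_infsum[of "f i" A] fi[of i] infsumI[OF s[of i]]
  unfolding Infinite_Set_Sum.abs_summable_on_def infsetsum_def by simp
 have "integral\<^sup>L (count_space A) g = L" using LIMSEQ_unique[OF cv] L unfolding fe by blast
 moreover have "Infinite_Set_Sum.abs_summable_on g A" using gi unfolding Infinite_Set_Sum.abs_summable_on_def .
 ultimately show ?thesis
  using infsetsum_infsum[of g A] abs_summable_equivalent[of g A] abs_summable_summable[of g A]
   has_sum_infsum[of g A] unfolding infsetsum_def by simp
qed

section \<open>The root lattice and coefficients of product series\<close>

context based_roots
begin

definition lat :: "'a set" where "lat = {\<Sum>b\<in>B. of_int (m b) *\<^sub>R b | m. True}"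

lemma lat_add: "x \<in> lat \<Longrightarrow> y \<in> lat \<Longrightarrow> x + y \<in> lat"
proof -
 assume "x \<in> lat" "y \<in> lat"
 then obtain m n where "x = (\<Sum>b\<in>B. of_int (m b) *\<^sub>R b)" "y = (\<Sum>b\<in>B. of_int (n b) *\<^sub>R b)" by (auto simp: lat_def)
 then have "x + y = (\<Sum>b\<in>B. of_int (m b + n b) *\<^sub>R b)" by (simp add: sum.distrib scaleR_add_left)
 then show ?thesis unfolding lat_def by (intro CollectI exI[of _ "\<lambda>b. m b + n b"]) simp
qed

lemma lat_scale: "x \<in> lat \<Longrightarrow> of_int k *\<^sub>R x \<in> lat"
proof -
 assume "x \<in> lat"
 then obtain m where "x = (\<Sum>b\<in>B. of_int (m b) *\<^sub>R b)" by (auto simp: lat_def)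
 then have "of_int k *\<^sub>R x = (\<Sum>b\<in>B. of_int (k * m b) *\<^sub>R b)" by (simp add: scaleR_sum_right)
 then show ?thesis unfolding lat_def by (intro CollectI exI[of _ "\<lambda>b. k * m b"]) simp
qed

lemma lat_minus: "x \<in> lat \<Longrightarrow> - x \<in> lat" using lat_scale[of x "-1"] by simp
lemma lat_diff: "x \<in> lat \<Longrightarrow> y \<in> lat \<Longrightarrow> x - y \<in> lat" using lat_add[of x "-y"] lat_minus by simp
lemma lat_0: "0 \<in> lat" unfolding lat_def by (intro CollectI exI[of _ "\<lambda>_. 0"]) simp
lemma lat_nat: "x \<in> lat \<Longrightarrow> real k *\<^sub>R x \<in> lat" using lat_scale[of x "int k"] by simp

lemma lat_B: assumes "b \<in> B" shows "b \<in> lat"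
proof -
 have "(\<Sum>c\<in>B. of_int (if c = b then 1 else 0) *\<^sub>R c) = (\<Sum>c\<in>B. if c = b then b else 0)"
  by (rule sum.cong) auto
 also have "\<dots> = b" using assms finite_B by simp
 finally show ?thesis unfolding lat_def by (intro CollectI exI[of _ "\<lambda>c. if c = b then 1 else 0"]) simp
qed

lemma lat_sum: "(\<And>x. x \<in> X \<Longrightarrow> f x \<in> lat) \<Longrightarrow> sum f X \<in> lat"
 by (induction X rule: infinite_finite_induct) (auto simp: lat_0 lat_add)

lemma lat_span: "x \<in> lat \<Longrightarrow> x \<in> span B" unfolding lat_def by (auto intro: span_sum span_mul span_base)

lemma W_lat: assumes "w \<in> W" "x \<in> lat" shows "w x \<in> lat"
 using assms
proof (induction rule: gen_subgroup_induct)
 case (step b w)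
 then have y: "w x \<in> lat" by blast
 then obtain m where m: "w x = (\<Sum>c\<in>B. of_int (m c) *\<^sub>R c)" by (auto simp: lat_def)
 have "cartan (w x) b \<in> \<int>" unfolding m cartan_sum cartan_scaleR
  using step(1) B_sub by (intro Ints_sum Ints_mult cartan_int) auto
 then obtain k where "cartan (w x) b = of_int k" by (auto elim: Ints_cases)
 then show ?case using lat_diff[OF y lat_scale[OF lat_B[OF step(1)], of k]] by (simp add: root_refl_cartan)
qed simp

text \<open>The source of integral coefficients: a root is the image of a simple root under
  \<open>W\<close>, and \<open>W\<close> preserves the lattice because Cartan numbers are
  integers.\<close>

lemma R_lat: "a \<in> R \<Longrightarrow> a \<in> lat"
 using W_root[of a] W_lat lat_B by blast

lemma rep_lat: assumes "x \<in> lat" shows "representation B x b \<in> \<int>"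
proof -
 obtain m where m: "x = (\<Sum>c\<in>B. of_int (m c) *\<^sub>R c)" using assms by (auto simp: lat_def)
 have "representation B x b = (\<Sum>c\<in>B. representation B (of_int (m c) *\<^sub>R c) b)"
  unfolding m by (subst real_vector.representation_sum[OF indep]) (auto intro: span_mul span_base)
 also have "\<dots> = (\<Sum>c\<in>B. of_int (m c) * (if b = c then 1 else 0))"
  by (rule sum.cong) (simp_all add: real_vector.representation_scale[OF indep] span_base rep_B)
 also have "\<dots> \<in> \<int>" by (intro Ints_sum Ints_mult) auto
 finally show ?thesis .
qed

lemma rep_R_int: "a \<in> R \<Longrightarrow> representation B a b \<in> \<int>" using R_lat rep_lat by blast

lemma ht_lat: "x \<in> lat \<Longrightarrow> ht x \<in> \<int>"
 by (subst ht_rep[OF lat_span]) (auto intro!: Ints_sum rep_lat)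

lemma ht_ge_1: "a \<in> pos \<Longrightarrow> 1 \<le> ht a"
 using ht_pos[of a] ht_lat[OF R_lat[OF pos_R], of a] by (auto elim!: Ints_cases)

lemma ht_nonsimple: assumes "a \<in> pos" "a \<notin> B" shows "2 \<le> ht a"
proof (rule ccontr)
 assume "\<not> 2 \<le> ht a"
 then have h1: "ht a = 1" using ht_pos[OF assms(1)] ht_lat[OF R_lat[OF pos_R[OF assms(1)]]] by (auto elim!: Ints_cases)
 have s: "a \<in> span B" using R_span pos_R assms by blast
 have nn: "0 \<le> representation B a b" if "b \<in> B" for b using assms(1) that by (simp add: pos_def)
 have "\<exists>b\<in>B. representation B a b \<noteq> 0"
  using rep_zero_imp[OF s] pos_nonzero[OF assms(1)] by blast
 then obtain b where b: "b \<in> B" "representation B a b \<noteq> 0" by blast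
 have "1 \<le> representation B a b" using nn[OF b(1)] b(2) rep_R_int[OF pos_R[OF assms(1)], of b]
  by (auto elim!: Ints_cases)
 moreover have e: "(\<Sum>c\<in>B. representation B a c) = representation B a b + (\<Sum>c\<in>B-{b}. representation B a c)"
  by (rule sum.remove[OF finite_B b(1)])
 moreover have "0 \<le> (\<Sum>c\<in>B-{b}. representation B a c)" by (rule sum_nonneg) (use nn in auto)
 ultimately have 1: "representation B a b = 1" "(\<Sum>c\<in>B-{b}. representation B a c) = 0"
  using h1 ht_rep[OF s] by linarith+
 then have z: "\<forall>c\<in>B-{b}. representation B a c = 0"
  using sum_nonneg_eq_0_iff[of "B - {b}" "representation B a"] finite_B nn by auto
 have "a = (\<Sum>c\<in>B. representation B a c *\<^sub>R c)" using expand[OF s] by simp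
 also have "\<dots> = representation B a b *\<^sub>R b + (\<Sum>c\<in>B-{b}. representation B a c *\<^sub>R c)"
  by (rule sum.remove[OF finite_B b(1)])
 also have "\<dots> = b" using 1 z by simp
 finally show False using assms b by simp
qed

text \<open>The reflection of \<open>b\<close> in \<open>c\<close> is a positive root, and its
  coefficient at \<open>c\<close> is \<open>- cartan b c\<close>.\<close>

lemma simple_obtuse: assumes "b \<in> B" "c \<in> B" "b \<noteq> c" shows "b \<bullet> c \<le> 0"
proof -
 have s: "root_refl c b \<in> pos" by (rule refl_pos) (use assms B_pos in auto)
 have "representation B (root_refl c b) c = representation B b c - cartan b c * representation B c c"
  unfolding root_refl_cartan using assms
  by (simp add: real_vector.representation_diff[OF indep] real_vector.representation_scale[OF indep] span_base span_mul)
 then have "representation B (root_refl c b) c = - cartan b c" using assms by (simp add: rep_B)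
 then have "cartan b c \<le> 0" using s assms by (auto simp: pos_def)
 moreover have "0 < c \<bullet> c" using assms B_pos pos_nonzero by simp
 ultimately show ?thesis by (simp add: cartan_def divide_le_0_iff mult_le_0_iff)
qed

text \<open>Write \<open>x\<close> as the difference of its positive part \<open>p\<close> and
  negative part \<open>n\<close>. Different simple roots do not form acute angles, so
  \<open>p \<bullet> n \<le> 0\<close>, whereas dominance gives
  \<open>x \<bullet> n \<ge> 0\<close>; together \<open>n \<bullet> n \<le> 0\<close>.\<close>

lemma dominant_rep_nonneg:
 assumes x: "dominant x" "x \<in> span B" and b: "b \<in> B"
 shows "0 \<le> representation B x b"
proof -
 let ?r = "representation B x"
 let ?p = "\<Sum>b\<in>B. max 0 (?r b) *\<^sub>R b" and ?n = "\<Sum>b\<in>B. max 0 (- ?r b) *\<^sub>R b"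
 have e: "x = ?p - ?n"
 proof -
  have "?p - ?n = (\<Sum>b\<in>B. (max 0 (?r b) - max 0 (- ?r b)) *\<^sub>R b)"
   by (simp add: sum_subtractf scaleR_diff_left)
  also have "\<dots> = (\<Sum>b\<in>B. ?r b *\<^sub>R b)" by (rule sum.cong) (auto simp: max_def)
  also have "\<dots> = x" by (rule expand[OF x(2)])
  finally show ?thesis by (rule sym)
 qed
 have "?p \<bullet> ?n = (\<Sum>b\<in>B. \<Sum>c\<in>B. (max 0 (?r b) * max 0 (- ?r c)) * (b \<bullet> c))"
  unfolding inner_sum_left unfolding inner_sum_right
  by (intro sum.cong refl) (simp only: inner_scaleR_left inner_scaleR_right mult_ac)
 also have "\<dots> \<le> 0"
 proof (intro sum_nonpos)
  fix b c assume "b \<in> B" "c \<in> B"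
  then show "(max 0 (?r b) * max 0 (- ?r c)) * (b \<bullet> c) \<le> 0"
  proof (cases "b = c")
   case False
   with \<open>b \<in> B\<close> \<open>c \<in> B\<close> show ?thesis by (intro mult_nonneg_nonpos mult_nonneg_nonneg simple_obtuse) simp_all
  qed (simp add: max_def)
 qed
 finally have pn: "?p \<bullet> ?n \<le> 0" .
 have "0 \<le> x \<bullet> ?n" unfolding inner_sum_right using x(1)
  by (intro sum_nonneg) (auto simp: dominant_def intro!: mult_nonneg_nonneg)
 moreover have "x \<bullet> ?n = (?p - ?n) \<bullet> ?n" by (rule arg_cong[OF e])
 ultimately have "?n \<bullet> ?n \<le> 0" using pn unfolding inner_diff_left by linarith
 then have "?n = 0" using inner_gt_zero_iff[of ?n] by (meson not_less)
 then have "max 0 (- ?r b) = 0"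
  by (rule real_vector.independentD[OF indep finite_B subset_refl _ b])
 then show ?thesis by linarith
qed

definition Lam :: "'a set" where "Lam = {x \<in> lat. dominant x}"

definition Npos :: "'a set" where "Npos = {x \<in> lat. \<forall>b\<in>B. 0 \<le> representation B x b}"

lemma Lam_Npos: "Lam \<subseteq> Npos" 
proof
 fix x assume "x \<in> Lam"
 then show "x \<in> Npos" using dominant_rep_nonneg[OF _ lat_span] unfolding Lam_def Npos_def by blast
qed

text \<open>Unique coefficients turn the sum into a product of geometric series, one for each simple
  root.\<close>

lemma Npos_summable:
 assumes u: "0 < u" "u < 1" shows "(\<lambda>x. u powr ht x) summable_on Npos"
proof -
 let ?f = "\<lambda>m. \<Sum>b\<in>B. real (m b) *\<^sub>R b"
 have inj: "inj_on ?f (PiE B (\<lambda>_. UNIV))"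
 proof (rule inj_onI)
  fix m n assume mn: "m \<in> PiE B (\<lambda>_. UNIV)" "n \<in> PiE B (\<lambda>_. UNIV)" "?f m = ?f n"
  then have "(\<Sum>b\<in>B. (real (m b) - real (n b)) *\<^sub>R b) = 0" by (simp only: scaleR_diff_left sum_subtractf diff_self)
  then have "real (m b) - real (n b) = 0" if "b \<in> B" for b
   by (rule real_vector.independentD[OF indep finite_B subset_refl _ that])
  then have "m b = n b" if "b \<in> B" for b using that by simp
  then show "m = n" by (rule PiE_ext[OF mn(1,2)])
 qed
 have sub: "Npos \<subseteq> ?f ` PiE B (\<lambda>_. UNIV)"
 proof
  fix x assume x: "x \<in> Npos"
  let ?m = "restrict (\<lambda>b. nat \<lfloor>representation B x b\<rfloor>) B"
  have "real (?m b) = representation B x b" if "b \<in> B" for b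
  proof -
   have "representation B x b \<in> \<int>" "0 \<le> representation B x b" using x that rep_lat by (auto simp: Npos_def)
   then show ?thesis using that by (auto elim!: Ints_cases)
  qed
  then have "?f ?m = (\<Sum>b\<in>B. representation B x b *\<^sub>R b)" by (intro sum.cong) (simp_all only:)
  also have "\<dots> = x" by (intro expand lat_span) (use x in \<open>simp add: Npos_def\<close>)
  finally have fm: "?f ?m = x" .
  have "?m \<in> PiE B (\<lambda>_. UNIV)" by (rule restrict_PiE_iff[THEN iffD2]) simp
  then show "x \<in> ?f ` PiE B (\<lambda>_. UNIV)" by (rule image_eqI[where f = ?f, OF fm[symmetric]])
 qed
 have "Infinite_Set_Sum.abs_summable_on (\<lambda>m. \<Prod>b\<in>B. u ^ m b) (PiE B (\<lambda>_. UNIV))"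
 proof (rule abs_summable_on_prod_PiE[OF finite_B])
  show "Infinite_Set_Sum.abs_summable_on (\<lambda>k. u ^ k) UNIV" for b :: 'a
   using u by (simp add: abs_summable_on_nat_iff' summable_geometric)
 qed auto
 then have "(\<lambda>m. \<Prod>b\<in>B. u ^ m b) summable_on (PiE B (\<lambda>_. UNIV))"
  unfolding abs_summable_equivalent[symmetric] by (rule abs_summable_summable)
 moreover have "(\<Prod>b\<in>B. u ^ m b) = u powr ht (?f m)" for m
 proof -
  have "ht (?f m) = (\<Sum>b\<in>B. real (m b))" by (simp add: ht_sum ht_scaleR ht_B)
  then have "u powr ht (?f m) = (\<Prod>b\<in>B. u powr real (m b))" using u by (simp add: powr_sum)
  then show ?thesis using u by (simp only: powr_realpow)
 qed
 ultimately have "(\<lambda>m. u powr ht (?f m)) summable_on (PiE B (\<lambda>_. UNIV))" by (simp only:)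
 then have "(\<lambda>x. u powr ht x) summable_on ?f ` PiE B (\<lambda>_. UNIV)"
  using summable_on_reindex[OF inj, of "\<lambda>x. u powr ht x"] unfolding o_def by (simp only:)
 then show ?thesis by (rule summable_on_subset_banach[OF _ sub])
qed

lemma rho_lat: "2 *\<^sub>R rho \<in> lat" unfolding rho_def using R_lat pos_R by (auto intro!: lat_sum)

lemma two_rho_rep: assumes b: "b \<in> B" shows "1 \<le> representation B (2 *\<^sub>R rho) b"
proof -
 have e: "2 *\<^sub>R rho = (\<Sum>a\<in>pos. a)" by (simp add: rho_def)
 have "representation B (2 *\<^sub>R rho) b = (\<Sum>a\<in>pos. representation B a b)"
  unfolding e using R_span pos_R by (subst real_vector.representation_sum[OF indep]) auto
 moreover have "representation B b b \<le> (\<Sum>a\<in>pos. representation B a b)"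
  using b B_pos by (intro member_le_sum finite_pos) (auto simp: pos_def)
 ultimately show ?thesis using b rep_B by simp
qed

text \<open>Every coefficient of \<open>2 *\<^sub>R rho\<close> is at least one, so its multiples
  move away from all walls of the cone at once. They form the sequence along which coefficients are
  taken to the limit.\<close>

lemma eventually_Npos:
 assumes y: "y \<in> lat" shows "\<forall>\<^sub>F k in sequentially. real k *\<^sub>R (2 *\<^sub>R rho) - y \<in> Npos"
proof -
 have "\<forall>\<^sub>F k in sequentially. 0 \<le> representation B (real k *\<^sub>R (2 *\<^sub>R rho) - y) b" if b: "b \<in> B" for b
 proof -
  have "\<forall>\<^sub>F k in sequentially. representation B y b \<le> real k"
   by (rule filterlim_real_sequentially[unfolded filterlim_at_top, rule_format])
  then show ?thesis
  proof eventually_elim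
   case (elim k)
   have "representation B (real k *\<^sub>R (2 *\<^sub>R rho) - y) b = real k * representation B (2 *\<^sub>R rho) b - representation B y b"
    using lat_span[OF rho_lat] lat_span[OF y]
    by (simp only: real_vector.representation_diff[OF indep] real_vector.representation_scale[OF indep] span_mul)
   moreover have "real k * 1 \<le> real k * representation B (2 *\<^sub>R rho) b"
    by (rule mult_left_mono[OF two_rho_rep[OF b]]) simp
   ultimately show ?case using elim by simp
  qed
 qed
 then have "\<forall>\<^sub>F k in sequentially. \<forall>b\<in>B. 0 \<le> representation B (real k *\<^sub>R (2 *\<^sub>R rho) - y) b"
  by (simp add: eventually_ball_finite_distrib[OF finite_B])
 then show ?thesis unfolding Npos_def
  using lat_diff[OF lat_nat[OF rho_lat] y] by simp
qed

text \<open>\<open>pcoef l x\<close> is the coefficient of \<open>z\<^sup>x\<close> in the product of the one-variable series \<open>g(z\<^sup>a)\<close> over \<open>(a, g)\<close> in \<open>l\<close>.\<close>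

fun pcoef :: "('a \<times> (nat \<Rightarrow> real)) list \<Rightarrow> 'a \<Rightarrow> real" where
 "pcoef [] x = (if x = 0 then 1 else 0)"
| "pcoef ((a, g) # l) x = (\<Sum>k\<in>{k. real k * ht a \<le> ht x}. g k * pcoef l (x - real k *\<^sub>R a))"

lemma pcoef_neg: "fst ` set l \<subseteq> pos \<Longrightarrow> ht x < 0 \<Longrightarrow> pcoef l x = 0"
proof (induction l arbitrary: x)
 case (Cons p l)
 obtain a g where p: "p = (a, g)" by (cases p)
 have "{k. real k * ht a \<le> ht x} = {}"
 proof -
  have "0 \<le> real k * ht a" for k using ht_pos[of a] Cons p by simp
  then show ?thesis using Cons by (smt (verit) Collect_empty_eq)
 qed
 then show ?case using p by simp
qed auto

lemma pcoef_Cons: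
 assumes "a \<in> pos" "fst ` set l \<subseteq> pos" "ht x < real N * ht a"
 shows "pcoef ((a, g) # l) x = (\<Sum>k<N. g k * pcoef l (x - real k *\<^sub>R a))"
proof -
 have h: "0 < ht a" using ht_pos assms by blast
 have "{k. real k * ht a \<le> ht x} \<subseteq> {..<N}"
 proof
  fix k assume "k \<in> {k. real k * ht a \<le> ht x}"
  then have "real k * ht a < real N * ht a" using assms by simp
  then show "k \<in> {..<N}" using h by simp
 qed
 then show ?thesis unfolding pcoef.simps
  using assms by (intro sum.mono_neutral_left) (auto simp: ht_diff ht_scaleR intro!: pcoef_neg)
qed

lemma pcoef_bound_ex: "a \<in> pos \<Longrightarrow> \<exists>N. ht x < real N * ht a"
 using reals_Archimedean3[OF ht_pos] by blast

text \<open>The hypothesis on \<open>h\<close> says that its series is \<open>c0 + c1 X\<close>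
  times that of \<open>g\<close>; on the lattice the factor \<open>X\<close> becomes a shift by
  \<open>a\<close>.\<close>

lemma pcoef_mult:
 assumes a: "a \<in> pos" "fst ` set l \<subseteq> pos"
  and h: "\<And>k. h k = c0 * g k + (if k = 0 then 0 else c1 * g (k - 1))"
 shows "pcoef ((a, h) # l) x = c0 * pcoef ((a, g) # l) x + c1 * pcoef ((a, g) # l) (x - a)"
proof -
 obtain N where N: "ht x < real N * ht a" using pcoef_bound_ex[OF a(1)] by blast
 have hp: "0 < ht a" using ht_pos a by blast
 have N1: "ht x < real (Suc N) * ht a" and N2: "ht (x - a) < real N * ht a"
  using N hp by (simp_all add: ht_diff algebra_simps)
 have "pcoef ((a, h) # l) x = (\<Sum>k<Suc N. h k * pcoef l (x - real k *\<^sub>R a))"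
  by (rule pcoef_Cons[OF a N1])
 also have "\<dots> = (\<Sum>k<Suc N. c0 * (g k * pcoef l (x - real k *\<^sub>R a)))
   + (\<Sum>k<Suc N. (if k = 0 then 0 else c1 * g (k - 1)) * pcoef l (x - real k *\<^sub>R a))"
  unfolding sum.distrib[symmetric] by (rule sum.cong) (simp_all only: h distrib_right mult.assoc)
 also have "(\<Sum>k<Suc N. c0 * (g k * pcoef l (x - real k *\<^sub>R a))) = c0 * pcoef ((a, g) # l) x"
  unfolding pcoef_Cons[OF a N1] by (simp only: sum_distrib_left)
 also have "(\<Sum>k<Suc N. (if k = 0 then 0 else c1 * g (k - 1)) * pcoef l (x - real k *\<^sub>R a))
   = (\<Sum>k<N. c1 * (g k * pcoef l ((x - a) - real k *\<^sub>R a)))"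
  by (subst sum.lessThan_Suc_shift) (simp add: scaleR_add_left algebra_simps)
 also have "\<dots> = c1 * pcoef ((a, g) # l) (x - a)"
  unfolding pcoef_Cons[OF a N2] by (simp only: sum_distrib_left)
 finally show ?thesis .
qed

text \<open>Apply \<open>pcoef_mult\<close> at each root. The subset \<open>Y\<close> records where
  the shift term is chosen, which accounts for the factors \<open>c1 a\<close> and for the
  displacement by \<open>\<Sum>Y\<close>.\<close>

lemma pcoef_subset:
 assumes "distinct as" "set as \<subseteq> pos"
  and h: "\<And>a k. h a k = c0 a * g a k + (if k = 0 then 0 else c1 a * g a (k - 1))"
 shows "pcoef (map (\<lambda>a. (a, h a)) as) x
  = (\<Sum>Y\<in>Pow (set as). (\<Prod>a\<in>Y. c1 a) * (\<Prod>a\<in>set as - Y. c0 a) * pcoef (map (\<lambda>a. (a, g a)) as) (x - \<Sum>Y))"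
 using assms(1,2)
proof (induction as arbitrary: x)
 case Nil
 then show ?case by simp
next
 case (Cons a as)
 let ?lh = "map (\<lambda>a. (a, h a)) as" and ?lg = "map (\<lambda>a. (a, g a)) as"
 let ?C = "\<lambda>Y. (\<Prod>a\<in>Y. c1 a) * (\<Prod>a\<in>set as - Y. c0 a)"
 have a: "a \<in> pos" "fst ` set ?lh \<subseteq> pos" "fst ` set ?lg \<subseteq> pos" and na: "a \<notin> set as" and as: "set as \<subseteq> pos"
  using Cons by auto
 obtain N where N: "ht x < real N * ht a" using pcoef_bound_ex[OF a(1)] by blast
 have N': "ht (x - \<Sum>Y) < real N * ht a" if "Y \<in> Pow (set as)" for Y
 proof -
  have "0 \<le> ht (\<Sum>Y)" unfolding ht_sum
  proof (rule sum_nonneg)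
   fix c assume "c \<in> Y"
   then have "c \<in> pos" using that as by blast
   then show "0 \<le> ht c" using ht_pos by (simp add: less_imp_le)
  qed
  then show ?thesis using N by (simp add: ht_diff)
 qed
 have IH: "pcoef ?lh y = (\<Sum>Y\<in>Pow (set as). ?C Y * pcoef ?lg (y - \<Sum>Y))" for y
  using Cons by simp
 have "pcoef (map (\<lambda>a. (a, h a)) (a # as)) x = (\<Sum>k<N. h a k * pcoef ?lh (x - real k *\<^sub>R a))"
  unfolding list.map by (rule pcoef_Cons[OF a(1,2) N])
 also have "\<dots> = (\<Sum>k<N. \<Sum>Y\<in>Pow (set as). ?C Y * (h a k * pcoef ?lg ((x - \<Sum>Y) - real k *\<^sub>R a)))"
  unfolding IH sum_distrib_left by (intro sum.cong refl) (simp only: mult_ac diff_diff_eq add.commute)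
 also have "\<dots> = (\<Sum>Y\<in>Pow (set as). ?C Y * (\<Sum>k<N. h a k * pcoef ?lg ((x - \<Sum>Y) - real k *\<^sub>R a)))"
  unfolding sum_distrib_left by (rule sum.swap)
 also have "\<dots> = (\<Sum>Y\<in>Pow (set as). ?C Y * (c0 a * pcoef ((a, g a) # ?lg) (x - \<Sum>Y)
   + c1 a * pcoef ((a, g a) # ?lg) (x - \<Sum>Y - a)))"
 proof (rule sum.cong)
  fix Y assume Y: "Y \<in> Pow (set as)"
  show "?C Y * (\<Sum>k<N. h a k * pcoef ?lg ((x - \<Sum>Y) - real k *\<^sub>R a)) = ?C Y * (c0 a * pcoef ((a, g a) # ?lg) (x - \<Sum>Y)
   + c1 a * pcoef ((a, g a) # ?lg) (x - \<Sum>Y - a))"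
   unfolding pcoef_Cons[OF a(1,3) N'[OF Y], symmetric] by (simp only: pcoef_mult[OF a(1,3) h])
 qed simp
 also have "\<dots> = (\<Sum>Y\<in>Pow (set as). ?C Y * c0 a * pcoef ((a, g a) # ?lg) (x - \<Sum>Y))
   + (\<Sum>Y\<in>Pow (set as). ?C Y * c1 a * pcoef ((a, g a) # ?lg) (x - \<Sum>Y - a))"
  by (simp only: sum.distrib distrib_left mult.assoc)
 finally have eq: "pcoef (map (\<lambda>a. (a, h a)) (a # as)) x = \<dots>" .
 let ?D = "\<lambda>Y. (\<Prod>a\<in>Y. c1 a) * (\<Prod>a\<in>set (a # as) - Y. c0 a) * pcoef ((a, g a) # ?lg) (x - \<Sum>Y)"
 have Pw: "Pow (set (a # as)) = Pow (set as) \<union> insert a ` Pow (set as)" by (simp add: Pow_insert)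
 have "(\<Sum>Y\<in>Pow (set (a # as)). ?D Y) = (\<Sum>Y\<in>Pow (set as). ?D Y) + (\<Sum>Y\<in>insert a ` Pow (set as). ?D Y)"
  unfolding Pw by (rule sum.union_disjoint) (use na in auto)
 also have "(\<Sum>Y\<in>insert a ` Pow (set as). ?D Y) = (\<Sum>Y\<in>Pow (set as). ?D (insert a Y))"
  by (subst sum.reindex) (use na in \<open>auto intro!: inj_onI\<close>)
 also have "(\<Sum>Y\<in>Pow (set as). ?D (insert a Y)) = (\<Sum>Y\<in>Pow (set as). ?C Y * c1 a * pcoef ((a, g a) # ?lg) (x - \<Sum>Y - a))"
 proof (rule sum.cong)
  fix Y assume Y: "Y \<in> Pow (set as)"
  then have f: "finite Y" "a \<notin> Y" using na by (auto intro: finite_subset)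
  have s: "set (a # as) - insert a Y = set as - Y" using na by auto
  have 1: "(\<Prod>a\<in>insert a Y. c1 a) = c1 a * (\<Prod>a\<in>Y. c1 a)" using f by (rule prod.insert)
  have 2: "\<Sum>(insert a Y) = \<Sum>Y + a" using f by (simp add: add.commute)
  show "?D (insert a Y) = ?C Y * c1 a * pcoef ((a, g a) # ?lg) (x - \<Sum>Y - a)"
   unfolding s 1 2 by (simp only: mult_ac diff_diff_eq)
 qed simp
 also have "(\<Sum>Y\<in>Pow (set as). ?D Y) = (\<Sum>Y\<in>Pow (set as). ?C Y * c0 a * pcoef ((a, g a) # ?lg) (x - \<Sum>Y))"
 proof (rule sum.cong)
  fix Y assume Y: "Y \<in> Pow (set as)"
  have s: "set (a # as) - Y = insert a (set as - Y)" using na Y by auto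
  have "a \<notin> set as - Y" using na by simp
  then have "(\<Prod>a\<in>insert a (set as - Y). c0 a) = c0 a * (\<Prod>a\<in>set as - Y. c0 a)" by (intro prod.insert) auto
  then show "?D Y = ?C Y * c0 a * pcoef ((a, g a) # ?lg) (x - \<Sum>Y)"
   unfolding s by (simp only: mult_ac)
 qed simp
 finally have "(\<Sum>Y\<in>Pow (set (a # as)). ?D Y) = (\<Sum>Y\<in>Pow (set as). ?C Y * c0 a * pcoef ((a, g a) # ?lg) (x - \<Sum>Y))
   + (\<Sum>Y\<in>Pow (set as). ?C Y * c1 a * pcoef ((a, g a) # ?lg) (x - \<Sum>Y - a))" .
 from this[symmetric] show ?case unfolding eq unfolding list.map .
qed

lemma pcoef_supp:
 assumes "distinct as" "set as \<subseteq> pos" "pcoef (map (\<lambda>a. (a, g a)) as) x \<noteq> 0"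
 shows "\<exists>m::'a \<Rightarrow> nat. x = (\<Sum>a\<in>set as. real (m a) *\<^sub>R a) \<and> (\<forall>a\<in>set as. g a (m a) \<noteq> 0)"
 using assms
proof (induction as arbitrary: x)
 case Nil
 then show ?case by (auto split: if_splits)
next
 case (Cons a as)
 obtain k where k: "g a k \<noteq> 0" "pcoef (map (\<lambda>a. (a, g a)) as) (x - real k *\<^sub>R a) \<noteq> 0"
 proof -
  have "(\<Sum>k\<in>{k. real k * ht a \<le> ht x}. g a k * pcoef (map (\<lambda>a. (a, g a)) as) (x - real k *\<^sub>R a)) \<noteq> 0"
   using Cons(4) by simp
  then obtain k where "g a k * pcoef (map (\<lambda>a. (a, g a)) as) (x - real k *\<^sub>R a) \<noteq> 0"
   by (rule sum.not_neutral_contains_not_neutral)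
  then show ?thesis using that by auto
 qed
 obtain m where m: "x - real k *\<^sub>R a = (\<Sum>a\<in>set as. real (m a) *\<^sub>R a)" "\<forall>a\<in>set as. g a (m a) \<noteq> 0"
  using Cons(1)[OF _ _ k(2)] Cons(2,3) by auto
 let ?m = "m(a := k)"
 have "(\<Sum>c\<in>set as. real (?m c) *\<^sub>R c) = (\<Sum>c\<in>set as. real (m c) *\<^sub>R c)"
  using Cons(2) by (intro sum.cong) auto
 then have "x = (\<Sum>c\<in>set (a # as). real (?m c) *\<^sub>R c)" using m(1) Cons(2) by (simp add: algebra_simps)
 moreover have "\<forall>c\<in>set (a # as). g c (?m c) \<noteq> 0" using k m(2) by auto
 ultimately show ?case by blast
qed

lemma pcoef_zero:
 assumes "set as \<subseteq> pos"
 shows "pcoef (map (\<lambda>a. (a, g a)) as) 0 = (\<Prod>a\<leftarrow>as. g a 0)"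
 using assms
proof (induction as)
 case (Cons a as)
 have "{k. real k * ht a \<le> ht 0} = {0}" using ht_pos[of a] Cons(2) by (auto simp: mult_le_0_iff)
 then show ?case using Cons by simp
qed simp

end

section \<open>Hall-Littlewood expansion\<close>

context based_roots
begin

abbreviation geo :: "real \<Rightarrow> nat \<Rightarrow> real" where "geo v k \<equiv> v ^ k"

text \<open>By independence of the base at most one exponent vector contributes, and its weight
  depends on the height alone because simple roots have height one.\<close>

lemma pcoef_simple:
 assumes v: "0 < v"
 shows "distinct bs \<Longrightarrow> set bs \<subseteq> B \<Longrightarrow>
  pcoef (map (\<lambda>b. (b, geo v)) bs) x = (if \<exists>m::'a \<Rightarrow> nat. x = (\<Sum>b\<in>set bs. real (m b) *\<^sub>R b) then v powr ht x else 0)"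
proof (induction bs arbitrary: x)
 case Nil
 show ?case using v by (cases "x = 0") simp_all
next
 case (Cons b bs)
 let ?l = "map (\<lambda>b. (b, geo v)) bs"
 let ?E = "\<lambda>X y. \<exists>m::'a \<Rightarrow> nat. y = (\<Sum>b\<in>X. real (m b) *\<^sub>R b)"
 have b: "b \<in> pos" "fst ` set ?l \<subseteq> pos" "b \<in> B" "b \<notin> set bs" "set bs \<subseteq> B" using Cons B_pos by auto
 have IH: "pcoef ?l y = (if ?E (set bs) y then v powr ht y else 0)" for y using Cons by simp
 obtain N where N: "ht x < real N * ht b" using pcoef_bound_ex[OF b(1)] by blast
 have eq: "pcoef (map (\<lambda>b. (b, geo v)) (b # bs)) x = (\<Sum>k<N. v ^ k * pcoef ?l (x - real k *\<^sub>R b))"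
  unfolding list.map by (rule pcoef_Cons[OF b(1,2) N])
 show ?case
 proof (cases "?E (set (b # bs)) x")
  case True
  then obtain m :: "'a \<Rightarrow> nat" where m: "x = (\<Sum>c\<in>set (b # bs). real (m c) *\<^sub>R c)" by blast
  have x: "x = real (m b) *\<^sub>R b + (\<Sum>c\<in>set bs. real (m c) *\<^sub>R c)" using m b(4) by simp
  have htx: "ht x = real (m b) + (\<Sum>c\<in>set bs. real (m c))"
   unfolding x using b by (simp add: ht_add ht_sum ht_scaleR ht_B subset_iff)
  have mN: "m b < N" using N htx ht_B[OF b(3)] sum_nonneg[of "set bs" "\<lambda>c. real (m c)"] by simp
  have z: "v ^ k * pcoef ?l (x - real k *\<^sub>R b) = 0" if "k \<noteq> m b" for k
  proof -
   have "\<not> ?E (set bs) (x - real k *\<^sub>R b)"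
   proof
    assume "?E (set bs) (x - real k *\<^sub>R b)"
    then obtain n :: "'a \<Rightarrow> nat" where n: "x - real k *\<^sub>R b = (\<Sum>c\<in>set bs. real (n c) *\<^sub>R c)" by blast
    let ?d = "\<lambda>c. if c = b then real (m b) - real k else real (m c) - real (n c)"
    have 0: "(\<Sum>c\<in>insert b (set bs). ?d c *\<^sub>R c) = ?d b *\<^sub>R b + (\<Sum>c\<in>set bs. ?d c *\<^sub>R c)"
     using b(4) by (intro sum.insert) auto
    have 1: "(\<Sum>c\<in>set bs. ?d c *\<^sub>R c) = (\<Sum>c\<in>set bs. real (m c) *\<^sub>R c - real (n c) *\<^sub>R c)"
     using b(4) by (intro sum.cong) (auto simp: scaleR_diff_left)
    have "(\<Sum>c\<in>insert b (set bs). ?d c *\<^sub>R c) = (real (m b) - real k) *\<^sub>R b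
      + ((\<Sum>c\<in>set bs. real (m c) *\<^sub>R c) - (x - real k *\<^sub>R b))"
     unfolding 0 1 n by (simp add: sum_subtractf)
    also have "\<dots> = 0" by (subst x) (simp add: scaleR_diff_left)
    finally have "?d b = 0"
     by (intro real_vector.independentD[OF indep, of "insert b (set bs)" ?d b]) (use b in auto)
    then show False using that by simp
   qed
   then show ?thesis unfolding IH by simp
  qed
  have "(\<Sum>k<N. v ^ k * pcoef ?l (x - real k *\<^sub>R b)) = (\<Sum>k<N. if k = m b then v ^ m b * pcoef ?l (x - real (m b) *\<^sub>R b) else 0)"
   by (rule sum.cong) (use z in auto)
  also have "\<dots> = v ^ m b * pcoef ?l (x - real (m b) *\<^sub>R b)" using mN by simp
  also have "pcoef ?l (x - real (m b) *\<^sub>R b) = v powr ht (x - real (m b) *\<^sub>R b)"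
  proof -
   have "x - real (m b) *\<^sub>R b = (\<Sum>c\<in>set bs. real (m c) *\<^sub>R c)" using x by simp
   then have "?E (set bs) (x - real (m b) *\<^sub>R b)" by (intro exI[of _ m])
   then show ?thesis unfolding IH by (rule if_P)
  qed
  also have "v ^ m b * v powr ht (x - real (m b) *\<^sub>R b) = v powr ht x"
   using v b(3) by (simp add: ht_diff ht_scaleR ht_B powr_diff powr_realpow)
  finally show ?thesis unfolding eq using True by (simp only: if_True)
 next
  case False
  have "\<not> ?E (set bs) (x - real k *\<^sub>R b)" for k
  proof
   assume "?E (set bs) (x - real k *\<^sub>R b)"
   then obtain n :: "'a \<Rightarrow> nat" where n: "x - real k *\<^sub>R b = (\<Sum>c\<in>set bs. real (n c) *\<^sub>R c)" by blast
   have "(\<Sum>c\<in>set bs. real ((n(b := k)) c) *\<^sub>R c) = (\<Sum>c\<in>set bs. real (n c) *\<^sub>R c)"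
    using b(4) by (intro sum.cong) auto
   then have "x = (\<Sum>c\<in>set (b # bs). real ((n(b := k)) c) *\<^sub>R c)" using n b(4) by (simp add: algebra_simps)
   with False show False by blast
  qed
  then have "pcoef ?l (x - real k *\<^sub>R b) = 0" for k unfolding IH by (rule if_not_P)
  then have "(\<Sum>k<N. v ^ k * pcoef ?l (x - real k *\<^sub>R b)) = 0" by simp
  with False show ?thesis unfolding eq by (simp only: if_False)
 qed
qed

text \<open>With parameter \<open>1/u\<close> in the series, the factor \<open>u powr ht x\<close>
  gives \<open>k\<close> copies of \<open>a\<close> the weight
  \<open>(u powr (ht a - 1)) ^ k\<close>. This is one for simple roots, whose part is therefore the
  indicator of the cone, and geometric with ratio below one for the others. Deep inside the cone the
  geometric series are no longer cut off, which gives the limit \<open>C\<close>.\<close>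

lemma pcoef_normalized:
 assumes u: "0 < u" "u < 1" and bs: "distinct bs" "set bs = B" and ns: "set ns \<subseteq> pos - B"
  and xs: "\<And>y. y \<in> lat \<Longrightarrow> \<forall>\<^sub>F n in sequentially. xs n - y \<in> Npos"
 defines "f \<equiv> \<lambda>x. u powr ht x * pcoef (map (\<lambda>a. (a, geo (1/u))) (ns @ bs)) x"
  and "C \<equiv> (\<Prod>a\<leftarrow>ns. 1 / (1 - u powr (ht a - 1)))"
 shows "(\<forall>x. 0 \<le> f x \<and> f x \<le> C) \<and> (\<forall>y\<in>lat. (\<lambda>n. f (xs n - y)) \<longlonglongrightarrow> C)"
 unfolding f_def C_def using ns
proof (induction ns)
 case Nil
 have v: "0 < 1/u" using u by simp
 have one: "u powr t * (1/u) powr t = 1" for t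
  using u by (simp add: powr_mult[symmetric])
 let ?E = "\<lambda>x. \<exists>m::'a \<Rightarrow> nat. x = (\<Sum>b\<in>B. real (m b) *\<^sub>R b)"
 have eq: "u powr ht x * pcoef (map (\<lambda>a. (a, geo (1/u))) ([] @ bs)) x = (if ?E x then 1 else 0)" for x
  using pcoef_simple[OF v bs(1) , of x] bs(2) one by simp
 have N: "?E x" if x: "x \<in> Npos" for x
 proof (rule exI[of _ "\<lambda>b. nat \<lfloor>representation B x b\<rfloor>"])
  have "real (nat \<lfloor>representation B x b\<rfloor>) = representation B x b" if "b \<in> B" for b
  proof -
   have "representation B x b \<in> \<int>" "0 \<le> representation B x b" using x that rep_lat by (auto simp: Npos_def)
   then show ?thesis by (auto elim!: Ints_cases)
  qed
  then have "(\<Sum>b\<in>B. real (nat \<lfloor>representation B x b\<rfloor>) *\<^sub>R b) = (\<Sum>b\<in>B. representation B x b *\<^sub>R b)"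
   by (intro sum.cong) simp_all
  also have "\<dots> = x" by (intro expand lat_span) (use x in \<open>simp add: Npos_def\<close>)
  finally show "x = (\<Sum>b\<in>B. real (nat \<lfloor>representation B x b\<rfloor>) *\<^sub>R b)" by (rule sym)
 qed
 have "(\<lambda>n. if ?E (xs n - y) then 1 else 0) \<longlonglongrightarrow> (1::real)" if "y \<in> lat" for y
 proof (rule tendsto_eventually)
  show "\<forall>\<^sub>F n in sequentially. (if ?E (xs n - y) then 1 else 0) = (1::real)"
   using xs[OF that] by eventually_elim (use N in simp)
 qed
 then show ?case unfolding eq by simp
next
 case (Cons a ns)
 let ?l = "map (\<lambda>a. (a, geo (1/u))) (ns @ bs)"
 let ?f = "\<lambda>x. u powr ht x * pcoef ?l x"
 let ?C = "\<Prod>a\<leftarrow>ns. 1 / (1 - u powr (ht a - 1))"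
 let ?q = "u powr (ht a - 1)"
 have a: "a \<in> pos" "fst ` set ?l \<subseteq> pos" "a \<notin> B" using Cons(2) bs B_pos by auto
 have q: "0 < ?q" "?q < 1" using u ht_nonsimple[OF a(1,3)] by (simp_all add: powr_def mult_pos_neg)
 have IH: "0 \<le> ?f x" "?f x \<le> ?C" "y \<in> lat \<Longrightarrow> (\<lambda>n. ?f (xs n - y)) \<longlonglongrightarrow> ?C" for x y
  using Cons by auto
 have C0: "0 \<le> ?C" using IH(1,2)[of 0] by linarith
 have gs: "summable (\<lambda>k. ?q ^ k * ?C)" and gv: "(\<Sum>k. ?q ^ k * ?C) = 1 / (1 - ?q) * ?C"
  using q by (simp_all add: summable_mult2 summable_geometric suminf_mult2[symmetric] suminf_geometric)
 \<comment> \<open>For fixed \<open>x\<close> only finitely many terms are nonzero. The infinite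
   form has a range that does not move with \<open>x\<close>, as the limit below requires.\<close>
 have s: "(\<lambda>k. ?q ^ k * ?f (x - real k *\<^sub>R a)) sums (u powr ht x * pcoef ((a, geo (1/u)) # ?l) x)" for x
 proof -
  obtain N where N: "ht x < real N * ht a" using pcoef_bound_ex[OF a(1)] by blast
  have t: "?q ^ k * ?f (x - real k *\<^sub>R a) = u powr ht x * ((1/u) ^ k * pcoef ?l (x - real k *\<^sub>R a))" for k
  proof -
   have "?q ^ k = u powr (real k * (ht a - 1))" using u by (simp add: powr_powr mult.commute flip: powr_realpow)
   then have "?q ^ k * u powr ht (x - real k *\<^sub>R a) = u powr (real k * (ht a - 1) + ht (x - real k *\<^sub>R a))"
    by (simp only: powr_add)
   also have "real k * (ht a - 1) + ht (x - real k *\<^sub>R a) = ht x - real k"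
    by (simp add: ht_diff ht_scaleR algebra_simps)
   also have "u powr (ht x - real k) = u powr ht x * (1/u) ^ k"
    using u by (simp add: powr_diff powr_realpow power_divide)
   finally show ?thesis by (simp only: mult.assoc[symmetric])
  qed
  have "(\<lambda>k. ?q ^ k * ?f (x - real k *\<^sub>R a)) sums (\<Sum>k<N. ?q ^ k * ?f (x - real k *\<^sub>R a))"
  proof (rule sums_finite)
   fix k assume "k \<notin> {..<N}"
   then have "real N * ht a \<le> real k * ht a" using ht_pos[OF a(1)] by simp
   then have "ht (x - real k *\<^sub>R a) < 0" using N by (simp add: ht_diff ht_scaleR)
   then show "?q ^ k * ?f (x - real k *\<^sub>R a) = 0" using pcoef_neg[OF a(2)] by simp
  qed simp
  also have "(\<Sum>k<N. ?q ^ k * ?f (x - real k *\<^sub>R a)) = u powr ht x * pcoef ((a, geo (1/u)) # ?l) x"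
   unfolding pcoef_Cons[OF a(1,2) N] t sum_distrib_left ..
  finally show ?thesis .
 qed
 let ?g = "\<lambda>x. u powr ht x * pcoef ((a, geo (1/u)) # ?l) x"
 have b1: "0 \<le> ?g x" for x
  by (rule sums_le[OF _ sums_zero s]) (intro mult_nonneg_nonneg[OF _ IH(1)], use q in simp)
 have b2: "?g x \<le> 1 / (1 - ?q) * ?C" for x
  unfolding gv[symmetric]
  by (rule sums_le[OF _ s summable_sums[OF gs]]) (intro mult_left_mono IH(2), use q in simp)
 have lim: "(\<lambda>n. ?g (xs n - y)) \<longlonglongrightarrow> 1 / (1 - ?q) * ?C" if y: "y \<in> lat" for y
 proof -
  let ?a = "\<lambda>k n. ?q ^ k * ?f ((xs n - y) - real k *\<^sub>R a)"
  have 1: "(\<lambda>n. ?a k n) \<longlonglongrightarrow> ?q ^ k * ?C" for k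
  proof -
   have "y + real k *\<^sub>R a \<in> lat" using y lat_nat[OF R_lat[OF pos_R[OF a(1)]]] lat_add by blast
   from IH(3)[OF this] show ?thesis by (intro tendsto_mult_left) (simp only: diff_diff_eq)
  qed
  have 2: "norm (?a k n) \<le> ?q ^ k * ?C" for k n
  proof -
   have "0 \<le> ?a k n" by (intro mult_nonneg_nonneg[OF _ IH(1)]) (use q in simp)
   moreover have "?a k n \<le> ?q ^ k * ?C" by (intro mult_left_mono IH(2)) (use q in simp)
   ultimately show ?thesis by simp
  qed
  have ev: "\<forall>\<^sub>F (k, n) in at_top \<times>\<^sub>F sequentially. norm (?a k n) \<le> ?q ^ k * ?C"
   by (rule always_eventually) (simp only: split_paired_All case_prod_conv 2 simp_thms)
  have "(\<lambda>n. \<Sum>k. ?a k n) \<longlonglongrightarrow> (\<Sum>k. ?q ^ k * ?C)"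
   by (rule tannerys_theorem[OF 1 ev gs, THEN conjunct2, THEN conjunct2]) simp
  then show ?thesis unfolding gv using sums_unique[OF s] by simp
 qed
 have m: "map (\<lambda>a. (a, geo (1/u))) ((a # ns) @ bs) = (a, geo (1/u)) # ?l" by simp
 have Cm: "(\<Prod>a\<leftarrow>a # ns. 1 / (1 - u powr (ht a - 1))) = 1 / (1 - ?q) * ?C" by simp
 show ?case unfolding m Cm using b1 b2 lim by blast
qed

definition poin :: "real \<Rightarrow> 'a \<Rightarrow> real" where "poin v x = (\<Sum>w\<in>stab x. v ^ card (Inv w))"
definition poinW :: "real \<Rightarrow> real" where "poinW v = (\<Sum>w\<in>W. v ^ card (Inv w))"

lemma poin_pos: "0 < v \<Longrightarrow> 0 < poin v x"
proof -
 assume v: "0 < v"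
 have "id \<in> stab x" by (simp add: stab_def)
 then show ?thesis unfolding poin_def using v by (intro sum_pos) auto
qed

lemma poinW_pos: "0 < v \<Longrightarrow> 0 < poinW v"
proof -
 assume v: "0 < v"
 have "W \<noteq> {}" using gen_subgroup_id by blast
 then show ?thesis unfolding poinW_def using v by (intro sum_pos) auto
qed

text \<open>The coefficient at exponent \<open>y\<close> of the alternating sum over the orbit of
  \<open>x\<close>, the formal counterpart of \<open>alt_exp\<close>.\<close>

definition alt_coef :: "'a \<Rightarrow> 'a \<Rightarrow> real" where
 "alt_coef x y = (\<Sum>w\<in>W. if w x = y then eps w else 0)"

lemma alt_coef_refl: assumes b: "b \<in> B" shows "alt_coef x (root_refl b y) = - alt_coef x y"
proof -
 have bij: "bij_betw (\<lambda>w. root_refl b \<circ> w) W W"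
 proof (rule bij_betw_byWitness[where f' = "\<lambda>w. root_refl b \<circ> w"])
  have "root_refl b \<circ> (root_refl b \<circ> w) = w" for w :: "'a \<Rightarrow> 'a" by auto
  then show "\<forall>w\<in>W. root_refl b \<circ> (root_refl b \<circ> w) = w" "\<forall>w\<in>W. root_refl b \<circ> (root_refl b \<circ> w) = w" by blast+
  show "(\<lambda>w. root_refl b \<circ> w) ` W \<subseteq> W" "(\<lambda>w. root_refl b \<circ> w) ` W \<subseteq> W"
   using W_comp[OF B_W[OF b]] by blast+
 qed
 have "alt_coef x (root_refl b y) = (\<Sum>w\<in>W. if (root_refl b \<circ> w) x = root_refl b y then eps (root_refl b \<circ> w) else 0)"
  unfolding alt_coef_def by (rule sum.reindex_bij_betw[OF bij, symmetric])
 also have "\<dots> = (\<Sum>w\<in>W. - (if w x = y then eps w else 0))"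
 proof (rule sum.cong)
  fix w assume w: "w \<in> W"
  have "root_refl b (w x) = root_refl b y \<longleftrightarrow> w x = y" by (metis root_refl_refl)
  then show "(if (root_refl b \<circ> w) x = root_refl b y then eps (root_refl b \<circ> w) else 0) = - (if w x = y then eps w else 0)"
   using eps_mult[OF B_W[OF b] w] eps_refl[OF b] by simp
 qed simp
 finally show ?thesis by (simp add: alt_coef_def sum_negf)
qed

lemma alt_coef_sum:
 assumes "finite U" "\<And>w. w \<in> W \<Longrightarrow> w x \<in> U"
 shows "(\<Sum>y\<in>U. alt_coef x y * f y) = (\<Sum>w\<in>W. eps w * f (w x))"
proof -
 have "(\<Sum>y\<in>U. alt_coef x y * f y) = (\<Sum>y\<in>U. \<Sum>w\<in>W. if w x = y then eps w * f y else 0)"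
  unfolding alt_coef_def sum_distrib_right by (intro sum.cong) auto
 also have "\<dots> = (\<Sum>w\<in>W. \<Sum>y\<in>U. if w x = y then eps w * f y else 0)" by (rule sum.swap)
 also have "\<dots> = (\<Sum>w\<in>W. eps w * f (w x))" using assms by (intro sum.cong) (simp_all add: sum.delta)
 finally show ?thesis .
qed

lemma alt_coef_supp: "alt_coef x y \<noteq> 0 \<Longrightarrow> \<exists>w\<in>W. y = w x"
proof -
 assume "alt_coef x y \<noteq> 0"
 then obtain w where "w \<in> W" "(if w x = y then eps w else 0) \<noteq> 0"
  unfolding alt_coef_def by (rule sum.not_neutral_contains_not_neutral)
 then show ?thesis by (auto split: if_splits)
qed

text \<open>A triangularity argument. An element \<open>e\<close> of greatest height in the support
  has nonnegative Cartan numbers; skewness excludes zero, so integrality makes them at least one and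
  \<open>e - rho\<close> is dominant. The test at \<open>e - rho\<close> sees only \<open>e\<close>,
  because \<open>p\<close> lives on \<open>0\<close> and on positive heights.\<close>

lemma skew_zero:
 assumes fin: "finite U" and supp: "\<And>y. d y \<noteq> 0 \<Longrightarrow> y \<in> U" and lt: "\<And>y. d y \<noteq> 0 \<Longrightarrow> y - rho \<in> lat"
  and skew: "\<And>b y. b \<in> B \<Longrightarrow> d (root_refl b y) = - d y"
  and p0: "p 0 = 1" and psupp: "\<And>x. p x \<noteq> 0 \<Longrightarrow> x = 0 \<or> 0 < ht x"
  and z: "\<And>x. x \<in> Lam \<Longrightarrow> (\<Sum>y\<in>U. d y * p (y - (x + rho))) = (0::real)"
 shows "d y = 0"
proof (rule ccontr)
 assume "d y \<noteq> 0"
 let ?S = "{y \<in> U. d y \<noteq> 0}"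
 have fS: "finite ?S" and ne: "?S \<noteq> {}" using fin supp \<open>d y \<noteq> 0\<close> by auto
 let ?m = "Max (ht ` ?S)"
 have "?m \<in> ht ` ?S" by (rule Max_in) (use fS ne in auto)
 then obtain e where e: "e \<in> U" "d e \<noteq> 0" "?m = ht e" by blast
 have mx: "ht y \<le> ht e" if "d y \<noteq> 0" for y
 proof -
  have "ht y \<le> ?m" by (rule Max_ge) (use fS supp that in auto)
  then show ?thesis using e by simp
 qed
 have "0 \<le> (e - rho) \<bullet> b" if b: "b \<in> B" for b
 proof -
  have bb: "0 < b \<bullet> b" using b B_pos pos_nonzero by simp
  have "d (root_refl b e) \<noteq> 0" using skew[OF b] e by simp
  then have "ht (root_refl b e) \<le> ht e" by (rule mx)
  then have "0 \<le> cartan e b" by (simp add: root_refl_cartan ht_diff ht_scaleR ht_B b)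
  moreover have "cartan e b \<noteq> 0"
  proof
   assume "cartan e b = 0"
   then have "root_refl b e = e" by (simp add: root_refl_cartan)
   then show False using skew[OF b, of e] e by simp
  qed
  moreover have "cartan e b = cartan (e - rho) b + 1" by (simp add: cartan_diff cartan_rho b)
  moreover have "cartan (e - rho) b \<in> \<int>"
  proof -
   obtain m where m: "e - rho = (\<Sum>c\<in>B. of_int (m c) *\<^sub>R c)" using lt[OF e(2)] by (auto simp: lat_def)
   show ?thesis unfolding m cartan_sum cartan_scaleR
    using b B_sub by (intro Ints_sum Ints_mult cartan_int) auto
  qed
  ultimately have c: "cartan (e - rho) b \<in> \<int>" "-1 < cartan (e - rho) b" by linarith+
  then obtain k where "cartan (e - rho) b = of_int k" by (auto elim: Ints_cases)
  then have "0 \<le> cartan (e - rho) b" using c(2) by simp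
  then have "0 \<le> cartan (e - rho) b * (b \<bullet> b)" using bb by (intro mult_nonneg_nonneg) simp_all
  then show ?thesis using bb by (simp add: cartan_def)
 qed
 then have "e - rho \<in> Lam" using lt[OF e(2)] by (simp add: Lam_def dominant_def)
 from z[OF this] have "(\<Sum>y\<in>U. d y * p (y - e)) = 0" by simp
 also have "(\<Sum>y\<in>U. d y * p (y - e)) = (\<Sum>y\<in>U. if y = e then d e else 0)"
 proof (rule sum.cong)
  fix y
  show "d y * p (y - e) = (if y = e then d e else 0)"
  proof (cases "d y * p (y - e) = 0")
   case False
   then have "d y \<noteq> 0" "p (y - e) \<noteq> 0" by auto
   then have "y = e" using psupp[of "y - e"] mx[of y] by (auto simp: ht_diff)
   then show ?thesis using p0 by simp
  qed (use p0 e in auto)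
 qed simp
 also have "\<dots> = d e" using fin e by simp
 finally show False using e by simp
qed

end

context based_roots
begin

lemma prod_if_card: "finite X \<Longrightarrow> Y \<subseteq> X \<Longrightarrow> (\<Prod>a\<in>X. if a \<in> Y then c else 1) = (c::real) ^ card Y"
 by (simp add: prod.If_cases Int_absorb1)

lemma list_prod_set: "distinct l \<Longrightarrow> (\<Prod>a\<leftarrow>l. f a) = (\<Prod>a\<in>set l. f a :: real)"
 by (induction l) auto

text \<open>The coefficient of a dominant \<open>y\<close> in a Hall-Littlewood polynomial divided by its leading factor is \<open>0\<close>
 unless \<open>y = x\<close>; this is the dual-basis property on which the expansion below rests.\<close>

lemma hall_littlewood_coef:
 assumes v: "0 < v" and as: "distinct as" "set as = pos" and x: "x \<in> Lam" and y: "y \<in> Lam"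
 shows "(\<Sum>w\<in>W. \<Sum>Y\<in>Pow pos. eps w * (- v) ^ card Y *
   pcoef (map (\<lambda>a. (a, geo v)) as) (w (x + rho - \<Sum>Y) - (y + rho))) = (if x = y then poin v x else 0)"
proof -
 let ?p = "pcoef (map (\<lambda>a. (a, geo v)) as)"
 have dx: "dominant x" and dy: "dominant y" using x y by (auto simp: Lam_def)
 \<comment> \<open>Over positive roots the signed numerator of \<open>w\<close> becomes a product of
   factors \<open>c0 + c1 X\<close>, where \<open>X\<close> stands for the shift by
   \<open>a\<close>: \<open>1 - v X\<close> where \<open>inv w\<close> keeps \<open>a\<close>
   positive, and \<open>v - X\<close> elsewhere, the sign of \<open>w\<close> being absorbed.
   Division by \<open>1 - v X\<close> gives the series \<open>h\<close>.\<close>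
 define c0 where "c0 w a = (if a \<in> Inv (inv w) then v else 1)" for w a
 define c1 where "c1 w a = (if a \<in> Inv (inv w) then -1 else - v)" for w a
 define h where "h w a k = c0 w a * geo v k + (if k = 0 then 0 else c1 w a * geo v (k - 1))" for w a k
 have weight: "(\<Prod>a\<in>Z. c1 w a) * (\<Prod>a\<in>pos - Z. c0 w a) = eps w * (- v) ^ card Y"
  if w: "w \<in> W" and Y: "Y \<subseteq> pos" and Z: "Z = flip w Y" for w Y Z
 proof -
  let ?h = "\<lambda>a. if w a \<in> pos then w a else - w a"
  have Zp: "Z \<subseteq> pos" unfolding Z by (rule flip_sub)
  have "(\<Prod>a\<in>Z. c1 w a) * (\<Prod>a\<in>pos - Z. c0 w a) = (\<Prod>a\<in>pos. if a \<in> Z then c1 w a else c0 w a)"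
  proof -
   have "pos \<inter> {a. a \<in> Z} = Z" "pos \<inter> - {a. a \<in> Z} = pos - Z" using Zp by auto
   then show ?thesis by (simp only: prod.If_cases[OF finite_pos])
  qed
  also have "\<dots> = (\<Prod>a\<in>pos. if ?h a \<in> Z then c1 w (?h a) else c0 w (?h a))"
   by (rule prod.reindex_bij_betw[OF W_pos_image[OF w], symmetric])
  also have "\<dots> = (\<Prod>a\<in>pos. (if a \<in> Inv w then -1 else 1) * (if a \<in> Y then - v else 1))"
  proof (rule prod.cong)
   fix a assume a: "a \<in> pos"
   have m: "- a \<notin> pos" using a neg_notin_pos by blast
   have iv: "inv w (w a) = a" "inv w (- w a) = - a"
    using W_inv(2)[OF w] W_minus[OF W_inv(1)[OF w]] by simp_all
   show "(if ?h a \<in> Z then c1 w (?h a) else c0 w (?h a)) = (if a \<in> Inv w then -1 else 1) * (if a \<in> Y then - v else 1)"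
   proof (cases "w a \<in> pos")
    case True
    then have "w a \<notin> Inv (inv w)" "w a \<in> Z \<longleftrightarrow> a \<in> Y" "a \<notin> Inv w" using a iv by (simp_all add: Inv_def Z flip_def)
    then show ?thesis using True by (simp add: c0_def c1_def)
   next
    case False
    have "- w a \<in> pos" using False notin_pos W_R[OF w] pos_R[OF a] by blast
    then have "- w a \<in> Inv (inv w)" "- w a \<in> Z \<longleftrightarrow> a \<notin> Y" "a \<in> Inv w"
     using a m iv False by (simp_all add: Inv_def Z flip_def)
    then show ?thesis using False by (simp add: c0_def c1_def)
   qed
  qed simp
  also have "\<dots> = (\<Prod>a\<in>pos. if a \<in> Inv w then -1 else 1) * (\<Prod>a\<in>pos. if a \<in> Y then - v else 1)" by (rule prod.distrib)
  also have "(\<Prod>a\<in>pos. if a \<in> Inv w then -1 else 1) = (-1::real) ^ card (Inv w)"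
   by (rule prod_if_card) (auto simp: Inv_def)
  also have "(\<Prod>a\<in>pos. if a \<in> Y then - v else 1) = (- v) ^ card Y" using Y by (intro prod_if_card) auto
  finally show ?thesis by (simp only: eps_def)
 qed
 have inner: "(\<Sum>Y\<in>Pow pos. eps w * (- v) ^ card Y * ?p (w (x + rho - \<Sum>Y) - (y + rho)))
   = pcoef (map (\<lambda>a. (a, h w a)) as) (w x - y)" if w: "w \<in> W" for w
 proof -
  have "pcoef (map (\<lambda>a. (a, h w a)) as) (w x - y)
   = (\<Sum>Z\<in>Pow (set as). (\<Prod>a\<in>Z. c1 w a) * (\<Prod>a\<in>set as - Z. c0 w a) * ?p (w x - y - \<Sum>Z))"
   by (rule pcoef_subset) (use as h_def in auto)
  also have "\<dots> = (\<Sum>Z\<in>Pow pos. (\<Prod>a\<in>Z. c1 w a) * (\<Prod>a\<in>pos - Z. c0 w a) * ?p (w x - y - \<Sum>Z))"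
   by (simp only: as)
  also have "\<dots> = (\<Sum>Y\<in>Pow pos. (\<Prod>a\<in>flip w Y. c1 w a) * (\<Prod>a\<in>pos - flip w Y. c0 w a) * ?p (w x - y - \<Sum>(flip w Y)))"
   by (rule sum.reindex_bij_betw[OF flip_bij[OF w], symmetric])
  also have "\<dots> = (\<Sum>Y\<in>Pow pos. eps w * (- v) ^ card Y * ?p (w (x + rho - \<Sum>Y) - (y + rho)))"
  proof (rule sum.cong)
   fix Y assume "Y \<in> Pow pos"
   then have Y: "Y \<subseteq> pos" by blast
   have "w (x + rho - \<Sum>Y) = w x + w (rho - \<Sum>Y)"
    using linear_add[OF W_linear[OF w], of x "rho - \<Sum>Y"] by (simp add: add_diff_eq)
   then have "w (x + rho - \<Sum>Y) - (y + rho) = w x - y - \<Sum>(flip w Y)" by (simp add: flip_rho[OF w Y])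
   then show "(\<Prod>a\<in>flip w Y. c1 w a) * (\<Prod>a\<in>pos - flip w Y. c0 w a) * ?p (w x - y - \<Sum>(flip w Y))
    = eps w * (- v) ^ card Y * ?p (w (x + rho - \<Sum>Y) - (y + rho))"
    by (simp only: weight[OF w Y refl])
  qed simp
  finally show ?thesis by (rule sym)
 qed
 have val: "pcoef (map (\<lambda>a. (a, h w a)) as) (w x - y) = (if x = y \<and> w x = x then v ^ card (Inv (inv w)) else 0)"
  if w: "w \<in> W" for w
 proof (cases "x = y \<and> w x = x")
  case True
  have "pcoef (map (\<lambda>a. (a, h w a)) as) 0 = (\<Prod>a\<leftarrow>as. h w a 0)" by (rule pcoef_zero) (use as in simp)
  also have "\<dots> = (\<Prod>a\<in>pos. h w a 0)" using list_prod_set[OF as(1)] as(2) by simp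
  also have "\<dots> = (\<Prod>a\<in>pos. if a \<in> Inv (inv w) then v else 1)" by (simp add: h_def c0_def)
  also have "\<dots> = v ^ card (Inv (inv w))" by (rule prod_if_card) (auto simp: Inv_def)
  moreover have "w x - y = 0" using True by (metis diff_self)
  ultimately show ?thesis using True by simp
 next
  case False
  have "pcoef (map (\<lambda>a. (a, h w a)) as) (w x - y) = 0"
  proof (rule ccontr)
   assume "pcoef (map (\<lambda>a. (a, h w a)) as) (w x - y) \<noteq> 0"
   then have "\<exists>m::'a \<Rightarrow> nat. w x - y = (\<Sum>a\<in>set as. real (m a) *\<^sub>R a) \<and> (\<forall>a\<in>set as. h w a (m a) \<noteq> 0)"
    by (intro pcoef_supp) (use as in auto)
   then obtain m :: "'a \<Rightarrow> nat" where m: "w x - y = (\<Sum>a\<in>pos. real (m a) *\<^sub>R a)" "\<And>a. a \<in> pos \<Longrightarrow> h w a (m a) \<noteq> 0"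
    unfolding as(2) by blast
   \<comment> \<open>Outside \<open>Inv (inv w)\<close> the series \<open>h\<close> is
     \<open>(1 - v X) / (1 - v X)\<close>, so only the exponent zero occurs.\<close>
   have m0: "m a = 0" if "a \<in> pos" "a \<notin> Inv (inv w)" for a
   proof (rule ccontr)
    assume "m a \<noteq> 0"
    then obtain k where "m a = Suc k" by (cases "m a") auto
    then have "h w a (m a) = 0" using that by (simp add: h_def c0_def c1_def)
    with m(2)[OF that(1)] show False by blast
   qed
   \<comment> \<open>Heights are compared twice. Directly, \<open>y\<close> is at most as high as
     \<open>w x\<close>; after applying \<open>inv w\<close>, which makes the occurring roots
     negative, \<open>x\<close> is at most as high as \<open>inv w y\<close>. Dominance of
     \<open>x\<close> and \<open>y\<close> closes the circle and forces all \<open>m a\<close> to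
     vanish.\<close>
   have "ht (w x - y) = (\<Sum>a\<in>pos. real (m a) * ht a)" unfolding m(1) by (simp add: ht_sum ht_scaleR)
   then have h1: "ht y = ht (w x) - (\<Sum>a\<in>pos. real (m a) * ht a)" by (simp add: ht_diff)
   have s0: "0 \<le> real (m a) * ht a" if "a \<in> pos" for a using ht_pos[OF that] by simp
   have "y = w x - (\<Sum>a\<in>pos. real (m a) *\<^sub>R a)" using m(1) by (simp add: algebra_simps)
   then have iy: "inv w y = x - (\<Sum>a\<in>pos. real (m a) *\<^sub>R inv w a)"
    using W_inv(2)[OF w, of x]
    by (simp add: linear_diff[OF W_linear[OF W_inv(1)[OF w]]] W_sum[OF W_inv(1)[OF w]] linear_cmul[OF W_linear[OF W_inv(1)[OF w]]])
   have "ht (inv w y) = ht x - (\<Sum>a\<in>pos. real (m a) * ht (inv w a))"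
    unfolding iy by (simp add: ht_diff ht_sum ht_scaleR)
   moreover have "(\<Sum>a\<in>pos. real (m a) * ht (inv w a)) \<le> 0"
   proof (rule sum_nonpos)
    fix a assume a: "a \<in> pos"
    show "real (m a) * ht (inv w a) \<le> 0"
    proof (cases "a \<in> Inv (inv w)")
     case True
     then have "inv w a \<notin> pos" by (simp add: Inv_def)
     then have "- inv w a \<in> pos" using notin_pos W_R[OF W_inv(1)[OF w]] pos_R[OF a] by blast
     then have "ht (inv w a) < 0" using ht_pos[of "- inv w a"] by (simp add: ht_minus)
     then show ?thesis by (simp add: mult_nonneg_nonpos)
    qed (use m0[OF a] in simp)
   qed
   ultimately have "ht x \<le> ht (inv w y)" by simp
   also have "\<dots> \<le> ht y" by (rule ht_W_le[OF W_inv(1)[OF w] dy])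
   finally have xy: "ht x \<le> ht y" .
   have wx: "ht (w x) \<le> ht x" by (rule ht_W_le[OF w dx])
   have S0: "(\<Sum>a\<in>pos. real (m a) * ht a) = 0"
    using xy wx h1 sum_nonneg[of pos "\<lambda>a. real (m a) * ht a"] s0 by fastforce
   then have "\<forall>a\<in>pos. real (m a) * ht a = 0"
    using sum_nonneg_eq_0_iff[OF finite_pos, of "\<lambda>a. real (m a) * ht a"] s0 by blast
   then have "real (m a) = 0" if "a \<in> pos" for a using that ht_pos[OF that] by force
   then have "w x = y" using m(1) by simp
   then have "w x = x" using dominant_unique[OF w dx] dy by simp
   with \<open>w x = y\<close> False show False by simp
  qed
  then show ?thesis unfolding if_not_P[OF False] .
 qed
 have "(\<Sum>w\<in>W. \<Sum>Y\<in>Pow pos. eps w * (- v) ^ card Y * ?p (w (x + rho - \<Sum>Y) - (y + rho)))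
   = (\<Sum>w\<in>W. if x = y \<and> w x = x then v ^ card (Inv (inv w)) else 0)"
  by (rule sum.cong) (simp_all only: inner val)
 also have "\<dots> = (if x = y then poin v x else 0)"
 proof (cases "x = y")
  case True
  have "(\<Sum>w\<in>W. if x = y \<and> w x = x then v ^ card (Inv (inv w)) else 0) = (\<Sum>w\<in>stab x. v ^ card (Inv (inv w)))"
   using True by (simp add: sum.inter_filter[symmetric] stab_def)
  also have "\<dots> = (\<Sum>w\<in>stab x. v ^ card (Inv w))"
  proof (rule sum.reindex_bij_betw)
   show "bij_betw inv (stab x) (stab x)"
    by (rule bij_betw_byWitness[where f' = inv]) (use inv_inv stab_W stab_inv in auto)
  qed
  finally show ?thesis using True by (simp add: poin_def)
 qed simp
 finally show ?thesis .
qed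

text \<open>At these points every \<open>w\<close> other than the identity contributes zero, as in
  \<open>macdonald_product\<close>; the surviving product is read off from
  \<open>alternating_numerator\<close> and the denominator formula.\<close>

lemma hall_littlewood_eval:
 assumes v: "0 < v" and z: "\<And>b. b \<in> B \<Longrightarrow> v * exp (b \<bullet> z) = 1" and reg: "\<And>a. a \<in> pos \<Longrightarrow> a \<bullet> z \<noteq> 0"
 shows "(\<Sum>w\<in>W. \<Sum>Y\<in>Pow pos. eps w * (- v) ^ card Y * exp (w (x + rho - \<Sum>Y) \<bullet> z))
  = exp (x \<bullet> z) * (poinW v * weyl_den z)"
proof -
 let ?N = "\<lambda>w. \<Prod>a\<in>pos. exp (w a \<bullet> z / 2) - v * exp (- (w a \<bullet> z) / 2)"
 have cardp: "(\<Prod>a\<in>Y. - v) = (- v) ^ card Y" for Y :: "'a set" by simp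
 have 1: "(\<Sum>Y\<in>Pow pos. eps w * (- v) ^ card Y * exp (w (x + rho - \<Sum>Y) \<bullet> z)) = eps w * exp (w x \<bullet> z) * ?N w"
  if w: "w \<in> W" for w
 proof -
  have "w (x + rho - \<Sum>Y) \<bullet> z = w x \<bullet> z + w (rho - \<Sum>Y) \<bullet> z" for Y
   using linear_add[OF W_linear[OF w], of x "rho - \<Sum>Y"] by (simp add: add_diff_eq inner_left_distrib)
  then have "(\<Sum>Y\<in>Pow pos. eps w * (- v) ^ card Y * exp (w (x + rho - \<Sum>Y) \<bullet> z))
   = (\<Sum>Y\<in>Pow pos. eps w * exp (w x \<bullet> z) * ((\<Prod>a\<in>Y. - v) * exp (w (rho - \<Sum>Y) \<bullet> z)))"
   by (simp only: exp_add cardp mult_ac)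
  then show ?thesis unfolding expand_numerator[OF w, where t = "\<lambda>_. v"] by (simp only: sum_distrib_left)
 qed
 have 0: "?N w = 0" if w: "w \<in> W" "w \<noteq> id" for w
 proof -
  obtain a b where ab: "a \<in> pos" "b \<in> B" "w a = - b" using W_maps_to_neg_simple[OF w] by blast
  have "exp (b \<bullet> z / 2) * (exp (w a \<bullet> z / 2) - v * exp (- (w a \<bullet> z) / 2)) = 1 - v * exp (b \<bullet> z)"
   unfolding ab(3) by (simp add: right_diff_distrib exp_minus field_simps flip: exp_add)
  then have "exp (w a \<bullet> z / 2) - v * exp (- (w a \<bullet> z) / 2) = 0" using z[OF ab(2)] by simp
  then show ?thesis using ab(1) by (intro prod_zero) auto
 qed
 have "(\<Sum>w\<in>W. \<Sum>Y\<in>Pow pos. eps w * (- v) ^ card Y * exp (w (x + rho - \<Sum>Y) \<bullet> z))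
  = (\<Sum>w\<in>W. eps w * exp (w x \<bullet> z) * ?N w)" by (rule sum.cong) (simp_all only: 1)
 also have "\<dots> = (\<Sum>w\<in>{id}. eps w * exp (w x \<bullet> z) * ?N w)" by (rule sum.mono_neutral_right) (use 0 in auto)
 also have "\<dots> = exp (x \<bullet> z) * (\<Prod>a\<in>pos. exp (a \<bullet> z / 2) - v * exp (- (a \<bullet> z) / 2))" by simp
 also have "(\<Prod>a\<in>pos. exp (a \<bullet> z / 2) - v * exp (- (a \<bullet> z) / 2)) = poinW v * weyl_den z"
 proof -
  have "(\<Sum>w\<in>W. eps w * ?N w) = weyl_den z * (\<Sum>w\<in>W. \<Prod>a\<in>Inv w. v)"
   unfolding alternating_numerator[of z "\<lambda>_. v"] weyl_denominator ..
  moreover have "(\<Sum>w\<in>W. eps w * ?N w) = (\<Sum>w\<in>{id}. eps w * ?N w)"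
   by (rule sum.mono_neutral_right) (use 0 in auto)
  ultimately show ?thesis by (simp add: poinW_def mult.commute)
 qed
 finally show ?thesis .
qed

end

lemma powr_nat_mult: "u powr (real k * t) = (u powr t) ^ k" if "0 < u" for u t :: real
 using that by (induction k) (simp_all add: distrib_left distrib_right powr_add mult.commute)

lemma powr_odd:
 assumes "0 < u" shows "u powr ((2 * real k + 1) * h) = u powr h * ((u powr h)\<^sup>2) ^ k"
proof -
 have "(2 * real k + 1) * h = h + real k * (2 * h)" by (simp add: algebra_simps)
 then have "u powr ((2 * real k + 1) * h) = u powr h * u powr (real k * (2 * h))" by (simp only: powr_add)
 also have "u powr (real k * (2 * h)) = (u powr (2 * h)) ^ k" by (rule powr_nat_mult[OF assms])
 also have "u powr (2 * h) = (u powr h)\<^sup>2" using powr_nat_mult[OF assms, of 2 h] by simp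
 finally show ?thesis .
qed

section \<open>Bott's sum over the dominant part of the lattice\<close>

context based_roots
begin

lemma Npos_finite: "finite {x \<in> Npos. ht x \<le> c}"
proof (rule finite_subset)
 let ?f = "\<lambda>m. \<Sum>b\<in>B. real (m b) *\<^sub>R b"
 show "finite (?f ` PiE B (\<lambda>_. {..nat \<lfloor>c\<rfloor>}))" by (intro finite_imageI finite_PiE finite_B) simp
 show "{x \<in> Npos. ht x \<le> c} \<subseteq> ?f ` PiE B (\<lambda>_. {..nat \<lfloor>c\<rfloor>})"
 proof
  fix x assume "x \<in> {x \<in> Npos. ht x \<le> c}"
  then have x: "x \<in> lat" "\<And>b. b \<in> B \<Longrightarrow> 0 \<le> representation B x b" "ht x \<le> c" by (auto simp: Npos_def)
  let ?m = "restrict (\<lambda>b. nat \<lfloor>representation B x b\<rfloor>) B"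
  have "(\<Sum>b\<in>B. real (?m b) *\<^sub>R b) = (\<Sum>b\<in>B. representation B x b *\<^sub>R b)"
  proof (rule sum.cong)
   fix b assume b: "b \<in> B"
   have "real (nat \<lfloor>representation B x b\<rfloor>) = representation B x b"
    using rep_lat[OF x(1), of b] x(2)[OF b] by (auto elim!: Ints_cases)
   then show "real (?m b) *\<^sub>R b = representation B x b *\<^sub>R b" using b by simp
  qed simp
  also have "\<dots> = x" by (intro expand lat_span x)
  finally have fm: "?f ?m = x" .
  have le: "representation B x b \<le> ht x" if "b \<in> B" for b
   unfolding ht_rep[OF lat_span[OF x(1)]] using x(2) that finite_B by (intro member_le_sum) auto
  have "?m b \<le> nat \<lfloor>c\<rfloor>" if "b \<in> B" for b
  proof -
   have "representation B x b \<le> c" using le[OF that] x(3) by linarith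
   then have "nat \<lfloor>representation B x b\<rfloor> \<le> nat \<lfloor>c\<rfloor>" by (intro nat_mono floor_mono)
   then show ?thesis using that by simp
  qed
  then have "?m \<in> PiE B (\<lambda>_. {..nat \<lfloor>c\<rfloor>})" by (intro PiE_I) auto
  then show "x \<in> ?f ` PiE B (\<lambda>_. {..nat \<lfloor>c\<rfloor>})" by (rule image_eqI[where f = ?f, OF fm[symmetric]])
 qed
qed

lemma W_rho_lat: assumes "w \<in> W" shows "w rho - rho \<in> lat"
proof -
 have "(\<Sum>a\<in>Inv (inv w). a) \<in> lat" by (rule lat_sum) (simp add: Inv_def R_lat pos_R)
 moreover have "w rho - rho = - (\<Sum>a\<in>Inv (inv w). a)" unfolding W_rho[OF assms] by simp
 ultimately show ?thesis using lat_minus by metis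
qed

text \<open>The expansion of the Weyl numerator of \<open>M\<rho>\<close> into Hall-Littlewood numerators, evaluated at \<open>z\<close>.\<close>

lemma expansion_at:
 assumes v: "0 < v" and as: "distinct as" "set as = pos"
  and z: "\<And>b. b \<in> B \<Longrightarrow> v * exp (b \<bullet> z) = 1" and reg: "\<And>a. a \<in> pos \<Longrightarrow> a \<bullet> z \<noteq> 0"
 defines "p \<equiv> pcoef (map (\<lambda>a. (a, geo v)) as)"
 defines "K \<equiv> \<lambda>k x. \<Sum>w\<in>W. eps w * p (w ((2 * real k + 1) *\<^sub>R rho) - (x + rho))"
 defines "F \<equiv> \<lambda>k. {x \<in> Lam. ht x \<le> ht (real k *\<^sub>R (2 *\<^sub>R rho))}"
 shows "finite (F k)" "x \<in> Lam \<Longrightarrow> x \<notin> F k \<Longrightarrow> K k x = 0"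
  "weyl_den ((2 * real k + 1) *\<^sub>R z) = (\<Sum>x\<in>F k. K k x / poin v x * exp (x \<bullet> z)) * (poinW v * weyl_den z)"
proof -
 \<comment> \<open>Odd multiples of \<open>rho\<close> differ from \<open>rho\<close> by multiples
   of \<open>2 *\<^sub>R rho\<close>, which lies in the lattice even when \<open>rho\<close> does
   not. Their numerators at \<open>z\<close> are Weyl denominators at multiples of
   \<open>z\<close>.\<close>
 let ?M = "2 * real k + 1"
 let ?r = "?M *\<^sub>R rho"
 have sub: "F k \<subseteq> {x \<in> Npos. ht x \<le> ht (real k *\<^sub>R (2 *\<^sub>R rho))}" using Lam_Npos by (auto simp: F_def)
 show fF: "finite (F k)" by (rule finite_subset[OF sub Npos_finite])
 have drho: "dominant ?r"
 proof -
  have "0 \<le> rho \<bullet> b" if "b \<in> B" for b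
  proof -
   have "0 < b \<bullet> b" using that B_pos pos_nonzero by simp
   moreover from this have "b \<bullet> b = 2 * (rho \<bullet> b)" using cartan_rho[OF that] by (simp add: cartan_def field_simps)
   ultimately show ?thesis by linarith
  qed
  then show ?thesis by (auto simp: dominant_def)
 qed
 have K0: "K k x = 0" if x: "x \<in> Lam" "x \<notin> F k" for x
 proof -
  have "p (w ?r - (x + rho)) = 0" if w: "w \<in> W" for w
   unfolding p_def
  proof (rule pcoef_neg)
   show "fst ` set (map (\<lambda>a. (a, geo v)) as) \<subseteq> pos" by (simp only: set_map image_image fst_conv image_ident as(2) subset_refl)
   have "ht (w ?r) \<le> ht ?r" by (rule ht_W_le[OF w drho])
   moreover have "ht (real k *\<^sub>R (2 *\<^sub>R rho)) < ht x" using x by (auto simp: F_def)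
   ultimately show "ht (w ?r - (x + rho)) < 0" by (simp add: ht_diff ht_add ht_scaleR algebra_simps)
  qed
  then show ?thesis by (simp add: K_def)
 qed
 then show "x \<in> Lam \<Longrightarrow> x \<notin> F k \<Longrightarrow> K k x = 0" by blast
 \<comment> \<open>\<open>?J x\<close> is the Hall-Littlewood numerator of \<open>x\<close> as a
   function of the exponent, and \<open>?d\<close> is the error of the proposed expansion. The
   coefficients \<open>K\<close> are chosen so that, by \<open>hall_littlewood_coef\<close>, every
   test required in \<open>skew_zero\<close> is zero on \<open>?d\<close>.\<close>
 let ?J = "\<lambda>x y. \<Sum>Y\<in>Pow pos. (- v) ^ card Y * alt_coef (x + rho - \<Sum>Y) y"
 let ?d = "\<lambda>y. alt_coef ?r y - (\<Sum>x\<in>F k. K k x / poin v x * ?J x y)"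
 let ?U = "(\<lambda>w. w ?r) ` W \<union> (\<Union>x\<in>F k. \<Union>Y\<in>Pow pos. (\<lambda>w. w (x + rho - \<Sum>Y)) ` W)"
 have fU: "finite ?U" using fF by simp
 have dsum: "(\<Sum>y\<in>?U. ?d y * f y) = (\<Sum>w\<in>W. eps w * f (w ?r))
   - (\<Sum>x\<in>F k. K k x / poin v x * (\<Sum>w\<in>W. \<Sum>Y\<in>Pow pos. eps w * (- v) ^ card Y * f (w (x + rho - \<Sum>Y))))" for f
 proof -
  have J: "(\<Sum>y\<in>?U. ?J x y * f y) = (\<Sum>w\<in>W. \<Sum>Y\<in>Pow pos. eps w * (- v) ^ card Y * f (w (x + rho - \<Sum>Y)))"
   if x: "x \<in> F k" for x
  proof -
   have "(\<Sum>y\<in>?U. ?J x y * f y) = (\<Sum>Y\<in>Pow pos. (- v) ^ card Y * (\<Sum>y\<in>?U. alt_coef (x + rho - \<Sum>Y) y * f y))"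
    unfolding sum_distrib_right sum_distrib_left mult.assoc by (rule sum.swap)
   also have "\<dots> = (\<Sum>Y\<in>Pow pos. (- v) ^ card Y * (\<Sum>w\<in>W. eps w * f (w (x + rho - \<Sum>Y))))"
   proof (rule sum.cong)
    fix Y assume Y: "Y \<in> Pow pos"
    have "(\<Sum>y\<in>?U. alt_coef (x + rho - \<Sum>Y) y * f y) = (\<Sum>w\<in>W. eps w * f (w (x + rho - \<Sum>Y)))"
    proof (rule alt_coef_sum[OF fU])
     fix w assume "w \<in> W"
     then show "w (x + rho - \<Sum>Y) \<in> ?U" by (intro UnI2 UN_I[OF x] UN_I[OF Y] imageI)
    qed
    then show "(- v) ^ card Y * (\<Sum>y\<in>?U. alt_coef (x + rho - \<Sum>Y) y * f y)
     = (- v) ^ card Y * (\<Sum>w\<in>W. eps w * f (w (x + rho - \<Sum>Y)))" by (simp only:)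
   qed simp
   also have "\<dots> = (\<Sum>Y\<in>Pow pos. \<Sum>w\<in>W. eps w * (- v) ^ card Y * f (w (x + rho - \<Sum>Y)))"
    unfolding sum_distrib_left by (simp only: mult_ac)
   also have "\<dots> = (\<Sum>w\<in>W. \<Sum>Y\<in>Pow pos. eps w * (- v) ^ card Y * f (w (x + rho - \<Sum>Y)))" by (rule sum.swap)
   finally show ?thesis .
  qed
  have "(\<Sum>y\<in>?U. ?d y * f y) = (\<Sum>y\<in>?U. alt_coef ?r y * f y) - (\<Sum>y\<in>?U. \<Sum>x\<in>F k. K k x / poin v x * (?J x y * f y))"
   unfolding sum_subtractf[symmetric] by (rule sum.cong) (simp_all only: left_diff_distrib sum_distrib_right mult.assoc)
  also have "(\<Sum>y\<in>?U. alt_coef ?r y * f y) = (\<Sum>w\<in>W. eps w * f (w ?r))"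
   by (rule alt_coef_sum[OF fU]) (rule UnI1[OF imageI])
  also have "(\<Sum>y\<in>?U. \<Sum>x\<in>F k. K k x / poin v x * (?J x y * f y)) = (\<Sum>x\<in>F k. K k x / poin v x * (\<Sum>y\<in>?U. ?J x y * f y))"
   unfolding sum_distrib_left[of "K k _ / poin v _"] by (rule sum.swap)
  also have "\<dots> = (\<Sum>x\<in>F k. K k x / poin v x * (\<Sum>w\<in>W. \<Sum>Y\<in>Pow pos. eps w * (- v) ^ card Y * f (w (x + rho - \<Sum>Y))))"
   by (rule sum.cong) (simp_all only: J)
  finally show ?thesis .
 qed
 have d0: "?d y = 0" for y
 proof (rule skew_zero[OF fU, where d = ?d and p = p])
  have dne: "(\<exists>w\<in>W. y = w ?r) \<or> (\<exists>x\<in>F k. \<exists>Y\<in>Pow pos. \<exists>w\<in>W. y = w (x + rho - \<Sum>Y))" if d: "?d y \<noteq> 0" for y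
  proof (rule ccontr)
   assume n: "\<not> ?thesis"
   then have "alt_coef ?r y = 0" using alt_coef_supp by blast
   moreover have "?J x y = 0" if "x \<in> F k" for x
   proof (rule sum.neutral, rule ballI)
    fix Y assume "Y \<in> Pow pos"
    then have "alt_coef (x + rho - \<Sum>Y) y = 0" using alt_coef_supp n that by blast
    then show "(- v) ^ card Y * alt_coef (x + rho - \<Sum>Y) y = 0" by simp
   qed
   ultimately show False using d by simp
  qed
  show "y \<in> ?U" if "?d y \<noteq> 0" for y using dne[OF that]
  proof (elim disjE bexE)
   fix w assume "w \<in> W" "y = w ?r"
   then show ?thesis by (intro UnI1 image_eqI[where x = w])
  next
   fix x Y w assume xY: "x \<in> F k" "Y \<in> Pow pos" "w \<in> W" "y = w (x + rho - \<Sum>Y)"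
   show ?thesis unfolding xY(4) by (intro UnI2 UN_I[OF xY(1)] UN_I[OF xY(2)] imageI xY(3))
  qed
  show "y - rho \<in> lat" if "?d y \<noteq> 0" for y
   using dne[OF that]
  proof (elim disjE bexE)
   fix w assume w: "w \<in> W" "y = w ?r"
   have "?r = real k *\<^sub>R (2 *\<^sub>R rho) + rho" by (simp add: scaleR_add_left)
   then have "y - rho = w (real k *\<^sub>R (2 *\<^sub>R rho)) + (w rho - rho)"
    using linear_add[OF W_linear[OF w(1)], of "real k *\<^sub>R (2 *\<^sub>R rho)" rho] w(2) by (simp only: add_diff_eq)
   then show ?thesis using lat_add[OF W_lat[OF w(1) lat_nat[OF rho_lat]] W_rho_lat[OF w(1)]] by (simp only:)
  next
   fix x Y w assume xY: "x \<in> F k" "Y \<in> Pow pos" "w \<in> W" "y = w (x + rho - \<Sum>Y)"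
   have "y - rho = w (x - \<Sum>Y) + (w rho - rho)"
    unfolding xY(4) by (simp add: linear_add[OF W_linear[OF xY(3)]] linear_diff[OF W_linear[OF xY(3)]])
   moreover have "x - \<Sum>Y \<in> lat" using xY(1,2) R_lat pos_R by (intro lat_diff lat_sum) (auto simp: F_def Lam_def)
   ultimately show ?thesis using lat_add[OF W_lat[OF xY(3)] W_rho_lat[OF xY(3)]] by (simp only:)
  qed
  show "?d (root_refl b y) = - ?d y" if "b \<in> B" for b y
   by (simp add: alt_coef_refl[OF that] sum_negf)
  show "p 0 = 1"
   unfolding p_def using as pcoef_zero[of as "\<lambda>_. geo v"] by (simp add: list_prod_set)
  show "x = 0 \<or> 0 < ht x" if "p x \<noteq> 0" for x
  proof -
   have "\<exists>m::'a \<Rightarrow> nat. x = (\<Sum>a\<in>set as. real (m a) *\<^sub>R a) \<and> (\<forall>a\<in>set as. geo v (m a) \<noteq> 0)"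
    by (rule pcoef_supp) (use as that p_def in auto)
   then obtain m :: "'a \<Rightarrow> nat" where m: "x = (\<Sum>a\<in>pos. real (m a) *\<^sub>R a)" using as by auto
   show ?thesis
   proof (cases "\<exists>a\<in>pos. m a \<noteq> 0")
    case True
    then obtain a where a: "a \<in> pos" "m a \<noteq> 0" by blast
    have "0 < (\<Sum>a\<in>pos. real (m a) * ht a)"
     by (rule sum_pos2[OF finite_pos a(1)]) (use a ht_pos in \<open>auto simp: less_imp_le\<close>)
    then show ?thesis unfolding m by (simp add: ht_sum ht_scaleR)
   next
    case False
    then show ?thesis unfolding m by simp
   qed
  qed
  show "(\<Sum>y\<in>?U. ?d y * p (y - (x + rho))) = 0" if x: "x \<in> Lam" for x
  proof -
   have "(\<Sum>y\<in>?U. ?d y * p (y - (x + rho))) = K k x - (\<Sum>x'\<in>F k. K k x' / poin v x' * (if x' = x then poin v x' else 0))"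
    unfolding dsum[of "\<lambda>y. p (y - (x + rho))"]
   proof (intro arg_cong2[where f = "(-)"] sum.cong refl)
    show "(\<Sum>w\<in>W. eps w * p (w ?r - (x + rho))) = K k x" by (simp add: K_def)
    fix x' assume "x' \<in> F k"
    then have "x' \<in> Lam" by (simp add: F_def)
    then show "K k x' / poin v x' * (\<Sum>w\<in>W. \<Sum>Y\<in>Pow pos. eps w * (- v) ^ card Y * p (w (x' + rho - \<Sum>Y) - (x + rho)))
     = K k x' / poin v x' * (if x' = x then poin v x' else 0)"
     unfolding p_def by (simp only: hall_littlewood_coef[OF v as _ x])
   qed
   also have "(\<Sum>x'\<in>F k. K k x' / poin v x' * (if x' = x then poin v x' else 0)) = (\<Sum>x'\<in>F k. if x' = x then K k x else 0)"
    by (rule sum.cong) (use poin_pos[OF v] in \<open>auto simp: less_imp_neq[symmetric]\<close>)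
   also have "\<dots> = (if x \<in> F k then K k x else 0)" using fF by simp
   finally show ?thesis using K0[OF x] by auto
  qed
 qed
 have HE: "(\<Sum>w\<in>W. \<Sum>Y\<in>Pow pos. eps w * (- v) ^ card Y * exp (w (x + rho - \<Sum>Y) \<bullet> z))
  = exp (x \<bullet> z) * (poinW v * weyl_den z)" for x
  by (rule hall_littlewood_eval[OF v z reg])
 have "(\<Sum>y\<in>?U. ?d y * exp (y \<bullet> z)) = 0"
  by (rule sum.neutral, rule ballI) (simp only: d0 mult_zero_left)
 then have "(\<Sum>w\<in>W. eps w * exp (w ?r \<bullet> z)) = (\<Sum>x\<in>F k. K k x / poin v x * (exp (x \<bullet> z) * (poinW v * weyl_den z)))"
  unfolding dsum[of "\<lambda>y. exp (y \<bullet> z)"] HE by (rule iffD1[OF right_minus_eq])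
 moreover have "(\<Sum>w\<in>W. eps w * exp (w ?r \<bullet> z)) = weyl_den (?M *\<^sub>R z)"
  unfolding weyl_denominator[symmetric] alt_exp_def
  by (rule sum.cong) (simp_all add: linear_cmul[OF W_linear])
 ultimately show "weyl_den (?M *\<^sub>R z) = (\<Sum>x\<in>F k. K k x / poin v x * exp (x \<bullet> z)) * (poinW v * weyl_den z)"
  by (simp only: sum_distrib_right mult.assoc)
qed

lemma inner_ht:
 assumes "x \<in> span B" "\<And>b. b \<in> B \<Longrightarrow> b \<bullet> z = c" shows "x \<bullet> z = ht x * c"
proof -
 have "x \<bullet> z = (\<Sum>b\<in>B. representation B x b * c)"
  unfolding expand_inner[OF assms(1)] by (rule sum.cong) (simp_all add: assms(2))
 then show ?thesis unfolding ht_rep[OF assms(1)] by (simp only: sum_distrib_right)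
qed

text \<open>Let \<open>k\<close> grow in \<open>expansion_at\<close>. After normalisation by a power
  of \<open>u\<close> the coefficient \<open>K k x\<close> tends to a constant \<open>C\<close> that
  does not depend on \<open>x\<close>, because only the term of the identity survives, and the
  quotient of the two Weyl denominators converges to a product over \<open>pos\<close>.\<close>

theorem bott_sum:
 assumes u: "0 < u" "u < 1"
 shows "((\<lambda>x. u powr (2 * ht x) * (poinW (1/u) / poin (1/u) x)) has_sum
  (\<Prod>a\<in>pos - B. 1 - u powr (ht a - 1)) / (\<Prod>a\<in>pos. 1 - u powr ht a)) Lam"
proof -
 let ?v = "1/u"
 have v: "0 < ?v" using u by simp
 obtain bs where bs: "distinct bs" "set bs = B" using finite_distinct_list[OF finite_B] by blast
 obtain ns where ns: "distinct ns" "set ns = pos - B" using finite_distinct_list[of "pos - B"] by blast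
 let ?as = "ns @ bs"
 have as: "distinct ?as" "set ?as = pos" using bs ns B_pos by auto
 obtain z where z: "\<forall>b\<in>B. b \<bullet> z = ln u" using dual_functional[of "\<lambda>_. ln u"] by blast
 have iz: "x \<bullet> z = ht x * ln u" if "x \<in> span B" for x by (rule inner_ht[OF that]) (use z in simp)
 have pz: "a \<bullet> z = ht a * ln u" if "a \<in> pos" for a using that pos_R R_span by (intro iz) blast
 have zz: "?v * exp (b \<bullet> z) = 1" if "b \<in> B" for b using z that u by simp
 have reg: "a \<bullet> z \<noteq> 0" if "a \<in> pos" for a using pz[OF that] ht_pos[OF that] u by simp
 define p where "p = pcoef (map (\<lambda>a. (a, geo ?v)) ?as)"
 let ?mu = "\<lambda>k. real k *\<^sub>R (2 *\<^sub>R rho)"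
 let ?r = "\<lambda>k. (2 * real k + 1) *\<^sub>R rho"
 define K where "K k x = (\<Sum>w\<in>W. eps w * p (w (?r k) - (x + rho)))" for k x
 define F where "F k = {x \<in> Lam. ht x \<le> ht (?mu k)}" for k
 note E = expansion_at[OF v as zz reg, folded p_def, folded K_def F_def]
 \<comment> \<open>The limit of the normalised coefficients; its inverse is the product over
   nonsimple roots in the result.\<close>
 define C where "C = (\<Prod>a\<leftarrow>ns. 1 / (1 - u powr (ht a - 1)))"
 have N: "(\<forall>x. 0 \<le> u powr ht x * p x \<and> u powr ht x * p x \<le> C) \<and>
  (\<forall>y\<in>lat. (\<lambda>n. u powr ht (?mu n - y) * p (?mu n - y)) \<longlonglongrightarrow> C)"
  unfolding C_def p_def by (rule pcoef_normalized[OF u bs]) (use ns eventually_Npos in auto)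
 have N1: "0 \<le> u powr ht x * p x" and N2: "u powr ht x * p x \<le> C" for x
  using N[THEN conjunct1, THEN spec, of x] by (rule conjunct1, rule conjunct2)
 note N3 = N[THEN conjunct2, THEN bspec]
 let ?g = "\<lambda>x. u powr (2 * ht x) * (poinW ?v / poin ?v x)"
 define f where "f k x = u powr ht (?mu k - x) * K k x * ?g x" for k x
 define s where "s k = (\<Prod>a\<in>pos. (1 - u powr ((2 * real k + 1) * ht a)) / (1 - u powr ht a))" for k
 have mur: "?r k = ?mu k + rho" for k by (simp add: scaleR_add_left)
 let ?T = "\<lambda>k x w. u powr ht (?mu k - x) * (eps w * p (w (?r k) - (x + rho)))"
 have Tsum: "u powr ht (?mu k - x) * K k x = (\<Sum>w\<in>W. ?T k x w)" for k x unfolding K_def sum_distrib_left ..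
 have drho: "dominant rho"
  unfolding dominant_def
 proof
  fix b assume b: "b \<in> B"
  have "0 < b \<bullet> b" using b B_pos pos_nonzero by simp
  moreover from this have "b \<bullet> b = 2 * (rho \<bullet> b)" using cartan_rho[OF b] by (simp add: cartan_def field_simps)
  ultimately show "0 \<le> rho \<bullet> b" by linarith
 qed
 have Tb: "\<bar>?T k x w\<bar> \<le> u powr ((2 * real k + 1) * (ht rho - ht (w rho))) * C" if w: "w \<in> W" for k x w
 proof -
  let ?y = "w (?r k) - (x + rho)"
  \<comment> \<open>Splits off the height that \<open>rho\<close> loses under \<open>w\<close>. Its
    multiple grows linearly in \<open>k\<close> and suppresses every term except that of the
    identity.\<close>
  have e: "ht (?mu k - x) = (2 * real k + 1) * (ht rho - ht (w rho)) + ht ?y"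
   unfolding linear_cmul[OF W_linear[OF w]] ht_diff ht_add ht_scaleR by (simp add: algebra_simps)
  have "?T k x w = eps w * (u powr ((2 * real k + 1) * (ht rho - ht (w rho))) * (u powr ht ?y * p ?y))"
   unfolding e powr_add by (simp only: mult_ac)
  moreover have "\<bar>eps w\<bar> = 1" by (simp add: eps_def)
  moreover have "\<bar>e * (A * X)\<bar> = A * X" if "\<bar>e\<bar> = 1" "0 \<le> A" "0 \<le> X" for e A X :: real
   using that by (simp add: abs_mult)
  ultimately have "\<bar>?T k x w\<bar> = u powr ((2 * real k + 1) * (ht rho - ht (w rho))) * (u powr ht ?y * p ?y)"
   using N1[of ?y] by (simp only: powr_ge_zero)
  also have "\<dots> \<le> u powr ((2 * real k + 1) * (ht rho - ht (w rho))) * C"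
   by (rule mult_left_mono[OF N2 powr_ge_zero])
  finally show ?thesis .
 qed
 have hw: "ht (w rho) < ht rho" if "w \<in> W" "w \<noteq> id" for w
 proof -
  have "inv w \<noteq> id" using that inv_inv inv_id by metis
  then have "Inv (inv w) \<noteq> {}" using Inv_empty_iff[OF W_inv(1)[OF that(1)]] by blast
  then have "0 < (\<Sum>a\<in>Inv (inv w). ht a)" by (intro sum_pos) (auto simp: Inv_def intro: ht_pos)
  then show ?thesis unfolding W_rho[OF that(1)] by (simp add: ht_diff ht_sum)
 qed
 have C0: "0 \<le> C" by (rule order_trans[OF N1 N2])
 have g0: "0 \<le> ?g x" for x using poinW_pos[OF v] poin_pos[OF v, of x] by (intro mult_nonneg_nonneg divide_nonneg_nonneg) simp_all
 have p1: "1 \<le> poin ?v x" for x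
 proof -
  have i: "id \<in> stab x" by (simp add: stab_def)
  have "Inv id = {}" by (auto simp: Inv_def)
  then have "?v ^ card (Inv id) = 1" by simp
  moreover have "?v ^ card (Inv id) \<le> poin ?v x" unfolding poin_def
   by (rule member_le_sum[OF i]) (use v in auto)
  ultimately show ?thesis by simp
 qed
 \<comment> \<open>The dominating function comes from bounding each of the \<open>card W\<close>
   terms by \<open>C\<close> and each stabilizer polynomial from below by one.\<close>
 have "((\<lambda>x. C * ?g x) has_sum (1 / (\<Prod>a\<in>pos. 1 - u powr ht a))) Lam"
 proof (rule has_sum_dominated[where f = f and s = s and h = "\<lambda>x. real (card W) * C * poinW ?v * u powr (2 * ht x)"])
  fix x assume x: "x \<in> Lam"
  have T1: "(\<lambda>k. ?T k x w) \<longlonglongrightarrow> (if w = id then C else 0)" if w: "w \<in> W" for w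
  proof (cases "w = id")
   case True
   have "x \<in> lat" using x by (simp add: Lam_def)
   then have l: "(\<lambda>n. u powr ht (?mu n - x) * p (?mu n - x)) \<longlonglongrightarrow> C" by (rule N3)
   have rn: "?r n - (x + rho) = ?mu n - x" for n unfolding mur by (rule add_diff_cancel_right)
   show ?thesis using l unfolding if_P[OF True] unfolding True id_apply eps_id rn mult_1 .
  next
   case False
   let ?h = "ht rho - ht (w rho)"
   have h: "0 < ?h" using hw[OF w False] by simp
   have q: "0 < u powr ?h" "u powr ?h < 1" using u h by (simp_all add: powr_def mult_pos_neg)
   have pk: "u powr ((2 * real k + 1) * ?h) = u powr ?h * ((u powr ?h)^2) ^ k" for k
    by (rule powr_odd[OF u(1)])
   have "(u powr ?h)^2 < 1" using q by (simp add: power_less_one_iff)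
   then have "(\<lambda>k. u powr ?h * ((u powr ?h)^2) ^ k * C) \<longlonglongrightarrow> u powr ?h * 0 * C"
    by (intro tendsto_intros LIMSEQ_realpow_zero) simp_all
   then have l: "(\<lambda>k. u powr ((2 * real k + 1) * ?h) * C) \<longlonglongrightarrow> 0" unfolding pk by simp
   have "(\<lambda>k. ?T k x w) \<longlonglongrightarrow> 0"
    by (rule Lim_null_comparison[OF _ l]) (use Tb[OF w] in simp)
   then show ?thesis using False by simp
  qed
  have "(\<lambda>k. u powr ht (?mu k - x) * K k x) \<longlonglongrightarrow> (\<Sum>w\<in>W. if w = id then C else 0)"
   unfolding Tsum by (rule tendsto_sum[OF T1])
  moreover have "(\<Sum>w\<in>W. if w = id then C else 0) = C" using finite_W gen_subgroup_id[of root_refl B] by simp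
  ultimately show "(\<lambda>k. f k x) \<longlonglongrightarrow> C * ?g x" unfolding f_def by (intro tendsto_mult_right) simp
  fix k
  have "\<bar>?T k x w\<bar> \<le> C" if w: "w \<in> W" for w
  proof -
   have "0 \<le> (2 * real k + 1) * (ht rho - ht (w rho))" using ht_W_le[OF w drho] by simp
   then have "u powr ((2 * real k + 1) * (ht rho - ht (w rho))) \<le> 1" using u
    by (simp add: powr_def mult_nonneg_nonpos)
   then have "u powr ((2 * real k + 1) * (ht rho - ht (w rho))) * C \<le> 1 * C" by (rule mult_right_mono[OF _ C0])
   then show ?thesis using Tb[OF w, of k x] by simp
  qed
  then have "(\<Sum>w\<in>W. \<bar>?T k x w\<bar>) \<le> (\<Sum>w\<in>W. C)" by (rule sum_mono)
  then have b: "\<bar>u powr ht (?mu k - x) * K k x\<bar> \<le> real (card W) * C" unfolding Tsum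
   by (intro order_trans[OF sum_abs]) simp
  have "?g x \<le> u powr (2 * ht x) * poinW ?v"
  proof (rule mult_left_mono)
   show "poinW ?v / poin ?v x \<le> poinW ?v" using p1[of x] poinW_pos[OF v] by (simp add: divide_le_eq)
  qed simp
  then have "\<bar>u powr ht (?mu k - x) * K k x\<bar> * ?g x \<le> real (card W) * C * (u powr (2 * ht x) * poinW ?v)"
   by (rule mult_mono[OF b]) (use C0 g0 in simp_all)
  moreover have "\<bar>f k x\<bar> = \<bar>u powr ht (?mu k - x) * K k x\<bar> * ?g x"
   unfolding f_def abs_mult[of _ "?g x"] abs_of_nonneg[OF g0] ..
  moreover have "real (card W) * C * (u powr (2 * ht x) * poinW ?v) = real (card W) * C * poinW ?v * u powr (2 * ht x)"
   by (simp only: mult_ac)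
  ultimately show "\<bar>f k x\<bar> \<le> real (card W) * C * poinW ?v * u powr (2 * ht x)" by (simp only:)
 next
  have "u\<^sup>2 < 1" using u by (simp add: power_less_one_iff)
  then have "(\<lambda>x. (u\<^sup>2) powr ht x) summable_on Npos" using u by (intro Npos_summable) simp_all
  moreover have "(u\<^sup>2) powr t = u powr (2 * t)" for t
   using u powr_powr[of u 2 t] by (simp add: powr_numeral)
  ultimately have "(\<lambda>x. u powr (2 * ht x)) summable_on Npos" by simp
  then have "(\<lambda>x. u powr (2 * ht x)) summable_on Lam" by (rule summable_on_subset_banach[OF _ Lam_Npos])
  then show "(\<lambda>x. real (card W) * C * poinW ?v * u powr (2 * ht x)) summable_on Lam"
   by (rule summable_on_cmult_right)
 next
  fix k
  \<comment> \<open>The quotient of the denominators at an odd multiple of \<open>z\<close> and at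
    \<open>z\<close> itself is elementary, factor by factor; this makes the left side of the
    expansion computable in the limit.\<close>
  have s1: "weyl_den ((2 * real k + 1) *\<^sub>R z) = u powr (- ht (?mu k)) * s k * weyl_den z"
  proof -
   have e: "exp ((2 * real k + 1) * t / 2) - exp (- ((2 * real k + 1) * t) / 2)
    = exp (- real k * t) * ((1 - exp ((2 * real k + 1) * t)) / (1 - exp t)) * (exp (t / 2) - exp (- t / 2))"
    if t: "t \<noteq> 0" for t
   proof -
    have d: "exp (r * t / 2) - exp (- (r * t) / 2) = - exp (- (r * t) / 2) * (1 - exp (r * t))" for r :: real
     by (simp add: right_diff_distrib flip: exp_add)
    have "exp (- ((2 * real k + 1) * t) / 2) = exp (- real k * t) * exp (- (1 * t) / 2)"
     by (simp flip: exp_add add: field_simps)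
    moreover have "1 - exp t \<noteq> 0" using t by simp
    ultimately show ?thesis using d[of "2 * real k + 1"] d[of 1] by simp
   qed
   have "weyl_den ((2 * real k + 1) *\<^sub>R z) = (\<Prod>a\<in>pos. exp (- real k * (a \<bullet> z)) *
    ((1 - exp ((2 * real k + 1) * (a \<bullet> z))) / (1 - exp (a \<bullet> z))) * (exp (a \<bullet> z / 2) - exp (- (a \<bullet> z) / 2)))"
    unfolding weyl_den_def
    by (rule prod.cong) (simp_all only: inner_scaleR_right e[OF reg])
   also have "\<dots> = (\<Prod>a\<in>pos. exp (- real k * (a \<bullet> z))) *
    (\<Prod>a\<in>pos. (1 - exp ((2 * real k + 1) * (a \<bullet> z))) / (1 - exp (a \<bullet> z))) * weyl_den z"
    unfolding weyl_den_def by (simp only: prod.distrib)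
   also have "(\<Prod>a\<in>pos. exp (- real k * (a \<bullet> z))) = u powr (- ht (?mu k))"
   proof -
    have "(\<Prod>a\<in>pos. exp (- real k * (a \<bullet> z))) = exp (\<Sum>a\<in>pos. - real k * (a \<bullet> z))"
     by (rule exp_sum[symmetric]) simp
    also have "(\<Sum>a\<in>pos. - real k * (a \<bullet> z)) = - (?mu k \<bullet> z)"
     by (simp add: rho_def inner_sum_left sum_distrib_left sum_negf)
    also have "?mu k \<bullet> z = ht (?mu k) * ln u" by (intro iz lat_span lat_nat rho_lat)
    finally show ?thesis using u by (simp add: powr_def)
   qed
   also have "(\<Prod>a\<in>pos. (1 - exp ((2 * real k + 1) * (a \<bullet> z))) / (1 - exp (a \<bullet> z))) = s k"
    unfolding s_def using u by (intro prod.cong) (simp_all add: pz powr_def mult_ac)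
   finally show ?thesis .
  qed
  have "weyl_den z \<noteq> 0" by (rule weyl_den_nz[OF reg])
  then have "u powr (- ht (?mu k)) * s k = (\<Sum>x\<in>F k. K k x / poin ?v x * exp (x \<bullet> z)) * poinW ?v"
   using E(3)[of k] unfolding s1 by simp
  moreover have "u powr t * u powr (- t) = 1" for t using u by (simp flip: powr_add)
  ultimately have "s k = u powr ht (?mu k) * ((\<Sum>x\<in>F k. K k x / poin ?v x * exp (x \<bullet> z)) * poinW ?v)"
   by (metis mult.assoc mult_1)
  also have "\<dots> = (\<Sum>x\<in>F k. f k x)"
   unfolding sum_distrib_left sum_distrib_right
  proof (rule sum.cong)
   fix x assume "x \<in> F k"
   then have "x \<in> span B" by (intro lat_span) (simp add: F_def Lam_def)
   then have "exp (x \<bullet> z) = u powr ht x" using iz u by (simp add: powr_def)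
   moreover have "u powr ht (?mu k - x) * u powr (2 * ht x) = u powr ht (?mu k) * u powr ht x"
    unfolding powr_add[symmetric] by (simp add: ht_diff add.commute)
   moreover have "f k x = (u powr ht (?mu k - x) * u powr (2 * ht x)) * (K k x / poin ?v x * poinW ?v)"
    unfolding f_def by simp
   ultimately show "u powr ht (?mu k) * (K k x / poin ?v x * exp (x \<bullet> z) * poinW ?v) = f k x"
    by (simp only: mult_ac)
  qed simp
  finally have sf: "s k = (\<Sum>x\<in>F k. f k x)" .
  have "(f k has_sum (\<Sum>x\<in>F k. f k x)) (F k)" by (rule has_sum_finite[OF E(1)])
  moreover have "(f k has_sum S) Lam \<longleftrightarrow> (f k has_sum S) (F k)" for S
  proof (rule has_sum_cong_neutral)
   fix x assume "x \<in> Lam - F k"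
   then show "f k x = 0" using E(2)[of x k] by (simp add: f_def)
  qed (auto simp: F_def)
  ultimately show "(f k has_sum s k) Lam" unfolding sf by blast
 next
  have "(\<lambda>k. (1 - u powr ((2 * real k + 1) * ht a)) / (1 - u powr ht a)) \<longlonglongrightarrow> (1 - 0) / (1 - u powr ht a)" if a: "a \<in> pos" for a
  proof -
   have q: "0 < u powr ht a" "u powr ht a < 1" using u ht_pos[OF a] by (simp_all add: powr_def mult_pos_neg)
   have pk: "u powr ((2 * real k + 1) * ht a) = u powr ht a * ((u powr ht a)^2) ^ k" for k
    by (rule powr_odd[OF u(1)])
   have "(u powr ht a)^2 < 1" using q by (simp add: power_less_one_iff)
   then have "(\<lambda>k. u powr ht a * ((u powr ht a)^2) ^ k) \<longlonglongrightarrow> u powr ht a * 0"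
    by (intro tendsto_intros LIMSEQ_realpow_zero) simp_all
   then have "(\<lambda>k. u powr ((2 * real k + 1) * ht a)) \<longlonglongrightarrow> 0" unfolding pk by simp
   then show ?thesis using q by (intro tendsto_intros) simp_all
  qed
  then have "s \<longlonglongrightarrow> (\<Prod>a\<in>pos. (1 - 0) / (1 - u powr ht a))" unfolding s_def by (rule tendsto_prod)
  then show "s \<longlonglongrightarrow> 1 / (\<Prod>a\<in>pos. 1 - u powr ht a)" by (simp add: prod_dividef)
 qed
 from has_sum_cmult_right[OF this, of "1 / C"]
 have hs: "((\<lambda>x. 1 / C * (C * ?g x)) has_sum (1 / C * (1 / (\<Prod>a\<in>pos. 1 - u powr ht a)))) Lam" .
 have Cs: "C = 1 / (\<Prod>a\<in>pos - B. 1 - u powr (ht a - 1))"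
  unfolding C_def list_prod_set[OF ns(1)] ns(2) by (simp add: prod_dividef)
 have "(\<Prod>a\<in>pos - B. 1 - u powr (ht a - 1)) \<noteq> 0"
 proof -
  have "1 - u powr (ht a - 1) \<noteq> 0" if "a \<in> pos - B" for a
  proof -
   have "u powr (ht a - 1) < 1" using u ht_nonsimple[of a] that by (simp add: powr_def mult_pos_neg)
   then show ?thesis by simp
  qed
  then show ?thesis by (simp add: prod_zero_iff)
 qed
 then have C: "C \<noteq> 0" "1 / C = (\<Prod>a\<in>pos - B. 1 - u powr (ht a - 1))" unfolding Cs by simp_all
 have c: "1 / C * (C * t) = t" for t using C(1) by simp
 have d: "1 / C * (1 / D) = (\<Prod>a\<in>pos - B. 1 - u powr (ht a - 1)) / D" for D unfolding C(2) by simp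
 show ?thesis using hs unfolding c d .
qed

end

section \<open>Products over minimal representatives, and angles between roots\<close>

context based_roots
begin

text \<open>By \<open>coset_sum\<close> with equal weights the sum over \<open>W\<close> factors.
  Dividing \<open>macdonald_product\<close> for \<open>R\<close> by the same product for the roots
  orthogonal to \<open>x\<close> leaves the factors with
  \<open>a \<bullet> x \<noteq> 0\<close>.\<close>

theorem min_reps_product:
 assumes x: "dominant x" and reg: "\<And>a. a \<in> pos \<Longrightarrow> a \<bullet> z \<noteq> 0"
  and inv: "\<And>w a. w \<in> W \<Longrightarrow> a \<in> R \<Longrightarrow> t (w a) = t a"
  and spec: "\<And>b. b \<in> B \<Longrightarrow> t b * exp (b \<bullet> z) = 1"
 shows "(\<Sum>w\<in>min_reps x. \<Prod>a\<in>Inv w. t a)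
  = (\<Prod>a\<in>{a\<in>pos. a \<bullet> x \<noteq> 0}. (1 - t a * exp (- (a \<bullet> z))) / (1 - exp (- (a \<bullet> z))))"
proof -
 let ?f = "\<lambda>a. (1 - t a * exp (- (a \<bullet> z))) / (1 - exp (- (a \<bullet> z)))"
 let ?R = "{a \<in> R. a \<bullet> x = 0}" and ?B = "{b \<in> B. b \<bullet> x = 0}"
 interpret O: based_roots ?R ?B by (rule orth_roots(1)[OF x])
 have Op: "O.pos = {a \<in> pos. a \<bullet> x = 0}" and OW: "O.W = stab x" using orth_roots(2,3)[OF x] .
 have OI: "O.Inv w = Inv w" if w: "w \<in> stab x" for w
 proof (intro set_eqI iffI)
  fix a assume a: "a \<in> O.Inv w"
  then have "a \<in> pos" "a \<bullet> x = 0" "w a \<notin> O.pos" unfolding O.Inv_def Op by auto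
  moreover have "w a \<bullet> x = 0" using stab_inner[OF w, of a] \<open>a \<bullet> x = 0\<close> by simp
  ultimately show "a \<in> Inv w" unfolding Op Inv_def by auto
 next
  fix a assume a: "a \<in> Inv w"
  then have "a \<bullet> x = 0" using Inv_stab[OF x w] by blast
  then show "a \<in> O.Inv w" using a unfolding O.Inv_def Op Inv_def by auto
 qed
 have tpos: "0 < t a" if a: "a \<in> R" for a
 proof -
  obtain w b where "w \<in> W" "b \<in> B" "a = w b" using W_root[OF a] by blast
  then have "t a * exp (b \<bullet> z) = 1" using inv[of w b] spec[of b] B_sub by auto
  then show ?thesis by (metis exp_gt_zero zero_less_mult_pos2 zero_less_one)
 qed
 have "(\<Sum>w\<in>O.W. \<Prod>a\<in>O.Inv w. t a) = (\<Prod>a\<in>O.pos. ?f a)"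
 proof (rule O.macdonald_product)
  show "a \<bullet> z \<noteq> 0" if "a \<in> O.pos" for a using that reg unfolding Op by auto
  show "t (w a) = t a" if "w \<in> O.W" "a \<in> ?R" for w a using that inv stab_W unfolding OW by auto
  show "t b * exp (b \<bullet> z) = 1" if "b \<in> ?B" for b using that spec by auto
 qed
 then have stabsum: "(\<Sum>w\<in>stab x. \<Prod>a\<in>Inv w. t a) = (\<Prod>a\<in>{a \<in> pos. a \<bullet> x = 0}. ?f a)"
  unfolding OW Op by (simp cong: sum.cong add: OI)
 have "0 < (\<Sum>w\<in>stab x. \<Prod>a\<in>Inv w. t a)"
 proof (rule sum_pos)
  show "stab x \<noteq> {}" using gen_subgroup_id by (auto simp: stab_def)
  show "0 < (\<Prod>a\<in>Inv w. t a)" for w using tpos pos_R by (intro prod_pos) (auto simp: Inv_def)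
 qed auto
 then have nz: "(\<Prod>a\<in>{a \<in> pos. a \<bullet> x = 0}. ?f a) \<noteq> 0" unfolding stabsum by (rule less_imp_neq[symmetric])
 have "(\<Prod>a\<in>pos. ?f a) = (\<Sum>w\<in>W. \<Prod>a\<in>Inv w. t a)" by (rule macdonald_product[where t = t and z = z, symmetric]) (simp_all add: reg inv spec)
 also have "\<dots> = (\<Prod>a\<in>{a \<in> pos. a \<bullet> x = 0}. ?f a) * (\<Sum>w\<in>min_reps x. \<Prod>a\<in>Inv w. t a)"
  using coset_sum[where t = t and t' = t, OF x] inv unfolding stabsum by simp
 finally have "(\<Prod>a\<in>pos. ?f a) = (\<Prod>a\<in>{a \<in> pos. a \<bullet> x = 0}. ?f a) * (\<Sum>w\<in>min_reps x. \<Prod>a\<in>Inv w. t a)" .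
 moreover have "(\<Prod>a\<in>pos. ?f a) = (\<Prod>a\<in>{a \<in> pos. a \<bullet> x = 0}. ?f a) * (\<Prod>a\<in>{a \<in> pos. a \<bullet> x \<noteq> 0}. ?f a)"
 proof -
  have "pos = {a \<in> pos. a \<bullet> x = 0} \<union> {a \<in> pos. a \<bullet> x \<noteq> 0}" by blast
  then have "(\<Prod>a\<in>pos. ?f a) = (\<Prod>a\<in>{a \<in> pos. a \<bullet> x = 0} \<union> {a \<in> pos. a \<bullet> x \<noteq> 0}. ?f a)" by (rule arg_cong)
  also have "\<dots> = (\<Prod>a\<in>{a \<in> pos. a \<bullet> x = 0}. ?f a) * (\<Prod>a\<in>{a \<in> pos. a \<bullet> x \<noteq> 0}. ?f a)"
   by (rule prod.union_disjoint) auto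
  finally show ?thesis .
 qed
 ultimately show ?thesis using nz by simp
qed

lemma min_reps_bij: assumes x: "dominant x" shows "bij_betw (\<lambda>w. w x) (min_reps x) ((\<lambda>w. w x) ` W)"
proof -
 have "inj_on (\<lambda>w. w x) (min_reps x)"
 proof (rule inj_onI)
  fix u u' assume u: "u \<in> min_reps x" "u' \<in> min_reps x" "u x = u' x"
  let ?y = "inv u' \<circ> u"
  have W: "u \<in> W" "u' \<in> W" using u min_reps_W by auto
  have y: "?y \<in> stab x" unfolding stab_def using W_comp[OF W_inv(1)[OF W(2)] W(1)] W_inv(2)[OF W(2), of x] u(3) by simp
  have "u = u' \<circ> ?y" using W_inv(3)[OF W(2)] by (auto simp: fun_eq_iff)
  moreover have "id \<in> stab x" by (simp only: stab_def mem_Collect_eq id_apply gen_subgroup_id simp_thms)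
  ultimately have "(\<lambda>(u, y). u \<circ> y) (u, id) = (\<lambda>(u, y). u \<circ> y) (u', ?y)" by (simp only: case_prod_conv comp_id)
  then have "(u, id) = (u', ?y)"
   by (rule inj_onD[OF bij_betw_imp_inj_on[OF coset_bij[OF x]]]) (use u y \<open>id \<in> stab x\<close> in \<open>simp_all only: mem_Sigma_iff\<close>)
  then show "u = u'" by (rule Pair_inject)
 qed
 moreover have "(\<lambda>w. w x) ` min_reps x = (\<lambda>w. w x) ` W"
 proof (intro set_eqI iffI)
  fix y assume "y \<in> (\<lambda>w. w x) ` W"
  then obtain w where w: "w \<in> W" "y = w x" by blast
  then have "w \<in> (\<lambda>(u, y). u \<circ> y) ` (min_reps x \<times> stab x)" using coset_bij[OF x] by (simp only: bij_betw_def)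
  then obtain u v where "u \<in> min_reps x" "v \<in> stab x" "w = u \<circ> v" by (auto simp only: image_iff mem_Sigma_iff case_prod_conv bex_simps)
  then show "y \<in> (\<lambda>w. w x) ` min_reps x" using w(2) by (auto simp: stab_def)
 qed (use min_reps_W in blast)
 ultimately show ?thesis by (simp add: bij_betw_def)
qed

lemma cartan_comm_div: assumes "a \<noteq> 0" "b \<noteq> 0" shows "cartan a b * (b \<bullet> b) = cartan b a * (a \<bullet> a)"
 using assms by (simp add: cartan_def inner_commute)

text \<open>Equality in the Cauchy-Schwarz inequality would make the roots proportional, which
  reducedness allows only for a root and its negative.\<close>

lemma cartan_prod_lt_4:
 assumes "a \<in> R" "b \<in> R" "a \<noteq> b" "a \<noteq> - b" shows "cartan a b * cartan b a < 4"
proof -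
 have nz: "0 < a \<bullet> a" "0 < b \<bullet> b" using assms zero_notin by auto
 have "(a \<bullet> b)\<^sup>2 \<noteq> (a \<bullet> a) * (b \<bullet> b)"
 proof
  assume "(a \<bullet> b)\<^sup>2 = (a \<bullet> a) * (b \<bullet> b)"
  then have "(a \<bullet> b)\<^sup>2 = (norm a * norm b)\<^sup>2" by (simp only: power_mult_distrib power2_norm_eq_inner)
  then have "a \<bullet> b = norm a * norm b \<or> a \<bullet> b = - (norm a * norm b)" by (simp only: power2_eq_iff)
  moreover have "0 \<le> norm a * norm b" by simp
  ultimately have "\<bar>a \<bullet> b\<bar> = norm a * norm b" by linarith
  then have "norm a *\<^sub>R b = norm b *\<^sub>R a \<or> norm a *\<^sub>R b = - norm b *\<^sub>R a"
   using norm_cauchy_schwarz_abs_eq[of a b] by simp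
  then have "b = (norm b / norm a) *\<^sub>R a \<or> b = (- norm b / norm a) *\<^sub>R a"
  proof
   assume "norm a *\<^sub>R b = norm b *\<^sub>R a"
   then have "(1 / norm a) *\<^sub>R norm a *\<^sub>R b = (1 / norm a) *\<^sub>R norm b *\<^sub>R a" by simp
   then show ?thesis using nz by simp
  next
   assume "norm a *\<^sub>R b = - norm b *\<^sub>R a"
   then have "(1 / norm a) *\<^sub>R norm a *\<^sub>R b = (1 / norm a) *\<^sub>R - norm b *\<^sub>R a" by simp
   then show ?thesis using nz by simp
  qed
  then obtain c where "b = c *\<^sub>R a" by blast
  then have "c = 1 \<or> c = -1" using red[OF assms(1), of c] assms(2) by simp
  then show False using \<open>b = c *\<^sub>R a\<close> assms(3,4) by auto
 qed
 moreover have "(a \<bullet> b)\<^sup>2 \<le> (a \<bullet> a) * (b \<bullet> b)" by (rule Cauchy_Schwarz_ineq)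
 ultimately have "(a \<bullet> b)\<^sup>2 < (a \<bullet> a) * (b \<bullet> b)" by simp
 moreover have "cartan a b * cartan b a = 4 * (a \<bullet> b)\<^sup>2 / ((a \<bullet> a) * (b \<bullet> b))"
  by (simp add: cartan_def inner_commute power2_eq_square)
 ultimately show ?thesis using nz by (simp add: divide_less_eq)
qed

text \<open>Two positive integers with product below four include a one, and a reflection with
  Cartan number one subtracts exactly one root from the other.\<close>

lemma diff_root:
 assumes "a \<in> R" "b \<in> R" "a \<noteq> b" "0 < a \<bullet> b" shows "a - b \<in> R"
proof -
 have "a \<noteq> - b"
 proof
  assume "a = - b"
  then have "a \<bullet> b = - (b \<bullet> b)" by simp
  then show False using assms(4) inner_ge_zero[of b] by linarith
 qed
 then have lt: "cartan a b * cartan b a < 4" using cartan_prod_lt_4 assms by blast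
 have "a \<noteq> 0" "b \<noteq> 0" using assms(1,2) zero_notin by blast+
 then have p: "0 < cartan a b" "0 < cartan b a" using assms(4) by (simp_all add: cartan_def inner_commute)
 obtain i j where ij: "cartan a b = of_int i" "cartan b a = of_int j"
  using cartan_int[OF assms(1,2)] cartan_int[OF assms(2,1)] by (auto elim!: Ints_cases)
 have "i * j < 4" using lt unfolding ij by (metis of_int_less_numeral_iff of_int_mult)
 moreover have "0 < i" "0 < j" using p ij by simp_all
 ultimately have "i = 1 \<or> j = 1" using mult_mono[of 2 i 2 j] by linarith
 then show ?thesis
 proof
  assume "i = 1"
  then have "root_refl b a = a - b" using ij by (simp add: root_refl_cartan)
  then show ?thesis using refl_closed[OF assms(2,1)] by simp
 next
  assume "j = 1"
  then have "root_refl a b = b - a" using ij by (simp add: root_refl_cartan)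
  then have "b - a \<in> R" using refl_closed[OF assms(1,2)] by simp
  then show ?thesis using neg_R[of "b - a"] by simp
 qed
qed

end

section \<open>Irreducible systems and the highest root\<close>

locale irreducible_roots = based_roots +
 assumes irr: "irreducible_rs R" and nonempty: "R \<noteq> {}"
begin

text \<open>If the two parts were orthogonal, every simple reflection would map each of their spans
  to itself. All roots are images of simple ones, so \<open>R\<close> would split into two nonempty
  orthogonal sets.\<close>

lemma B_connected:
 assumes "B = B1 \<union> B2" "B1 \<inter> B2 = {}" "B1 \<noteq> {}" "B2 \<noteq> {}"
 shows "\<exists>b\<in>B1. \<exists>c\<in>B2. b \<bullet> c \<noteq> 0"
proof (rule ccontr)
 assume "\<not> ?thesis"
 then have orth: "b \<bullet> c = 0" if "b \<in> B1" "c \<in> B2" for b c using that by blast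
 have B12: "B1 \<subseteq> B" "B2 \<subseteq> B" using assms(1) by simp_all
 have sp: "x \<bullet> y = 0" if "x \<in> span B1" "y \<in> span B2" for x y
 proof -
  have "x \<bullet> c = 0" if "c \<in> B2" "x \<in> span B1" for x c
   using that(2) by (induction rule: span_induct_alt) (simp_all add: inner_left_distrib orth that(1))
  note xc = this
  from that(2) show ?thesis
   by (induction rule: span_induct_alt) (simp_all add: inner_right_distrib xc[OF _ that(1)])
 qed
 have pr: "w x \<in> span B1 \<or> w x \<in> span B2" if "w \<in> W" "x \<in> span B1 \<or> x \<in> span B2" for w x
  using that
 proof (induction rule: gen_subgroup_induct)
  case (step c w)
  have *: "root_refl c y \<in> span B1 \<or> root_refl c y \<in> span B2" if y: "y \<in> span B1 \<or> y \<in> span B2" for y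
  proof -
   have c: "c \<in> B1 \<or> c \<in> B2" using step(1) unfolding assms(1) Un_iff .
   have in1: "root_refl c y \<in> span X" if "c \<in> X" "y \<in> span X" for X
    unfolding root_refl_cartan using that by (intro span_diff span_mul) (auto intro: span_base)
   have "root_refl c y = y" if "c \<in> B1" "y \<in> span B2" using sp[OF span_base[OF that(1)] that(2)]
    by (simp add: root_refl_def inner_commute)
   moreover have "root_refl c y = y" if "c \<in> B2" "y \<in> span B1" using sp[OF that(2) span_base[OF that(1)]]
    by (simp add: root_refl_def inner_commute)
   ultimately show ?thesis using c y in1[of B1] in1[of B2] by (elim disjE) simp_all
  qed
  then show ?case using step(3)[OF step(4)] by simp
 qed simp
 let ?R1 = "R \<inter> span B1" and ?R2 = "R - span B1"
 have R2: "a \<in> span B2" if "a \<in> ?R2" for a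
 proof -
  have "a \<in> R" using that by (rule DiffD1)
  from W_root[OF this] obtain w b where wb: "w \<in> W" "b \<in> B" "a = w b" by (elim bexE)
  then have "b \<in> span B1 \<or> b \<in> span B2" unfolding assms(1) Un_iff by (auto intro: span_base)
  then have "a \<in> span B1 \<or> a \<in> span B2" unfolding wb(3) by (rule pr[OF wb(1)])
  then show ?thesis using that by simp
 qed
 obtain b0 where b0: "b0 \<in> B1" using assms(3) unfolding ex_in_conv[symmetric] by (elim exE)
 have "b0 \<in> ?R1" using b0 subsetD[OF B_sub subsetD[OF B12(1) b0]] span_base[OF b0] by simp
 then have R1ne: "?R1 \<noteq> {}" unfolding ex_in_conv[symmetric] by (rule exI)
 obtain c where c: "c \<in> B2" using assms(4) unfolding ex_in_conv[symmetric] by (elim exE)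
 have "c \<notin> span B1"
 proof
  assume "c \<in> span B1"
  then have "c \<bullet> c = 0" by (rule sp[OF _ span_base[OF c]])
  then have "c = 0" by simp
  then show False using subsetD[OF B_sub subsetD[OF B12(2) c]] zero_notin by simp
 qed
 then have "c \<in> ?R2" using subsetD[OF B_sub subsetD[OF B12(2) c]] by simp
 then have R2ne: "?R2 \<noteq> {}" unfolding ex_in_conv[symmetric] by (rule exI)
 have o: "\<forall>a\<in>?R1. \<forall>b\<in>?R2. a \<bullet> b = 0"
 proof (intro ballI)
  fix a b assume "a \<in> ?R1" "b \<in> ?R2"
  then show "a \<bullet> b = 0" by (intro sp R2) simp_all
 qed
 have u: "R = ?R1 \<union> ?R2" "?R1 \<inter> ?R2 = {}" by blast+
 have "\<exists>R1 R2. R1 \<noteq> {} \<and> R2 \<noteq> {} \<and> R = R1 \<union> R2 \<and> R1 \<inter> R2 = {} \<and> (\<forall>a\<in>R1. \<forall>b\<in>R2. a \<bullet> b = 0)"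
  by (rule exI[of _ ?R1], rule exI[of _ ?R2]) (intro conjI R1ne R2ne u o)
 with irr[unfolded irreducible_rs_def] show False by (rule notE)
qed

text \<open>Otherwise connectedness gives a simple root \<open>d\<close> outside the support of
  \<open>x\<close> and not orthogonal to some member of it. As different simple roots do not form
  acute angles, this makes \<open>x \<bullet> d\<close> negative.\<close>

lemma dominant_full:
 assumes x: "dominant x" "x \<in> span B" "x \<noteq> 0" and b: "b \<in> B"
 shows "0 < representation B x b"
proof (rule ccontr)
 assume n: "\<not> ?thesis"
 have nn: "0 \<le> representation B x c" if "c \<in> B" for c by (rule dominant_rep_nonneg[OF x(1,2) that])
 let ?B1 = "{c \<in> B. representation B x c \<noteq> 0}" and ?B2 = "{c \<in> B. representation B x c = 0}"
 have "?B1 \<noteq> {}" using rep_zero_imp[OF x(2)] x(3) by blast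
 moreover have "?B2 \<noteq> {}" using n nn[OF b] b by force
 moreover have "B = ?B1 \<union> ?B2" "?B1 \<inter> ?B2 = {}" by blast+
 ultimately have "\<exists>c\<in>?B1. \<exists>d\<in>?B2. c \<bullet> d \<noteq> 0" using B_connected[of ?B1 ?B2] by simp
 then obtain c d where cd: "c \<in> ?B1" "d \<in> ?B2" "c \<bullet> d \<noteq> 0" by (elim bexE)
 have "x \<bullet> d = (\<Sum>e\<in>B. representation B x e * (e \<bullet> d))" by (rule expand_inner[OF x(2)])
 also have "\<dots> = - (\<Sum>e\<in>B. - (representation B x e * (e \<bullet> d)))" by (simp add: sum_negf)
 also have "\<dots> < 0"
 proof (rule neg_less_0_iff_less[THEN iffD2], rule sum_pos2)
  show "finite B" "c \<in> B" using finite_B cd by auto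
  have "c \<in> B" "d \<in> B" "c \<noteq> d" using cd(1,2) by auto
  from simple_obtuse[OF this] nn[OF this(1)] cd have "representation B x c * (c \<bullet> d) < 0" by (intro mult_pos_neg) simp_all
  then show "0 < - (representation B x c * (c \<bullet> d))" by simp
  have "representation B x e * (e \<bullet> d) \<le> 0" if "e \<in> B" for e
   using nn[OF that] simple_obtuse[OF that, of d] cd(2) by (cases "e = d") (simp_all add: mult_nonneg_nonpos)
  then show "0 \<le> - (representation B x e * (e \<bullet> d))" if "e \<in> B" for e using that by simp
 qed
 finally have "x \<bullet> d < 0" .
 moreover have "0 \<le> x \<bullet> d" using x(1) cd(2) by (simp add: dominant_def)
 ultimately show False by simp
qed

lemma dominant_inner:
 assumes "dominant x" "x \<in> span B" "x \<noteq> 0" "dominant y" "y \<in> span B" "y \<noteq> 0"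
 shows "0 < x \<bullet> y"
proof -
 have "\<exists>b\<in>B. b \<bullet> y \<noteq> 0"
 proof (rule ccontr)
  assume "\<not> ?thesis"
  then have "y \<bullet> y = 0" unfolding expand_inner[OF assms(5)] by simp
  with assms(6) show False by simp
 qed
 then obtain b where b: "b \<in> B" "b \<bullet> y \<noteq> 0" by blast
 have nn: "0 \<le> c \<bullet> y" if "c \<in> B" for c using assms(4) that by (simp add: dominant_def inner_commute)
 show ?thesis unfolding expand_inner[OF assms(2)]
 proof (rule sum_pos2[OF finite_B b(1)])
  show "0 < representation B x b * (b \<bullet> y)"
   using dominant_full[OF assms(1-3) b(1)] nn[OF b(1)] b(2) by (intro mult_pos_pos) simp_all
  show "0 \<le> representation B x c * (c \<bullet> y)" if "c \<in> B" for c
   using dominant_full[OF assms(1-3) that] nn[OF that] by simp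
 qed
qed

definition is_highest :: "'a \<Rightarrow> bool" where
 "is_highest t \<longleftrightarrow> t \<in> R \<and> (\<forall>a\<in>R. \<forall>b\<in>B. representation B a b \<le> representation B t b)"

lemma R_spanB: "a \<in> R \<Longrightarrow> a \<in> span B" using R_span by blast
lemma R_nz: "a \<in> R \<Longrightarrow> a \<noteq> 0" using zero_notin by blast

lemma max_ht_dominant:
 assumes m: "m \<in> X" "X \<subseteq> R" and up: "\<And>b. b \<in> B \<Longrightarrow> m \<bullet> b < 0 \<Longrightarrow> root_refl b m \<in> X"
  and mx: "\<And>c. c \<in> X \<Longrightarrow> ht c \<le> ht m"
 shows "dominant m"
proof -
 have "0 \<le> m \<bullet> b" if b: "b \<in> B" for b
 proof (rule ccontr)
  assume n: "\<not> 0 \<le> m \<bullet> b"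
  have "0 < b \<bullet> b" using b B_pos pos_nonzero by simp
  then have "cartan m b < 0" using n by (simp add: cartan_def divide_less_0_iff)
  then have "ht m < ht (root_refl b m)" by (simp add: root_refl_cartan ht_diff ht_scaleR ht_B b)
  then show False using mx[OF up[OF b]] n by simp
 qed
 then show ?thesis by (simp add: dominant_def)
qed

lemma finite_max: assumes "finite X" "X \<noteq> {}" obtains m where "m \<in> X" "\<And>c. c \<in> X \<Longrightarrow> ht c \<le> ht m"
proof -
 have "Max (ht ` X) \<in> ht ` X" using assms by (intro Max_in) auto
 then obtain m where "m \<in> X" "Max (ht ` X) = ht m" by blast
 then show ?thesis using that assms(1) by (metis Max_ge finite_imageI imageI)
qed

text \<open>Take \<open>t\<close> of greatest height among all roots and \<open>m\<close> of
  greatest height among the roots above a given one in every coefficient. Both are dominant, so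
  \<open>m \<bullet> t > 0\<close>; if they differ, \<open>m - t\<close> is a root, and by height it
  is \<open>t - m\<close> that is positive.\<close>

lemma highest_exists: "\<exists>t. is_highest t"
proof -
 obtain t where t: "t \<in> R" "\<And>c. c \<in> R \<Longrightarrow> ht c \<le> ht t" using finite_max[OF finite_R nonempty] by blast
 have dt: "dominant t" by (rule max_ht_dominant[OF t(1) subset_refl _ t(2)]) (use refl_closed B_sub t(1) in blast)+
 have "representation B a b \<le> representation B t b" if a: "a \<in> R" and b: "b \<in> B" for a b
 proof -
  let ?X = "{c \<in> R. \<forall>b\<in>B. representation B a b \<le> representation B c b}"
  have "finite ?X" "?X \<noteq> {}" using finite_R a by auto
  then obtain m where m: "m \<in> ?X" "\<And>c. c \<in> ?X \<Longrightarrow> ht c \<le> ht m" using finite_max by blast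
  have dm: "dominant m"
  proof (rule max_ht_dominant[OF m(1) _ _ m(2)])
   fix b assume b: "b \<in> B" "m \<bullet> b < 0"
   have "0 < b \<bullet> b" using b B_pos pos_nonzero by simp
   then have c: "cartan m b < 0" using b(2) by (simp add: cartan_def divide_less_0_iff)
   have "representation B (root_refl b m) d = representation B m d - cartan m b * representation B b d" for d
    unfolding root_refl_cartan using m(1) b R_spanB
    by (simp add: real_vector.representation_diff[OF indep] real_vector.representation_scale[OF indep] span_base span_mul)
   then have "representation B m d \<le> representation B (root_refl b m) d" if "d \<in> B" for d
    using c b that rep_B[OF b(1)] by simp
   moreover have "root_refl b m \<in> R" using m(1) b B_sub refl_closed by blast
   ultimately show "root_refl b m \<in> ?X" using m(1) by force
  qed auto
  show ?thesis
  proof (cases "m = t")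
   case False
   have mR: "m \<in> R" using m by blast
   have "0 < m \<bullet> t" by (intro dominant_inner dm dt R_spanB mR t(1) R_nz)
   then have r: "m - t \<in> R" using diff_root[OF mR t(1) False] by blast
   have "m - t \<notin> pos"
   proof
    assume "m - t \<in> pos"
    then have "0 < ht (m - t)" by (rule ht_pos)
    then show False using t(2)[OF mR] by (simp add: ht_diff)
   qed
   then have "t - m \<in> pos" using notin_pos[OF r] by simp
   then have "0 \<le> representation B (t - m) b" using b by (simp add: pos_def)
   then have "representation B m b \<le> representation B t b"
    using R_spanB mR t(1) by (simp add: real_vector.representation_diff[OF indep])
   then show ?thesis using m(1) b by force
  qed (use m b in blast)
 qed
 then show ?thesis using t(1) unfolding is_highest_def by blast
qed

lemma ht_mono: assumes "a \<in> span B" "c \<in> span B" "\<And>b. b \<in> B \<Longrightarrow> representation B a b \<le> representation B c b"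
 shows "ht a \<le> ht c"
 unfolding ht_rep[OF assms(1)] ht_rep[OF assms(2)] by (rule sum_mono) (rule assms(3))

context fixes t assumes t: "is_highest t" begin

lemma highest_R: "t \<in> R" using t by (simp add: is_highest_def)

lemma highest_ht: "a \<in> R \<Longrightarrow> ht a \<le> ht t"
 by (rule ht_mono) (use t R_spanB in \<open>auto simp: is_highest_def\<close>)

lemma highest_dominant: "dominant t"
 by (rule max_ht_dominant[OF highest_R subset_refl _ highest_ht]) (use refl_closed B_sub highest_R in blast)+

lemma highest_pos: "t \<in> pos"
 using dominant_full[OF highest_dominant R_spanB[OF highest_R] R_nz[OF highest_R]] highest_R
 by (simp add: pos_def less_imp_le)

text \<open>For a Cartan number \<open>k \<ge> 2\<close> the root \<open>k t - a\<close> would have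
  to stay below \<open>t\<close> in every coefficient, which together with \<open>a\<close> below
  \<open>t\<close> is possible only for \<open>a = t\<close>.\<close>

lemma highest_cartan:
 assumes a: "a \<in> pos" "a \<noteq> t" shows "cartan a t = 0 \<or> cartan a t = 1"
proof -
 have aR: "a \<in> R" by (rule pos_R[OF a(1)])
 have nn: "0 \<le> cartan a t"
  using dominant_pos[OF highest_dominant a(1)] by (simp add: cartan_def inner_commute)
 obtain k where k: "cartan a t = of_int k" using cartan_int[OF aR highest_R] by (auto elim: Ints_cases)
 have "\<not> 2 \<le> k"
 proof
  assume k2: "2 \<le> k"
  have "- root_refl t a \<in> R" using refl_closed[OF highest_R aR] neg_R by blast
  then have r: "of_int k *\<^sub>R t - a \<in> R" using k by (simp add: root_refl_cartan)
  have eq: "representation B a b = representation B t b" if b: "b \<in> B" for b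
  proof -
   have "representation B (of_int k *\<^sub>R t - a) b = of_int k * representation B t b - representation B a b"
    using R_spanB[OF aR] R_spanB[OF highest_R]
    by (simp add: real_vector.representation_diff[OF indep] real_vector.representation_scale[OF indep] span_mul)
   moreover have "representation B (of_int k *\<^sub>R t - a) b \<le> representation B t b" using t r b by (auto simp: is_highest_def)
   moreover have "0 < representation B t b"
    by (rule dominant_full[OF highest_dominant R_spanB[OF highest_R] R_nz[OF highest_R] b])
   moreover from this have "2 * representation B t b \<le> of_int k * representation B t b" using k2
    by (intro mult_right_mono) simp_all
   moreover have "representation B a b \<le> representation B t b" using t aR b by (auto simp: is_highest_def)
   ultimately show ?thesis by linarith
  qed
  have "(\<Sum>b\<in>B. representation B a b *\<^sub>R b) = (\<Sum>b\<in>B. representation B t b *\<^sub>R b)" using eq by simp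
  then show False using a(2) unfolding expand[OF R_spanB[OF aR]] expand[OF R_spanB[OF highest_R]] by simp
 qed
 then show ?thesis using k nn by (cases "k = 0"; cases "k = 1") auto
qed

text \<open>\<open>highest_cartan\<close> gives \<open>cartan f t = 1\<close>, so
  \<open>cartan t f\<close> is the ratio of square lengths. Ratio one would make
  \<open>t - f\<close> a positive root with negative inner product against the dominant
  \<open>f\<close>; four or more contradicts \<open>cartan_prod_lt_4\<close>.\<close>

lemma highest_longest:
 assumes f: "f \<in> R" "dominant f" "f \<noteq> t"
 shows "cartan t f = 2 \<or> cartan t f = 3" "(t \<bullet> t) = cartan t f * (f \<bullet> f)"
proof -
 have fp: "f \<in> pos" using dominant_full[OF f(2) R_spanB[OF f(1)] R_nz[OF f(1)]] f(1) by (simp add: pos_def less_imp_le)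
 have ip: "0 < f \<bullet> t" by (intro dominant_inner f highest_dominant R_spanB highest_R R_nz)
 have c1: "cartan f t = 1" using highest_cartan[OF fp f(3)] ip R_nz[OF highest_R] by (auto simp: cartan_def)
 then show eq: "(t \<bullet> t) = cartan t f * (f \<bullet> f)"
  using cartan_comm_div[OF R_nz[OF highest_R] R_nz[OF f(1)]] by simp
 have "f \<noteq> - t"
 proof
  assume "f = - t"
  then have "f \<bullet> t = - (t \<bullet> t)" by simp
  then show False using ip inner_ge_zero[of t] by linarith
 qed
 then have lt: "cartan t f < 4" using cartan_prod_lt_4[OF f(1) highest_R f(3)] c1 by simp
 have p: "0 < cartan t f" using ip R_nz[OF f(1)] by (simp add: cartan_def inner_commute)
 have "cartan t f \<noteq> 1"
 proof
  assume c: "cartan t f = 1"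
  have "t - f \<in> pos"
  proof -
   have r: "t - f \<in> R" using diff_root[OF highest_R f(1)] f(3) ip by (simp add: inner_commute)
   have "f - t \<notin> pos"
   proof
    assume "f - t \<in> pos"
    then have "0 < ht (f - t)" by (rule ht_pos)
    then show False using highest_ht[OF f(1)] by (simp add: ht_diff)
   qed
   then show ?thesis using pos_or_neg[OF r] by auto
  qed
  then have "0 \<le> f \<bullet> (t - f)" by (rule dominant_pos[OF f(2)])
  moreover have "f \<bullet> t = (f \<bullet> f) / 2" using c R_nz[OF f(1)] by (simp add: cartan_def field_simps inner_commute)
  moreover have "0 < f \<bullet> f" using R_nz[OF f(1)] by simp
  ultimately show False by (simp add: inner_diff_right)
 qed
 then show "cartan t f = 2 \<or> cartan t f = 3"
  using lt p cartan_int[OF highest_R f(1)] by (auto elim!: Ints_cases)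
qed

end

lemma dual_irreducible: "irreducible_roots (coroot ` R) (coroot ` B)"
proof (rule irreducible_roots.intro[OF dual], unfold_locales)
 show "coroot ` R \<noteq> {}" using nonempty by blast
 show "irreducible_rs (coroot ` R)"
  unfolding irreducible_rs_def
 proof (rule notI, elim exE conjE)
  fix R1 R2 assume r: "R1 \<noteq> {}" "R2 \<noteq> {}" "coroot ` R = R1 \<union> R2" "R1 \<inter> R2 = {}" "\<forall>a\<in>R1. \<forall>b\<in>R2. a \<bullet> b = 0"
  let ?R1 = "coroot ` R1" and ?R2 = "coroot ` R2"
  have "R = coroot ` coroot ` R" by (simp add: image_image)
  then have 1: "R = ?R1 \<union> ?R2" unfolding r(3) image_Un .
  have 2: "?R1 \<inter> ?R2 = {}" unfolding image_Int[OF inj_coroot, symmetric] r(4) by simp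
  have 3: "\<forall>a\<in>?R1. \<forall>b\<in>?R2. a \<bullet> b = 0"
  proof (intro ballI)
   fix a b assume "a \<in> ?R1" "b \<in> ?R2"
   then obtain c d where "c \<in> R1" "d \<in> R2" "a = coroot c" "b = coroot d" by blast
   then show "a \<bullet> b = 0" using r(5) by (simp add: coroot_def)
  qed
  have 4: "?R1 \<noteq> {}" "?R2 \<noteq> {}" using r(1,2) by simp_all
  have "\<exists>R1 R2. R1 \<noteq> {} \<and> R2 \<noteq> {} \<and> R = R1 \<union> R2 \<and> R1 \<inter> R2 = {} \<and> (\<forall>a\<in>R1. \<forall>b\<in>R2. a \<bullet> b = 0)"
   by (rule exI[of _ ?R1], rule exI[of _ ?R2]) (intro conjI 1 2 3 4)
  with irr[unfolded irreducible_rs_def] show False by (rule notE)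
 qed
qed

lemma dual_dominant: "based_roots.dominant (coroot ` B) (coroot f) \<longleftrightarrow> dominant f"
 and dual_dominant': "based_roots.dominant (coroot ` B) f \<longleftrightarrow> dominant f"
proof -
 interpret D: based_roots "coroot ` R" "coroot ` B" by (rule dual)
 have "0 \<le> coroot f \<bullet> coroot b \<longleftrightarrow> 0 \<le> f \<bullet> b" and "0 \<le> f \<bullet> coroot b \<longleftrightarrow> 0 \<le> f \<bullet> b" if "b \<in> B" for b
 proof -
  have b: "0 < 2 / (b \<bullet> b)" using that B_pos pos_nonzero by simp
  have *: "0 \<le> c * y \<longleftrightarrow> 0 \<le> y" if "0 < c" for c y :: real using that by (simp add: zero_le_mult_iff)
  show 1: "0 \<le> f \<bullet> coroot b \<longleftrightarrow> 0 \<le> f \<bullet> b" unfolding coroot_def inner_scaleR_right by (rule *[OF b])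
  show "0 \<le> coroot f \<bullet> coroot b \<longleftrightarrow> 0 \<le> f \<bullet> b"
  proof (cases "f = 0")
   case False
   then have "0 < 2 / (f \<bullet> f)" by simp
   then show ?thesis unfolding coroot_def[of f] inner_scaleR_left using * 1 by blast
  qed (simp add: coroot_def)
 qed
 then show "D.dominant (coroot f) \<longleftrightarrow> dominant f" "D.dominant f \<longleftrightarrow> dominant f"
  unfolding D.dominant_def dominant_def by simp_all
qed

text \<open>At most two root lengths occur, so a dominant root is either the highest root or its coroot is the highest
 coroot.\<close>

lemma dominant_root_cases:
 assumes t: "is_highest t" and s: "irreducible_roots.is_highest (coroot ` R) (coroot ` B) (coroot s)" "s \<in> R"
  and f: "f \<in> R" "dominant f"
 shows "f = t \<or> f = s"
proof (rule ccontr)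
 assume n: "\<not> ?thesis"
 interpret D: irreducible_roots "coroot ` R" "coroot ` B" by (rule dual_irreducible)
 have ds: "dominant s" using D.highest_dominant[OF s(1)] dual_dominant by simp
 have Df: "coroot f \<in> coroot ` R" "D.dominant (coroot f)" "coroot f \<noteq> coroot s"
  using f n dual_dominant by (auto dest: inj_onD[OF inj_coroot[of UNIV]])
 have 1: "cartan t f = 2 \<or> cartan t f = 3" "t \<bullet> t = cartan t f * (f \<bullet> f)" using highest_longest[OF t f] n by auto
 have 2: "cartan f s = 2 \<or> cartan f s = 3" "coroot s \<bullet> coroot s = cartan f s * (coroot f \<bullet> coroot f)"
  using D.highest_longest[OF s(1) Df] by (simp_all add: cartan_coroot)
 have pf: "0 < f \<bullet> f" and ps: "0 < s \<bullet> s" using R_nz f s(2) by auto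
 have 3: "f \<bullet> f = cartan f s * (s \<bullet> s)" using 2(2) pf ps unfolding coroot_norm by (simp add: field_simps)
 have ts: "t \<bullet> t = cartan t f * cartan f s * (s \<bullet> s)" using 1(2) 3 by simp
 have "s \<noteq> t"
 proof
  assume "s = t"
  then have "cartan t f * cartan f s = 1" using ts ps by simp
  then show False using 1(1) 2(1) by auto
 qed
 from highest_longest[OF t s(2) ds this] have 4: "cartan t s = 2 \<or> cartan t s = 3" "t \<bullet> t = cartan t s * (s \<bullet> s)" by auto
 \<comment> \<open>Ratios of square lengths multiply from \<open>s\<close> over \<open>f\<close> to
   \<open>t\<close>, but a product of two numbers from 2 and 3 is not again 2 or 3.\<close>
 have "cartan t s = cartan t f * cartan f s" using 4(2) ts ps by simp
 then show False using 1(1) 2(1) 4(1) by auto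
qed

end

section \<open>Multiplicities at roots of unity\<close>

definition one_minus :: "nat \<Rightarrow> complex poly" where "one_minus m = 1 - monom 1 m"

lemma poly_one_minus [simp]: "poly (one_minus m) z = 1 - z ^ m"
 by (simp add: one_minus_def poly_monom)

lemma one_minus_nz: "0 < m \<Longrightarrow> one_minus m \<noteq> 0"
proof
 assume "0 < m" "one_minus m = 0"
 then have "poly (one_minus m) 0 = 0" by simp
 then show False using \<open>0 < m\<close> by (simp add: power_0_left)
qed

lemma order_one_minus: assumes "0 < m" shows "order z (one_minus m) = (if z ^ m = 1 then 1 else 0)"
proof (cases "z ^ m = 1")
 case True
 have d: "pderiv (one_minus m) = - monom (of_nat m) (m - 1)"
  by (simp add: one_minus_def pderiv_diff pderiv_monom)
 have z: "z \<noteq> 0" using True assms by (auto simp: power_0_left)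
 then have n: "poly (pderiv (one_minus m)) z \<noteq> 0" unfolding d using assms by (simp add: poly_monom)
 then have nz: "pderiv (one_minus m) \<noteq> 0" by auto
 have "order z (one_minus m) \<noteq> 0" using order_root[of "one_minus m" z] one_minus_nz[OF assms] True by simp
 from order_pderiv[OF one_minus_nz[OF assms], of z] show ?thesis using order_0I[OF n] True by simp
qed (auto intro: order_0I)

lemma order_prod_one_minus:
 assumes "finite A" "\<And>a. a \<in> A \<Longrightarrow> 0 < e a"
 shows "(\<Prod>a\<in>A. one_minus (e a)) \<noteq> 0" "order z (\<Prod>a\<in>A. one_minus (e a)) = card {a \<in> A. z ^ e a = 1}"
proof -
 show nz: "(\<Prod>a\<in>A. one_minus (e a)) \<noteq> 0" using assms one_minus_nz by (simp add: prod_zero_iff)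
 have "order z (\<Prod>a\<in>A. one_minus (e a)) = (\<Sum>a\<in>A. order z (one_minus (e a)))"
  using assms
 proof (induction A rule: finite_induct)
  case (insert a A)
  have "one_minus (e a) * (\<Prod>a\<in>A. one_minus (e a)) \<noteq> 0"
   using insert one_minus_nz by (simp add: prod_zero_iff)
  then have "order z (one_minus (e a) * (\<Prod>a\<in>A. one_minus (e a)))
   = order z (one_minus (e a)) + order z (\<Prod>a\<in>A. one_minus (e a))" by (rule order_mult)
  then show ?case using insert by simp
 qed simp
 also have "\<dots> = (\<Sum>a\<in>A. if z ^ e a = 1 then 1 else 0)" by (rule sum.cong) (simp_all add: order_one_minus assms)
 also have "\<dots> = card {a \<in> A. z ^ e a = 1}" using assms(1) by (simp add: sum.If_cases Int_def)
 finally show "order z (\<Prod>a\<in>A. one_minus (e a)) = card {a \<in> A. z ^ e a = 1}" .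
qed

lemma poly_eq_unit_interval:
 fixes p q :: "complex poly"
 assumes "\<And>u::real. 0 < u \<Longrightarrow> u < 1 \<Longrightarrow> poly p (of_real u) = poly q (of_real u)"
 shows "p = q"
proof (rule ccontr)
 assume "p \<noteq> q"
 then have "finite {x. poly (p - q) x = 0}" by (intro poly_roots_finite) simp
 moreover have "complex_of_real ` {0<..<1} \<subseteq> {x. poly (p - q) x = 0}" using assms by auto
 ultimately have "finite (complex_of_real ` {0<..<1::real})" using finite_subset by blast
 then have "finite {0<..<1::real}" by (rule finite_imageD) (simp add: inj_on_def)
 then show False using infinite_Ioo[of 0 "1::real"] by simp
qed

text \<open>Agreement on the unit interval is a polynomial identity. The multiplicity of
  \<open>z\<close> on the right exceeds that of the product on the left, and the sum must supply the
  difference.\<close>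

lemma vanish_at:
 fixes D :: "'i \<Rightarrow> nat"
 assumes A: "finite A" "\<And>a. a \<in> A \<Longrightarrow> 0 < e a" "\<And>a. a \<in> A \<Longrightarrow> 0 < f a" and I: "finite I"
  and eq: "\<And>u::real. 0 < u \<Longrightarrow> u < 1 \<Longrightarrow> (\<Sum>i\<in>I. u ^ D i) * (\<Prod>a\<in>A. 1 - u ^ e a) = (\<Prod>a\<in>A. 1 - u ^ f a)"
  and lt: "card {a \<in> A. z ^ e a = 1} < card {a \<in> A. z ^ f a = 1}"
 shows "(\<Sum>i\<in>I. z ^ D i) = (0::complex)"
proof -
 let ?P = "\<Sum>i\<in>I. monom 1 (D i) :: complex poly"
 let ?E = "\<Prod>a\<in>A. one_minus (e a)" and ?F = "\<Prod>a\<in>A. one_minus (f a)"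
 have PEF: "?P * ?E = ?F"
 proof (rule poly_eq_unit_interval)
  fix u :: real assume u: "0 < u" "u < 1"
  have "complex_of_real ((\<Sum>i\<in>I. u ^ D i) * (\<Prod>a\<in>A. 1 - u ^ e a)) = complex_of_real (\<Prod>a\<in>A. 1 - u ^ f a)"
   using eq[OF u] by (simp only:)
  then show "poly (?P * ?E) (of_real u) = poly ?F (of_real u)"
   by (simp add: poly_sum poly_prod poly_monom)
 qed
 have nz: "?P * ?E \<noteq> 0" unfolding PEF by (rule order_prod_one_minus(1)[OF A(1,3)])
 have "order z ?P + order z ?E = order z ?F" unfolding PEF[symmetric] by (rule order_mult[OF nz, symmetric])
 then have "order z ?P \<noteq> 0"
  using lt order_prod_one_minus(2)[of A e z] order_prod_one_minus(2)[of A f z] A by simp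
 then have "poly ?P z = 0" using order_root by blast
 then show ?thesis by (simp add: poly_sum poly_monom)
qed

text \<open>Both numbers are the multiplicity of a primitive \<open>d\<close>-th root of unity in
  the same polynomial.\<close>

lemma count_dvd:
 assumes A: "finite A" "\<And>a. a \<in> A \<Longrightarrow> 0 < e a" and B: "finite B" "\<And>b. b \<in> B \<Longrightarrow> 0 < f b"
  and eq: "\<And>u::real. 0 < u \<Longrightarrow> u < 1 \<Longrightarrow> (\<Prod>a\<in>A. 1 - u ^ e a) = (\<Prod>b\<in>B. 1 - u ^ f b)"
  and d: "1 \<le> d"
 shows "card {a \<in> A. d dvd e a} = card {b \<in> B. d dvd f b}"
proof -
 let ?z = "exp (2 * of_real pi * \<i> / of_nat d) :: complex"
 have z: "?z ^ m = 1 \<longleftrightarrow> d dvd m" for m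
 proof -
  have "?z ^ m = exp (of_nat m * (2 * of_real pi * \<i> / of_nat d))" by (rule exp_of_nat_mult[symmetric])
  also have "of_nat m * (2 * of_real pi * \<i> / of_nat d) = 2 * of_real pi * \<i> * of_nat m / of_nat d" by simp
  finally show ?thesis using complex_root_unity_eq_1[OF d, of m] by simp
 qed
 have "(\<Prod>a\<in>A. one_minus (e a)) = (\<Prod>b\<in>B. one_minus (f b))"
 proof (rule poly_eq_unit_interval)
  fix u :: real assume u: "0 < u" "u < 1"
  have "complex_of_real (\<Prod>a\<in>A. 1 - u ^ e a) = complex_of_real (\<Prod>b\<in>B. 1 - u ^ f b)"
   using eq[OF u] by (simp only:)
  then show "poly (\<Prod>a\<in>A. one_minus (e a)) (of_real u) = poly (\<Prod>b\<in>B. one_minus (f b)) (of_real u)"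
   by (simp add: poly_prod)
 qed
 then show ?thesis using order_prod_one_minus(2)[where A = A and e = e and z = ?z] order_prod_one_minus(2)[where A = B and e = f and z = ?z] A B
  unfolding z by simp
qed

text \<open>\<open>(x - 1) Q\<close> vanishes at every \<open>g\<close>-th root of unity and has
  degree at most \<open>g\<close>, hence is a multiple of \<open>x^g - 1\<close>; comparing
  coefficients shows that those of \<open>Q\<close> do not change.\<close>

lemma poly_const_coeffs:
 fixes Q :: "complex poly"
 assumes g: "0 < g" and deg: "degree Q < g" and z: "\<And>z. z ^ g = 1 \<Longrightarrow> z \<noteq> 1 \<Longrightarrow> poly Q z = 0"
  and m: "m < g"
 shows "poly.coeff Q m = poly.coeff Q 0"
proof -
 let ?c = "poly.coeff Q (g - 1)"
 \<comment> \<open>Subtracting this multiple of \<open>x^g - 1\<close> cancels the term of degree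
   \<open>g\<close>, so the degree drops below the number of roots of unity.\<close>
 let ?S = "[:-1, 1:] * Q - smult ?c (monom 1 g - 1)"
 have cS: "poly.coeff ?S n = (if n = 0 then 0 else poly.coeff Q (n - 1)) - poly.coeff Q n - ?c * ((if n = g then 1 else 0) - (if n = 0 then 1 else 0))" for n
  by (cases n) (simp_all add: coeff_monom coeff_1 algebra_simps)
 have hi: "poly.coeff Q n = 0" if "g \<le> n" for n using that deg by (intro coeff_eq_0) simp
 have "?S = 0"
 proof (rule poly_eqI_degree)
  let ?A = "{z::complex. z ^ g = 1}"
  have "degree ?S \<le> g - 1"
  proof (rule degree_le, intro allI impI)
   fix n assume "g - 1 < n"
   then show "poly.coeff ?S n = 0" unfolding cS using g hi[of n] hi[of "n - 1"] by (cases "n = g") auto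
  qed
  then show "degree ?S < card ?A" using card_roots_unity_eq[OF g] g by simp
  show "degree (0::complex poly) < card ?A" using card_roots_unity_eq[OF g] g by simp
  fix x assume x: "x \<in> ?A"
  show "poly ?S x = poly 0 x"
  proof (cases "x = 1")
   case False
   then show ?thesis using x z[of x] by (simp add: poly_monom)
  qed (simp add: poly_monom)
 qed
 then have S0: "poly.coeff ?S n = 0" for n by simp
 have "poly.coeff Q m = poly.coeff Q 0" if "m < g" for m
  using that
 proof (induction m)
  case (Suc m)
  then show ?case using S0[of "Suc m", unfolded cS] by simp
 qed simp
 then show ?thesis using m by blast
qed

section \<open>Integral heights and vanishing orbit sums\<close>

context based_roots
begin

definition nht :: "'a \<Rightarrow> nat" where "nht a = nat \<lfloor>ht a\<rfloor>"

lemma nht: "a \<in> pos \<Longrightarrow> real (nht a) = ht a" and nht_ge_1: "a \<in> pos \<Longrightarrow> 1 \<le> nht a"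
proof -
 assume a: "a \<in> pos"
 have "ht a \<in> \<int>" "1 \<le> ht a" using ht_lat[OF R_lat[OF pos_R[OF a]]] ht_ge_1[OF a] by auto
 then show "real (nht a) = ht a" "1 \<le> nht a" unfolding nht_def by (auto elim!: Ints_cases)
qed

lemma W_coroot_pos: assumes "w \<in> W" "a \<in> R"
 shows "w (coroot a) \<in> coroot ` pos \<longleftrightarrow> w a \<in> pos"
 unfolding W_coroot[OF assms(1), symmetric] by (rule inj_image_mem_iff[OF inj_coroot])

lemma dual_Inv: assumes w: "w \<in> W" shows "based_roots.Inv (coroot ` R) (coroot ` B) w = coroot ` Inv w"
proof -
 interpret D: based_roots "coroot ` R" "coroot ` B" by (rule dual)
 show ?thesis
 proof (intro set_eqI iffI)
  fix c assume "c \<in> D.Inv w"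
  then obtain a where a: "a \<in> pos" "c = coroot a" "w (coroot a) \<notin> coroot ` pos" unfolding D.Inv_def dual_pos by blast
  then have "a \<in> Inv w" using W_coroot_pos[OF w pos_R] by (simp add: Inv_def)
  then show "c \<in> coroot ` Inv w" using a by blast
 next
  fix c assume "c \<in> coroot ` Inv w"
  then obtain a where a: "a \<in> pos" "c = coroot a" "w a \<notin> pos" unfolding Inv_def by blast
  then show "c \<in> D.Inv w" using W_coroot_pos[OF w pos_R[OF a(1)]] unfolding D.Inv_def dual_pos by blast
 qed
qed

text \<open>\<open>macdonald_product\<close> with constant weight \<open>u\<close>, at a point where
  a positive root of height \<open>m\<close> satisfies
  \<open>exp (- (a \<bullet> z)) = u ^ m\<close>.\<close>

theorem poinW_product:
 assumes u: "0 < u" "u < 1"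
 shows "poinW u = (\<Prod>a\<in>pos. 1 - u ^ (nht a + 1)) / (\<Prod>a\<in>pos. 1 - u ^ nht a)"
proof -
 obtain z where z: "\<forall>b\<in>B. b \<bullet> z = - ln u" using dual_functional[of "\<lambda>_. - ln u"] by (elim exE)
 have az: "a \<bullet> z = - (real (nht a) * ln u)" if a: "a \<in> pos" for a
  using inner_ht[of a z "- ln u"] z pos_R[OF a] R_span nht[OF a] by auto
 have ez: "exp (- (a \<bullet> z)) = u ^ nht a" if "a \<in> pos" for a using u by (simp add: az[OF that] exp_of_nat_mult)
 have "poinW u = (\<Sum>w\<in>W. \<Prod>a\<in>Inv w. u)" by (simp add: poinW_def)
 also have "\<dots> = (\<Prod>a\<in>pos. (1 - u * exp (- (a \<bullet> z))) / (1 - exp (- (a \<bullet> z))))"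
 proof (rule macdonald_product)
  show "a \<bullet> z \<noteq> 0" if "a \<in> pos" for a using nht_ge_1[OF that] u by (simp add: az[OF that])
  show "u * exp (b \<bullet> z) = 1" if "b \<in> B" for b using z that u by (simp add: exp_minus)
 qed simp
 also have "\<dots> = (\<Prod>a\<in>pos. (1 - u ^ (nht a + 1)) / (1 - u ^ nht a))" by (rule prod.cong) (simp_all add: ez)
 finally show ?thesis by (simp only: prod_dividef)
qed

end

context irreducible_roots
begin

text \<open>The weighted length generating function of the orbit of \<open>f\<close> is computed through the dual root system.\<close>

lemma orbit_sum_vanishes:
 fixes k e :: "'a \<Rightarrow> nat" and z :: complex
 assumes f: "f \<in> R" "dominant f"
  and k: "\<And>w a. w \<in> W \<Longrightarrow> a \<in> R \<Longrightarrow> k (w a) = k a" "k f = 1"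
  and H: "\<And>a. a \<in> pos \<Longrightarrow> a \<bullet> f \<noteq> 0 \<Longrightarrow> a \<noteq> f \<Longrightarrow> cartan f a = real (k a)"
  and y: "\<And>a. a \<in> pos \<Longrightarrow> coroot a \<bullet> y = real (e a)" "\<And>b. b \<in> B \<Longrightarrow> e b = k b" "\<And>a. a \<in> pos \<Longrightarrow> 0 < e a"
  and refl: "\<And>a. a \<in> pos \<Longrightarrow> a \<bullet> f \<noteq> 0 \<Longrightarrow> a \<noteq> f \<Longrightarrow> - root_refl f a \<in> pos \<and> e a + k a + e (- root_refl f a) = k a * g"
  and ef: "e f + 1 = g" and z: "z ^ g = 1" "z \<noteq> 1"
 shows "(\<Sum>a\<in>(\<lambda>w. w f) ` W \<inter> pos. z ^ (nht f - nht a) + z ^ (nht f + nht a - 1)) = 0"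
proof -
 let ?O = "(\<lambda>w. w f) ` W"
 let ?A = "{a \<in> pos. a \<bullet> f \<noteq> 0}"
 interpret D: based_roots "coroot ` R" "coroot ` B" by (rule dual)
 have DW: "D.W = W" and Dpos: "D.pos = coroot ` pos" by (rule dual_W, rule dual_pos)
 have fp: "f \<in> pos" using dominant_full[OF f(2) R_spanB[OF f(1)] R_nz[OF f(1)]] f(1) by (simp add: pos_def less_imp_le)
 note DI = dual_Inv
 have orth: "coroot a \<bullet> f = 0 \<longleftrightarrow> a \<bullet> f = 0" if "a \<in> pos" for a
  using pos_nonzero[OF that] by (simp add: coroot_def)
 have DM: "D.min_reps f = min_reps f"
 proof -
  have "(\<forall>c\<in>coroot ` pos. c \<bullet> f = 0 \<longrightarrow> w c \<in> coroot ` pos) \<longleftrightarrow> (\<forall>a\<in>pos. a \<bullet> f = 0 \<longrightarrow> w a \<in> pos)" if w: "w \<in> W" for w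
   unfolding ball_simps using orth W_coroot_pos[OF w pos_R] by blast
  then show ?thesis unfolding D.min_reps_def min_reps_def DW Dpos by blast
 qed
 have Ddom: "D.dominant f" using f(2) dual_dominant' by simp
 \<comment> \<open>Macdonald's product over coset representatives of the dual system, with weight
   \<open>u ^ k a\<close> at the coroot of \<open>a\<close>. The exponents \<open>e a\<close> come
   from the pairing with \<open>y\<close>; they agree with \<open>k\<close> on simple roots, as the
   specialisation of the product demands.\<close>
 have gen: "(\<Sum>a\<in>?O. u ^ (if a \<in> pos then nht f - nht a else nht f + nht (- a) - 1)) * (\<Prod>a\<in>?A. 1 - u ^ e a)
  = (\<Prod>a\<in>?A. 1 - u ^ (e a + k a))" if u: "0 < u" "u < 1" for u :: real
 proof -
  define zz where "zz = - ln u *\<^sub>R y"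
  define t where "t c = u ^ k (coroot c)" for c
  have ez: "exp (- (coroot a \<bullet> zz)) = u ^ e a" if "a \<in> pos" for a
  proof -
   have "- (coroot a \<bullet> zz) = ln u * real (e a)" unfolding zz_def using y(1)[OF that] by simp
   then show ?thesis using u by (simp add: exp_of_nat2_mult)
  qed
  have ue: "u ^ e a < 1" if "a \<in> pos" for a using y(3)[OF that] u by (simp add: power_less_one_iff)
  have "(\<Sum>w\<in>D.min_reps f. \<Prod>c\<in>D.Inv w. t c)
   = (\<Prod>c\<in>{c\<in>D.pos. c \<bullet> f \<noteq> 0}. (1 - t c * exp (- (c \<bullet> zz))) / (1 - exp (- (c \<bullet> zz))))"
  proof (rule D.min_reps_product[OF Ddom])
   fix c assume "c \<in> D.pos"
   then obtain a where a: "a \<in> pos" "c = coroot a" unfolding Dpos by blast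
   show "c \<bullet> zz \<noteq> 0"
   proof
    assume "c \<bullet> zz = 0"
    then have "u ^ e a = 1" using ez[OF a(1)] a(2) by simp
    then show False using ue[OF a(1)] by simp
   qed
  next
   fix w c assume w: "w \<in> D.W" "c \<in> coroot ` R"
   then obtain a where a: "a \<in> R" "c = coroot a" by blast
   show "t (w c) = t c" unfolding t_def a(2) using W_coroot[of w a] w(1) k(1)[of w a] a(1) by (simp add: DW flip: W_coroot)
  next
   fix c assume "c \<in> coroot ` B"
   then obtain b where b: "b \<in> B" "c = coroot b" by blast
   have "exp (c \<bullet> zz) * u ^ e b = 1" unfolding b(2) ez[OF B_pos[OF b(1)], symmetric] by (simp flip: exp_add)
   then show "t c * exp (c \<bullet> zz) = 1" unfolding t_def b(2) using y(2)[OF b(1)] by (simp add: mult.commute)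
  qed
  also have "{c\<in>D.pos. c \<bullet> f \<noteq> 0} = coroot ` ?A" unfolding Dpos using orth by blast
  also have "(\<Prod>c\<in>coroot ` ?A. (1 - t c * exp (- (c \<bullet> zz))) / (1 - exp (- (c \<bullet> zz))))
   = (\<Prod>a\<in>?A. (1 - u ^ (e a + k a)) / (1 - u ^ e a))"
   unfolding prod.reindex[OF inj_coroot] comp_def
   by (rule prod.cong) (simp_all add: ez t_def power_add mult.commute)
  also have "(\<Sum>w\<in>D.min_reps f. \<Prod>c\<in>D.Inv w. t c)
   = (\<Sum>w\<in>min_reps f. u ^ (if w f \<in> pos then nht f - nht (w f) else nht f + nht (- w f) - 1))"
   unfolding DM
  proof (rule sum.cong)
   fix w assume w: "w \<in> min_reps f"
   then have wW: "w \<in> W" by (rule min_reps_W)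
   have orthI: "a \<bullet> f \<noteq> 0" if "a \<in> Inv w" for a using w that by (auto simp: min_reps_def Inv_def)
   have "(\<Prod>c\<in>D.Inv w. t c) = (\<Prod>a\<in>Inv w. u ^ k a)"
    unfolding DI[OF wW] prod.reindex[OF inj_coroot] comp_def by (simp add: t_def)
   also have "\<dots> = u ^ (\<Sum>a\<in>Inv w. k a)" by (rule power_sum[symmetric])
   also have "(\<Sum>a\<in>Inv w. k a) = (if w f \<in> pos then nht f - nht (w f) else nht f + nht (- w f) - 1)"
   proof -
    \<comment> \<open>\<open>cartan f f\<close> is 2 while \<open>k f\<close> is 1; this excess
      causes the \<open>- 1\<close> in the exponent of the negative roots of the orbit.\<close>
    have c: "cartan f a = real (k a) + (if a = f then 1 else 0)" if a: "a \<in> Inv w" for a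
     using H[of a] orthI[OF a] a k(2) cartan_self[OF R_nz[OF f(1)]] by (auto simp: Inv_def)
    have "ht f - ht (w f) = (\<Sum>a\<in>Inv w. cartan f a)" using ht_W[OF wW, of f] by simp
    also have "\<dots> = (\<Sum>a\<in>Inv w. real (k a) + (if a = f then 1 else 0))" by (rule sum.cong) (simp_all add: c)
    also have "\<dots> = real (\<Sum>a\<in>Inv w. k a) + (if f \<in> Inv w then 1 else 0)" by (simp add: sum.distrib)
    finally have h: "ht f - ht (w f) = real (\<Sum>a\<in>Inv w. k a) + (if f \<in> Inv w then 1 else 0)" .
    have fI: "f \<in> Inv w \<longleftrightarrow> w f \<notin> pos" using fp by (simp add: Inv_def)
    show ?thesis
    proof (cases "w f \<in> pos")
     case True
     then have "real (\<Sum>a\<in>Inv w. k a) = real (nht f) - real (nht (w f))" using h fI nht[OF fp] nht[OF True] by simp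
     then have "(\<Sum>a\<in>Inv w. k a) + nht (w f) = nht f" by linarith
     then show ?thesis using True by simp
    next
     case False
     then have m: "- w f \<in> pos" using notin_pos W_R[OF wW f(1)] by blast
     have "real (\<Sum>a\<in>Inv w. k a) + 1 = real (nht f) + real (nht (- w f))"
      using False h fI nht[OF fp] nht[OF m] by (simp add: ht_minus)
     then have "(\<Sum>a\<in>Inv w. k a) + 1 = nht f + nht (- w f)" by linarith
     then show ?thesis using False by simp
    qed
   qed
   finally show "(\<Prod>c\<in>D.Inv w. t c) = u ^ (if w f \<in> pos then nht f - nht (w f) else nht f + nht (- w f) - 1)" .
  qed simp
  also have "\<dots> = (\<Sum>a\<in>?O. u ^ (if a \<in> pos then nht f - nht a else nht f + nht (- a) - 1))"
   by (rule sum.reindex_bij_betw[OF min_reps_bij[OF f(2)]])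
  finally have "(\<Sum>a\<in>?O. u ^ (if a \<in> pos then nht f - nht a else nht f + nht (- a) - 1))
   = (\<Prod>a\<in>?A. 1 - u ^ (e a + k a)) / (\<Prod>a\<in>?A. 1 - u ^ e a)" by (simp only: prod_dividef)
  moreover have "(\<Prod>a\<in>?A. 1 - u ^ e a) \<noteq> 0" using less_imp_neq[OF ue] by (auto simp: prod_zero_iff)
  ultimately show ?thesis by simp
 qed
 let ?A' = "?A - {f}"
 let ?s = "\<lambda>a. - root_refl f a"
 have fA: "f \<in> ?A" using fp R_nz[OF f(1)] by simp
 have sA: "?s a \<in> ?A'" if a: "a \<in> ?A'" for a
 proof -
  have "?s a \<in> pos" using refl[of a] a by auto
  moreover have "?s a \<bullet> f = a \<bullet> f" using root_refl_inner[of f a f] by simp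
  moreover have "?s a \<noteq> f"
  proof
   assume "?s a = f"
   then have "root_refl f a = - f" by (metis minus_minus)
   then have "a = root_refl f (- f)" by (metis root_refl_refl)
   then show False using a by (simp add: linear_neg[OF linear_root_refl])
  qed
  ultimately show ?thesis using a by simp
 qed
 have ss: "?s (?s a) = a" for a by (simp add: linear_neg[OF linear_root_refl])
 \<comment> \<open>On roots other than \<open>f\<close> the involution
   \<open>a \<mapsto> - root_refl f a\<close> exchanges \<open>z ^ e a = 1\<close> with
   \<open>z ^ (e a + k a) = 1\<close>, by the hypothesis \<open>refl\<close> and
   \<open>z ^ g = 1\<close>. Zeros of numerator and denominator thus cancel in pairs, and
   \<open>f\<close> alone contributes a surplus zero.\<close>
 have bij: "bij_betw ?s {a \<in> ?A'. z ^ e a = 1} {a \<in> ?A'. z ^ (e a + k a) = 1}"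
 proof (rule bij_betw_byWitness[where f' = ?s])
  have r: "z ^ (e a + k a) * z ^ e (?s a) = 1" if "a \<in> ?A'" for a
  proof -
   have "e a + k a + e (?s a) = k a * g" using refl[of a] that by auto
   then have "z ^ (e a + k a) * z ^ e (?s a) = z ^ (g * k a)" by (metis power_add mult.commute)
   then show ?thesis using z(1) by (simp add: power_mult)
  qed
  show "\<forall>a\<in>{a \<in> ?A'. z ^ e a = 1}. ?s (?s a) = a" "\<forall>a\<in>{a \<in> ?A'. z ^ (e a + k a) = 1}. ?s (?s a) = a" using ss by blast+
  show "?s ` {a \<in> ?A'. z ^ e a = 1} \<subseteq> {a \<in> ?A'. z ^ (e a + k a) = 1}"
  proof (rule image_subsetI)
   fix a assume a: "a \<in> {a \<in> ?A'. z ^ e a = 1}"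
   then have "?s a \<in> ?A'" using sA by blast
   moreover have "z ^ (e (?s a) + k (?s a)) = 1" using r[OF \<open>?s a \<in> ?A'\<close>] a unfolding ss by simp
   ultimately show "?s a \<in> {a \<in> ?A'. z ^ (e a + k a) = 1}" by blast
  qed
  show "?s ` {a \<in> ?A'. z ^ (e a + k a) = 1} \<subseteq> {a \<in> ?A'. z ^ e a = 1}"
  proof (rule image_subsetI)
   fix a assume a: "a \<in> {a \<in> ?A'. z ^ (e a + k a) = 1}"
   then have "?s a \<in> ?A'" using sA by blast
   moreover have "z ^ e (?s a) = 1" using r[of a] a by simp
   ultimately show "?s a \<in> {a \<in> ?A'. z ^ e a = 1}" by blast
  qed
 qed
 have zf: "z ^ e f \<noteq> 1"
 proof
  assume "z ^ e f = 1"
  then have "z ^ (e f + 1) = z" by simp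
  then have "z ^ g = z" unfolding ef .
  then show False using z by simp
 qed
 have zf': "z ^ (e f + k f) = 1" unfolding k(2) ef by (rule z(1))
 have fin: "finite ?A" by simp
 have 1: "{a \<in> ?A. z ^ e a = 1} = {a \<in> ?A'. z ^ e a = 1}" using zf by blast
 have 2: "{a \<in> ?A. z ^ (e a + k a) = 1} = insert f {a \<in> ?A'. z ^ (e a + k a) = 1}" using zf' fA by blast
 have lt: "card {a \<in> ?A. z ^ e a = 1} < card {a \<in> ?A. z ^ (e a + k a) = 1}"
 proof -
  have "finite {a \<in> ?A'. z ^ (e a + k a) = 1}" "f \<notin> {a \<in> ?A'. z ^ (e a + k a) = 1}" using fin by auto
  then have "card (insert f {a \<in> ?A'. z ^ (e a + k a) = 1}) = Suc (card {a \<in> ?A'. z ^ (e a + k a) = 1})"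
   by (rule card_insert_disjoint)
  then show ?thesis unfolding 1 2 using bij_betw_same_card[OF bij] by linarith
 qed
 have O_R: "?O \<subseteq> R" using W_R f(1) by blast
 have fO: "finite ?O" by simp
 have "(\<Sum>a\<in>?O. z ^ (if a \<in> pos then nht f - nht a else nht f + nht (- a) - 1)) = 0"
 proof (rule vanish_at[where A = ?A and e = e and f = "\<lambda>a. e a + k a", OF fin _ _ fO gen lt])
  show "0 < e a" if "a \<in> ?A" for a using y(3) that by simp
  then show "0 < e a + k a" if "a \<in> ?A" for a using that by simp
 qed
 then have z0: "(\<Sum>a\<in>?O. z ^ (if a \<in> pos then nht f - nht a else nht f + nht (- a) - 1)) = 0" .
 have Oeq: "?O = (?O \<inter> pos) \<union> uminus ` (?O \<inter> pos)"
 proof -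
  have neg: "- a \<in> ?O" if "a \<in> ?O" for a
  proof -
   from that obtain w where w: "w \<in> W" "a = w f" by (elim imageE)
   then have "- a = (w \<circ> root_refl f) f" by (simp add: W_minus)
   then show ?thesis using W_comp[OF w(1) refl_W[OF f(1)]] by (rule image_eqI)
  qed
  show ?thesis
  proof (intro equalityI subsetI)
   fix a assume a: "a \<in> ?O"
   show "a \<in> (?O \<inter> pos) \<union> uminus ` (?O \<inter> pos)"
   proof (cases "a \<in> pos")
    case True
    with a show ?thesis by (intro UnI1 IntI)
   next
    case False
    then have "- a \<in> pos" using notin_pos[OF subsetD[OF O_R a]] by simp
    have "- a \<in> ?O \<inter> pos" by (rule IntI[OF neg[OF a] \<open>- a \<in> pos\<close>])
    then have "- (- a) \<in> uminus ` (?O \<inter> pos)" by (rule imageI)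
    then show ?thesis unfolding minus_minus by (rule UnI2)
   qed
  next
   fix a assume "a \<in> (?O \<inter> pos) \<union> uminus ` (?O \<inter> pos)"
   then show "a \<in> ?O"
   proof
    assume "a \<in> uminus ` (?O \<inter> pos)"
    then obtain c where c: "a = - c" "c \<in> ?O \<inter> pos" unfolding image_iff by (elim bexE) (rule that)
    show ?thesis unfolding c(1) by (rule neg[OF IntD1[OF c(2)]])
   qed (rule IntD1)
  qed
 qed
 define F where "F a = z ^ (if a \<in> pos then nht f - nht a else nht f + nht (- a) - 1)" for a
 define P where "P = ?O \<inter> pos"
 have "sum F ?O = 0" using z0 unfolding F_def .
 then have "sum F (P \<union> uminus ` P) = 0" unfolding P_def Oeq[symmetric] .
 moreover have "sum F (P \<union> uminus ` P) = sum F P + sum F (uminus ` P)"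
 proof (rule sum.union_disjoint)
  show "finite P" "finite (uminus ` P)" unfolding P_def using fO by simp_all
  have "- a \<notin> P" if "a \<in> P" for a using neg_notin_pos[of a] that unfolding P_def by simp
  then show "P \<inter> uminus ` P = {}" by blast
 qed
 moreover have "sum F (uminus ` P) = (\<Sum>a\<in>P. z ^ (nht f + nht a - 1))"
 proof -
  have "sum F (uminus ` P) = (\<Sum>a\<in>P. F (- a))" by (subst sum.reindex) (simp_all add: inj_on_def)
  also have "\<dots> = (\<Sum>a\<in>P. z ^ (nht f + nht a - 1))"
   by (rule sum.cong) (simp_all add: F_def P_def neg_notin_pos)
  finally show ?thesis .
 qed
 moreover have "sum F P = (\<Sum>a\<in>P. z ^ (nht f - nht a))" by (rule sum.cong) (simp_all add: F_def P_def)
 ultimately show ?thesis unfolding sum.distrib P_def by simp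
qed

end

section \<open>Roots and coroots have the same height statistics\<close>

lemma card_by_value:
 fixes h :: "'i \<Rightarrow> nat"
 assumes "finite A" "\<And>a. a \<in> A \<Longrightarrow> h a \<le> M"
 shows "card {a \<in> A. P (h a)} = (\<Sum>m\<in>{m. m \<le> M \<and> P m}. card {a \<in> A. h a = m})"
proof -
 have "card {a \<in> A. P (h a)} = (\<Sum>a\<in>{a \<in> A. P (h a)}. 1)" by simp
 also have "\<dots> = (\<Sum>m\<in>{m. m \<le> M \<and> P m}. \<Sum>a\<in>{a \<in> {a \<in> A. P (h a)}. h a = m}. 1)"
  by (rule sum.group[symmetric]) (use assms in auto)
 also have "\<dots> = (\<Sum>m\<in>{m. m \<le> M \<and> P m}. card {a \<in> A. h a = m})"
 proof (rule sum.cong)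
  fix m assume "m \<in> {m. m \<le> M \<and> P m}"
  then have "{a \<in> {a \<in> A. P (h a)}. h a = m} = {a \<in> A. h a = m}" by auto
  then show "(\<Sum>a\<in>{a \<in> {a \<in> A. P (h a)}. h a = m}. 1) = card {a \<in> A. h a = m}" by simp
 qed simp
 finally show ?thesis .
qed

lemma card_dvd_ge:
 fixes H :: "'i \<Rightarrow> nat"
 assumes "\<And>x. x \<in> X \<Longrightarrow> 1 \<le> H x"
 shows "card {x \<in> X. j + 1 dvd H x} = card {x \<in> X. j < H x \<and> j + 1 dvd H x}"
proof -
 have "j < H x" if "x \<in> X" "j + 1 dvd H x" for x
  using dvd_imp_le[OF that(2)] assms[OF that(1)] by simp
 then have "{x \<in> X. j + 1 dvd H x} = {x \<in> X. j < H x \<and> j + 1 dvd H x}" by blast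
 then show ?thesis by simp
qed

lemma card_dvd_Suc_ge:
 fixes H :: "'i \<Rightarrow> nat"
 assumes "finite X"
 shows "card {x \<in> X. j + 1 dvd H x + 1} = card {x \<in> X. H x = j} + card {x \<in> X. j < H x \<and> j + 1 dvd H x + 1}"
proof -
 have "j \<le> H x" if "j + 1 dvd H x + 1" for x using dvd_imp_le[OF that] by simp
 then have "{x \<in> X. j + 1 dvd H x + 1} = {x \<in> X. H x = j} \<union> {x \<in> X. j < H x \<and> j + 1 dvd H x + 1}"
  by (auto simp: le_less)
 moreover have "card ({x \<in> X. H x = j} \<union> {x \<in> X. j < H x \<and> j + 1 dvd H x + 1})
  = card {x \<in> X. H x = j} + card {x \<in> X. j < H x \<and> j + 1 dvd H x + 1}"
  by (rule card_Un_disjoint) (use assms in auto)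
 ultimately show ?thesis by simp
qed

text \<open>Downward induction: with \<open>d = j + 1\<close> the only heights at most \<open>j\<close> that contribute are those equal to \<open>j\<close>.\<close>

lemma count_eq_of_shift:
 fixes h :: "'i \<Rightarrow> nat" and h' :: "'j \<Rightarrow> nat"
 assumes fin: "finite A" "finite B" and ge: "\<And>a. a \<in> A \<Longrightarrow> 1 \<le> h a" "\<And>b. b \<in> B \<Longrightarrow> 1 \<le> h' b"
  and dv: "\<And>d. 2 \<le> d \<Longrightarrow> card {a \<in> A. d dvd h a + 1} + card {b \<in> B. d dvd h' b}
   = card {b \<in> B. d dvd h' b + 1} + card {a \<in> A. d dvd h a}"
  and j: "1 \<le> j"
 shows "card {a \<in> A. h a = j} = card {b \<in> B. h' b = j}"
proof -
 obtain M where M: "\<And>a. a \<in> A \<Longrightarrow> h a \<le> M" "\<And>b. b \<in> B \<Longrightarrow> h' b \<le> M"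
 proof
  show "h a \<le> Max (insert 0 (h ` A)) + Max (insert 0 (h' ` B))" if "a \<in> A" for a
   using fin that by (intro trans_le_add1 Max_ge) auto
  show "h' b \<le> Max (insert 0 (h ` A)) + Max (insert 0 (h' ` B))" if "b \<in> B" for b
   using fin that by (intro trans_le_add2 Max_ge) auto
 qed
 show ?thesis using j
 proof (induction "Suc M - j" arbitrary: j rule: less_induct)
  case less
  show ?case
  proof (cases "M < j")
   case True
   then have "{a \<in> A. h a = j} = {}" "{b \<in> B. h' b = j} = {}" using M by force+
   then show ?thesis by (simp only: card.empty)
  next
   case False
   have IH: "card {a \<in> A. h a = m} = card {b \<in> B. h' b = m}" if "j < m" for m
    using less(1)[of m] False less(2) that by simp
   have eqP: "card {a \<in> A. j < h a \<and> P (h a)} = card {b \<in> B. j < h' b \<and> P (h' b)}" for P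
   proof -
    have "card {a \<in> A. j < h a \<and> P (h a)} = (\<Sum>m\<in>{m. m \<le> M \<and> j < m \<and> P m}. card {a \<in> A. h a = m})"
     by (rule card_by_value[where P = "\<lambda>m. j < m \<and> P m"]) (use fin M in auto)
    also have "\<dots> = (\<Sum>m\<in>{m. m \<le> M \<and> j < m \<and> P m}. card {b \<in> B. h' b = m})"
     by (rule sum.cong) (use IH in auto)
    also have "\<dots> = card {b \<in> B. j < h' b \<and> P (h' b)}"
     by (rule card_by_value[where P = "\<lambda>m. j < m \<and> P m", symmetric]) (use fin M in auto)
    finally show ?thesis .
   qed
   have "2 \<le> j + 1" using less(2) by simp
   from dv[OF this] show ?thesis
    using card_dvd_ge[of A h j, OF ge(1)] card_dvd_ge[of B h' j, OF ge(2)]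
     card_dvd_Suc_ge[OF fin(1), of j h] card_dvd_Suc_ge[OF fin(2), of j h']
     eqP[of "\<lambda>m. j + 1 dvd m"] eqP[of "\<lambda>m. j + 1 dvd m + 1"] by linarith
  qed
 qed
qed

context based_roots
begin

definition cht :: "'a \<Rightarrow> nat" where "cht a = based_roots.nht (coroot ` R) (coroot ` B) (coroot a)"

lemma cht: "a \<in> pos \<Longrightarrow> real (cht a) = based_roots.ht (coroot ` R) (coroot ` B) (coroot a)"
 and cht_ge_1: "a \<in> pos \<Longrightarrow> 1 \<le> cht a" and cht_B: "b \<in> B \<Longrightarrow> cht b = 1" and nht_B: "b \<in> B \<Longrightarrow> nht b = 1"
proof -
 interpret D: based_roots "coroot ` R" "coroot ` B" by (rule dual)
 have p: "coroot a \<in> D.pos" if "a \<in> pos" for a unfolding dual_pos using that by (rule imageI)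
 show "a \<in> pos \<Longrightarrow> real (cht a) = D.ht (coroot a)" "a \<in> pos \<Longrightarrow> 1 \<le> cht a"
  unfolding cht_def using D.nht[OF p] D.nht_ge_1[OF p] by simp_all
 show "b \<in> B \<Longrightarrow> cht b = 1" unfolding cht_def using D.ht_B[of "coroot b"] by (simp add: D.nht_def)
 show "b \<in> B \<Longrightarrow> nht b = 1" using ht_B[of b] by (simp add: nht_def)
qed

text \<open>The group and its lengths are shared by \<open>R\<close> and its dual, so the two forms
  of \<open>poinW_product\<close> are equal. Cross multiplication collects the factors over
  \<open>pos <+> pos\<close>, and \<open>count_dvd\<close> then compares how many exponents are
  multiples of \<open>d\<close>.\<close>

theorem dual_count:
 assumes "1 \<le> j" shows "card {a \<in> pos. nht a = j} = card {a \<in> pos. cht a = j}"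
proof (rule count_eq_of_shift)
 fix d :: nat assume d: "2 \<le> d"
 interpret D: based_roots "coroot ` R" "coroot ` B" by (rule dual)
 let ?A = "pos <+> pos"
 let ?e = "case_sum (\<lambda>a. nht a + 1) cht" and ?f = "case_sum (\<lambda>a. cht a + 1) nht"
 have fin: "finite ?A" by simp
 have e: "0 < ?e x" "0 < ?f x" if "x \<in> ?A" for x using that by (auto dest: nht_ge_1 cht_ge_1)
 have ps: "(\<Prod>x\<in>?A. 1 - u ^ case_sum F G x) = (\<Prod>a\<in>pos. 1 - u ^ F a) * (\<Prod>a\<in>pos. 1 - u ^ G a)" for F G and u :: real
  by (subst prod.Plus) simp_all
 have eq: "(\<Prod>x\<in>?A. 1 - u ^ ?e x) = (\<Prod>x\<in>?A. 1 - u ^ ?f x)" if u: "0 < u" "u < 1" for u :: real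
 proof -
  have "D.poinW u = poinW u"
   unfolding D.poinW_def poinW_def dual_W by (rule sum.cong) (simp_all add: dual_Inv card_image inj_coroot)
  then have "(\<Prod>a\<in>coroot ` pos. 1 - u ^ (D.nht a + 1)) / (\<Prod>a\<in>coroot ` pos. 1 - u ^ D.nht a)
   = (\<Prod>a\<in>pos. 1 - u ^ (nht a + 1)) / (\<Prod>a\<in>pos. 1 - u ^ nht a)"
   unfolding D.poinW_product[OF u] poinW_product[OF u] dual_pos .
  then have q: "(\<Prod>a\<in>pos. 1 - u ^ (cht a + 1)) / (\<Prod>a\<in>pos. 1 - u ^ cht a)
   = (\<Prod>a\<in>pos. 1 - u ^ (nht a + 1)) / (\<Prod>a\<in>pos. 1 - u ^ nht a)"
   by (simp only: prod.reindex[OF inj_coroot] comp_def cht_def[symmetric])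
  have "u ^ cht a < 1" "u ^ nht a < 1" if "a \<in> pos" for a
   using u nht_ge_1[OF that] cht_ge_1[OF that] by (simp_all add: power_less_one_iff)
  then have "(\<Prod>a\<in>pos. 1 - u ^ cht a) \<noteq> 0" "(\<Prod>a\<in>pos. 1 - u ^ nht a) \<noteq> 0" by (force simp: prod_zero_iff)+
  then show ?thesis using q unfolding ps by (simp add: frac_eq_eq mult.commute)
 qed
 have "card {x \<in> ?A. d dvd ?e x} = card {x \<in> ?A. d dvd ?f x}"
  by (rule count_dvd[OF fin e(1) fin e(2) eq]) (use d in auto)
 moreover have "card {x \<in> ?A. d dvd case_sum F G x} = card {a \<in> pos. d dvd F a} + card {a \<in> pos. d dvd G a}" for F G
 proof -
  have "{x \<in> ?A. d dvd case_sum F G x} = {a \<in> pos. d dvd F a} <+> {a \<in> pos. d dvd G a}" by auto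
  then show ?thesis by (simp add: card_Plus)
 qed
 ultimately show "card {a \<in> pos. d dvd nht a + 1} + card {b \<in> pos. d dvd cht b}
  = card {b \<in> pos. d dvd cht b + 1} + card {a \<in> pos. d dvd nht a}" by simp
qed (use assms nht_ge_1 cht_ge_1 in auto)

end

section \<open>Height duality\<close>

context irreducible_roots
begin

definition theta :: 'a where "theta = (SOME t. is_highest t)"
text \<open>The root whose coroot is highest in the dual system: the highest short root, equal to
  \<open>theta\<close> when all roots have the same length.\<close>

definition theta_s :: 'a where
 "theta_s = coroot (irreducible_roots.theta (coroot ` R) (coroot ` B))"
definition cnum :: nat where "cnum = nht theta + 1"

lemma theta: "is_highest theta" unfolding theta_def using highest_exists by (rule someI_ex)
lemma theta_s: "irreducible_roots.is_highest (coroot ` R) (coroot ` B) (coroot theta_s)"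
 unfolding theta_s_def coroot_coroot by (rule irreducible_roots.theta[OF dual_irreducible])

lemma nht_le: "a \<in> pos \<Longrightarrow> nht a \<le> nht theta"
 using highest_ht[OF theta pos_R, of a] nht[of a] nht[OF highest_pos[OF theta]] by linarith

lemma theta_s_pos: "theta_s \<in> pos"
proof -
 interpret D: irreducible_roots "coroot ` R" "coroot ` B" by (rule dual_irreducible)
 have "coroot theta_s \<in> coroot ` pos" using D.highest_pos[OF theta_s] unfolding dual_pos .
 then show ?thesis unfolding inj_image_mem_iff[OF inj_coroot] .
qed

lemma theta_s_dominant: "dominant theta_s"
proof -
 interpret D: irreducible_roots "coroot ` R" "coroot ` B" by (rule dual_irreducible)
 show ?thesis using D.highest_dominant[OF theta_s] dual_dominant by simp
qed

lemma cht_le: "a \<in> pos \<Longrightarrow> cht a \<le> cht theta_s"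
proof -
 interpret D: irreducible_roots "coroot ` R" "coroot ` B" by (rule dual_irreducible)
 assume a: "a \<in> pos"
 have "D.ht (coroot a) \<le> D.ht (coroot theta_s)" by (rule D.highest_ht[OF theta_s]) (use pos_R[OF a] in simp)
 then show ?thesis using cht[OF a] cht[OF theta_s_pos] by linarith
qed

text \<open>By \<open>dual_count\<close> the largest height of either system is also attained in the
  other, so each bounds the other.\<close>

lemma cht_theta_s: "cht theta_s = nht theta"
proof (rule antisym)
 have ex: "\<exists>a\<in>A. h a = j" if "card {a \<in> A. h a = j} \<noteq> 0" for A :: "'a set" and h :: "'a \<Rightarrow> nat" and j
  using that by (metis (mono_tags, lifting) card.empty empty_Collect_eq)
 have ne: "card {a \<in> pos. h a = h x} \<noteq> 0" if "x \<in> pos" for h :: "'a \<Rightarrow> nat" and x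
  using that by (simp add: card_eq_0_iff) blast
 have "card {a \<in> pos. nht a = cht theta_s} \<noteq> 0"
  unfolding dual_count[OF cht_ge_1[OF theta_s_pos]] by (rule ne[OF theta_s_pos])
 from ex[OF this] show "cht theta_s \<le> nht theta" using nht_le by force
 have "card {a \<in> pos. cht a = nht theta} \<noteq> 0"
  unfolding dual_count[OF nht_ge_1[OF highest_pos[OF theta]], symmetric] by (rule ne[OF highest_pos[OF theta]])
 from ex[OF this] show "nht theta \<le> cht theta_s" using cht_le by force
qed

text \<open>The Cartan number against \<open>theta\<close> is one, so the reflection is
  \<open>a - theta\<close>, and \<open>a\<close> is paired with \<open>theta - a\<close>. This
  supplies the hypothesis \<open>refl\<close> of \<open>orbit_sum_vanishes\<close>.\<close>

lemma highest_flip: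
 assumes a: "a \<in> pos" "a \<bullet> theta \<noteq> 0" "a \<noteq> theta"
 shows "cartan a theta = 1" "- root_refl theta a \<in> pos" "nht a + nht (- root_refl theta a) = nht theta"
proof -
 have tz: "theta \<noteq> 0" using R_nz highest_R[OF theta] by blast
 show c: "cartan a theta = 1" using highest_cartan[OF theta a(1,3)] a(2) tz by (auto simp: cartan_def)
 have eq: "- root_refl theta a = theta - a" by (simp add: root_refl_cartan c)
 have r: "theta - a \<in> R" using refl_closed[OF highest_R[OF theta] pos_R[OF a(1)]] neg_R[of "root_refl theta a"] unfolding eq by simp
 have "a - theta \<notin> pos"
 proof
  assume "a - theta \<in> pos"
  then have "0 < local.ht (a - theta)" by (rule ht_pos)
  then show False using highest_ht[OF theta pos_R[OF a(1)]] by (simp add: ht_diff)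
 qed
 then have p: "theta - a \<in> pos" using pos_or_neg[OF r] by auto
 then show "- root_refl theta a \<in> pos" unfolding eq .
 show "nht a + nht (- root_refl theta a) = nht theta"
  unfolding eq using nht[OF p] nht[OF a(1)] nht[OF highest_pos[OF theta]] by (simp add: ht_diff)
qed

lemma dominant_pos_root: assumes "f \<in> R" "dominant f" shows "f \<in> pos"
 using dominant_full[OF assms(2) R_spanB[OF assms(1)] R_nz[OF assms(1)]] assms(1) by (simp add: pos_def less_imp_le)

text \<open>The weight \<open>k a\<close> is the ratio of the square lengths of \<open>theta\<close>
  and \<open>a\<close>, which is 1, 2 or 3; it equals \<open>cartan theta a\<close> for positive
  roots other than \<open>theta\<close> that are not orthogonal to it. Scaling \<open>corho\<close>
  by half the square length of \<open>theta\<close> makes the coroot of \<open>a\<close> pair to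
  \<open>k a * nht a\<close>.\<close>

lemma orbit_sum_long:
 assumes z: "z ^ cnum = (1::complex)" "z \<noteq> 1"
 shows "(\<Sum>a\<in>(\<lambda>w. w theta) ` W \<inter> pos. z ^ (nht theta - nht a) + z ^ (nht theta + nht a - 1)) = 0"
proof -
 define k where "k a = nat \<lfloor>(theta \<bullet> theta) / (a \<bullet> a)\<rfloor>" for a :: 'a
 have tR: "theta \<in> R" by (rule highest_R[OF theta])
 have tt: "0 < theta \<bullet> theta" using R_nz[OF tR] by simp
 have kW: "k (w a) = k a" if "w \<in> W" for w and a :: 'a unfolding k_def W_inner[OF that] ..
 have kr: "real (k a) = (theta \<bullet> theta) / (a \<bullet> a)" "0 < k a" if a: "a \<in> R" for a
 proof -
  obtain w where w: "w \<in> W" "dominant (w a)" using dominant_exists by blast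
  have wR: "w a \<in> R" by (rule W_R[OF w(1) a])
  have aa: "0 < a \<bullet> a" using R_nz[OF a] by simp
  have "(theta \<bullet> theta) / (a \<bullet> a) = 1 \<or> (theta \<bullet> theta) / (a \<bullet> a) = 2 \<or> (theta \<bullet> theta) / (a \<bullet> a) = 3"
  proof (cases "w a = theta")
   case True
   then have "theta \<bullet> theta = a \<bullet> a" using W_inner[OF w(1), of a a] by simp
   then show ?thesis using aa by simp
  next
   case False
   from highest_longest[OF theta wR w(2) False] show ?thesis unfolding W_inner[OF w(1)] using aa by (auto simp: field_simps)
  qed
  then show "real (k a) = (theta \<bullet> theta) / (a \<bullet> a)" "0 < k a" unfolding k_def by auto
 qed
 show ?thesis
 proof (rule orbit_sum_vanishes[where k = k and e = "\<lambda>a. k a * nht a" and y = "((theta \<bullet> theta) / 2) *\<^sub>R corho" and g = cnum])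
  show "k theta = 1" unfolding k_def using tt by simp
  show "cartan theta a = real (k a)" if a: "a \<in> pos" "a \<bullet> theta \<noteq> 0" "a \<noteq> theta" for a
   using highest_flip(1)[OF a] kr(1)[OF pos_R[OF a(1)]] tt by (simp add: cartan_def inner_commute field_simps)
  show "coroot a \<bullet> (((theta \<bullet> theta) / 2) *\<^sub>R corho) = real (k a * nht a)" if "a \<in> pos" for a
  proof -
   have "coroot a \<bullet> (((theta \<bullet> theta) / 2) *\<^sub>R corho) = (theta \<bullet> theta) / (a \<bullet> a) * local.ht a"
    by (simp add: coroot_def ht_def)
   then show ?thesis by (simp add: kr(1)[OF pos_R[OF that]] nht[OF that])
  qed
  show "0 < k a * nht a" if "a \<in> pos" for a using kr(2)[OF pos_R[OF that]] nht_ge_1[OF that] by simp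
  show "- root_refl theta a \<in> pos \<and> k a * nht a + k a + k (- root_refl theta a) * nht (- root_refl theta a) = k a * cnum"
   if a: "a \<in> pos" "a \<bullet> theta \<noteq> 0" "a \<noteq> theta" for a
  proof
   have "k (- root_refl theta a) = k a" unfolding k_def by (simp add: root_refl_inner)
   then show "k a * nht a + k a + k (- root_refl theta a) * nht (- root_refl theta a) = k a * cnum"
    unfolding cnum_def using highest_flip(3)[OF a] by (simp add: algebra_simps flip: add_mult_distrib2)
  qed (rule highest_flip(2)[OF a])
  show "k theta * nht theta + 1 = cnum" unfolding cnum_def k_def using tt by simp
 qed (use tR highest_dominant[OF theta] kW nht_B z in auto)
qed

text \<open>The flip is now taken in the dual system, where the coroot of \<open>theta_s\<close> is
  highest. The relevant Cartan numbers are one, so all weights are one, and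
  \<open>cht_theta_s\<close> yields the same \<open>cnum\<close> as for the long orbit.\<close>

lemma orbit_sum_short:
 assumes z: "z ^ cnum = (1::complex)" "z \<noteq> 1"
 shows "(\<Sum>a\<in>(\<lambda>w. w theta_s) ` W \<inter> pos. z ^ (nht theta_s - nht a) + z ^ (nht theta_s + nht a - 1)) = 0"
proof -
 interpret D: irreducible_roots "coroot ` R" "coroot ` B" by (rule dual_irreducible)
 have tR: "theta_s \<in> R" by (rule pos_R[OF theta_s_pos])
 have Dt: "D.theta = coroot theta_s" unfolding theta_s_def by simp
 have fl: "cartan theta_s a = 1" "- root_refl theta_s a \<in> pos" "cht a + cht (- root_refl theta_s a) = cht theta_s"
  if a: "a \<in> pos" "a \<bullet> theta_s \<noteq> 0" "a \<noteq> theta_s" for a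
 proof -
  have h: "coroot a \<in> D.pos" "coroot a \<bullet> D.theta \<noteq> 0" "coroot a \<noteq> D.theta"
   unfolding dual_pos Dt using a R_nz[OF tR] pos_nonzero[OF a(1)]
   by (auto simp: coroot_def dest: inj_onD[OF inj_coroot[of UNIV]]) (metis coroot_coroot coroot_def)
  have eq: "- root_refl D.theta (coroot a) = coroot (- root_refl theta_s a)"
   unfolding Dt root_refl_coroot root_refl_coroot_coroot coroot_minus ..
  show "cartan theta_s a = 1" using D.highest_flip(1)[OF h] unfolding Dt cartan_coroot .
  show "- root_refl theta_s a \<in> pos" using D.highest_flip(2)[OF h] unfolding eq dual_pos inj_image_mem_iff[OF inj_coroot] .
  show "cht a + cht (- root_refl theta_s a) = cht theta_s" using D.highest_flip(3)[OF h] unfolding eq unfolding cht_def Dt .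
 qed
 show ?thesis
 proof (rule orbit_sum_vanishes[where k = "\<lambda>_. 1" and e = cht and y = D.corho and g = cnum])
  show "cartan theta_s a = real 1" if a: "a \<in> pos" "a \<bullet> theta_s \<noteq> 0" "a \<noteq> theta_s" for a using fl(1)[OF a] by simp
  show "coroot a \<bullet> D.corho = real (cht a)" if "a \<in> pos" for a using cht[OF that] by (simp add: D.ht_def)
  show "0 < cht a" if "a \<in> pos" for a using cht_ge_1[OF that] by simp
  show "- root_refl theta_s a \<in> pos \<and> cht a + 1 + cht (- root_refl theta_s a) = 1 * cnum"
   if a: "a \<in> pos" "a \<bullet> theta_s \<noteq> 0" "a \<noteq> theta_s" for a
   using fl(2,3)[OF a] cht_theta_s by (simp add: cnum_def)
  show "cht theta_s + 1 = cnum" by (simp add: cht_theta_s cnum_def)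
 qed (use tR theta_s_dominant cht_B z in auto)
qed

text \<open>Multiplying by a power of \<open>z\<close> removes the dependence on the height of the dominant root.\<close>

lemma orbit_sum_normalize:
 assumes z: "z ^ cnum = (1::complex)" "z \<noteq> 1" and f: "f \<in> pos" "dominant f"
  and s: "(\<Sum>a\<in>(\<lambda>w. w f) ` W \<inter> pos. z ^ (nht f - nht a) + z ^ (nht f + nht a - 1)) = 0"
 shows "(\<Sum>a\<in>(\<lambda>w. w f) ` W \<inter> pos. z ^ (cnum - nht a) + z ^ (nht a - 1)) = 0"
proof -
 have "(\<Sum>a\<in>(\<lambda>w. w f) ` W \<inter> pos. z ^ (cnum - nht a) + z ^ (nht a - 1))
  = (\<Sum>a\<in>(\<lambda>w. w f) ` W \<inter> pos. z ^ (cnum - nht f) * (z ^ (nht f - nht a) + z ^ (nht f + nht a - 1)))"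
 proof (rule sum.cong)
  fix a assume "a \<in> (\<lambda>w. w f) ` W \<inter> pos"
  then obtain w where w: "w \<in> W" "a = w f" "a \<in> pos" by blast
  have "nht a \<le> nht f" using ht_W_le[OF w(1) f(2)] nht[OF w(3)] nht[OF f(1)] w(2) by simp
  moreover have "nht f < cnum" using nht_le[OF f(1)] by (simp add: cnum_def)
  moreover have "1 \<le> nht a" by (rule nht_ge_1[OF w(3)])
  ultimately have e: "cnum - nht a = (cnum - nht f) + (nht f - nht a)" "(cnum - nht f) + (nht f + nht a - 1) = cnum + (nht a - 1)" by simp_all
  have "z ^ (cnum - nht f) * z ^ (nht f + nht a - 1) = z ^ (nht a - 1)"
   unfolding power_add[symmetric] e(2) using z(1) by (simp add: power_add)
  moreover have "z ^ (cnum - nht f) * z ^ (nht f - nht a) = z ^ (cnum - nht a)"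
   unfolding power_add[symmetric] e(1) ..
  ultimately show "z ^ (cnum - nht a) + z ^ (nht a - 1) = z ^ (cnum - nht f) * (z ^ (nht f - nht a) + z ^ (nht f + nht a - 1))"
   by (simp add: distrib_left)
 qed simp
 then show ?thesis using s by (simp flip: sum_distrib_left)
qed

text \<open>By \<open>dominant_root_cases\<close> the positive roots are covered by the orbits of
  \<open>theta\<close> and \<open>theta_s\<close>. These are disjoint unless the two roots coincide,
  since a dominant root is alone in its orbit.\<close>

lemma height_sum_vanishes:
 assumes z: "z ^ cnum = (1::complex)" "z \<noteq> 1"
 shows "(\<Sum>a\<in>pos. z ^ (cnum - nht a) + z ^ (nht a - 1)) = 0"
proof -
 let ?O = "\<lambda>f. (\<lambda>w. w f) ` W \<inter> pos" and ?F = "\<lambda>a. z ^ (cnum - nht a) + z ^ (nht a - 1)"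
 have l: "(\<Sum>a\<in>?O theta. ?F a) = 0"
  by (rule orbit_sum_normalize[OF z highest_pos[OF theta] highest_dominant[OF theta] orbit_sum_long[OF z]])
 have s: "(\<Sum>a\<in>?O theta_s. ?F a) = 0"
  by (rule orbit_sum_normalize[OF z theta_s_pos theta_s_dominant orbit_sum_short[OF z]])
 have sub: "a \<in> ?O theta \<union> ?O theta_s" if a: "a \<in> pos" for a
 proof -
  obtain w where w: "w \<in> W" "dominant (w a)" using dominant_exists by blast
  have "w a = theta \<or> w a = theta_s"
   by (rule dominant_root_cases[OF theta theta_s pos_R[OF theta_s_pos] W_R[OF w(1) pos_R[OF a]] w(2)])
  moreover have "a = inv w (w a)" using W_inv(2)[OF w(1)] by simp
  ultimately have "a = inv w theta \<or> a = inv w theta_s" by metis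
  then show ?thesis using W_inv(1)[OF w(1)] a by blast
 qed
 then have un: "pos = ?O theta \<union> ?O theta_s" by blast
 show ?thesis
 proof (cases "theta = theta_s")
  case True
  then have "pos = ?O theta" using un by simp
  then show ?thesis using l by simp
 next
  case False
  have "?O theta \<inter> ?O theta_s = {}"
  proof (rule ccontr)
   assume "\<not> ?thesis"
   then obtain v w where vw: "v \<in> W" "w \<in> W" "v theta = w theta_s" by blast
   then have "(inv w \<circ> v) theta = theta_s" using W_inv(2)[OF vw(2)] by simp
   moreover have "(inv w \<circ> v) theta = theta"
    by (rule dominant_unique[OF W_comp[OF W_inv(1)[OF vw(2)] vw(1)] highest_dominant[OF theta]])
     (use \<open>(inv w \<circ> v) theta = theta_s\<close> theta_s_dominant in simp)
   ultimately show False using False by simp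
  qed
  then have "sum ?F (?O theta \<union> ?O theta_s) = 0" using l s by (subst sum.union_disjoint) simp_all
  then show ?thesis using un by simp
 qed
qed

text \<open>The left side is the coefficient at \<open>m\<close> of a polynomial that vanishes at
  every \<open>cnum\<close>-th root of unity except one, so it does not depend on \<open>m\<close>.
  At \<open>m = 0\<close> no root has height \<open>cnum\<close>, and the roots of height one are
  the simple ones.\<close>

theorem height_duality:
 assumes m: "m < cnum"
 shows "card {a \<in> pos. nht a = cnum - m} + card {a \<in> pos. nht a = m + 1} = card B"
proof -
 let ?Q = "\<Sum>a\<in>pos. monom 1 (cnum - nht a) + monom 1 (nht a - 1) :: complex poly"
 have g: "1 \<le> nht a \<and> nht a < cnum" if "a \<in> pos" for a using nht_ge_1[OF that] nht_le[OF that] by (simp add: cnum_def)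
 have c: "poly.coeff ?Q n = of_nat (card {a \<in> pos. cnum - nht a = n} + card {a \<in> pos. nht a - 1 = n})" for n
  by (simp add: coeff_sum sum.distrib coeff_monom sum.If_cases Int_def)
 have c': "poly.coeff ?Q n = of_nat (card {a \<in> pos. nht a = cnum - n} + card {a \<in> pos. nht a = n + 1})" if "n < cnum" for n
 proof -
  have "{a \<in> pos. cnum - nht a = n} = {a \<in> pos. nht a = cnum - n}" "{a \<in> pos. nht a - 1 = n} = {a \<in> pos. nht a = n + 1}"
   using g that by fastforce+
  then show ?thesis unfolding c by simp
 qed
 have "poly.coeff ?Q m = poly.coeff ?Q 0"
 proof (rule poly_const_coeffs[OF _ _ _ m])
  show g0: "0 < cnum" by (simp add: cnum_def)
  have "degree ?Q \<le> cnum - 1"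
  proof (rule degree_le, intro allI impI)
   fix n assume "cnum - 1 < n"
   then have "{a \<in> pos. cnum - nht a = n} = {}" "{a \<in> pos. nht a - 1 = n} = {}" using g by fastforce+
   then show "poly.coeff ?Q n = 0" unfolding c by (simp only: card.empty of_nat_0 add_0)
  qed
  then show "degree ?Q < cnum" using g0 by simp
  show "poly ?Q z = 0" if "z ^ cnum = 1" "z \<noteq> 1" for z
   using height_sum_vanishes[OF that] by (simp add: poly_sum poly_monom)
 qed
 moreover have "card {a \<in> pos. nht a = cnum - 0} = 0"
 proof -
  have "{a \<in> pos. nht a = cnum - 0} = {}" using g by fastforce
  then show ?thesis by (simp only: card.empty)
 qed
 moreover have "{a \<in> pos. nht a = 0 + 1} = B"
 proof (intro set_eqI iffI)
  fix a assume "a \<in> {a \<in> pos. nht a = 0 + 1}"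
  then show "a \<in> B" using ht_nonsimple[of a] nht[of a] by force
 qed (auto simp: nht_B B_pos)
 moreover have "0 < cnum" by (simp add: cnum_def)
 ultimately have "of_nat (card {a \<in> pos. nht a = cnum - m} + card {a \<in> pos. nht a = m + 1}) = (of_nat (card B) :: complex)"
  using c'[OF m] c'[of 0] by simp
 then show ?thesis by (simp only: of_nat_eq_iff)
qed

text \<open>Sum \<open>height_duality\<close> over all \<open>m < cnum\<close>; every positive root
  is counted once in each of its two terms.\<close>

lemma card_pos: "2 * card pos = cnum * card B"
proof -
 have g: "1 \<le> nht a \<and> nht a < cnum" if "a \<in> pos" for a using nht_ge_1[OF that] nht_le[OF that] by (simp add: cnum_def)
 have "card pos = (\<Sum>m\<in>{..<cnum}. card {a \<in> pos. nht a = cnum - m})"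
 proof -
  have "card pos = (\<Sum>m\<in>{..<cnum}. \<Sum>a\<in>{a \<in> pos. cnum - nht a = m}. 1)"
   by (subst sum.group) (use g in \<open>force+\<close>)
  also have "\<dots> = (\<Sum>m\<in>{..<cnum}. card {a \<in> pos. nht a = cnum - m})"
  proof (rule sum.cong)
   fix m assume "m \<in> {..<cnum}"
   then have "{a \<in> pos. cnum - nht a = m} = {a \<in> pos. nht a = cnum - m}" using g by fastforce
   then show "(\<Sum>a\<in>{a \<in> pos. cnum - nht a = m}. 1) = card {a \<in> pos. nht a = cnum - m}" by simp
  qed simp
  finally show ?thesis .
 qed
 moreover have "card pos = (\<Sum>m\<in>{..<cnum}. card {a \<in> pos. nht a = m + 1})"
 proof -
  have "card pos = (\<Sum>m\<in>{..<cnum}. \<Sum>a\<in>{a \<in> pos. nht a - 1 = m}. 1)"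
   by (subst sum.group) (use g in \<open>force+\<close>)
  also have "\<dots> = (\<Sum>m\<in>{..<cnum}. card {a \<in> pos. nht a = m + 1})"
  proof (rule sum.cong)
   fix m
   have "{a \<in> pos. nht a - 1 = m} = {a \<in> pos. nht a = m + 1}" using g by fastforce
   then show "(\<Sum>a\<in>{a \<in> pos. nht a - 1 = m}. 1) = card {a \<in> pos. nht a = m + 1}" by simp
  qed simp
  finally show ?thesis .
 qed
 ultimately have "2 * card pos = (\<Sum>m\<in>{..<cnum}. card {a \<in> pos. nht a = cnum - m} + card {a \<in> pos. nht a = m + 1})"
  by (simp add: sum.distrib)
 also have "\<dots> = (\<Sum>m\<in>{..<cnum}. card B)" by (rule sum.cong) (use height_duality in auto)
 finally show ?thesis by simp
qed

end

section \<open>The Coxeter number\<close>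

locale spanning_roots = irreducible_roots +
 assumes full: "span B = UNIV"
begin

text \<open>Fundamental weights, dual to the simple coroots, so that a simple reflection moves only
  its own weight.\<close>

definition fw :: "'a \<Rightarrow> 'a" where
 "fw b = (SOME z. \<forall>d\<in>B. z \<bullet> coroot d = (if d = b then 1 else 0))"

lemma fw: assumes "d \<in> B" shows "fw b \<bullet> coroot d = (if d = b then 1 else 0)"
proof -
 interpret D: based_roots "coroot ` R" "coroot ` B" by (rule dual)
 obtain z where z: "\<forall>c\<in>coroot ` B. c \<bullet> z = (if coroot c = b then 1 else 0)"
  using D.dual_functional[of "\<lambda>c. if coroot c = b then 1 else 0"] by (elim exE)
 have "\<forall>d\<in>B. z \<bullet> coroot d = (if d = b then 1 else 0)" using z by (simp add: inner_commute)
 then have "\<forall>d\<in>B. fw b \<bullet> coroot d = (if d = b then 1 else 0)" unfolding fw_def by (rule someI)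
 then show ?thesis using assms by (rule bspec)
qed

lemma refl_fw: "d \<in> B \<Longrightarrow> root_refl d (fw b) = (if d = b then fw b - b else fw b)"
 using fw[of d b] by (simp add: root_refl_cartan inner_coroot[symmetric])

lemma orth_zero: assumes "\<And>b. b \<in> B \<Longrightarrow> x \<bullet> b = 0" shows "x = 0"
proof -
 have "x \<in> span B" unfolding full by simp
 then have "x \<bullet> x = (\<Sum>b\<in>B. representation B x b * (b \<bullet> x))" by (rule expand_inner)
 also have "\<dots> = 0" by (rule sum.neutral) (simp add: assms inner_commute[of _ x])
 finally show ?thesis by simp
qed

lemma expand_fw: "x = (\<Sum>j\<in>B. cartan x j *\<^sub>R fw j)"
proof -
 have "x - (\<Sum>j\<in>B. cartan x j *\<^sub>R fw j) = 0"
 proof (rule orth_zero)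
  fix b assume b: "b \<in> B"
  have "(\<Sum>j\<in>B. cartan x j *\<^sub>R fw j) \<bullet> coroot b = (\<Sum>j\<in>B. if b = j then cartan x j else 0)"
   unfolding inner_sum_left by (rule sum.cong) (simp_all add: fw[OF b])
  also have "\<dots> = cartan x b" by (simp add: b finite_B)
  finally have "(x - (\<Sum>j\<in>B. cartan x j *\<^sub>R fw j)) \<bullet> coroot b = 0"
   by (simp add: inner_diff_left inner_coroot[of x])
  moreover have "b \<noteq> 0" by (rule pos_nonzero[OF B_pos[OF b]])
  ultimately show "(x - (\<Sum>j\<in>B. cartan x j *\<^sub>R fw j)) \<bullet> b = 0" by (simp add: coroot_def)
 qed
 then show ?thesis by simp
qed

lemma fw_dominant: "dominant (fw b)"
 unfolding dominant_def
proof
 fix d assume d: "d \<in> B"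
 have "0 < 2 / (d \<bullet> d)" using pos_nonzero[OF B_pos[OF d]] by simp
 moreover have "0 \<le> fw b \<bullet> coroot d" by (simp add: fw[OF d])
 then have "0 \<le> 2 / (d \<bullet> d) * (fw b \<bullet> d)" by (simp only: coroot_def inner_scaleR_right)
 ultimately show "0 \<le> fw b \<bullet> d" unfolding zero_le_mult_iff by linarith
qed

lemma fw_inj: assumes "b \<in> B" "fw b = fw d" shows "b = d"
 using fw[OF assms(1), of b] fw[OF assms(1), of d] assms(2) by (simp split: if_splits)

lemma word_W: "set ws \<subseteq> B \<Longrightarrow> word_elt root_refl ws \<in> W" by (rule word_elt_in_gen)

lemma word_fw: "set ws \<subseteq> B \<Longrightarrow> b \<notin> set ws \<Longrightarrow> word_elt root_refl ws (fw b) = fw b"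
 by (induction ws) (auto simp: refl_fw)

lemma word_diff_span: "x - word_elt root_refl ws x \<in> span (set ws)"
proof (induction ws)
 case (Cons b ws)
 let ?y = "word_elt root_refl ws x"
 have "x - word_elt root_refl (b # ws) x = (x - ?y) + cartan ?y b *\<^sub>R b" by (simp add: root_refl_cartan)
 moreover have "x - ?y \<in> span (set (b # ws))" using Cons span_mono[of "set ws" "set (b # ws)"] by auto
 moreover have "cartan ?y b *\<^sub>R b \<in> span (set (b # ws))" by (intro span_mul span_base) simp
 ultimately show ?case by (simp only: span_add)
qed (simp add: span_zero)

text \<open>The first letter changes its argument by a multiple of its simple root, while the
  remaining letters change \<open>x\<close> within the span of the other simple roots. For
  \<open>x\<close> to return, independence forces both changes to vanish.\<close>

lemma word_fixed:
 assumes "distinct ws" "set ws \<subseteq> B" "word_elt root_refl ws x = x" "b \<in> set ws"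
 shows "x \<bullet> b = 0"
 using assms
proof (induction ws)
 case (Cons d ws)
 define y where "y = word_elt root_refl ws x"
 have d: "d \<in> B" using Cons.prems(2) by simp
 have "root_refl d y = x" using Cons.prems(3) unfolding y_def by simp
 then have "y - cartan y d *\<^sub>R d = x" unfolding root_refl_cartan .
 then have e: "x - y = - cartan y d *\<^sub>R d" by (simp add: algebra_simps)
 have c0: "cartan y d = 0"
 proof (rule ccontr)
  assume n: "cartan y d \<noteq> 0"
  then have "d = (- 1 / cartan y d) *\<^sub>R (x - y)" unfolding e by simp
  moreover have "x - y \<in> span (B - {d})"
   unfolding y_def by (rule subsetD[OF span_mono word_diff_span]) (use Cons.prems in auto)
  ultimately have "d \<in> span (B - {d})" by (metis span_mul)
  then show False using indep d unfolding dependent_def by blast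
 qed
 then have y: "y = x" using e by simp
 have "d \<noteq> 0" by (rule pos_nonzero[OF B_pos[OF d]])
 then have "x \<bullet> d = 0" using c0 unfolding y by (simp add: cartan_def)
 then show ?case using Cons y unfolding y_def by auto
qed simp

text \<open>Undo the word from the left: a positive root turns negative only when it equals the
  letter being undone, and the letters undone before carry that simple root to
  \<open>a\<close>.\<close>

lemma inv_word_neg:
 assumes "set ws \<subseteq> B" "a \<in> pos" "inv (word_elt root_refl ws) a \<notin> pos"
 shows "\<exists>us b vs. ws = us @ b # vs \<and> a = word_elt root_refl us b"
 using assms
proof (induction ws arbitrary: a)
 case (Cons d ws)
 let ?v = "word_elt root_refl ws"
 have d: "d \<in> B" and v: "?v \<in> W" using Cons.prems(1) word_W by simp_all
 show ?case
 proof (cases "a = d")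
  case True
  then show ?thesis by (intro exI[of _ "[]"] exI[of _ d] exI[of _ ws]) simp
 next
  case False
  have "inv (root_refl d \<circ> ?v) = inv ?v \<circ> inv (root_refl d)"
   by (rule o_inv_distrib) (use W_inv(4)[OF B_W[OF d]] W_inv(4)[OF v] in simp_all)
  from fun_cong[OF this, of a] have e: "inv (root_refl d \<circ> ?v) a = inv ?v (root_refl d a)" unfolding comp_apply inv_refl .
  have "inv ?v (root_refl d a) \<notin> pos" using Cons.prems(3) unfolding word_elt_Cons e .
  moreover have "root_refl d a \<in> pos" by (rule refl_pos[OF d Cons.prems(2) False])
  ultimately obtain us b vs where "ws = us @ b # vs" "root_refl d a = word_elt root_refl us b"
   using Cons.IH[of "root_refl d a"] Cons.prems(1) by auto
  moreover from this(2) have "a = word_elt root_refl (d # us) b" by (metis comp_apply root_refl_refl word_elt_Cons)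
  ultimately show ?thesis by (intro exI[of _ "d # us"] exI[of _ b] exI[of _ vs]) simp
 qed
qed simp

definition fixset :: "nat \<Rightarrow> 'a list \<Rightarrow> 'a set" where
 "fixset m ws = {b \<in> B. (word_elt root_refl ws ^^ m) (fw b) = fw b}"

lemma W_pow: "w \<in> W \<Longrightarrow> w ^^ m \<in> W"
proof (induction m)
 case 0 show ?case unfolding funpow.simps(1) by (rule gen_subgroup_id)
next
 case (Suc m) then show ?case unfolding funpow.simps(2) by (intro W_comp)
qed

lemma W_inj_eq: "w \<in> W \<Longrightarrow> w x = w y \<longleftrightarrow> x = y"
 using W_inv(4) by (metis bij_is_inj inj_eq)

text \<open>The two words are conjugate by \<open>root_refl b\<close>, which fixes every fundamental
  weight except \<open>fw b\<close>. The letters of \<open>ws\<close> fix \<open>fw b\<close>, so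
  its reflection is its image under the whole word, and the word commutes with its powers.\<close>

lemma fixset_rotate1:
 assumes "set (b # ws) \<subseteq> B" "b \<notin> set ws"
 shows "fixset m (b # ws) = fixset m (ws @ [b])"
proof -
 let ?s = "root_refl b" and ?v = "word_elt root_refl ws"
 let ?c = "?s \<circ> ?v" and ?c' = "?v \<circ> ?s"
 have b: "b \<in> B" and v: "?v \<in> W" using assms word_W by simp_all
 have cW: "?c \<in> W" by (rule W_comp[OF B_W[OF b] v])
 have conj: "?s ((?c' ^^ m) x) = (?c ^^ m) (?s x)" for x
  by (induction m) simp_all
 have "(?c' ^^ m) (fw d) = fw d \<longleftrightarrow> (?c ^^ m) (fw d) = fw d" if d: "d \<in> B" for d
 proof -
  have 1: "(?c' ^^ m) (fw d) = fw d \<longleftrightarrow> (?c ^^ m) (?s (fw d)) = ?s (fw d)"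
   unfolding conj[symmetric] by (rule W_inj_eq[OF B_W[OF b], symmetric])
  show ?thesis
  proof (cases "d = b")
   case False
   then have "?s (fw d) = fw d" using refl_fw[OF b] by simp
   then show ?thesis using 1 by simp
  next
   case True
   then have "?v (fw d) = fw d" using word_fw assms by simp
   then have e: "?s (fw d) = ?c (fw d)" by simp
   have "(?c ^^ m) (?c (fw d)) = ?c ((?c ^^ m) (fw d))" by (metis comp_apply funpow_Suc_right funpow.simps(2))
   then have "(?c ^^ m) (?s (fw d)) = ?s (fw d) \<longleftrightarrow> ?c ((?c ^^ m) (fw d)) = ?c (fw d)" unfolding e by simp
   then show ?thesis using 1 W_inj_eq[OF cW] by simp
  qed
 qed
 moreover have "word_elt root_refl (b # ws) = ?c" "word_elt root_refl (ws @ [b]) = ?c'"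
  by (simp_all only: word_elt_Cons word_elt_append word_elt_Nil comp_id)
 ultimately show ?thesis unfolding fixset_def by auto
qed

lemma fixset_rotate:
 assumes "set (xs @ ys) \<subseteq> B" "distinct (xs @ ys)"
 shows "fixset m (xs @ ys) = fixset m (ys @ xs)"
 using assms
proof (induction xs arbitrary: ys)
 case (Cons x xs)
 have "fixset m ((x # xs) @ ys) = fixset m (xs @ (ys @ [x]))"
  using fixset_rotate1[of x "xs @ ys" m] Cons.prems by simp
 also have "\<dots> = fixset m ((ys @ [x]) @ xs)" by (rule Cons.IH) (use Cons.prems in auto)
 finally show ?case by simp
qed simp

text \<open>The power fixes \<open>fw b + ?c (fw b)\<close>, a nonnegative combination of the other
  weights. A group element never raises the height of a dominant weight, so equality of heights in
  the sum forces it for every weight with positive coefficient, that is for the neighbours of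
  \<open>b\<close>.\<close>

lemma fixset_head:
 assumes "set (b # ws) = B" "distinct (b # ws)" and b: "b \<in> fixset m (b # ws)" and d: "d \<in> B" "d \<noteq> b" "b \<bullet> d \<noteq> 0"
 shows "d \<in> fixset m (b # ws)"
proof -
 let ?c = "word_elt root_refl (b # ws)"
 let ?g = "?c ^^ m"
 have bB: "b \<in> B" and sub: "set (b # ws) \<subseteq> B" using assms(1) by auto
 have cW: "?c \<in> W" by (rule word_W[OF sub])
 have gW: "?g \<in> W" by (rule W_pow[OF cW])
 have "word_elt root_refl ws (fw b) = fw b" by (rule word_fw) (use assms in auto)
 then have cb: "?c (fw b) = fw b - b" by (simp add: refl_fw[OF bB])
 have gb: "?g (fw b) = fw b" using b by (simp add: fixset_def)
 have "?g (?c (fw b)) = ?c (?g (fw b))" by (metis comp_apply funpow_Suc_right funpow.simps(2))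
 then have gcb: "?g (?c (fw b)) = ?c (fw b)" unfolding gb .
 let ?x = "fw b + ?c (fw b)"
 have gx: "?g ?x = ?x" unfolding linear_add[OF W_linear[OF gW]] gb gcb ..
 have "b = cartan b b *\<^sub>R fw b + (\<Sum>j\<in>B - {b}. cartan b j *\<^sub>R fw j)"
  using expand_fw[of b] sum.remove[OF finite_B bB, of "\<lambda>j. cartan b j *\<^sub>R fw j"] by simp
 then have "b = 2 *\<^sub>R fw b + (\<Sum>j\<in>B - {b}. cartan b j *\<^sub>R fw j)"
  using cartan_self[OF pos_nonzero[OF B_pos[OF bB]]] by simp
 then have x: "?x = (\<Sum>j\<in>B - {b}. - cartan b j *\<^sub>R fw j)"
  unfolding cb by (simp add: sum_negf scaleR_2 algebra_simps)
 have "local.ht (?g ?x) = (\<Sum>j\<in>B - {b}. - cartan b j * local.ht (?g (fw j)))"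
  unfolding x linear_sum[OF W_linear[OF gW]] linear_cmul[OF W_linear[OF gW]] by (simp add: ht_sum ht_scaleR ht_minus)
 moreover have "local.ht ?x = (\<Sum>j\<in>B - {b}. - cartan b j * local.ht (fw j))"
  unfolding x by (simp add: ht_sum ht_scaleR ht_minus)
 ultimately have "(\<Sum>j\<in>B - {b}. - cartan b j * (local.ht (fw j) - local.ht (?g (fw j)))) = 0"
  using gx by (simp add: right_diff_distrib sum_subtractf sum_negf)
 moreover have "0 \<le> - cartan b j * (local.ht (fw j) - local.ht (?g (fw j)))" if j: "j \<in> B - {b}" for j
 proof (rule mult_nonneg_nonneg)
  have "b \<bullet> j \<le> 0" by (rule simple_obtuse[OF bB]) (use j in auto)
  then show "0 \<le> - cartan b j" by (simp add: cartan_def divide_nonpos_nonneg)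
  show "0 \<le> local.ht (fw j) - local.ht (?g (fw j))" using ht_W_le[OF gW fw_dominant] by simp
 qed
 ultimately have "- cartan b d * (local.ht (fw d) - local.ht (?g (fw d))) = 0"
  using sum_nonneg_eq_0_iff[of "B - {b}" "\<lambda>j. - cartan b j * (local.ht (fw j) - local.ht (?g (fw j)))"] finite_B d by simp
 moreover have "cartan b d \<noteq> 0" using d pos_nonzero[OF B_pos[OF d(1)]] by (simp add: cartan_def)
 ultimately have "local.ht (?g (fw d)) = local.ht (fw d)" by simp
 then have "?g (fw d) = fw d" by (rule ht_W_eq[OF gW fw_dominant])
 then show ?thesis using d by (simp add: fixset_def)
qed

text \<open>The set of fundamental weights fixed by a power of a Coxeter element is invariant under rotating the word, so every
 simple root can be moved to the front; there, \<open>fw b + c (fw b)\<close> is a nonnegative combination of neighbouring weights.\<close>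

lemma coxeter_power_id:
 assumes bs: "set bs = B" "distinct bs" and b: "b \<in> B" "(word_elt root_refl bs ^^ m) (fw b) = fw b"
 shows "word_elt root_refl bs ^^ m = id"
proof -
 let ?J = "fixset m bs" and ?g = "word_elt root_refl bs ^^ m"
 have adj: "d \<in> ?J" if cd: "c \<in> ?J" "d \<in> B" "d \<noteq> c" "c \<bullet> d \<noteq> 0" for c d
 proof -
  have "c \<in> set bs" using cd(1) bs(1) by (simp add: fixset_def)
  then obtain xs ys where x: "bs = xs @ c # ys" by (meson split_list)
  have rot: "fixset m bs = fixset m (c # (ys @ xs))" using fixset_rotate[of xs "c # ys" m] bs x by auto
  show ?thesis unfolding rot
   by (rule fixset_head) (use bs x cd rot in auto)
 qed
 have "?J = B"
 proof (rule ccontr)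
  assume n: "?J \<noteq> B"
  have "?J \<subseteq> B" by (auto simp: fixset_def)
  moreover have "b \<in> ?J" using b by (simp add: fixset_def)
  ultimately have "\<exists>c\<in>?J. \<exists>d\<in>B - ?J. c \<bullet> d \<noteq> 0" by (intro B_connected) (use n in auto)
  then obtain c d where "c \<in> ?J" "d \<in> B - ?J" "c \<bullet> d \<noteq> 0" by (elim bexE)
  then show False using adj[of c d] by auto
 qed
 then have fx: "?g (fw j) = fw j" if "j \<in> B" for j using that by (auto simp: fixset_def)
 have gW: "?g \<in> W" by (rule W_pow[OF word_W]) (use bs in simp)
 have "?g x = x" for x
 proof -
  have "?g x = (\<Sum>j\<in>B. cartan x j *\<^sub>R ?g (fw j))"
   by (subst expand_fw[of x]) (simp only: linear_sum[OF W_linear[OF gW]] linear_cmul[OF W_linear[OF gW]])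
  also have "\<dots> = (\<Sum>j\<in>B. cartan x j *\<^sub>R fw j)" by (rule sum.cong) (simp_all add: fx)
  also have "\<dots> = x" by (rule expand_fw[symmetric])
  finally show ?thesis .
 qed
 then show ?thesis by (intro ext) simp
qed

lemma card_R: "card R = 2 * card pos"
proof -
 have "R = pos \<union> uminus ` pos"
 proof (intro equalityI subsetI)
  fix a assume a: "a \<in> R"
  show "a \<in> pos \<union> uminus ` pos"
  proof (cases "a \<in> pos")
   case False
   then have "- a \<in> pos" using notin_pos[OF a] by simp
   then have "- (- a) \<in> uminus ` pos" by (rule imageI)
   then show ?thesis by simp
  qed simp
 next
  fix a assume "a \<in> pos \<union> uminus ` pos"
  then show "a \<in> R" by (auto intro: neg_R pos_R)
 qed
 moreover have "card (pos \<union> uminus ` pos) = card pos + card (uminus ` pos)"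
  by (rule card_Un_disjoint) (use neg_notin_pos in auto)
 moreover have "card (uminus ` pos) = card pos" by (rule card_image) (simp add: inj_on_def)
 ultimately show ?thesis by simp
qed

text \<open>The vectors \<open>th b = fw b - c (fw b)\<close> are roots, and applying
  \<open>k < h\<close> powers of the Coxeter element \<open>c\<close> of order \<open>h\<close> to
  them lists every root exactly once. Hence \<open>card R = h * card B\<close>, to be compared with
  \<open>card_pos\<close>.\<close>

lemma coxeter_number_word:
 assumes bs: "set bs = B" "distinct bs"
 shows "(LEAST m. m > 0 \<and> word_elt root_refl bs ^^ m = id) = cnum"
proof -
 let ?c = "word_elt root_refl bs"
 let ?h = "LEAST m. m > 0 \<and> ?c ^^ m = id"
 have cW: "?c \<in> W" by (rule word_W) (use bs in simp)
 have pW: "?c ^^ m \<in> W" for m by (rule W_pow[OF cW])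
 have ex: "\<exists>m. m > 0 \<and> ?c ^^ m = id"
 proof -
  have "\<not> inj (\<lambda>m::nat. ?c ^^ m)"
  proof
   assume "inj (\<lambda>m::nat. ?c ^^ m)"
   moreover have "finite (range (\<lambda>m::nat. ?c ^^ m))" by (rule finite_subset[OF _ finite_W]) (use pW in auto)
   ultimately have "finite (UNIV :: nat set)" by (rule finite_imageD[rotated])
   then show False by simp
  qed
  then obtain i j :: nat where ij: "?c ^^ i = ?c ^^ j" "i \<noteq> j" unfolding inj_def by blast
  have *: "\<exists>m. m > 0 \<and> ?c ^^ m = id" if "?c ^^ i = ?c ^^ j" "i < j" for i j :: nat
  proof -
   have "?c ^^ j = ?c ^^ i \<circ> ?c ^^ (j - i)" using that(2) by (simp flip: funpow_add)
   then have "(?c ^^ i) ((?c ^^ (j - i)) x) = (?c ^^ i) x" for x using that(1) by (metis comp_apply)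
   then have "(?c ^^ (j - i)) x = x" for x unfolding W_inj_eq[OF pW] .
   then show ?thesis using that(2) by (intro exI[of _ "j - i"]) (simp add: fun_eq_iff)
  qed
  show ?thesis using ij *[of i j] *[of j i] by (cases "i < j") auto
 qed
 have h: "0 < ?h" "?c ^^ ?h = id" using LeastI_ex[OF ex] by simp_all
 have least: "m = 0" if "m < ?h" "?c ^^ m = id" for m using not_less_Least[OF that(1)] that(2) by auto
 have hx: "(?c ^^ ?h) x = x" for x using fun_cong[OF h(2)] by simp
 have fixed0: "x = 0" if "?c x = x" for x
  by (rule orth_zero) (rule word_fixed[OF bs(2) _ that], use bs in auto)
 define th where "th b = fw b - ?c (fw b)" for b
 have th_word: "th b = word_elt root_refl us b" if "bs = us @ b # vs" for us b vs
 proof -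
  have b: "b \<in> B" and us: "set us \<subseteq> B" "b \<notin> set us" and vs: "set vs \<subseteq> B" "b \<notin> set vs" using bs that by auto
  have "?c (fw b) = word_elt root_refl us (root_refl b (word_elt root_refl vs (fw b)))"
   unfolding that by (simp add: word_elt_append)
  also have "\<dots> = word_elt root_refl us (fw b - b)" by (simp add: word_fw[OF vs] refl_fw[OF b])
  also have "\<dots> = fw b - word_elt root_refl us b"
   by (simp add: linear_diff[OF W_linear[OF word_W[OF us(1)]]] word_fw[OF us])
  finally show ?thesis by (simp add: th_def)
 qed
 have thR: "th b \<in> R" if "b \<in> B" for b
 proof -
  have "b \<in> set bs" using that bs(1) by simp
  from split_list[OF this] obtain us vs where s: "bs = us @ b # vs" by (elim exE)
  show ?thesis unfolding th_word[OF s] by (rule W_R[OF word_W]) (use bs s that B_sub in auto)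
 qed
 define F where "F p = (?c ^^ snd p) (th (fst p))" for p
 have "bij_betw F (B \<times> {..<?h}) R"
  unfolding bij_betw_def
 proof
  have key: "b = d \<and> k = l" if "b \<in> B" "d \<in> B" "k \<le> l" "l < ?h" "(?c ^^ k) (th b) = (?c ^^ l) (th d)" for b d k l
  proof -
   \<comment> \<open>As \<open>th b\<close> is the difference of \<open>fw b\<close> and its image,
     equality of the two roots says that \<open>?c\<close> fixes \<open>?x\<close>. So
     \<open>?x\<close> is zero, and two dominant weights lie in one orbit.\<close>
   let ?x = "(?c ^^ k) (fw b) - (?c ^^ l) (fw d)"
   have cc: "(?c ^^ n) (?c x) = ?c ((?c ^^ n) x)" for n x by (metis comp_apply funpow_Suc_right funpow.simps(2))
   have "?c ?x = ?x" using that(5) unfolding th_def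
    by (simp add: linear_diff[OF W_linear[OF pW]] linear_diff[OF W_linear[OF cW]] cc algebra_simps)
   then have "?x = 0" by (rule fixed0)
   then have e: "(?c ^^ k) (fw b) = (?c ^^ l) (fw d)" by simp
   also have "(?c ^^ l) (fw d) = (?c ^^ k) ((?c ^^ (l - k)) (fw d))"
   proof -
    have "?c ^^ l = ?c ^^ k \<circ> ?c ^^ (l - k)" using that(3) by (simp flip: funpow_add)
    then show ?thesis by simp
   qed
   finally have e': "fw b = (?c ^^ (l - k)) (fw d)" unfolding W_inj_eq[OF pW] .
   then have "(?c ^^ (l - k)) (fw d) = fw d"
    by (intro dominant_unique[OF pW fw_dominant]) (metis fw_dominant)
   then have "b = d" "?c ^^ (l - k) = id" using e' fw_inj that coxeter_power_id[OF bs that(2)] by auto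
   then have "l - k = 0" using least[of "l - k"] that(4) by simp
   then show ?thesis using \<open>b = d\<close> that(3) by simp
  qed
  show "inj_on F (B \<times> {..<?h})"
  proof (rule inj_onI)
   fix p q assume p: "p \<in> B \<times> {..<?h}" and q: "q \<in> B \<times> {..<?h}" and e: "F p = F q"
   have "fst p = fst q \<and> snd p = snd q"
   proof (cases "snd p \<le> snd q")
    case True
    show ?thesis by (rule key) (use p q e True F_def in auto)
   next
    case False
    have "fst q = fst p \<and> snd q = snd p" by (rule key) (use p q e False F_def in auto)
    then show ?thesis by simp
   qed
   then show "p = q" by (simp add: prod_eq_iff)
  qed
  show "F ` (B \<times> {..<?h}) = R"
  proof (intro equalityI subsetI)
   fix a assume "a \<in> F ` (B \<times> {..<?h})"
   then show "a \<in> R" using thR W_R[OF pW] by (auto simp: F_def)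
  next
   fix a assume a: "a \<in> R"
   define x where "x k = (?c ^^ k) a" for k
   have xR: "x k \<in> R" for k unfolding x_def by (rule W_R[OF pW a])
   have xS: "x (Suc k) = ?c (x k)" for k by (simp add: x_def)
   have xh: "x (k + ?h) = x k" for k unfolding x_def funpow_add by (simp add: hx)
   \<comment> \<open>The sum over an orbit is a fixed vector, hence zero. The orbit therefore
     contains positive and negative roots, and somewhere steps from negative to positive, where a
     root \<open>th b\<close> is found.\<close>
   have "?c (\<Sum>k<?h. x k) = (\<Sum>k<?h. x (Suc k))" by (simp add: linear_sum[OF W_linear[OF cW]] xS)
   also have "\<dots> = (\<Sum>k<?h. x k)"
    using sum.lessThan_Suc_shift[of x ?h] sum.lessThan_Suc[of x ?h] xh[of 0] by simp
   finally have "(\<Sum>k<?h. x k) = 0" by (rule fixed0)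
   then have s0: "(\<Sum>k<?h. local.ht (x k)) = 0" by (metis ht_0 ht_sum)
   have ex_pos: "\<exists>k<?h. x k \<in> pos"
   proof (rule ccontr)
    assume "\<not> ?thesis"
    then have "0 < - local.ht (x k)" if "k \<in> {..<?h}" for k
     using that notin_pos[OF xR[of k]] ht_pos[of "- x k"] by (simp add: ht_minus)
    then have "0 < (\<Sum>k<?h. - local.ht (x k))" using h(1) by (intro sum_pos) auto
    then show False using s0 by (simp add: sum_negf)
   qed
   have ex_neg: "\<exists>k<?h. x k \<notin> pos"
   proof (rule ccontr)
    assume "\<not> ?thesis"
    then have "0 < (\<Sum>k<?h. local.ht (x k))" using h(1) ht_pos by (intro sum_pos) auto
    then show False using s0 by simp
   qed
   obtain p q where p: "p < ?h" "x p \<in> pos" and q: "q < ?h" "x q \<notin> pos" using ex_pos ex_neg by (elim exE conjE)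
   have "\<exists>k. x k \<notin> pos \<and> x (Suc k) \<in> pos"
   proof (rule ccontr)
    assume n: "\<not> ?thesis"
    have "x (q + j) \<notin> pos" for j
    proof (induction j)
     case (Suc j) then show ?case using n by auto
    qed (use q in simp)
    from this[of "p + ?h - q"] show False using xh[of p] p q by simp
   qed
   then obtain k where k: "x k \<notin> pos" "x (Suc k) \<in> pos" by (elim exE conjE)
   have "inv ?c (x (Suc k)) = x k" unfolding xS by (rule W_inv(2)[OF cW])
   then have "\<exists>us b vs. bs = us @ b # vs \<and> x (Suc k) = word_elt root_refl us b"
    using k bs by (intro inv_word_neg) simp_all
   then obtain us b vs where s: "bs = us @ b # vs" "x (Suc k) = word_elt root_refl us b" by (elim exE conjE)
   have b: "b \<in> B" using bs s by auto
   \<comment> \<open>Taking \<open>?h - 1\<close> times the \<open>Suc k\<close> steps undoes them,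
     since \<open>?c ^^ ?h\<close> is the identity.\<close>
   define m where "m = ((?h - 1) * Suc k) mod ?h"
   have tb: "th b = (?c ^^ Suc k) a" using s(2) unfolding th_word[OF s(1)] x_def by simp
   have "F (b, m) = (?c ^^ ((?h - 1) * Suc k)) (th b)" unfolding F_def m_def fst_conv snd_conv by (rule funpow_mod_eq[OF hx])
   also have "\<dots> = (?c ^^ ((?h - 1) * Suc k + Suc k)) a" unfolding tb funpow_add comp_apply ..
   also have "(?h - 1) * Suc k + Suc k = Suc k * ?h" using h(1) by (cases ?h) (simp_all add: algebra_simps)
   also have "(?c ^^ (Suc k * ?h)) a = a"
   proof -
    have "(?c ^^ ((Suc k * ?h) mod ?h)) a = (?c ^^ (Suc k * ?h)) a" by (rule funpow_mod_eq[OF hx])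
    then show ?thesis by simp
   qed
   finally have "a = F (b, m)" by (rule sym)
   moreover have "m < ?h" unfolding m_def using h(1) by simp
   ultimately show "a \<in> F ` (B \<times> {..<?h})" using b by (intro image_eqI[where x = "(b, m)"]) simp_all
  qed
 qed
 then have "card (B \<times> {..<?h}) = card R" by (rule bij_betw_same_card)
 then have "card B * ?h = cnum * card B" using card_R card_pos by (simp add: card_cartesian_product)
 moreover have "B \<noteq> {}" using nonempty R_spanB R_nz by auto
 then have "card B \<noteq> 0" using finite_B by simp
 ultimately show ?thesis by simp
qed

theorem coxeter_number_eq: "coxeter_number B = cnum"
proof -
 let ?bs = "SOME bs. distinct bs \<and> set bs = B"
 have "\<exists>bs. distinct bs \<and> set bs = B" using finite_distinct_list[OF finite_B] by blast
 then have "distinct ?bs \<and> set ?bs = B" by (rule someI_ex)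
 then have "(LEAST m. m > 0 \<and> word_elt root_refl ?bs ^^ m = id) = cnum" by (intro coxeter_number_word) simp_all
 moreover have "weyl_gen = (root_refl :: 'a \<Rightarrow> 'a \<Rightarrow> 'a)" by (simp add: weyl_gen_def fun_eq_iff)
 ultimately show ?thesis unfolding coxeter_number_def Let_def by simp
qed

end

section \<open>Moebius inversion over supports\<close>

text \<open>Inserting or removing a fixed element outside \<open>J\<close> pairs the sets and
  inverts the factor.\<close>

lemma prod_signs_cancel:
 fixes g :: "real fps"
 assumes S: "finite S" "J \<subseteq> S" "J \<noteq> S" and g: "g * inverse g = 1"
 shows "(\<Prod>I\<in>{I\<in>Pow S. J \<subseteq> I}. if even (card I + card S) then g else inverse g) = 1"
proof -
 obtain i where i: "i \<in> S" "i \<notin> J" using S by blast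
 let ?A = "{I\<in>Pow (S - {i}). J \<subseteq> I}" and ?h = "\<lambda>I::'a set. if even (card I + card S) then g else inverse g"
 have fin: "finite ?A" using S(1) by simp
 have sp: "{I\<in>Pow S. J \<subseteq> I} = ?A \<union> insert i ` ?A"
 proof (intro equalityI subsetI)
  fix I assume I: "I \<in> {I\<in>Pow S. J \<subseteq> I}"
  show "I \<in> ?A \<union> insert i ` ?A"
  proof (cases "i \<in> I")
   case True
   then have "I = insert i (I - {i})" by blast
   moreover have "I - {i} \<in> ?A" using I i by blast
   ultimately show ?thesis by blast
  qed (use I in blast)
 qed (use i in auto)
 have inj: "inj_on (insert i) ?A" by (rule inj_onI) blast
 have "prod ?h {I\<in>Pow S. J \<subseteq> I} = prod ?h ?A * prod ?h (insert i ` ?A)"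
  unfolding sp by (rule prod.union_disjoint) (use fin in auto)
 also have "prod ?h (insert i ` ?A) = (\<Prod>I\<in>?A. ?h (insert i I))" unfolding prod.reindex[OF inj] comp_def ..
 also have "prod ?h ?A * (\<Prod>I\<in>?A. ?h (insert i I)) = (\<Prod>I\<in>?A. ?h I * ?h (insert i I))" by (simp add: prod.distrib)
 also have "\<dots> = 1"
 proof (rule prod.neutral, rule ballI)
  fix I assume I: "I \<in> ?A"
  then have "finite I" "i \<notin> I" using S(1) finite_subset by auto
  then have "card (insert i I) = Suc (card I)" by simp
  then show "?h I * ?h (insert i I) = 1" using g by (simp add: mult.commute)
 qed
 finally show ?thesis .
qed

text \<open>After exchanging the two products, \<open>f x\<close> occurs for all \<open>I\<close>
  between \<open>sp x\<close> and \<open>S\<close> with alternating exponents, and these cancel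
  unless \<open>sp x = S\<close>.\<close>

lemma moebius_prod:
 fixes f :: "'x \<Rightarrow> real fps"
 assumes S: "finite S" and X: "finite X" "\<And>x. x \<in> X \<Longrightarrow> sp x \<subseteq> S" and f: "\<And>x. x \<in> X \<Longrightarrow> f x * inverse (f x) = 1"
 shows "(\<Prod>I\<in>Pow S. if even (card I + card S) then (\<Prod>x\<in>{x\<in>X. sp x \<subseteq> I}. f x) else inverse (\<Prod>x\<in>{x\<in>X. sp x \<subseteq> I}. f x))
  = (\<Prod>x\<in>{x\<in>X. sp x = S}. f x)"
proof -
 have inv: "inverse (\<Prod>x\<in>Y. f x) = (\<Prod>x\<in>Y. inverse (f x))" if "finite Y" for Y
  using that by (induction Y rule: finite_induct) (simp_all add: fps_inverse_mult)
 let ?h = "\<lambda>I x. if even (card I + card S) then f x else inverse (f x)"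
 have "(\<Prod>I\<in>Pow S. if even (card I + card S) then (\<Prod>x\<in>{x\<in>X. sp x \<subseteq> I}. f x) else inverse (\<Prod>x\<in>{x\<in>X. sp x \<subseteq> I}. f x))
  = (\<Prod>I\<in>Pow S. \<Prod>x\<in>{x\<in>X. sp x \<subseteq> I}. ?h I x)"
  by (rule prod.cong) (simp_all add: inv X(1))
 also have "\<dots> = (\<Prod>x\<in>X. \<Prod>I\<in>{I\<in>Pow S. sp x \<subseteq> I}. ?h I x)"
  by (rule prod.swap_restrict) (use S X in auto)
 also have "\<dots> = (\<Prod>x\<in>X. if sp x = S then f x else 1)"
 proof (rule prod.cong)
  fix x assume x: "x \<in> X"
  show "(\<Prod>I\<in>{I\<in>Pow S. sp x \<subseteq> I}. ?h I x) = (if sp x = S then f x else 1)"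
  proof (cases "sp x = S")
   case True
   then have "{I\<in>Pow S. sp x \<subseteq> I} = {S}" by auto
   then show ?thesis using True by simp
  next
   case False
   then show ?thesis using prod_signs_cancel[OF S X(2)[OF x] False f[OF x]] by simp
  qed
 qed simp
 also have "\<dots> = (\<Prod>x\<in>{x\<in>X. sp x = S}. f x)" using X(1) by (simp add: prod.If_cases Int_def)
 finally show ?thesis .
qed

definition om :: "nat \<Rightarrow> real fps" where "om m = 1 - fps_X ^ m"
text \<open>The factor that a positive root of height \<open>m\<close> contributes to the Poincare
  polynomial of a finite reflection group.\<close>

definition hf :: "nat \<Rightarrow> real fps" where "hf m = om (m + 1) * inverse (om m)"

lemma om_nth_0: "0 < m \<Longrightarrow> fps_nth (om m) 0 = 1" by (simp add: om_def)
lemma om_unit: "0 < m \<Longrightarrow> om m * inverse (om m) = 1" by (rule inverse_mult_eq_1') (simp add: om_nth_0)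
lemma hf_om: "0 < m \<Longrightarrow> hf m * om m = om (m + 1)" using om_unit[of m] by (simp add: hf_def mult_ac)
lemma hf_unit: "0 < m \<Longrightarrow> hf m * inverse (hf m) = 1" by (rule inverse_mult_eq_1') (simp add: hf_def om_nth_0)

lemma real_poly_eq:
 fixes p q :: "real poly"
 assumes "\<And>u. 0 < u \<Longrightarrow> u < 1 \<Longrightarrow> poly p u = poly q u"
 shows "p = q"
proof (rule ccontr)
 assume "p \<noteq> q"
 then have "finite {x. poly (p - q) x = 0}" by (intro poly_roots_finite) simp
 moreover have "{0<..<1} \<subseteq> {x. poly (p - q) x = 0}" using assms by auto
 ultimately have "finite {0<..<1::real}" using finite_subset by blast
 then show False using infinite_Ioo[of 0 "1::real"] by simp
qed

context based_roots
begin

lemma cox_len_Inv: "w \<in> W \<Longrightarrow> cox_len root_refl B w = card (Inv (inv w))"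
 using cox_len_eq(1)[OF subset_refl, of w] inversions_eq[of w] by (simp add: card_image inj_on_def fn_inj)

text \<open>Cleared of denominators, \<open>poinW_product\<close> is a polynomial identity and
  therefore one of power series. Passing to inverse elements reconciles \<open>cox_len\<close> with
  \<open>Inv\<close>.\<close>

theorem poincare_W: "poincare root_refl B B = (\<Prod>a\<in>pos. hf (nht a))"
proof -
 define p where "p = (\<Sum>w\<in>W. monom 1 (card (Inv w)) :: real poly)"
 define q where "q m = (1 - monom 1 m :: real poly)" for m
 have "p * (\<Prod>a\<in>pos. q (nht a)) = (\<Prod>a\<in>pos. q (nht a + 1))"
 proof (rule real_poly_eq)
  fix u :: real assume u: "0 < u" "u < 1"
  have "u ^ nht a < 1" if "a \<in> pos" for a using u nht_ge_1[OF that] by (simp add: power_less_one_iff)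
  then have "(\<Prod>a\<in>pos. 1 - u ^ nht a) \<noteq> 0" by (force simp: prod_zero_iff)
  then have "poinW u * (\<Prod>a\<in>pos. 1 - u ^ nht a) = (\<Prod>a\<in>pos. 1 - u ^ (nht a + 1))" using poinW_product[OF u] by simp
  then show "poly (p * (\<Prod>a\<in>pos. q (nht a))) u = poly (\<Prod>a\<in>pos. q (nht a + 1)) u"
   by (simp add: p_def q_def poinW_def poly_sum poly_prod poly_monom)
 qed
 then have "fps_of_poly (p * (\<Prod>a\<in>pos. q (nht a))) = fps_of_poly (\<Prod>a\<in>pos. q (nht a + 1))" by (rule arg_cong)
 then have e: "fps_of_poly p * (\<Prod>a\<in>pos. om (nht a)) = (\<Prod>a\<in>pos. om (nht a + 1))"
  by (simp add: fps_of_poly_mult fps_of_poly_prod q_def om_def fps_of_poly_diff fps_of_poly_monom)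
 have "(\<Prod>a\<in>pos. hf (nht a)) * (\<Prod>a\<in>pos. om (nht a)) = (\<Prod>a\<in>pos. om (nht a + 1))"
 proof (unfold prod.distrib[symmetric], rule prod.cong)
  fix a assume "a \<in> pos"
  then have "0 < nht a" using nht_ge_1 by (simp add: Suc_le_eq)
  then show "hf (nht a) * om (nht a) = om (nht a + 1)" by (rule hf_om)
 qed simp
 moreover have "(\<Prod>a\<in>pos. om (nht a)) \<noteq> 0"
 proof -
  have "om (nht a) \<noteq> 0" if "a \<in> pos" for a using om_unit[of "nht a"] nht_ge_1[OF that] by auto
  then show ?thesis by (simp add: prod_zero_iff)
 qed
 ultimately have pe: "fps_of_poly p = (\<Prod>a\<in>pos. hf (nht a))" using e by (metis mult_right_cancel)
 have "poincare root_refl B B = fps_of_poly p"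
 proof (rule fps_ext)
  fix k
  have "{x \<in> W. cox_len root_refl B x = k} = {x \<in> W. card (Inv (inv x)) = k}" using cox_len_Inv by auto
  also have "card \<dots> = card {x \<in> W. card (Inv x) = k}"
  proof (rule bij_betw_same_card, rule bij_betw_byWitness[where f' = inv])
   show "\<forall>a\<in>{x \<in> W. card (Inv (inv x)) = k}. inv (inv a) = a" "\<forall>a\<in>{x \<in> W. card (Inv x) = k}. inv (inv a) = a"
    using inv_inv by auto
   show "inv ` {x \<in> W. card (Inv (inv x)) = k} \<subseteq> {x \<in> W. card (Inv x) = k}"
    "inv ` {x \<in> W. card (Inv x) = k} \<subseteq> {x \<in> W. card (Inv (inv x)) = k}"
    using inv_inv W_inv(1) by auto
  qed
  also have "real \<dots> = fps_nth (fps_of_poly p) k"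
   by (simp add: p_def coeff_sum coeff_monom sum.If_cases Int_def)
  finally show "fps_nth (poincare root_refl B B) k = fps_nth (fps_of_poly p) k" by (simp add: poincare_def)
 qed
 then show ?thesis unfolding pe .
qed

end

section \<open>Affine roots and finite parabolic subgroups\<close>

definition aform :: "'a::euclidean_space \<times> int \<Rightarrow> 'a \<Rightarrow> real" where
 "aform x v = fst x \<bullet> v + of_int (snd x)"

lemma aform_inj: assumes "aform x = aform y" shows "x = y"
proof -
 have e: "fst x \<bullet> v + of_int (snd x) = fst y \<bullet> v + of_int (snd y)" for v using fun_cong[OF assms, of v] by (simp add: aform_def)
 have s: "snd x = snd y" using e[of 0] by simp
 have "(fst x - fst y) \<bullet> (fst x - fst y) = 0" using e[of "fst x - fst y"] s by (simp add: inner_diff_left)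
 then show ?thesis using s by (simp add: prod_eq_iff)
qed

lemma aff_refl_aform: "aff_refl x v = v - (2 * aform x v / (fst x \<bullet> fst x)) *\<^sub>R fst x"
 by (cases x) (simp add: aff_refl_def aform_def mult.commute)

text \<open>The reflection in \<open>x\<close> acting on affine roots; the coefficient is an integer for roots.\<close>
definition arefl :: "'a::euclidean_space \<times> int \<Rightarrow> 'a \<times> int \<Rightarrow> 'a \<times> int" where
 "arefl x y = (root_refl (fst x) (fst y), snd y - \<lfloor>cartan (fst y) (fst x)\<rfloor> * snd x)"

text \<open>A common frame for the finite system (\<open>\<Phi> = R \<times> {0}\<close>) and the affine system (\<open>\<Phi> = R \<times> UNIV\<close>).\<close>

locale affine_roots = based_roots R B for R B :: "'a::euclidean_space set" +
 fixes \<Phi> :: "('a \<times> int) set" and S :: "'g set" and r :: "'g \<Rightarrow> 'a \<times> int" and cf :: "'a \<times> int \<Rightarrow> 'g \<Rightarrow> int"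
 assumes finite_S: "finite S"
  and r_in: "i \<in> S \<Longrightarrow> r i \<in> \<Phi>"
  and \<Phi>_R: "x \<in> \<Phi> \<Longrightarrow> fst x \<in> R"
  and expand_fst: "x \<in> \<Phi> \<Longrightarrow> fst x = (\<Sum>i\<in>S. of_int (cf x i) *\<^sub>R fst (r i))"
  and expand_snd: "x \<in> \<Phi> \<Longrightarrow> snd x = (\<Sum>i\<in>S. cf x i * snd (r i))"
  and uniq: "(\<Sum>i\<in>S. of_int (m i) *\<^sub>R fst (r i)) = 0 \<Longrightarrow> (\<Sum>i\<in>S. m i * snd (r i)) = 0 \<Longrightarrow> i \<in> S \<Longrightarrow> m i = 0"
  and cf_sign: "x \<in> \<Phi> \<Longrightarrow> (\<forall>i\<in>S. 0 \<le> cf x i) \<or> (\<forall>i\<in>S. cf x i \<le> 0)"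
  and arefl_in: "x \<in> \<Phi> \<Longrightarrow> y \<in> \<Phi> \<Longrightarrow> arefl x y \<in> \<Phi>"
begin

definition s :: "'g \<Rightarrow> 'a \<Rightarrow> 'a" where "s i = aff_refl (r i)"
definition apos :: "('a \<times> int) set" where "apos = {x \<in> \<Phi>. \<forall>i\<in>S. 0 \<le> cf x i}"
definition sup :: "'a \<times> int \<Rightarrow> 'g set" where "sup x = {i \<in> S. cf x i \<noteq> 0}"
definition aht :: "'a \<times> int \<Rightarrow> int" where "aht x = (\<Sum>i\<in>S. cf x i)"

lemma fst_nz: "x \<in> \<Phi> \<Longrightarrow> fst x \<noteq> 0" using \<Phi>_R zero_notin by metis

lemma cf_unique:
 assumes x: "x \<in> \<Phi>" and "fst x = (\<Sum>i\<in>S. of_int (m i) *\<^sub>R fst (r i))" "snd x = (\<Sum>i\<in>S. m i * snd (r i))" and i: "i \<in> S"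
 shows "cf x i = m i"
proof -
 have "(\<Sum>i\<in>S. of_int (cf x i - m i) *\<^sub>R fst (r i)) = 0"
  using expand_fst[OF x] assms(2) by (simp add: scaleR_left_diff_distrib sum_subtractf)
 moreover have "(\<Sum>i\<in>S. (cf x i - m i) * snd (r i)) = 0"
  using expand_snd[OF x] assms(3) by (simp add: left_diff_distrib sum_subtractf)
 ultimately show ?thesis using uniq[of "\<lambda>i. cf x i - m i", OF _ _ i] by simp
qed

lemma cf_r: assumes "i \<in> S" "j \<in> S" shows "cf (r i) j = (if j = i then 1 else 0)"
proof (rule cf_unique[OF r_in[OF assms(1)] _ _ assms(2)])
 have "(\<Sum>j\<in>S. of_int (if j = i then 1 else 0) *\<^sub>R fst (r j)) = (\<Sum>j\<in>S. if j = i then fst (r j) else 0)"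
  by (rule sum.cong) auto
 then show "fst (r i) = (\<Sum>j\<in>S. of_int (if j = i then 1 else 0) *\<^sub>R fst (r j))" using assms(1) finite_S by simp
 have "(\<Sum>j\<in>S. (if j = i then 1 else 0) * snd (r j)) = (\<Sum>j\<in>S. if j = i then snd (r j) else 0)"
  by (rule sum.cong) auto
 then show "snd (r i) = (\<Sum>j\<in>S. (if j = i then 1 else 0) * snd (r j))" using assms(1) finite_S by simp
qed

lemma cartan_floor: "x \<in> \<Phi> \<Longrightarrow> y \<in> \<Phi> \<Longrightarrow> of_int \<lfloor>cartan (fst y) (fst x)\<rfloor> = cartan (fst y) (fst x)"
 using cartan_int[OF \<Phi>_R \<Phi>_R, of y x] by (auto elim!: Ints_cases)

lemma aform_refl: assumes "x \<in> \<Phi>" "y \<in> \<Phi>" shows "aform y (aff_refl x v) = aform (arefl x y) v"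
proof -
 have "aform (arefl x y) v = root_refl (fst x) (fst y) \<bullet> v + of_int (snd y) - cartan (fst y) (fst x) * of_int (snd x)"
  using cartan_floor[OF assms] by (simp add: aform_def arefl_def)
 also have "\<dots> = fst y \<bullet> v + of_int (snd y) - cartan (fst y) (fst x) * aform x v"
  by (simp add: root_refl_cartan aform_def inner_diff_left algebra_simps)
 also have "\<dots> = aform y (aff_refl x v)"
  unfolding aff_refl_aform by (simp add: aform_def[of y] cartan_def inner_diff_right)
 finally show ?thesis by simp
qed

lemma cf_arefl: assumes "x \<in> \<Phi>" "y \<in> \<Phi>" "j \<in> S"
 shows "cf (arefl x y) j = cf y j - \<lfloor>cartan (fst y) (fst x)\<rfloor> * cf x j"
proof (rule cf_unique[OF arefl_in[OF assms(1,2)] _ _ assms(3)])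
 define n where "n = \<lfloor>cartan (fst y) (fst x)\<rfloor>"
 have f: "fst (arefl x y) = fst y - of_int n *\<^sub>R fst x"
  unfolding n_def arefl_def fst_conv root_refl_cartan cartan_floor[OF assms(1,2)] ..
 have g: "snd (arefl x y) = snd y - n * snd x" by (simp add: n_def arefl_def)
 note f
 also have "fst y - of_int n *\<^sub>R fst x = (\<Sum>i\<in>S. of_int (cf y i) *\<^sub>R fst (r i)) - of_int n *\<^sub>R (\<Sum>i\<in>S. of_int (cf x i) *\<^sub>R fst (r i))"
  by (simp only: expand_fst[OF assms(1), symmetric] expand_fst[OF assms(2), symmetric])
 also have "\<dots> = (\<Sum>i\<in>S. of_int (cf y i - n * cf x i) *\<^sub>R fst (r i))"
  by (simp add: scaleR_sum_right sum_subtractf[symmetric] scaleR_left_diff_distrib)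
 finally show "fst (arefl x y) = (\<Sum>i\<in>S. of_int (cf y i - \<lfloor>cartan (fst y) (fst x)\<rfloor> * cf x i) *\<^sub>R fst (r i))" unfolding n_def .
 have "snd y - n * snd x = (\<Sum>i\<in>S. cf y i * snd (r i)) - n * (\<Sum>i\<in>S. cf x i * snd (r i))"
  by (simp only: expand_snd[OF assms(1), symmetric] expand_snd[OF assms(2), symmetric])
 also have "\<dots> = (\<Sum>i\<in>S. (cf y i - n * cf x i) * snd (r i))"
  by (simp add: sum_distrib_left sum_subtractf[symmetric] left_diff_distrib mult.assoc)
 finally show "snd (arefl x y) = (\<Sum>i\<in>S. (cf y i - \<lfloor>cartan (fst y) (fst x)\<rfloor> * cf x i) * snd (r i))" unfolding g n_def .
qed

lemma uminus_in: assumes "x \<in> \<Phi>" shows "- x \<in> \<Phi>" "i \<in> S \<Longrightarrow> cf (- x) i = - cf x i"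
proof -
 have c: "cartan (fst x) (fst x) = 2" by (rule cartan_self[OF fst_nz[OF assms]])
 have e: "arefl x x = - x" unfolding arefl_def c by (simp add: root_refl_cartan c prod_eq_iff scaleR_2)
 show "- x \<in> \<Phi>" using arefl_in[OF assms assms] unfolding e .
 show "i \<in> S \<Longrightarrow> cf (- x) i = - cf x i" using cf_arefl[OF assms assms] unfolding e c by simp
qed

lemma apos_\<Phi>: "x \<in> apos \<Longrightarrow> x \<in> \<Phi>" by (simp add: apos_def)

lemma apos_I: assumes "x \<in> \<Phi>" "j \<in> S" "0 < cf x j" shows "x \<in> apos"
 using cf_sign[OF assms(1)] assms by (force simp: apos_def)

lemma cf_nz: assumes "x \<in> \<Phi>" shows "\<exists>i\<in>S. cf x i \<noteq> 0"
proof (rule ccontr)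
 assume "\<not> ?thesis"
 then have "fst x = 0" using expand_fst[OF assms] by simp
 then show False using fst_nz[OF assms] by simp
qed

lemma aform_minus: "(\<lambda>v. - aform x v) = aform (- x)" by (simp add: aform_def fun_eq_iff)

lemma s_R: "i \<in> S \<Longrightarrow> fst (r i) \<in> R" by (rule \<Phi>_R[OF r_in])

definition lin :: "('a \<Rightarrow> 'a) \<Rightarrow> 'a \<Rightarrow> 'a" where "lin w v = w v - w 0"

lemma lin_s: "lin (s i \<circ> w) = root_refl (fst (r i)) \<circ> lin w"
proof
 fix v
 have "aform (r i) (w v) - aform (r i) (w 0) = lin w v \<bullet> fst (r i)"
  by (simp add: aform_def lin_def inner_diff_right inner_diff_left inner_commute)
 then have *: "2 * aform (r i) (w v) / (fst (r i) \<bullet> fst (r i)) - 2 * aform (r i) (w 0) / (fst (r i) \<bullet> fst (r i)) = cartan (lin w v) (fst (r i))"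
  by (simp add: cartan_def diff_divide_distrib[symmetric] right_diff_distrib[symmetric])
 have "lin (s i \<circ> w) v = (w v - w 0) - (2 * aform (r i) (w v) / (fst (r i) \<bullet> fst (r i)) - 2 * aform (r i) (w 0) / (fst (r i) \<bullet> fst (r i))) *\<^sub>R fst (r i)"
  by (simp add: lin_def s_def aff_refl_aform scaleR_left_diff_distrib)
 then show "lin (s i \<circ> w) v = (root_refl (fst (r i)) \<circ> lin w) v"
  unfolding * by (simp add: root_refl_cartan lin_def)
qed

lemma lin_id: "lin id = id" by (simp add: lin_def fun_eq_iff)

lemma lin_W: assumes "w \<in> gen_subgroup s S" shows "lin w \<in> W"
 using assms
proof (induction rule: gen_subgroup_induct)
 case id show ?case unfolding lin_id by (rule gen_subgroup_id)
next
 case (step i w)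
 show ?case unfolding lin_s by (rule W_comp[OF refl_W[OF s_R[OF step(1)]] step(3)])
qed

lemma lin_word: "lin (word_elt s ws) = word_elt root_refl (map (\<lambda>i. fst (r i)) ws)"
 by (induction ws) (simp_all only: word_elt_Nil word_elt_Cons list.map lin_id lin_s)

sublocale A: reflection_system s S "aform ` apos" "\<lambda>i. aform (r i)"
proof
 fix f assume "f \<in> aform ` apos"
 then obtain x where x: "x \<in> apos" "f = aform x" by (elim imageE)
 show "(\<lambda>v. - f v) \<notin> aform ` apos"
 proof
  assume "(\<lambda>v. - f v) \<in> aform ` apos"
  then obtain y where "y \<in> apos" "(\<lambda>v. - f v) = aform y" by (elim imageE)
  then have y: "y \<in> apos" "aform (- x) = aform y" unfolding x(2) aform_minus by simp_all
  have m: "- x \<in> apos" unfolding aform_inj[OF y(2)] by (rule y(1))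
  obtain i where "i \<in> S" "cf x i \<noteq> 0" using cf_nz[OF apos_\<Phi>[OF x(1)]] by (elim bexE)
  then show False using x(1) m uminus_in(2)[OF apos_\<Phi>[OF x(1)], of i] by (force simp: apos_def)
 qed
next
 fix i assume i: "i \<in> S"
 show "aform (r i) \<in> aform ` apos" using r_in[OF i] cf_r[OF i] by (intro imageI) (simp add: apos_def)
 have nz: "fst (r i) \<bullet> fst (r i) \<noteq> 0" using fst_nz[OF r_in[OF i]] by simp
 have a: "aform (r i) (aff_refl (r i) v) = - aform (r i) v" for v
 proof -
  define c where "c = 2 * aform (r i) v / (fst (r i) \<bullet> fst (r i))"
  have "aff_refl (r i) v = v - c *\<^sub>R fst (r i)" unfolding c_def by (rule aff_refl_aform)
  then have "aform (r i) (aff_refl (r i) v) = aform (r i) v - c * (fst (r i) \<bullet> fst (r i))"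
   by (simp add: aform_def inner_diff_right)
  also have "c * (fst (r i) \<bullet> fst (r i)) = 2 * aform (r i) v" unfolding c_def using nz by simp
  finally show ?thesis by simp
 qed
 show "aform (r i) \<circ> s i = (\<lambda>v. - aform (r i) v)" by (simp add: fun_eq_iff s_def a)
 show "s i \<circ> s i = id"
 proof
  fix v
  define c where "c = 2 * aform (r i) v / (fst (r i) \<bullet> fst (r i))"
  have 1: "aff_refl (r i) v = v - c *\<^sub>R fst (r i)" unfolding c_def by (rule aff_refl_aform)
  have "aff_refl (r i) (aff_refl (r i) v) = aff_refl (r i) v - (2 * aform (r i) (aff_refl (r i) v) / (fst (r i) \<bullet> fst (r i))) *\<^sub>R fst (r i)"
   by (rule aff_refl_aform)
  also have "2 * aform (r i) (aff_refl (r i) v) / (fst (r i) \<bullet> fst (r i)) = - c" unfolding a c_def by simp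
  finally have "aff_refl (r i) (aff_refl (r i) v) = aff_refl (r i) v - - c *\<^sub>R fst (r i)" .
  also have "\<dots> = v" by (subst 1) simp
  finally have "aff_refl (r i) (aff_refl (r i) v) = v" .
  then show "(s i \<circ> s i) v = id v" by (simp add: s_def)
 qed
next
 fix i f assume i: "i \<in> S" and "f \<in> aform ` apos" and n: "f \<noteq> aform (r i)"
 then obtain x where x: "x \<in> apos" "f = aform x" by (elim imageE)
 have xP: "x \<in> \<Phi>" by (rule apos_\<Phi>[OF x(1)])
 \<comment> \<open>As in \<open>refl_pos\<close>: reducedness of the gradients leaves only
   \<open>r i\<close> as a positive root supported on \<open>i\<close>, and any other nonzero
   coefficient is untouched by \<open>s i\<close> and keeps the image positive.\<close>
 have "\<exists>j\<in>S. j \<noteq> i \<and> cf x j \<noteq> 0"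
 proof (rule ccontr)
  assume "\<not> ?thesis"
  then have z: "cf x j = 0" if "j \<in> S" "j \<noteq> i" for j using that by blast
  have "fst x = (\<Sum>j\<in>S. if j = i then of_int (cf x i) *\<^sub>R fst (r i) else 0)"
   unfolding expand_fst[OF xP] by (rule sum.cong) (auto simp: z)
  then have f1: "fst x = of_int (cf x i) *\<^sub>R fst (r i)" using i finite_S by simp
  have "snd x = (\<Sum>j\<in>S. if j = i then cf x i * snd (r i) else 0)"
   unfolding expand_snd[OF xP] by (rule sum.cong) (auto simp: z)
  then have f2: "snd x = cf x i * snd (r i)" using i finite_S by simp
  have "of_int (cf x i) = (1::real) \<or> of_int (cf x i) = (-1::real)"
   by (rule red[OF s_R[OF i]]) (use \<Phi>_R[OF xP] f1 in simp)
  moreover have "0 \<le> cf x i" using x(1) i by (simp add: apos_def)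
  ultimately have "cf x i = 1" by linarith
  then have "x = r i" using f1 f2 by (simp add: prod_eq_iff)
  then show False using n x(2) by simp
 qed
 then obtain j where j: "j \<in> S" "j \<noteq> i" "cf x j \<noteq> 0" by (elim bexE conjE)
 have "0 < cf x j" using j x(1) by (simp add: apos_def less_le)
 then have "0 < cf (arefl (r i) x) j" unfolding cf_arefl[OF r_in[OF i] xP j(1)] using cf_r[OF i j(1)] j(2) by simp
 then have "arefl (r i) x \<in> apos" by (rule apos_I[OF arefl_in[OF r_in[OF i] xP] j(1)])
 moreover have "f \<circ> s i = aform (arefl (r i) x)" unfolding x(2) s_def by (simp add: fun_eq_iff aform_refl[OF r_in[OF i] xP])
 ultimately show "f \<circ> s i \<in> aform ` apos" by (simp only: imageI)
next
 fix i j w assume i: "i \<in> S" and j: "j \<in> S" and w: "w \<in> gen_subgroup s S" and e: "aform (r i) \<circ> w = aform (r j)"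
 have L: "lin w \<in> W" by (rule lin_W[OF w])
 have wv: "w v = lin w v + w 0" for v by (simp add: lin_def)
 have e': "aform (r i) (w v) = aform (r j) v" for v using fun_cong[OF e, of v] by simp
 have "fst (r i) \<bullet> lin w v = fst (r j) \<bullet> v" for v
  using e'[of v] e'[of 0] by (simp add: aform_def lin_def inner_diff_right)
 then have "inv (lin w) (fst (r i)) \<bullet> v = fst (r j) \<bullet> v" for v
  using W_inner_inv[OF L, of v "fst (r i)"] by (simp add: inner_commute)
 then have "inv (lin w) (fst (r i)) = fst (r j)" by (metis vector_eq_rdot)
 then have lb: "lin w (fst (r j)) = fst (r i)" using W_inv(3)[OF L] by metis
 then have nn: "fst (r i) \<bullet> fst (r i) = fst (r j) \<bullet> fst (r j)" using W_inner[OF L] by metis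
 show "s i \<circ> w = w \<circ> s j"
 proof
  fix v
  define n where "n = 2 * aform (r j) v / (fst (r j) \<bullet> fst (r j))"
  have sj: "s j v = v - n *\<^sub>R fst (r j)" unfolding s_def aff_refl_aform n_def ..
  have si: "s i (w v) = w v - n *\<^sub>R fst (r i)" unfolding s_def aff_refl_aform n_def e' nn ..
  have "w (s j v) = lin w (v - n *\<^sub>R fst (r j)) + w 0" unfolding sj by (rule wv)
  also have "\<dots> = lin w v - n *\<^sub>R fst (r i) + w 0"
   unfolding linear_diff[OF W_linear[OF L]] linear_cmul[OF W_linear[OF L]] lb ..
  also have "\<dots> = s i (w v)" unfolding si by (simp add: lin_def)
  finally show "(s i \<circ> w) v = (w \<circ> s j) v" by simp
 qed
qed

lemma cox_len_sub: assumes "I \<subseteq> S" "w \<in> gen_subgroup s I" shows "cox_len s S w = cox_len s I w"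
 using A.cox_len_eq(1)[OF assms] A.cox_len_eq(1)[OF subset_refl, of w] gen_subgroup_mono[OF assms(1)] assms(2) by auto

lemma apos_zero: "x \<in> apos \<Longrightarrow> 0 < aht x"
proof -
 assume x: "x \<in> apos"
 obtain i where i: "i \<in> S" "cf x i \<noteq> 0" using cf_nz[OF apos_\<Phi>[OF x]] by (elim bexE)
 show "0 < aht x" unfolding aht_def
  by (rule sum_pos2[OF finite_S i(1)]) (use i x in \<open>auto simp: apos_def less_le\<close>)
qed

text \<open>Independent gradients give the forms in \<open>I\<close> a common zero, which the
  subgroup fixes. Its elements are then determined by their linear parts, words correspond to words
  of the same length, and the gradients of the roots supported on \<open>I\<close> form a finite
  root system with the same heights, to which \<open>poincare_W\<close> applies.\<close>

theorem parabolic_poincare: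
 assumes I: "I \<subseteq> S" and ind: "independent ((\<lambda>i. fst (r i)) ` I)" and inj: "inj_on (\<lambda>i. fst (r i)) I"
 shows "poincare s S I = (\<Prod>x\<in>{x\<in>apos. sup x \<subseteq> I}. hf (nat (aht x)))"
  and "finite {x\<in>apos. sup x \<subseteq> I}"
proof -
 let ?b = "\<lambda>i. fst (r i)"
 define D where "D = {x\<in>\<Phi>. sup x \<subseteq> I}"
 let ?R = "fst ` D" and ?B = "?b ` I"
 have finI: "finite I" by (rule finite_subset[OF I finite_S])
 have DP: "x \<in> \<Phi>" if "x \<in> D" for x using that by (simp add: D_def)
 have Dz: "cf x i = 0" if "x \<in> D" "i \<in> S" "i \<notin> I" for x i using that by (auto simp: D_def sup_def)
 have Dfst: "fst x = (\<Sum>i\<in>I. of_int (cf x i) *\<^sub>R ?b i)" and Dsnd: "snd x = (\<Sum>i\<in>I. cf x i * snd (r i))" if "x \<in> D" for x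
  unfolding expand_fst[OF DP[OF that]] expand_snd[OF DP[OF that]]
  by (rule sum.mono_neutral_right[OF finite_S I]; use Dz[OF that] in auto)+
 have rep: "representation ?B (fst x) (?b i) = of_int (cf x i)" if x: "x \<in> D" and i: "i \<in> I" for x i
 proof -
  define g where "g b = (of_int (cf x (the_inv_into I ?b b)) :: real)" for b
  have g: "g (?b j) = of_int (cf x j)" if "j \<in> I" for j unfolding g_def the_inv_into_f_f[OF inj that] ..
  have "fst x = (\<Sum>b\<in>?B. g b *\<^sub>R b)" unfolding sum.reindex[OF inj] comp_def Dfst[OF x] by (rule sum.cong) (simp_all add: g)
  then have "representation ?B (fst x) (?b i) = representation ?B (\<Sum>b\<in>?B. g b *\<^sub>R b) (?b i)" by (rule arg_cong)
  also have "\<dots> = (\<Sum>b\<in>?B. representation ?B (g b *\<^sub>R b) (?b i))"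
   by (subst real_vector.representation_sum[OF ind]) (auto intro: span_mul span_base)
  also have "\<dots> = (\<Sum>b\<in>?B. if b = ?b i then g (?b i) else 0)"
   by (rule sum.cong) (auto simp: real_vector.representation_scale[OF ind] real_vector.representation_basis[OF ind] span_base)
  also have "\<dots> = g (?b i)" using finI i by simp
  finally show ?thesis using g[OF i] by simp
 qed
 have D_inj: "inj_on fst D"
 proof (rule inj_onI)
  fix x y assume x: "x \<in> D" and y: "y \<in> D" and e: "fst x = fst y"
  have "real_of_int (cf x i) = of_int (cf y i)" if "i \<in> I" for i using rep[OF x that] rep[OF y that] e by simp
  then have "snd x = snd y" unfolding Dsnd[OF x] Dsnd[OF y] by simp
  then show "x = y" using e by (simp add: prod_eq_iff)
 qed
 have D_I: "x \<in> D" if "x \<in> \<Phi>" "\<And>i. i \<in> S \<Longrightarrow> i \<notin> I \<Longrightarrow> cf x i = 0" for x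
  using that unfolding D_def sup_def by blast
 have rD: "r i \<in> D" if i: "i \<in> I" for i
 proof (rule D_I)
  have iS: "i \<in> S" using i I by (rule rev_subsetD)
  show "r i \<in> \<Phi>" by (rule r_in[OF iS])
  show "cf (r i) j = 0" if "j \<in> S" "j \<notin> I" for j using cf_r[OF iS that(1)] that(2) i by (cases "j = i") simp_all
 qed
 have areflD: "arefl x y \<in> D" if "x \<in> D" "y \<in> D" for x y
 proof (rule D_I)
  show "arefl x y \<in> \<Phi>" by (rule arefl_in[OF DP[OF that(1)] DP[OF that(2)]])
  show "cf (arefl x y) i = 0" if "i \<in> S" "i \<notin> I" for i
   unfolding cf_arefl[OF DP[OF \<open>x \<in> D\<close>] DP[OF \<open>y \<in> D\<close>] that(1)] using Dz[OF \<open>x \<in> D\<close> that] Dz[OF \<open>y \<in> D\<close> that] by simp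
 qed
 have br: "based_roots ?R ?B"
 proof
  show "finite ?R" by (rule finite_subset[OF _ finite_R]) (use \<Phi>_R[OF DP] in blast)
  show "?B \<subseteq> ?R" using rD by (intro image_subsetI imageI)
  show "independent ?B" by (rule ind)
  show "root_refl a x \<in> ?R" if "a \<in> ?R" "x \<in> ?R" for a x
  proof -
   obtain y z where "y \<in> D" "z \<in> D" "a = fst y" "x = fst z" using \<open>a \<in> ?R\<close> \<open>x \<in> ?R\<close> by (elim imageE)
   then have "arefl y z \<in> D" "root_refl a x = fst (arefl y z)" using areflD by (simp_all add: arefl_def)
   then show ?thesis by (intro image_eqI)
  qed
  have RR: "a \<in> R" if "a \<in> ?R" for a using that \<Phi>_R[OF DP] by (elim imageE) simp
  show "cartan a b \<in> \<int>" if "a \<in> ?R" "b \<in> ?R" for a b by (rule cartan_int[OF RR RR, OF that])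
  show "c = 1 \<or> c = -1" if "a \<in> ?R" "c *\<^sub>R a \<in> ?R" for a c by (rule red[OF RR RR, OF that])
  show "0 \<notin> ?R" using RR zero_notin by metis
  show "?R \<subseteq> span ?B"
  proof (rule image_subsetI)
   fix x assume "x \<in> D"
   show "fst x \<in> span ?B" unfolding Dfst[OF \<open>x \<in> D\<close>] by (intro span_sum span_mul span_base imageI)
  qed
  show "(\<forall>b\<in>?B. 0 \<le> representation ?B a b) \<or> (\<forall>b\<in>?B. representation ?B a b \<le> 0)" if aR: "a \<in> ?R" for a
  proof -
   obtain x where x: "x \<in> D" "a = fst x" using aR by (elim imageE)
   have S: "i \<in> S" if "i \<in> I" for i using that I by (rule rev_subsetD)
   from cf_sign[OF DP[OF x(1)]] show ?thesis
   proof
    assume "\<forall>i\<in>S. 0 \<le> cf x i"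
    then have "\<forall>i\<in>I. 0 \<le> representation ?B a (?b i)" using S rep[OF x(1)] unfolding x(2) by simp
    then show ?thesis by simp
   next
    assume "\<forall>i\<in>S. cf x i \<le> 0"
    then have "\<forall>i\<in>I. representation ?B a (?b i) \<le> 0" using S rep[OF x(1)] unfolding x(2) by simp
    then show ?thesis by simp
   qed
  qed
 qed
 interpret P: based_roots ?R ?B by (rule br)
 let ?X = "{x\<in>apos. sup x \<subseteq> I}"
 have XD: "?X \<subseteq> D" by (auto simp: D_def apos_def)
 have Ppos: "P.pos = fst ` ?X"
 proof -
  have 1: "x \<in> apos \<longleftrightarrow> (\<forall>i\<in>I. 0 \<le> cf x i)" if x: "x \<in> D" for x
  proof
   assume "\<forall>i\<in>I. 0 \<le> cf x i"
   then have "0 \<le> cf x i" if "i \<in> S" for i using Dz[OF x that] by (cases "i \<in> I") simp_all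
   then show "x \<in> apos" using DP[OF x] by (simp add: apos_def)
  next
   assume "x \<in> apos"
   then show "\<forall>i\<in>I. 0 \<le> cf x i" using subsetD[OF I] by (simp add: apos_def)
  qed
  have 2: "(\<forall>i\<in>I. 0 \<le> cf x i) \<longleftrightarrow> (\<forall>b\<in>?B. 0 \<le> representation ?B (fst x) b)" if x: "x \<in> D" for x
   using rep[OF x] by simp
  have "?X = {x \<in> D. \<forall>b\<in>?B. 0 \<le> representation ?B (fst x) b}"
  proof (intro set_eqI iffI)
   fix x assume "x \<in> ?X"
   then have "x \<in> D" "x \<in> apos" using XD by auto
   then show "x \<in> {x \<in> D. \<forall>b\<in>?B. 0 \<le> representation ?B (fst x) b}" using 1 2 by simp
  next
   fix x assume "x \<in> {x \<in> D. \<forall>b\<in>?B. 0 \<le> representation ?B (fst x) b}"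
   then have "x \<in> D" "\<forall>b\<in>?B. 0 \<le> representation ?B (fst x) b" by simp_all
   then show "x \<in> ?X" using 1[of x] 2[of x] by (simp add: D_def)
  qed
  then show ?thesis unfolding P.pos_def by (simp only:) blast
 qed
 have inX: "inj_on fst ?X" by (rule inj_on_subset[OF D_inj XD])
 have "finite (fst ` ?X)" unfolding Ppos[symmetric] by simp
 then show finX: "finite ?X" by (rule finite_imageD[OF _ inX])
 have ht: "P.nht (fst x) = nat (aht x)" if x: "x \<in> ?X" for x
 proof -
  have xD: "x \<in> D" using XD x by blast
  have "fst x \<in> span ?B" using P.R_span xD by blast
  then have "P.ht (fst x) = (\<Sum>b\<in>?B. representation ?B (fst x) b)" by (rule P.ht_rep)
  also have "\<dots> = (\<Sum>i\<in>I. of_int (cf x i))" unfolding sum.reindex[OF inj] comp_def by (rule sum.cong) (simp_all add: rep[OF xD])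
  also have "\<dots> = of_int (\<Sum>i\<in>I. cf x i)" by simp
  also have "(\<Sum>i\<in>I. cf x i) = aht x" unfolding aht_def by (rule sum.mono_neutral_left[OF finite_S I]) (use Dz[OF xD] in auto)
  finally show ?thesis by (simp add: P.nht_def)
 qed
 \<comment> \<open>The prescribed inner products say that \<open>aform (r i) p = 0\<close> for all
   \<open>i\<close> in \<open>I\<close>.\<close>
 obtain p where p: "\<forall>b\<in>?B. b \<bullet> p = - of_int (snd (r (the_inv_into I ?b b)))"
  using P.dual_functional[of "\<lambda>b. - of_int (snd (r (the_inv_into I ?b b)))"] by (elim exE)
 have sp: "s i p = p" if i: "i \<in> I" for i
 proof -
  have "?b i \<bullet> p = - of_int (snd (r i))" using p i the_inv_into_f_f[OF inj i] by simp
  then show ?thesis by (simp add: s_def aff_refl_aform aform_def)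
 qed
 have fix_p: "w p = p" if "w \<in> gen_subgroup s I" for w
  using that by (induction rule: gen_subgroup_induct) (simp_all add: sp)
 have lin_inj: "v = w" if "v \<in> gen_subgroup s I" "w \<in> gen_subgroup s I" "lin v = lin w" for v w
 proof
  fix x
  have "v x - v p = lin v x - lin v p" "w x - w p = lin w x - lin w p" by (simp_all add: lin_def)
  then have "v x - v p = w x - w p" using that(3) by simp
  then show "v x = w x" unfolding fix_p[OF that(1)] fix_p[OF that(2)] by simp
 qed
 have word: "word_elt s ws = w \<longleftrightarrow> word_elt root_refl (map ?b ws) = lin w" if "w \<in> gen_subgroup s I" "set ws \<subseteq> I" for w ws
  unfolding lin_word[symmetric] using lin_inj[OF word_elt_in_gen[OF that(2)] that(1)] by auto
 have sets: "\<exists>ws. set ws \<subseteq> I \<and> vs = map ?b ws" if "set vs \<subseteq> ?B" for vs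
  using that
 proof (induction vs)
  case (Cons v vs)
  then obtain ws i where "set ws \<subseteq> I" "vs = map ?b ws" "i \<in> I" "v = ?b i" by auto
  then show ?case by (intro exI[of _ "i # ws"]) simp
 qed simp
 have len: "cox_len s I w = cox_len root_refl ?B (lin w)" if w: "w \<in> gen_subgroup s I" for w
 proof -
  have "(\<exists>ws. set ws \<subseteq> I \<and> length ws = k \<and> word_elt s ws = w)
   \<longleftrightarrow> (\<exists>vs. set vs \<subseteq> ?B \<and> length vs = k \<and> word_elt root_refl vs = lin w)" for k
  proof
   assume "\<exists>ws. set ws \<subseteq> I \<and> length ws = k \<and> word_elt s ws = w"
   then obtain ws where "set ws \<subseteq> I" "length ws = k" "word_elt s ws = w" by (elim exE conjE)
   then show "\<exists>vs. set vs \<subseteq> ?B \<and> length vs = k \<and> word_elt root_refl vs = lin w"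
    using word[OF w] by (intro exI[of _ "map ?b ws"]) auto
  next
   assume "\<exists>vs. set vs \<subseteq> ?B \<and> length vs = k \<and> word_elt root_refl vs = lin w"
   then obtain vs where vs: "set vs \<subseteq> ?B" "length vs = k" "word_elt root_refl vs = lin w" by (elim exE conjE)
   obtain ws where ws: "set ws \<subseteq> I" "vs = map ?b ws" using sets[OF vs(1)] by (elim exE conjE)
   then show "\<exists>ws. set ws \<subseteq> I \<and> length ws = k \<and> word_elt s ws = w"
    using word[OF w ws(1)] vs by (intro exI[of _ ws]) auto
  qed
  then show ?thesis unfolding cox_len_def by simp
 qed
 have bij: "bij_betw lin (gen_subgroup s I) P.W"
  unfolding bij_betw_def
 proof
  show "inj_on lin (gen_subgroup s I)" by (rule inj_onI) (rule lin_inj)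
  show "lin ` gen_subgroup s I = P.W"
  proof (intro equalityI subsetI)
   fix u assume "u \<in> lin ` gen_subgroup s I"
   then obtain ws where "set ws \<subseteq> I" "u = lin (word_elt s ws)" by (elim imageE gen_subgroupE) simp
   then show "u \<in> P.W" unfolding lin_word by (simp only:) (intro word_elt_in_gen, auto)
  next
   fix u assume "u \<in> P.W"
   then obtain vs where vs: "set vs \<subseteq> ?B" "u = word_elt root_refl vs" by (rule gen_subgroupE)
   obtain ws where ws: "set ws \<subseteq> I" "vs = map ?b ws" using sets[OF vs(1)] by (elim exE conjE)
   show "u \<in> lin ` gen_subgroup s I" unfolding vs(2) ws(2) lin_word[symmetric] by (intro imageI word_elt_in_gen ws(1))
  qed
 qed
 have "poincare s S I = poincare root_refl ?B ?B"
 proof (rule fps_ext)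
  fix k
  have "bij_betw lin {x \<in> gen_subgroup s I. cox_len s S x = k} {x \<in> P.W. cox_len root_refl ?B x = k}"
   unfolding bij_betw_def
  proof
   show "inj_on lin {x \<in> gen_subgroup s I. cox_len s S x = k}"
    by (rule inj_on_subset[OF bij_betw_imp_inj_on[OF bij]]) auto
   have "lin ` {x \<in> gen_subgroup s I. cox_len s S x = k} = {y \<in> lin ` gen_subgroup s I. cox_len root_refl ?B y = k}"
    using cox_len_sub[OF I] len by auto
   then show "lin ` {x \<in> gen_subgroup s I. cox_len s S x = k} = {x \<in> P.W. cox_len root_refl ?B x = k}"
    unfolding bij_betw_imp_surj_on[OF bij] .
  qed
  then have "card {x \<in> gen_subgroup s I. cox_len s S x = k} = card {x \<in> P.W. cox_len root_refl ?B x = k}"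
   by (rule bij_betw_same_card)
  then show "fps_nth (poincare s S I) k = fps_nth (poincare root_refl ?B ?B) k" unfolding poincare_def by simp
 qed
 also have "\<dots> = (\<Prod>a\<in>fst ` ?X. hf (P.nht a))" unfolding P.poincare_W Ppos ..
 also have "\<dots> = (\<Prod>x\<in>?X. hf (nat (aht x)))" unfolding prod.reindex[OF inX] comp_def by (rule prod.cong) (simp_all add: ht)
 finally show "poincare s S I = (\<Prod>x\<in>?X. hf (nat (aht x)))" .
qed

end

section \<open>From values on the unit interval to power series\<close>

text \<open>Divide by the leading power of the variable and let \<open>u\<close> tend to zero from
  the right. Continuity at zero makes the constant term vanish, against the choice of that
  power.\<close>

lemma fps_eq_zero_of_eval:
 fixes c :: "real fps"
 assumes rad: "1 \<le> fps_conv_radius c" and z: "\<And>u. 0 < u \<Longrightarrow> u < 1 \<Longrightarrow> eval_fps c u = 0"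
 shows "c = 0"
proof (rule ccontr)
 assume nz: "c \<noteq> 0"
 define m where "m = subdegree c"
 define d where "d = fps_shift m c"
 have c: "d * fps_X ^ m = c" unfolding d_def m_def using subdegree_decompose[of c] by (rule sym)
 have d0: "fps_nth d 0 \<noteq> 0" unfolding d_def m_def using nz by simp
 have rd: "1 \<le> fps_conv_radius d" unfolding d_def using rad by simp
 have lt: "ereal (norm u) < fps_conv_radius d" if "0 \<le> u" "u < 1" for u :: real
  by (rule less_le_trans[OF _ rd]) (use that in simp)
 have dz: "eval_fps d u = 0" if u: "0 < u" "u < 1" for u
 proof -
  have "eval_fps c u = eval_fps (d * fps_X ^ m) u" by (simp only: c)
  also have "\<dots> = eval_fps d u * eval_fps (fps_X ^ m) u" by (rule eval_fps_mult) (use lt[of u] u in auto)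
  also have "\<dots> = eval_fps d u * u ^ m" by simp
  finally show ?thesis using z[OF u] u by simp
 qed
 have "continuous (at 0 within {0<..<1}) (eval_fps d)" by (rule continuous_eval_fps) (use lt[of 0] in simp)
 then have "(eval_fps d \<longlongrightarrow> eval_fps d 0) (at 0 within {0<..<1})" by (simp add: continuous_within)
 then have l: "(eval_fps d \<longlongrightarrow> fps_nth d 0) (at 0 within {0<..<1})" by (simp only: eval_fps_at_0)
 have "\<forall>\<^sub>F u in at 0 within {0<..<1::real}. eval_fps d u = 0" unfolding eventually_at_filter by (rule eventuallyI) (simp add: dz)
 then have c0: "((\<lambda>_. 0) \<longlongrightarrow> fps_nth d 0) (at 0 within {0<..<1::real})" using l by (rule Lim_transform_eventually[rotated])
 have nb: "at 0 within {0<..<1::real} \<noteq> bot"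
 proof -
  have "0 \<in> closure {0<..<1::real}" by simp
  then have "0 islimpt {0<..<1::real}" unfolding closure_def by auto
  then show ?thesis by (simp add: trivial_limit_within)
 qed
 have "fps_nth d 0 = 0" by (rule tendsto_unique[OF nb c0 tendsto_const])
 then show False using d0 by contradiction
qed

text \<open>Convergence on the unit interval makes the radius at least one, so the difference of
  both sides is a series to which \<open>fps_eq_zero_of_eval\<close> applies.\<close>

lemma fps_rational:
 fixes a :: "real fps" and D N :: "real poly"
 assumes s: "\<And>u. 0 < u \<Longrightarrow> u < 1 \<Longrightarrow> (\<lambda>k. fps_nth a k * u ^ k) sums val u"
  and v: "\<And>u. 0 < u \<Longrightarrow> u < 1 \<Longrightarrow> val u * poly D u = poly N u"
 shows "a * fps_of_poly D = fps_of_poly N"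
proof -
 have ra: "1 \<le> fps_conv_radius a" unfolding fps_conv_radius_def
 proof (rule conv_radius_geI_ex')
  fix r :: real assume "0 < r" "ereal r < 1"
  then show "summable (\<lambda>n. fps_nth a n * of_real r ^ n)" using s[of r] by (auto simp: sums_iff)
 qed
 have rm: "1 \<le> fps_conv_radius (a * fps_of_poly D)"
  by (rule order_trans[OF _ fps_conv_radius_mult]) (use ra in simp)
 have "a * fps_of_poly D - fps_of_poly N = 0"
 proof (rule fps_eq_zero_of_eval)
  show "1 \<le> fps_conv_radius (a * fps_of_poly D - fps_of_poly N)"
   by (rule order_trans[OF _ fps_conv_radius_diff]) (use rm in simp)
  fix u :: real assume u: "0 < u" "u < 1"
  have lt: "ereal (norm u) < r" if "1 \<le> r" for r by (rule less_le_trans[OF _ that]) (use u in simp)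
  have "eval_fps (a * fps_of_poly D) u = eval_fps a u * poly D u"
   by (subst eval_fps_mult) (use lt[OF ra] in simp_all)
  then have "eval_fps (a * fps_of_poly D - fps_of_poly N) u = eval_fps a u * poly D u - poly N u"
   by (subst eval_fps_diff) (use lt[OF rm] in simp_all)
  also have "eval_fps a u = val u" unfolding eval_fps_def using s[OF u] by (simp add: sums_iff)
  finally show "eval_fps (a * fps_of_poly D - fps_of_poly N) u = 0" using v[OF u] by simp
 qed
 then show ?thesis by simp
qed

lemma sum_aff_simple: "finite B \<Longrightarrow> (\<Sum>i\<in>aff_simple B. f i) = f None + (\<Sum>b\<in>B. f (Some b))"
 unfolding aff_simple_def by (subst sum.insert) (simp_all add: sum.reindex comp_def)

lemma floor_Ints: "x \<in> \<int> \<Longrightarrow> of_int \<lfloor>x\<rfloor> = x" by (auto elim!: Ints_cases)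

section \<open>The affine Weyl group and its lengths\<close>

context irreducible_roots
begin

definition crd :: "'a \<Rightarrow> 'a \<Rightarrow> int" where "crd a b = \<lfloor>representation B a b\<rfloor>"
definition afi :: "'a option \<Rightarrow> 'a \<times> int" where "afi i = (case i of None \<Rightarrow> (- theta, 1) | Some b \<Rightarrow> (b, 0))"
definition acf :: "'a \<times> int \<Rightarrow> 'a option \<Rightarrow> int" where
 "acf x i = (case i of None \<Rightarrow> snd x | Some b \<Rightarrow> snd x * crd theta b + crd (fst x) b)"

lemma crd: "a \<in> R \<Longrightarrow> of_int (crd a b) = representation B a b"
 unfolding crd_def by (rule floor_Ints[OF rep_R_int])

lemma crd_minus: assumes "a \<in> R" shows "crd (- a) b = - crd a b"
proof -
 have "real_of_int (crd (- a) b) = of_int (- crd a b)"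
  using crd[OF assms] crd[OF neg_R[OF assms]] real_vector.representation_neg[OF indep R_spanB[OF assms]] by simp
 then show ?thesis by (simp only: of_int_eq_iff)
qed

lemma theta_R: "theta \<in> R" by (rule highest_R[OF theta])

lemma crd_le: assumes "a \<in> R" "b \<in> B" shows "crd a b \<le> crd theta b" "- crd theta b \<le> crd a b"
proof -
 have *: "crd a b \<le> crd theta b" if "a \<in> R" for a
 proof -
  have "real_of_int (crd a b) \<le> of_int (crd theta b)" using theta that assms(2) crd[OF that] crd[OF theta_R] by (simp add: is_highest_def)
  then show ?thesis by simp
 qed
 show "crd a b \<le> crd theta b" "- crd theta b \<le> crd a b" using *[OF assms(1)] *[OF neg_R[OF assms(1)]] crd_minus[OF assms(1)] by simp_all
qed

lemma crd_theta_pos: assumes "b \<in> B" shows "0 < crd theta b"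
proof -
 have "0 < representation B theta b"
  by (rule dominant_full[OF highest_dominant[OF theta] R_spanB[OF theta_R] R_nz[OF theta_R] assms])
 then have "0 < real_of_int (crd theta b)" using crd[OF theta_R] by simp
 then show ?thesis by simp
qed

lemma pos_crd: "a \<in> R \<Longrightarrow> a \<in> pos \<longleftrightarrow> (\<forall>b\<in>B. 0 \<le> crd a b)"
 using crd[of a] by (simp add: pos_def flip: of_int_0_le_iff[where ?'a = real])

lemma crd_expand: "a \<in> R \<Longrightarrow> (\<Sum>b\<in>B. of_int (crd a b) *\<^sub>R b) = a"
 using crd[of a] expand[OF R_spanB, of a] by simp

sublocale AF: affine_roots R B "R \<times> UNIV" "aff_simple B" afi acf
proof unfold_locales
 show "finite (aff_simple B)" using finite_B by (simp add: aff_simple_def)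
 show "afi i \<in> R \<times> UNIV" if "i \<in> aff_simple B" for i
  using that theta_R neg_R B_sub by (auto simp: aff_simple_def afi_def)
 show "fst x \<in> R" if "x \<in> R \<times> UNIV" for x :: "'a \<times> int" using that by auto
 show "fst x = (\<Sum>i\<in>aff_simple B. of_int (acf x i) *\<^sub>R fst (afi i))" if "x \<in> R \<times> UNIV" for x :: "'a \<times> int"
 proof -
  have xR: "fst x \<in> R" using that by auto
  have "(\<Sum>i\<in>aff_simple B. of_int (acf x i) *\<^sub>R fst (afi i))
   = of_int (snd x) *\<^sub>R (- theta) + (\<Sum>b\<in>B. of_int (snd x * crd theta b + crd (fst x) b) *\<^sub>R b)"
   by (simp add: sum_aff_simple[OF finite_B] acf_def afi_def)
  also have "(\<Sum>b\<in>B. of_int (snd x * crd theta b + crd (fst x) b) *\<^sub>R b)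
   = of_int (snd x) *\<^sub>R (\<Sum>b\<in>B. of_int (crd theta b) *\<^sub>R b) + (\<Sum>b\<in>B. of_int (crd (fst x) b) *\<^sub>R b)"
   by (simp add: scaleR_left_distrib sum.distrib scaleR_sum_right)
  finally show ?thesis unfolding crd_expand[OF theta_R] crd_expand[OF xR] by simp
 qed
 show "snd x = (\<Sum>i\<in>aff_simple B. acf x i * snd (afi i))" for x :: "'a \<times> int"
  by (simp add: sum_aff_simple[OF finite_B] acf_def afi_def)
 show "m i = 0" if m: "(\<Sum>i\<in>aff_simple B. of_int (m i) *\<^sub>R fst (afi i)) = 0" "(\<Sum>i\<in>aff_simple B. m i * snd (afi i)) = 0"
  and i: "i \<in> aff_simple B" for m i
 proof -
  have n: "m None = 0" using m(2) by (simp add: sum_aff_simple[OF finite_B] afi_def)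
  have "(\<Sum>b\<in>B. of_int (m (Some b)) *\<^sub>R b) = 0" using m(1) by (simp add: sum_aff_simple[OF finite_B] afi_def n)
  then have "of_int (m (Some b)) = (0::real)" if "b \<in> B" for b
   using real_vector.independentD[OF indep finite_B subset_refl, of "\<lambda>b. of_int (m (Some b))"] that by blast
  then show ?thesis using n i by (auto simp: aff_simple_def)
 qed
 show "(\<forall>i\<in>aff_simple B. 0 \<le> acf x i) \<or> (\<forall>i\<in>aff_simple B. acf x i \<le> 0)" if "x \<in> R \<times> UNIV" for x :: "'a \<times> int"
 proof -
  have xR: "fst x \<in> R" using that by auto
  show ?thesis
  proof (cases "snd x = 0")
   case True
   then have e: "acf x None = 0" "\<And>b. acf x (Some b) = crd (fst x) b" by (simp_all add: acf_def)
   have "(\<forall>b\<in>B. 0 \<le> crd (fst x) b) \<or> (\<forall>b\<in>B. crd (fst x) b \<le> 0)"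
    using pos_or_neg[OF xR] pos_crd[OF xR] pos_crd[OF neg_R[OF xR]] crd_minus[OF xR] by auto
   then show ?thesis using e by (auto simp: aff_simple_def)
  next
   case False
   show ?thesis
   proof (cases "0 < snd x")
    case True
    \<comment> \<open>Coefficients of roots are bounded by those of \<open>theta\<close> in absolute
      value, so one copy of \<open>theta\<close> already outweighs any negative coefficient.\<close>
    have "0 \<le> snd x * crd theta b + crd (fst x) b" if b: "b \<in> B" for b
    proof -
     have "1 * crd theta b \<le> snd x * crd theta b" by (rule mult_right_mono) (use True crd_theta_pos[OF b] in auto)
     then show ?thesis using crd_le(2)[OF xR b] by linarith
    qed
    then have "\<forall>i\<in>aff_simple B. 0 \<le> acf x i" using True by (auto simp: aff_simple_def acf_def)
    then show ?thesis by (rule disjI1)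
   next
    case nn: False
    have "snd x * crd theta b + crd (fst x) b \<le> 0" if b: "b \<in> B" for b
    proof -
     have "snd x * crd theta b \<le> -1 * crd theta b" by (rule mult_right_mono) (use nn False crd_theta_pos[OF b] in auto)
     then show ?thesis using crd_le(1)[OF xR b] by linarith
    qed
    then have "\<forall>i\<in>aff_simple B. acf x i \<le> 0" using nn by (auto simp: aff_simple_def acf_def)
    then show ?thesis by (rule disjI2)
   qed
  qed
 qed
 show "arefl x y \<in> R \<times> UNIV" if "x \<in> R \<times> UNIV" "y \<in> R \<times> UNIV" for x y :: "'a \<times> int"
  using that refl_closed by (auto simp: arefl_def)
qed

text \<open>The least \<open>k\<close> for which the affine root \<open>(a, k)\<close> is
  positive.\<close>

definition ch :: "'a \<Rightarrow> int" where "ch a = (if a \<in> pos then 0 else 1)"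

lemma apos_iff: assumes "a \<in> R" shows "(a, k) \<in> AF.apos \<longleftrightarrow> ch a \<le> k"
proof
 assume "(a, k) \<in> AF.apos"
 then have h: "0 \<le> acf (a, k) i" if "i \<in> aff_simple B" for i using that by (simp add: AF.apos_def)
 have k: "0 \<le> k" using h[of None] by (simp add: aff_simple_def acf_def)
 show "ch a \<le> k"
 proof (cases "k = 0")
  case True
  have "0 \<le> crd a b" if "b \<in> B" for b using h[of "Some b"] that True by (simp add: aff_simple_def acf_def)
  then have "a \<in> pos" using pos_crd[OF assms] by simp
  then show ?thesis using True by (simp add: ch_def)
 qed (use k in \<open>simp add: ch_def\<close>)
next
 assume c: "ch a \<le> k"
 then have k: "0 \<le> k" by (simp add: ch_def split: if_splits)
 have "\<not> (\<forall>i\<in>aff_simple B. acf (a, k) i \<le> 0) \<or> (\<forall>i\<in>aff_simple B. 0 \<le> acf (a, k) i)"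
 proof (cases "k = 0")
  case True
  then have "a \<in> pos" using c by (simp add: ch_def split: if_splits)
  then show ?thesis using pos_crd[OF assms] True by (auto simp: aff_simple_def acf_def)
 next
  case False
  then have "\<not> acf (a, k) None \<le> 0" using k by (simp add: acf_def)
  then show ?thesis by (auto simp: aff_simple_def)
 qed
 then have "\<forall>i\<in>aff_simple B. 0 \<le> acf (a, k) i" using AF.cf_sign[of "(a, k)"] assms by auto
 then show "(a, k) \<in> AF.apos" using assms by (simp add: AF.apos_def)
qed

abbreviation "Qv \<equiv> based_roots.lat (coroot ` B)"
abbreviation "Wa \<equiv> gen_subgroup AF.s (aff_simple B)"
abbreviation "aff_elt L x \<equiv> \<lambda>v. L v + x"

lemma Qv_int: assumes "a \<in> R" "x \<in> Qv" shows "a \<bullet> x \<in> \<int>"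
proof -
 interpret D: based_roots "coroot ` R" "coroot ` B" by (rule dual)
 obtain m :: "'a \<Rightarrow> int" where x: "x = (\<Sum>b\<in>coroot ` B. of_int (m b) *\<^sub>R b)" using assms(2) unfolding D.lat_def by blast
 have "of_int (m b) * (a \<bullet> b) \<in> \<int>" if b: "b \<in> coroot ` B" for b
 proof -
  obtain c where "c \<in> B" "b = coroot c" using b by (elim imageE)
  then have "a \<bullet> b \<in> \<int>" using cartan_int[OF assms(1), of c] B_sub by (auto simp: inner_coroot)
  then show ?thesis by (intro Ints_mult) simp_all
 qed
 then show ?thesis unfolding x inner_sum_right inner_scaleR_right by (intro Ints_sum) blast
qed

text \<open>Composition with the map sends the affine root \<open>(a, k)\<close> to
  \<open>(inv L a, k + a \<bullet> x)\<close>, so for each gradient \<open>a\<close> the inversions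
  are the integers \<open>k\<close> in an interval between two values of \<open>ch\<close>, one of
  them shifted.\<close>

lemma card_inversions_aff:
 assumes L: "L \<in> W" and x: "x \<in> Qv"
 shows "card (AF.A.inversions (aff_elt L x)) = (\<Sum>a\<in>R. nat (ch (inv L a) - \<lfloor>a \<bullet> x\<rfloor> - ch a))"
proof -
 let ?n = "\<lambda>a. \<lfloor>a \<bullet> x\<rfloor>"
 let ?T = "SIGMA a:R. {ch a..<ch (inv L a) - ?n a}"
 have L': "inv L a \<in> R" if "a \<in> R" for a by (rule W_R[OF W_inv(1)[OF L] that])
 have c: "aform (a, k) \<circ> aff_elt L x = aform (inv L a, k + ?n a)" if "a \<in> R" for a k
 proof
  fix v
  have e: "of_int (?n a) = a \<bullet> x" by (rule floor_Ints[OF Qv_int[OF that x]])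
  have e1: "a \<bullet> L v = inv L a \<bullet> v" using W_inner_inv[OF L, of v a] by (simp only: inner_commute)
  show "(aform (a, k) \<circ> aff_elt L x) v = aform (inv L a, k + ?n a) v"
   unfolding aform_def comp_apply fst_conv snd_conv inner_add_right of_int_add e e1 by simp
 qed
 have mem: "aform y \<in> aform ` AF.apos \<longleftrightarrow> y \<in> AF.apos" for y :: "'a \<times> int"
  by (rule inj_image_mem_iff) (rule injI, rule aform_inj)
 have "AF.A.inversions (aff_elt L x) = aform ` ?T"
 proof (intro equalityI subsetI)
  fix f assume "f \<in> AF.A.inversions (aff_elt L x)"
  then have f: "f \<in> aform ` AF.apos" "f \<circ> aff_elt L x \<notin> aform ` AF.apos" unfolding AF.A.inversions_def by simp_all
  obtain p where p: "p \<in> AF.apos" "f = aform p" using f(1) by (elim imageE)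
  obtain a k where "p = (a, k)" by (cases p)
  then have ak: "(a, k) \<in> AF.apos" "f = aform (a, k)" using p by simp_all
  have aR: "a \<in> R" using AF.apos_\<Phi>[OF ak(1)] by simp
  have "(inv L a, k + ?n a) \<notin> AF.apos" using f(2) unfolding ak(2) c[OF aR] mem .
  then have "(a, k) \<in> ?T" using ak(1) aR apos_iff[OF aR] apos_iff[OF L'[OF aR]] by simp
  then show "f \<in> aform ` ?T" unfolding ak(2) by (rule imageI)
 next
  fix f assume "f \<in> aform ` ?T"
  then obtain p where p: "f = aform p" "p \<in> ?T" by (elim imageE)
  obtain a k where "p = (a, k)" by (cases p)
  then have ak: "f = aform (a, k)" "(a, k) \<in> ?T" using p by simp_all
  then have aR: "a \<in> R" by simp
  have 1: "f \<in> aform ` AF.apos" unfolding ak(1) mem using ak(2) apos_iff[OF aR] by simp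
  have 2: "f \<circ> aff_elt L x \<notin> aform ` AF.apos" unfolding ak(1) c[OF aR] mem using ak(2) apos_iff[OF L'[OF aR]] by simp
  show "f \<in> AF.A.inversions (aff_elt L x)" unfolding AF.A.inversions_def using 1 2 by simp
 qed
 then have "card (AF.A.inversions (aff_elt L x)) = card ?T"
  by (simp add: card_image inj_on_def aform_inj)
 also have "\<dots> = (\<Sum>a\<in>R. card {ch a..<ch (inv L a) - ?n a})" by (rule card_SigmaI) (use finite_R in auto)
 finally show ?thesis by (simp add: algebra_simps)
qed

text \<open>With \<open>w = t(y \<mu>) y z\<inverse>\<close>, \<open>\<mu>\<close> dominant and \<open>y\<close> a minimal representative, the length splits into a sum over positive roots.\<close>

lemma length_weight:
 assumes mu: "mu \<in> Qv" "dominant mu" and y: "y \<in> min_reps mu" and z: "z \<in> W" and u: "0 < (u::real)"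
 shows "u ^ card (AF.A.inversions (aff_elt (y \<circ> inv z) (y mu)))
  = u powr (2 * based_roots.ht (coroot ` R) (coroot ` B) mu) * u ^ card (Inv y) * (\<Prod>a\<in>Inv z. if a \<bullet> mu = 0 then u else 1 / u)"
proof -
 interpret D: based_roots "coroot ` R" "coroot ` B" by (rule dual)
 have yW: "y \<in> W" by (rule min_reps_W[OF y])
 have ymu: "y mu \<in> Qv" by (rule D.W_lat[unfolded dual_W, OF yW mu(1)])
 have LW: "y \<circ> inv z \<in> W" by (rule W_comp[OF yW W_inv(1)[OF z]])
 define N where "N a = nat (ch (z a) - \<lfloor>a \<bullet> mu\<rfloor> - ch (y a))" for a
 have bij: "bij_betw y R R"
  by (rule bij_betw_byWitness[where f' = "inv y"])
   (use W_inv(2,3)[OF yW] W_R[OF yW] W_R[OF W_inv(1)[OF yW]] in auto)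
 have "card (AF.A.inversions (aff_elt (y \<circ> inv z) (y mu))) = (\<Sum>a\<in>R. nat (ch (inv (y \<circ> inv z) a) - \<lfloor>a \<bullet> y mu\<rfloor> - ch a))"
  by (rule card_inversions_aff[OF LW ymu])
 also have "\<dots> = (\<Sum>a\<in>R. nat (ch (inv (y \<circ> inv z) (y a)) - \<lfloor>y a \<bullet> y mu\<rfloor> - ch (y a)))"
  by (rule sum.reindex_bij_betw[OF bij, symmetric])
 also have "\<dots> = sum N R"
 proof (rule sum.cong)
  fix a assume "a \<in> R"
  have "(y \<circ> inv z) (z a) = y a" using W_inv(2)[OF z] by simp
  then have "inv (y \<circ> inv z) (y a) = z a" using W_inv(2)[OF LW, of "z a"] by metis
  then show "nat (ch (inv (y \<circ> inv z) (y a)) - \<lfloor>y a \<bullet> y mu\<rfloor> - ch (y a)) = N a" unfolding N_def W_inner[OF yW] by simp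
 qed simp
 \<comment> \<open>Counting \<open>a\<close> and \<open>- a\<close> together leaves one factor for
   each positive root: \<open>u powr (a \<bullet> mu)\<close>, corrected according to the signs of
   \<open>y a\<close> and \<open>z a\<close>.\<close>
 also have "\<dots> = (\<Sum>a\<in>pos. N a + N (- a))"
 proof -
  have "R = pos \<union> uminus ` pos"
  proof (intro equalityI subsetI)
   fix a assume a: "a \<in> R"
   show "a \<in> pos \<union> uminus ` pos"
   proof (cases "a \<in> pos")
    case False
    then have "- a \<in> pos" using notin_pos[OF a] by simp
    then have "- (- a) \<in> uminus ` pos" by (rule imageI)
    then show ?thesis by simp
   qed simp
  next
   fix a assume "a \<in> pos \<union> uminus ` pos"
   then show "a \<in> R" by (auto intro: neg_R pos_R)
  qed
  then have "sum N R = sum N (pos \<union> uminus ` pos)" by simp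
  also have "\<dots> = sum N pos + sum N (uminus ` pos)"
   by (rule sum.union_disjoint) (use neg_notin_pos in auto)
  also have "sum N (uminus ` pos) = (\<Sum>a\<in>pos. N (- a))" by (subst sum.reindex) (simp_all add: inj_on_def)
  finally show ?thesis by (simp add: sum.distrib)
 qed
 finally have "u ^ card (AF.A.inversions (aff_elt (y \<circ> inv z) (y mu))) = (\<Prod>a\<in>pos. u ^ (N a + N (- a)))"
  by (simp only: power_sum)
 also have "\<dots> = (\<Prod>a\<in>pos. u powr (a \<bullet> mu) * (if y a \<notin> pos then u else 1) * (if z a \<notin> pos then (if a \<bullet> mu = 0 then u else 1 / u) else 1))"
 proof (rule prod.cong)
  fix a assume a: "a \<in> pos"
  have aR: "a \<in> R" by (rule pos_R[OF a])
  have chm: "ch (- b) = 1 - ch b" if "b \<in> R" for b using notin_pos[OF that] by (cases "b \<in> pos") (simp_all add: ch_def)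
  obtain i where i: "a \<bullet> mu = of_int i" using Qv_int[OF aR mu(1)] by (elim Ints_cases)
  have i0: "0 \<le> i" using dominant_pos[OF mu(2) a] i by (simp add: inner_commute)
  have Na: "N a = nat (ch (z a) - i - ch (y a))" unfolding N_def i by simp
  have "\<lfloor>- a \<bullet> mu\<rfloor> = - i" using i by simp
  moreover have "ch (z (- a)) = 1 - ch (z a)" "ch (y (- a)) = 1 - ch (y a)"
   unfolding W_minus[OF z] W_minus[OF yW] using chm[OF W_R[OF z aR]] chm[OF W_R[OF yW aR]] by simp_all
  ultimately have Nm: "N (- a) = nat (i + ch (y a) - ch (z a))" unfolding N_def by simp
  obtain j where j: "i = int j" using i0 by (elim nonneg_int_cases)
  have pw: "u powr (a \<bullet> mu) = u ^ nat i" using i j u by (simp add: powr_realpow)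
  show "u ^ (N a + N (- a)) = u powr (a \<bullet> mu) * (if y a \<notin> pos then u else 1) * (if z a \<notin> pos then (if a \<bullet> mu = 0 then u else 1 / u) else 1)"
  proof (cases "i = 0")
   case True
   \<comment> \<open>Minimality of \<open>y\<close> enters here: roots orthogonal to
     \<open>mu\<close> stay positive under \<open>y\<close>, so they are counted only through
     \<open>z\<close>, with weight \<open>u\<close> instead of \<open>1 / u\<close>.\<close>
   then have "y a \<in> pos" using y a i by (simp add: min_reps_def)
   then show ?thesis unfolding Na Nm pw i using True u by (simp add: ch_def)
  next
   case False
   then obtain k where "j = Suc k" using j by (cases j) simp_all
   then have k: "i = int k + 1" using j by simp
   have N0: "N a = 0" unfolding Na using k by (simp add: ch_def)
   have nz: "a \<bullet> mu \<noteq> 0" using False i by simp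
   have ni: "nat i = Suc k" using k by simp
   have Nm': "N (- a) = nat (int k + 1 + ch (y a) - ch (z a))" unfolding Nm k by simp
   show ?thesis
   proof (cases "y a \<in> pos")
    case True
    show ?thesis
    proof (cases "z a \<in> pos")
     case z: True
     have "N (- a) = Suc k" unfolding Nm' using True z by (simp add: ch_def)
     then show ?thesis unfolding pw ni N0 using True z by simp
    next
     case z: False
     have "N (- a) = k" unfolding Nm' using True z by (simp add: ch_def)
     then show ?thesis unfolding pw ni N0 using True z nz u by simp
    qed
   next
    case y: False
    show ?thesis
    proof (cases "z a \<in> pos")
     case True
     have "N (- a) = Suc (Suc k)" unfolding Nm' using True y by (simp add: ch_def)
     then show ?thesis unfolding pw ni N0 using True y by simp
    next
     case z: False
     have "N (- a) = Suc k" unfolding Nm' using y z by (simp add: ch_def)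
     then show ?thesis unfolding pw ni N0 using y z nz u by simp
    qed
   qed
  qed
 qed simp
 also have "\<dots> = (\<Prod>a\<in>pos. u powr (a \<bullet> mu)) * (\<Prod>a\<in>pos. if y a \<notin> pos then u else 1)
   * (\<Prod>a\<in>pos. if z a \<notin> pos then (if a \<bullet> mu = 0 then u else 1 / u) else 1)" by (simp only: prod.distrib)
 also have "(\<Prod>a\<in>pos. u powr (a \<bullet> mu)) = u powr (\<Sum>a\<in>pos. a \<bullet> mu)" using u by (simp add: powr_sum)
 also have "(\<Sum>a\<in>pos. a \<bullet> mu) = 2 * D.ht mu"
  unfolding D.ht_def D.corho_def dual_pos by (simp add: sum.reindex inj_coroot inner_sum_right inner_commute)
 also have "(\<Prod>a\<in>pos. if y a \<notin> pos then u else 1) = u ^ card (Inv y)"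
  unfolding Inv_def by (subst prod.If_cases) (simp_all add: Int_def)
 also have "(\<Prod>a\<in>pos. if z a \<notin> pos then (if a \<bullet> mu = 0 then u else 1 / u) else 1) = (\<Prod>a\<in>Inv z. if a \<bullet> mu = 0 then u else 1 / u)"
  unfolding Inv_def by (subst prod.If_cases) (simp_all add: Int_def)
 finally show ?thesis .
qed

text \<open>The sums over \<open>y\<close> and \<open>z\<close> factor. By \<open>coset_sum\<close>
  with weights \<open>u\<close> and \<open>1 / u\<close> the second is \<open>poin u mu\<close>
  times a sum over representatives at \<open>1 / u\<close>; the former completes the first sum to
  \<open>poinW u\<close>, the latter is a quotient of Poincare polynomials at
  \<open>1 / u\<close>.\<close>

lemma weight_sum:
 assumes mu: "dominant mu" and u: "0 < (u::real)"
 shows "(\<Sum>y\<in>min_reps mu. \<Sum>z\<in>W. u ^ card (Inv y) * (\<Prod>a\<in>Inv z. if a \<bullet> mu = 0 then u else 1 / u))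
  = poinW u * (poinW (1 / u) / poin (1 / u) mu)"
proof -
 have c: "(\<Sum>w\<in>W. \<Prod>a\<in>Inv w. if a \<bullet> mu = 0 then t else t') = poin t mu * (\<Sum>w\<in>min_reps mu. t' ^ card (Inv w))" for t t' :: real
  unfolding poin_def prod_constant[symmetric] by (rule coset_sum[OF mu]) (rule refl)
 have cc: "poinW t = poin t mu * (\<Sum>w\<in>min_reps mu. t ^ card (Inv w))" for t
  using c[of t t] by (simp only: if_cancel prod_constant poinW_def)
 have 1: "poinW u = poin u mu * (\<Sum>w\<in>min_reps mu. u ^ card (Inv w))"
  and 2: "poinW (1 / u) = poin (1 / u) mu * (\<Sum>w\<in>min_reps mu. (1 / u) ^ card (Inv w))" by (rule cc)+
 have q: "poin (1 / u) mu \<noteq> 0" using poin_pos[of "1 / u" mu] u by simp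
 have "(\<Sum>y\<in>min_reps mu. \<Sum>z\<in>W. u ^ card (Inv y) * (\<Prod>a\<in>Inv z. if a \<bullet> mu = 0 then u else 1 / u))
  = (\<Sum>y\<in>min_reps mu. u ^ card (Inv y)) * (\<Sum>z\<in>W. \<Prod>a\<in>Inv z. if a \<bullet> mu = 0 then u else 1 / u)"
  by (rule sum_product[symmetric])
 also have "(\<Sum>z\<in>W. \<Prod>a\<in>Inv z. if a \<bullet> mu = 0 then u else 1 / u) = poin u mu * (\<Sum>w\<in>min_reps mu. (1 / u) ^ card (Inv w))"
  by (rule c)
 also have "(\<Sum>y\<in>min_reps mu. u ^ card (Inv y)) * (poin u mu * (\<Sum>w\<in>min_reps mu. (1 / u) ^ card (Inv w)))
  = poinW u * (poinW (1 / u) / poin (1 / u) mu)"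
 proof -
  have r: "a * (p * b) = (p * a) * ((c * b) / c)" if "c \<noteq> 0" for a p b c :: real using that by simp
  show ?thesis unfolding 1 2 by (rule r[OF q])
 qed
 finally show ?thesis .
qed

text \<open>\<open>AF.s None\<close> composed with the reflection in \<open>theta\<close> is the
  translation by \<open>coroot theta\<close>. The set \<open>T\<close> of vectors whose translation
  lies in the group is closed under addition and under \<open>W\<close>, and it is shown to contain
  every coroot.\<close>

lemma Wa_eq: "Wa = (\<lambda>(L, x). aff_elt L x) ` (W \<times> Qv)"
proof -
 interpret D: based_roots "coroot ` R" "coroot ` B" by (rule dual)
 have Qv_W: "w x \<in> Qv" if "w \<in> W" "x \<in> Qv" for w x by (rule D.W_lat[unfolded dual_W, OF that])
 have s0: "AF.s None v = root_refl theta v + coroot theta" for v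
 proof -
  have "2 * (1 - v \<bullet> theta) / (theta \<bullet> theta) = 2 / (theta \<bullet> theta) - 2 * (v \<bullet> theta) / (theta \<bullet> theta)"
   by (simp add: diff_divide_distrib)
  moreover have "AF.s None v = v + (2 * (1 - v \<bullet> theta) / (theta \<bullet> theta)) *\<^sub>R theta"
   by (simp add: AF.s_def afi_def aff_refl_aform aform_def inner_commute)
  ultimately show ?thesis by (simp add: root_refl_def coroot_def scaleR_left_diff_distrib)
 qed
 have sb: "AF.s (Some b) = root_refl b" for b
  by (simp add: AF.s_def afi_def aff_refl_aform aform_def root_refl_def fun_eq_iff inner_commute)
 have Wsub: "w \<in> Wa" if "w \<in> W" for w
  using that
 proof (induction rule: gen_subgroup_induct)
  case id show ?case by (rule gen_subgroup_id)
 next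
  case (step b w)
  have "AF.s (Some b) \<circ> w \<in> Wa" by (rule gen_subgroup_comp[OF gen_subgroup_gen step(3)]) (simp add: aff_simple_def step(1))
  then show ?case unfolding sb .
 qed
 define T where "T = {x. (\<lambda>v. v + x) \<in> Wa}"
 have T_add: "x + y \<in> T" if "x \<in> T" "y \<in> T" for x y
 proof -
  have "(\<lambda>v. v + y) \<circ> (\<lambda>v. v + x) \<in> Wa" by (rule gen_subgroup_comp) (use that in \<open>simp_all add: T_def\<close>)
  then show ?thesis by (simp add: T_def comp_def add.assoc)
 qed
 have T_W: "w x \<in> T" if "w \<in> W" "x \<in> T" for w x
 proof -
  have "w \<circ> ((\<lambda>v. v + x) \<circ> inv w) \<in> Wa"
   by (rule gen_subgroup_comp[OF Wsub[OF that(1)] gen_subgroup_comp[OF _ Wsub[OF W_inv(1)[OF that(1)]]]])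
    (use that(2) in \<open>simp add: T_def\<close>)
  moreover have "w \<circ> ((\<lambda>v. v + x) \<circ> inv w) = (\<lambda>v. v + w x)"
   by (simp add: fun_eq_iff linear_add[OF W_linear[OF that(1)]] W_inv(3)[OF that(1)])
  ultimately show ?thesis by (simp add: T_def)
 qed
 have T_theta: "coroot theta \<in> T"
 proof -
  have "AF.s None \<circ> root_refl theta \<in> Wa"
   by (rule gen_subgroup_comp[OF gen_subgroup_gen Wsub[OF refl_W[OF theta_R]]]) (simp add: aff_simple_def)
  moreover have "AF.s None \<circ> root_refl theta = (\<lambda>v. v + coroot theta)" by (simp add: fun_eq_iff s0)
  ultimately show ?thesis by (simp add: T_def)
 qed
 have T_neg: "- coroot theta \<in> T"
 proof -
  have "root_refl theta (coroot theta) \<in> T" by (rule T_W[OF refl_W[OF theta_R] T_theta])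
  moreover have "root_refl theta (coroot theta) = - coroot theta" unfolding root_refl_coroot_coroot by (simp add: coroot_minus)
  ultimately show ?thesis by simp
 qed
 have T_dom: "coroot f \<in> T" if f: "f \<in> R" "dominant f" for f
 proof (cases "f = theta")
  case False
  have fp: "f \<in> pos" by (rule dominant_pos_root[OF f])
  have "0 < f \<bullet> theta" by (intro dominant_inner f highest_dominant[OF theta] R_spanB theta_R R_nz)
  then have c: "cartan f theta = 1" using highest_flip(1)[OF fp _ False] by simp
  \<comment> \<open>For a dominant root other than \<open>theta\<close>, the value
    \<open>cartan f theta = 1\<close> expresses its coroot as the difference of
    \<open>coroot theta\<close> and a conjugate of it, so all translations arise from
    \<open>theta\<close>.\<close>
  have "root_refl f (coroot theta) = coroot theta - cartan f theta *\<^sub>R coroot f"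
   by (simp add: root_refl_def coroot_def cartan_def inner_commute)
  then have "coroot f = coroot theta + root_refl f (- coroot theta)" by (simp add: c linear_neg[OF linear_root_refl])
  then show ?thesis using T_add[OF T_theta T_W[OF refl_W[OF f(1)] T_neg]] by simp
 qed (use T_theta in simp)
 have T_root: "coroot a \<in> T" if a: "a \<in> R" for a
 proof -
  obtain w where w: "w \<in> W" "dominant (w a)" using dominant_exists by blast
  have "inv w (coroot (w a)) \<in> T" by (rule T_W[OF W_inv(1)[OF w(1)] T_dom[OF W_R[OF w(1) a] w(2)]])
  then show ?thesis by (simp add: W_coroot[OF w(1)] W_inv(2)[OF w(1)])
 qed
 have T0: "0 \<in> T"
 proof -
  have e: "(\<lambda>v. v + 0) = (id :: 'a \<Rightarrow> 'a)" by (simp add: fun_eq_iff)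
  show ?thesis unfolding T_def mem_Collect_eq e by (rule gen_subgroup_id)
 qed
 have T_nat: "real k *\<^sub>R x \<in> T" if "x \<in> T" for k x
  by (induction k) (simp_all add: T0 T_add that scaleR_left_distrib)
 have T_int: "of_int k *\<^sub>R coroot a \<in> T" if a: "a \<in> R" for k a
 proof (cases "0 \<le> k")
  case True
  then show ?thesis using T_nat[OF T_root[OF a], of "nat k"] by simp
 next
  case False
  then show ?thesis using T_nat[OF T_root[OF neg_R[OF a]], of "nat (- k)"] by (simp add: coroot_minus)
 qed
 have T_sum: "sum f X \<in> T" if "\<And>x. x \<in> X \<Longrightarrow> f x \<in> T" for f :: "'a \<Rightarrow> 'a" and X
  using that by (induction X rule: infinite_finite_induct) (simp_all add: T0 T_add)
 have T_Qv: "x \<in> T" if "x \<in> Qv" for x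
 proof -
  obtain m :: "'a \<Rightarrow> int" where x: "x = (\<Sum>b\<in>coroot ` B. of_int (m b) *\<^sub>R b)" using \<open>x \<in> Qv\<close> unfolding D.lat_def by blast
  show ?thesis unfolding x
  proof (rule T_sum)
   fix c assume "c \<in> coroot ` B"
   then obtain b where "b \<in> B" "c = coroot b" by (elim imageE)
   then show "of_int (m c) *\<^sub>R c \<in> T" using T_int[of b] B_sub by auto
  qed
 qed
 show ?thesis
 proof (intro equalityI subsetI)
  fix w assume "w \<in> Wa"
  then have "\<exists>L x. L \<in> W \<and> x \<in> Qv \<and> w = aff_elt L x"
  proof (induction rule: gen_subgroup_induct)
   case id
   have e: "id = aff_elt (id :: 'a \<Rightarrow> 'a) 0" by (simp add: fun_eq_iff)
   show ?case by (rule exI[of _ id], rule exI[of _ 0]) (intro conjI gen_subgroup_id D.lat_0 e)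
  next
   case (step i w)
   then obtain L x where L: "L \<in> W" "x \<in> Qv" "w = aff_elt L x" by (elim exE conjE)
   show ?case
   proof (cases i)
    case None
    have "AF.s i \<circ> w = aff_elt (root_refl theta \<circ> L) (root_refl theta x + coroot theta)"
     unfolding None L(3) by (simp add: fun_eq_iff s0 linear_add[OF linear_root_refl])
    moreover have "root_refl theta x + coroot theta \<in> Qv"
     by (rule D.lat_add[OF Qv_W[OF refl_W[OF theta_R] L(2)] D.R_lat[OF imageI[OF theta_R]]])
    ultimately show ?thesis using W_comp[OF refl_W[OF theta_R] L(1)] by (intro exI conjI)
   next
    case (Some b)
    then have b: "b \<in> B" using step(1) by (auto simp: aff_simple_def)
    have "AF.s i \<circ> w = aff_elt (root_refl b \<circ> L) (root_refl b x)"
     unfolding Some L(3) sb by (simp add: fun_eq_iff linear_add[OF linear_root_refl])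
    then show ?thesis using W_comp[OF B_W[OF b] L(1)] Qv_W[OF B_W[OF b] L(2)] by (intro exI conjI)
   qed
  qed
  then show "w \<in> (\<lambda>(L, x). aff_elt L x) ` (W \<times> Qv)" by auto
 next
  fix w assume "w \<in> (\<lambda>(L, x). aff_elt L x) ` (W \<times> Qv)"
  then obtain L x where L: "L \<in> W" "x \<in> Qv" "w = aff_elt L x" by auto
  have "(\<lambda>v. v + x) \<circ> L \<in> Wa" by (rule gen_subgroup_comp[OF _ Wsub[OF L(1)]]) (use T_Qv[OF L(2)] in \<open>simp add: T_def\<close>)
  then show "w \<in> Wa" unfolding L(3) by (simp add: comp_def)
 qed
qed

end

section \<open>The Poincare series of the affine group\<close>

lemma prod_by_value:
 fixes h :: "'i \<Rightarrow> nat" and G :: "nat \<Rightarrow> 'r::comm_monoid_mult"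
 assumes "finite A" "\<And>a. a \<in> A \<Longrightarrow> h a \<le> M"
 shows "(\<Prod>a\<in>A. G (h a)) = (\<Prod>m\<in>{..M}. G m ^ card {a \<in> A. h a = m})"
proof -
 have "(\<Prod>m\<in>{..M}. \<Prod>a\<in>{a \<in> A. h a = m}. G (h a)) = (\<Prod>a\<in>A. G (h a))"
  by (rule prod.group) (use assms in auto)
 moreover have "(\<Prod>a\<in>{a \<in> A. h a = m}. G (h a)) = G m ^ card {a \<in> A. h a = m}" for m
  by (simp add: prod_constant)
 ultimately show ?thesis by simp
qed

lemma fps_cancel: "c \<noteq> 0 \<Longrightarrow> a * c = b * c \<Longrightarrow> a = b" for a b c :: "real fps"
 by simp

lemma Alt_factor:
 assumes "finite S"
 shows "Alt s S = poincare s S S * (\<Prod>I\<in>Pow S - {S}. if even (card I + card S) then poincare s S I else inverse (poincare s S I))"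
proof -
 have f: "finite (Pow S)" "S \<in> Pow S" and ev: "even (card S + card S)" using assms by simp_all
 show ?thesis unfolding Alt_def
  using prod.remove[OF f, of "\<lambda>I. if even (card I + card S) then poincare s S I else inverse (poincare s S I)"]
  unfolding if_P[OF ev] .
qed

context irreducible_roots
begin

lemma B_iff_nht: "a \<in> pos \<Longrightarrow> a \<in> B \<longleftrightarrow> nht a = 1"
 using ht_nonsimple[of a] nht[of a] nht_B[of a] by force

lemma B_iff_cht: assumes a: "a \<in> pos" shows "a \<in> B \<longleftrightarrow> cht a = 1"
proof -
 have "B = {a \<in> pos. nht a = 1}" using B_iff_nht B_pos by blast
 then have c: "card {a \<in> pos. cht a = 1} = card B" using dual_count[of 1] by simp
 have sub: "B \<subseteq> {a \<in> pos. cht a = 1}" using B_pos cht_B by auto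
 have "B = {a \<in> pos. cht a = 1}" by (rule card_subset_eq[OF _ sub c[symmetric]]) simp
 then show ?thesis using a by auto
qed

text \<open>Such a product depends only on how many roots have each height, so
  \<open>dual_count\<close> lets heights of coroots be replaced by heights of roots.\<close>

lemma prod_cht:
 fixes G :: "nat \<Rightarrow> 'r::comm_monoid_mult"
 shows "(\<Prod>a\<in>pos. G (cht a)) = (\<Prod>a\<in>pos. G (nht a))"
proof -
 have l: "cht a \<le> nht theta" "nht a \<le> nht theta" if "a \<in> pos" for a using cht_le[OF that] nht_le[OF that] cht_theta_s by simp_all
 have "card {a \<in> pos. cht a = m} = card {a \<in> pos. nht a = m}" for m
 proof (cases "m = 0")
  case True
  have "{a \<in> pos. cht a = m} = {}" "{a \<in> pos. nht a = m} = {}" using True cht_ge_1 nht_ge_1 by fastforce+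
  then show ?thesis by (simp only:)
 next
  case False
  then show ?thesis using dual_count[of m] by simp
 qed
 then have "(\<Prod>m\<in>{..nht theta}. G m ^ card {a \<in> pos. cht a = m}) = (\<Prod>m\<in>{..nht theta}. G m ^ card {a \<in> pos. nht a = m})"
  by simp
 moreover have "(\<Prod>a\<in>pos. G (cht a)) = (\<Prod>m\<in>{..nht theta}. G m ^ card {a \<in> pos. cht a = m})"
  by (rule prod_by_value) (simp_all add: l)
 moreover have "(\<Prod>a\<in>pos. G (nht a)) = (\<Prod>m\<in>{..nht theta}. G m ^ card {a \<in> pos. nht a = m})"
  by (rule prod_by_value) (simp_all add: l)
 ultimately show ?thesis by (simp only:)
qed

lemma prod_nonsimple:
 fixes G :: "nat \<Rightarrow> 'r::comm_monoid_mult"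
 shows "(\<Prod>a\<in>pos - B. G (nht a - 1)) = (\<Prod>a\<in>pos. if nht a = 1 then 1 else G (nht a - 1))"
  and "(\<Prod>a\<in>pos - B. G (cht a - 1)) = (\<Prod>a\<in>pos. if cht a = 1 then 1 else G (cht a - 1))"
proof -
 show "(\<Prod>a\<in>pos - B. G (nht a - 1)) = (\<Prod>a\<in>pos. if nht a = 1 then 1 else G (nht a - 1))"
  by (rule prod.mono_neutral_cong_left) (use B_iff_nht in auto)
 show "(\<Prod>a\<in>pos - B. G (cht a - 1)) = (\<Prod>a\<in>pos. if cht a = 1 then 1 else G (cht a - 1))"
  by (rule prod.mono_neutral_cong_left) (use B_iff_cht in auto)
qed

lemma prod_cht_nonsimple:
 fixes G :: "nat \<Rightarrow> 'r::comm_monoid_mult"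
 shows "(\<Prod>a\<in>pos - B. G (cht a - 1)) = (\<Prod>a\<in>pos - B. G (nht a - 1))"
 unfolding prod_nonsimple by (rule prod_cht)

text \<open>Compare the exponents of each \<open>G m\<close>: by \<open>height_duality\<close> both
  sides are the product of \<open>G m ^ card B\<close> over \<open>1 \<le> m \<le> cnum\<close>. On
  the right the value \<open>m = cnum\<close> is supplied by the extra factor.\<close>

lemma height_product:
 fixes G :: "nat \<Rightarrow> 'r::comm_monoid_mult"
 shows "(\<Prod>a\<in>pos. G (cnum - nht a + 1)) * (\<Prod>a\<in>pos. G (nht a))
  = (\<Prod>a\<in>pos. G (cnum - nht a)) * (\<Prod>a\<in>pos - B. G (nht a - 1)) * G cnum ^ card B"
proof -
 have g: "1 \<le> nht a \<and> nht a < cnum" if "a \<in> pos" for a using nht_ge_1[OF that] nht_le[OF that] by (simp add: cnum_def)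
 have n1: "cnum - nht a + 1 \<le> cnum" "nht a \<le> cnum" "cnum - nht a \<le> cnum - 1" if "a \<in> pos" for a using g[OF that] by auto
 have n2: "nht a - 1 \<le> cnum - 1" if "a \<in> pos - B" for a using g[of a] that by auto
 define c where "c m = card {a \<in> pos. nht a = m}" for m
 have e: "{a \<in> pos. nht a = 0} = {}" "{a \<in> pos. nht a = cnum} = {}" using g by fastforce+
 have c0: "c 0 = 0" and cg: "c cnum = 0" unfolding c_def e by (rule card.empty)+
 have du: "c (cnum - m) + c (m + 1) = card B" if "m < cnum" for m unfolding c_def by (rule height_duality[OF that])
 have e1: "card {a \<in> pos. cnum - nht a + 1 = m} = (if m = 0 then 0 else c (cnum - (m - 1)))" if "m \<le> cnum" for m
 proof (cases "m = 0")
  case False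
  have "{a \<in> pos. cnum - nht a + 1 = m} = {a \<in> pos. nht a = cnum - (m - 1)}" using g False that by fastforce
  then show ?thesis using False by (simp add: c_def)
 qed simp
 have e2: "card {a \<in> pos. cnum - nht a = m} = c (cnum - m)" if "m \<le> cnum - 1" for m
 proof -
  have "0 < cnum" by (simp add: cnum_def)
  then have "{a \<in> pos. cnum - nht a = m} = {a \<in> pos. nht a = cnum - m}" using g that by fastforce
  then show ?thesis by (simp add: c_def)
 qed
 have e3: "card {a \<in> pos - B. nht a - 1 = m} = (if m = 0 then 0 else c (m + 1))" for m
 proof (cases "m = 0")
  case True
  have "{a \<in> pos - B. nht a - 1 = m} = {}" using True B_iff_nht g by fastforce
  then have "card {a \<in> pos - B. nht a - 1 = m} = 0" by (simp only: card.empty)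
  then show ?thesis unfolding if_P[OF True] .
 next
  case False
  have "{a \<in> pos - B. nht a - 1 = m} = {a \<in> pos. nht a = m + 1}" using False B_iff_nht g by fastforce
  then show ?thesis using False by (simp add: c_def)
 qed
 have gs: "{..cnum} = insert cnum {..cnum - 1}" "cnum \<notin> {..cnum - 1}" using cnum_def by auto
 have "(\<Prod>a\<in>pos. G (cnum - nht a + 1)) * (\<Prod>a\<in>pos. G (nht a))
  = (\<Prod>m\<in>{..cnum}. G m ^ (if m = 0 then 0 else c (cnum - (m - 1)))) * (\<Prod>m\<in>{..cnum}. G m ^ c m)"
 proof -
  have "(\<Prod>a\<in>pos. G (cnum - nht a + 1)) = (\<Prod>m\<in>{..cnum}. G m ^ card {a \<in> pos. cnum - nht a + 1 = m})"
   by (rule prod_by_value) (use n1 in auto)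
  moreover have "(\<Prod>m\<in>{..cnum}. G m ^ card {a \<in> pos. cnum - nht a + 1 = m}) = (\<Prod>m\<in>{..cnum}. G m ^ (if m = 0 then 0 else c (cnum - (m - 1))))"
   by (rule prod.cong) (simp_all only: e1 atMost_iff)
  moreover have "(\<Prod>a\<in>pos. G (nht a)) = (\<Prod>m\<in>{..cnum}. G m ^ c m)"
   unfolding c_def by (rule prod_by_value) (use n1 in auto)
  ultimately show ?thesis by simp
 qed
 also have "\<dots> = (\<Prod>m\<in>{..cnum}. G m ^ (if m = 0 then 0 else card B))"
  unfolding prod.distrib[symmetric]
 proof (rule prod.cong)
  fix m assume m: "m \<in> {..cnum}"
  show "G m ^ (if m = 0 then 0 else c (cnum - (m - 1))) * G m ^ c m = G m ^ (if m = 0 then 0 else card B)"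
  proof (cases "m = 0")
   case False
   then have "c (cnum - (m - 1)) + c m = card B" using du[of "m - 1"] m by simp
   then show ?thesis using False by (simp flip: power_add)
  qed (simp add: c0)
 qed simp
 also have "\<dots> = G cnum ^ card B * (\<Prod>m\<in>{..cnum - 1}. G m ^ (if m = 0 then 0 else card B))"
  unfolding gs(1) by (subst prod.insert) (use gs(2) cnum_def in auto)
 also have "(\<Prod>m\<in>{..cnum - 1}. G m ^ (if m = 0 then 0 else card B))
  = (\<Prod>m\<in>{..cnum - 1}. G m ^ c (cnum - m)) * (\<Prod>m\<in>{..cnum - 1}. G m ^ (if m = 0 then 0 else c (m + 1)))"
  unfolding prod.distrib[symmetric]
 proof (rule prod.cong)
  fix m assume m: "m \<in> {..cnum - 1}"
  show "G m ^ (if m = 0 then 0 else card B) = G m ^ c (cnum - m) * G m ^ (if m = 0 then 0 else c (m + 1))"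
  proof (cases "m = 0")
   case False
   have "m < cnum" using m cnum_def by auto
   from du[OF this] show ?thesis using False by (simp flip: power_add)
  qed (simp add: cg)
 qed simp
 also have "(\<Prod>m\<in>{..cnum - 1}. G m ^ c (cnum - m)) = (\<Prod>a\<in>pos. G (cnum - nht a))"
 proof -
  have "(\<Prod>a\<in>pos. G (cnum - nht a)) = (\<Prod>m\<in>{..cnum - 1}. G m ^ card {a \<in> pos. cnum - nht a = m})"
   by (rule prod_by_value) (use n1 in auto)
  also have "\<dots> = (\<Prod>m\<in>{..cnum - 1}. G m ^ c (cnum - m))" by (rule prod.cong) (simp_all only: e2 atMost_iff)
  finally show ?thesis by (rule sym)
 qed
 also have "(\<Prod>m\<in>{..cnum - 1}. G m ^ (if m = 0 then 0 else c (m + 1))) = (\<Prod>a\<in>pos - B. G (nht a - 1))"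
  unfolding e3[symmetric] by (rule prod_by_value[symmetric]) (use n2 in auto)
 finally show ?thesis by (simp add: mult_ac)
qed

text \<open>The value at \<open>u\<close> of the affine length generating function, from
  \<open>bott_sum\<close> for the coroots but written with heights of roots.\<close>

definition wval :: "real \<Rightarrow> real" where
 "wval u = poinW u * ((\<Prod>a\<in>pos - B. 1 - u ^ (nht a - 1)) / (\<Prod>a\<in>pos. 1 - u ^ nht a))"

text \<open>The translation part lies in the orbit of one dominant \<open>mu\<close> and equals
  \<open>y mu\<close> for one minimal \<open>y\<close>; the linear part then determines
  \<open>z\<close>. These are the coordinates of \<open>length_weight\<close>.\<close>

lemma aff_bij:
 "bij_betw (\<lambda>(mu, y, z). aff_elt (y \<circ> inv z) (y mu))
  (Sigma {x \<in> Qv. dominant x} (\<lambda>mu. min_reps mu \<times> W)) Wa"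
 unfolding bij_betw_def
proof
 interpret D: based_roots "coroot ` R" "coroot ` B" by (rule dual)
 have Qv_W: "w x \<in> Qv" if "w \<in> W" "x \<in> Qv" for w x by (rule D.W_lat[unfolded dual_W, OF that])
 let ?T = "Sigma {x \<in> Qv. dominant x} (\<lambda>mu. min_reps mu \<times> W)" and ?P = "\<lambda>(mu, y, z). aff_elt (y \<circ> inv z) (y mu)"
 show "inj_on ?P ?T"
 proof (rule inj_onI)
  fix p q assume pT: "p \<in> ?T" and qT: "q \<in> ?T" and e: "?P p = ?P q"
  obtain mu y z where p: "p = (mu, y, z)" by (cases p)
  obtain mu' y' z' where q: "q = (mu', y', z')" by (cases q)
  have h: "dominant mu" "y \<in> min_reps mu" "z \<in> W" "dominant mu'" "y' \<in> min_reps mu'" "z' \<in> W"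
   using pT qT unfolding p q by simp_all
  have yW: "y \<in> W" "y' \<in> W" using h min_reps_W by simp_all
  have LW: "y \<circ> inv z \<in> W" "y' \<circ> inv z' \<in> W" by (intro W_comp yW W_inv(1) h)+
  have e': "(y \<circ> inv z) v + y mu = (y' \<circ> inv z') v + y' mu'" for v using fun_cong[OF e, of v] unfolding p q by simp
  have ym: "y mu = y' mu'" using e'[of 0] linear_0[OF W_linear[OF LW(1)]] linear_0[OF W_linear[OF LW(2)]] by simp
  have L: "y \<circ> inv z = y' \<circ> inv z'" using e' unfolding ym by (intro ext) simp
  have m: "(inv y' \<circ> y) mu = mu'" using ym W_inv(2)[OF yW(2)] by simp
  have "(inv y' \<circ> y) mu = mu"
   by (rule dominant_unique[OF W_comp[OF W_inv(1)[OF yW(2)] yW(1)] h(1)]) (use m h(4) in simp)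
  then have mm: "mu' = mu" using m by simp
  have yy: "y = y'" by (rule inj_onD[OF bij_betw_imp_inj_on[OF min_reps_bij[OF h(1)]]]) (use ym h mm in simp_all)
  have "inv z v = inv z' v" for v using fun_cong[OF L, of v] unfolding yy by (simp add: inj_eq[OF bij_is_inj[OF W_inv(4)[OF yW(2)]]])
  then have "inv z = inv z'" by (rule ext)
  then have "z = z'" using inv_inv[OF h(3)] inv_inv[OF h(6)] by metis
  then show "p = q" unfolding p q mm yy by simp
 qed
 show "?P ` ?T = Wa"
 proof (intro equalityI subsetI)
  fix w assume "w \<in> ?P ` ?T"
  then obtain p where pT: "p \<in> ?T" and w: "w = ?P p" by (elim imageE)
  obtain mu y z where p: "p = (mu, y, z)" by (cases p)
  have h: "mu \<in> Qv" "y \<in> min_reps mu" "z \<in> W" using pT unfolding p by simp_all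
  have yW: "y \<in> W" using h min_reps_W by simp
  have "(y \<circ> inv z, y mu) \<in> W \<times> Qv" using W_comp[OF yW W_inv(1)[OF h(3)]] Qv_W[OF yW h(1)] by (rule SigmaI)
  then have "(\<lambda>(L, x). aff_elt L x) (y \<circ> inv z, y mu) \<in> (\<lambda>(L, x). aff_elt L x) ` (W \<times> Qv)" by (rule imageI)
  then show "w \<in> Wa" unfolding Wa_eq w p case_prod_conv .
 next
  fix w assume "w \<in> Wa"
  then obtain q where q: "w = (\<lambda>(L, x). aff_elt L x) q" "q \<in> W \<times> Qv" unfolding Wa_eq by (elim imageE)
  obtain L x where Lx: "q = (L, x)" by (cases q)
  have L: "L \<in> W" and x: "x \<in> Qv" using q(2) unfolding Lx by simp_all
  from dominant_exists[of x] obtain v where v: "v \<in> W" "dominant (v x)" by (elim bexE)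
  have "inv v (v x) \<in> (\<lambda>w. w (v x)) ` W" using W_inv(1)[OF v(1)] by (rule imageI)
  then have "x \<in> (\<lambda>w. w (v x)) ` min_reps (v x)"
   unfolding W_inv(2)[OF v(1)] bij_betw_imp_surj_on[OF min_reps_bij[OF v(2)]] .
  then obtain y where y: "x = y (v x)" "y \<in> min_reps (v x)" by (elim imageE)
  have yW: "y \<in> W" by (rule min_reps_W[OF y(2)])
  have uW: "inv y \<circ> L \<in> W" by (rule W_comp[OF W_inv(1)[OF yW] L])
  have "inv (inv (inv y \<circ> L)) = inv y \<circ> L" by (rule inv_inv[OF uW])
  then have yL: "y \<circ> inv (inv (inv y \<circ> L)) = L" using W_inv(3)[OF yW] by (simp add: fun_eq_iff)
  have "(v x, y, inv (inv y \<circ> L)) \<in> ?T" using v y W_inv(1)[OF uW] Qv_W[OF v(1) x] by simp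
  then have "?P (v x, y, inv (inv y \<circ> L)) \<in> ?P ` ?T" by (rule imageI)
  then show "w \<in> ?P ` ?T" unfolding case_prod_conv yL y(1)[symmetric] q(1) Lx .
 qed
qed

text \<open>For fixed \<open>mu\<close> the sum over \<open>y\<close> and \<open>z\<close> is
  \<open>weight_sum\<close>; what remains is \<open>bott_sum\<close> for the dual system, whose
  lattice is that of the translations. All terms are nonnegative, which justifies the iterated
  summation.\<close>

lemma aff_has_sum:
 assumes u: "0 < u" "u < 1"
 shows "((\<lambda>w. u ^ card (AF.A.inversions w)) has_sum wval u) Wa"
proof -
 interpret D: based_roots "coroot ` R" "coroot ` B" by (rule dual)
 let ?P = "\<lambda>(mu, y, z). aff_elt (y \<circ> inv z) (y mu)"
 let ?A = "{x \<in> Qv. dominant x}" and ?Bf = "\<lambda>mu. min_reps mu \<times> W"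
 define f where "f p = u ^ card (AF.A.inversions (?P p))" for p :: "'a \<times> ('a \<Rightarrow> 'a) \<times> ('a \<Rightarrow> 'a)"
 define g where "g mu = poinW u * (u powr (2 * D.ht mu) * (poinW (1 / u) / poin (1 / u) mu))" for mu
 have Lam: "D.Lam = ?A" unfolding D.Lam_def using dual_dominant' by simp
 have DI: "card (D.Inv w) = card (Inv w)" if "w \<in> W" for w
  unfolding dual_Inv[OF that] by (rule card_image[OF inj_coroot])
 have pW: "D.poinW v = poinW v" for v
  unfolding D.poinW_def poinW_def dual_W by (rule sum.cong) (simp_all add: DI)
 have st: "D.stab x = stab x" for x unfolding D.stab_def stab_def dual_W ..
 have pn: "D.poin v x = poin v x" for v x
  unfolding D.poin_def poin_def st by (rule sum.cong) (simp_all add: DI stab_W)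
 have inner: "((\<lambda>p. f (mu, p)) has_sum g mu) (?Bf mu)" if mu: "mu \<in> ?A" for mu
 proof (rule has_sum_finiteI)
  have d: "mu \<in> Qv" "dominant mu" using mu by simp_all
  show "finite (?Bf mu)" by simp
  have "(\<Sum>p\<in>?Bf mu. f (mu, p)) = (\<Sum>y\<in>min_reps mu. \<Sum>z\<in>W. f (mu, y, z))"
   by (simp add: sum.cartesian_product)
  also have "\<dots> = (\<Sum>y\<in>min_reps mu. \<Sum>z\<in>W. u powr (2 * D.ht mu) * (u ^ card (Inv y) * (\<Prod>a\<in>Inv z. if a \<bullet> mu = 0 then u else 1 / u)))"
  proof (intro sum.cong refl)
   fix y z assume yz: "y \<in> min_reps mu" "z \<in> W"
   show "f (mu, y, z) = u powr (2 * D.ht mu) * (u ^ card (Inv y) * (\<Prod>a\<in>Inv z. if a \<bullet> mu = 0 then u else 1 / u))"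
    unfolding f_def case_prod_conv length_weight[OF d yz u(1)] by (rule mult.assoc)
  qed
  also have "\<dots> = u powr (2 * D.ht mu) * (\<Sum>y\<in>min_reps mu. \<Sum>z\<in>W. u ^ card (Inv y) * (\<Prod>a\<in>Inv z. if a \<bullet> mu = 0 then u else 1 / u))"
   by (simp only: sum_distrib_left)
  also have "\<dots> = g mu" unfolding weight_sum[OF d(2) u(1)] g_def by (rule mult.left_commute)
  finally show "g mu = (\<Sum>p\<in>?Bf mu. f (mu, p))" by (rule sym)
 qed
 have V: "(\<Prod>c\<in>D.pos - coroot ` B. 1 - u powr (D.ht c - 1)) / (\<Prod>c\<in>D.pos. 1 - u powr D.ht c)
  = (\<Prod>a\<in>pos - B. 1 - u ^ (nht a - 1)) / (\<Prod>a\<in>pos. 1 - u ^ nht a)"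
 proof -
  have h1: "u powr D.ht (coroot a) = u ^ cht a" "u powr (D.ht (coroot a) - 1) = u ^ (cht a - 1)" if a: "a \<in> pos" for a
  proof -
   show "u powr D.ht (coroot a) = u ^ cht a" unfolding cht[OF a, symmetric] using u by (simp add: powr_realpow)
   have e: "real (cht a) - 1 = real (cht a - 1)" using cht_ge_1[OF a] by simp
   show "u powr (D.ht (coroot a) - 1) = u ^ (cht a - 1)"
    unfolding cht[OF a, symmetric] e by (rule powr_realpow[OF u(1)])
  qed
  have "(\<Prod>c\<in>D.pos. 1 - u powr D.ht c) = (\<Prod>a\<in>pos. 1 - u ^ cht a)"
   unfolding dual_pos prod.reindex[OF inj_coroot] comp_def by (rule prod.cong) (simp_all add: h1)
  moreover have "D.pos - coroot ` B = coroot ` (pos - B)" unfolding dual_pos by (rule image_set_diff[OF inj_coroot, symmetric])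
  then have "(\<Prod>c\<in>D.pos - coroot ` B. 1 - u powr (D.ht c - 1)) = (\<Prod>c\<in>coroot ` (pos - B). 1 - u powr (D.ht c - 1))" by simp
  moreover have "\<dots> = (\<Prod>a\<in>pos - B. 1 - u ^ (cht a - 1))"
   unfolding prod.reindex[OF inj_coroot] comp_def by (rule prod.cong) (simp_all add: h1)
  ultimately show ?thesis using prod_cht[of "\<lambda>m. 1 - u ^ m"] prod_cht_nonsimple[of "\<lambda>m. 1 - u ^ m"] by simp
 qed
 have outer: "(g has_sum wval u) ?A"
  unfolding g_def wval_def V[symmetric] using has_sum_cmult_right[OF D.bott_sum[OF u], of "poinW u"] unfolding Lam pW pn .
 have "(f has_sum wval u) (Sigma ?A ?Bf)"
 proof (rule has_sum_SigmaI[OF inner outer])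
  show "f summable_on Sigma ?A ?Bf"
  proof (rule summable_on_SigmaI[OF inner])
   show "g summable_on ?A" using outer by (rule has_sum_imp_summable)
   show "0 \<le> f (x, y)" for x y unfolding f_def using u by simp
  qed
 qed
 then show ?thesis unfolding f_def has_sum_reindex_bij_betw[OF aff_bij, where f = "\<lambda>w. u ^ card (AF.A.inversions w)"] .
qed

abbreviation "PA \<equiv> poincare AF.s (aff_simple B) (aff_simple B)"

lemma aff_sums:
 assumes u: "0 < u" "u < 1"
 shows "(\<lambda>k. fps_nth PA k * u ^ k) sums wval u"
proof (rule has_sum_imp_sums)
 let ?F = "\<lambda>k. {x \<in> Wa. card (AF.A.inversions x) = k}"
 have "bij_betw snd (Sigma UNIV ?F) Wa"
  by (rule bij_betw_byWitness[where f' = "\<lambda>w. (card (AF.A.inversions w), w)"]) auto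
 then have 1: "((\<lambda>p. u ^ card (AF.A.inversions (snd p))) has_sum wval u) (Sigma UNIV ?F)"
  using has_sum_reindex_bij_betw[of snd "Sigma UNIV ?F" Wa "\<lambda>w. u ^ card (AF.A.inversions w)" "wval u"] aff_has_sum[OF u] by blast
 show "((\<lambda>k. fps_nth PA k * u ^ k) has_sum wval u) UNIV"
 proof (rule has_sum_SigmaD[OF 1])
  fix k :: nat
  show "((\<lambda>y. u ^ card (AF.A.inversions (snd (k, y)))) has_sum fps_nth PA k * u ^ k) (?F k)"
  proof (rule has_sum_finiteI)
   show "finite (?F k)" by (rule AF.A.finite_length_le[OF AF.finite_S])
   have "(\<Sum>y\<in>?F k. u ^ card (AF.A.inversions (snd (k, y)))) = (\<Sum>y\<in>?F k. u ^ k)" by (rule sum.cong) auto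
   also have "\<dots> = fps_nth PA k * u ^ k" unfolding AF.A.poincare_eq[OF subset_refl] by simp
   finally show "fps_nth PA k * u ^ k = (\<Sum>y\<in>?F k. u ^ card (AF.A.inversions (snd (k, y))))" by (rule sym)
  qed
 qed
qed

lemma om_pos_nz: "(\<And>a. a \<in> A \<Longrightarrow> 0 < h a) \<Longrightarrow> finite A \<Longrightarrow> (\<Prod>a\<in>A. om (h a)) \<noteq> 0"
proof -
 assume "\<And>a. a \<in> A \<Longrightarrow> 0 < h a" "finite A"
 moreover have "om m \<noteq> 0" if "0 < m" for m using om_unit[OF that] by auto
 ultimately show ?thesis by (simp add: prod_zero_iff)
qed

lemma hf_prod: "(\<And>a. a \<in> A \<Longrightarrow> 0 < h a) \<Longrightarrow> (\<Prod>a\<in>A. hf (h a)) * (\<Prod>a\<in>A. om (h a)) = (\<Prod>a\<in>A. om (h a + 1))"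
 unfolding prod.distrib[symmetric] by (rule prod.cong) (simp_all only: hf_om)

text \<open>The values on the unit interval give a rational identity through
  \<open>fps_rational\<close>, and one of its two copies of the denominator is absorbed into the
  factors \<open>hf\<close>.\<close>

lemma PA_om: "PA * (\<Prod>a\<in>pos. om (nht a)) = (\<Prod>a\<in>pos. hf (nht a)) * (\<Prod>a\<in>pos - B. om (nht a - 1))"
proof -
 define q where "q m = (1 - monom 1 m :: real poly)" for m
 have q: "fps_of_poly (q m) = om m" for m by (simp add: q_def om_def fps_of_poly_diff fps_of_poly_monom)
 have hp: "0 < nht a" if "a \<in> pos" for a using nht_ge_1[OF that] by simp
 have "PA * fps_of_poly ((\<Prod>a\<in>pos. q (nht a)) * (\<Prod>a\<in>pos. q (nht a)))
  = fps_of_poly ((\<Prod>a\<in>pos. q (nht a + 1)) * (\<Prod>a\<in>pos - B. q (nht a - 1)))"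
 proof (rule fps_rational[OF aff_sums])
  fix u :: real assume u: "0 < u" "u < 1"
  have "u ^ nht a < 1" if "a \<in> pos" for a using u hp[OF that] by (simp add: power_less_one_iff)
  from less_imp_neq[OF this] have nz: "(\<Prod>a\<in>pos. 1 - u ^ nht a) \<noteq> 0" by (auto simp: prod_zero_iff)
  have pq: "poly (\<Prod>a\<in>A. q (h a)) u = (\<Prod>a\<in>A. 1 - u ^ h a)" for A and h :: "'a \<Rightarrow> nat" by (simp add: poly_prod q_def poly_monom)
  have r: "(a / d) * (b / d) * (d * d) = a * b" if "d \<noteq> 0" for a b d :: real using that by simp
  show "wval u * poly ((\<Prod>a\<in>pos. q (nht a)) * (\<Prod>a\<in>pos. q (nht a))) u
   = poly ((\<Prod>a\<in>pos. q (nht a + 1)) * (\<Prod>a\<in>pos - B. q (nht a - 1))) u"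
   unfolding poly_mult pq wval_def poinW_product[OF u] by (rule r[OF nz])
 qed
 then have "PA * ((\<Prod>a\<in>pos. om (nht a)) * (\<Prod>a\<in>pos. om (nht a))) = (\<Prod>a\<in>pos. om (nht a + 1)) * (\<Prod>a\<in>pos - B. om (nht a - 1))"
  unfolding fps_of_poly_mult fps_of_poly_prod q .
 also have "(\<Prod>a\<in>pos. om (nht a + 1)) = (\<Prod>a\<in>pos. hf (nht a)) * (\<Prod>a\<in>pos. om (nht a))" by (rule hf_prod[OF hp, symmetric])
 finally have "(PA * (\<Prod>a\<in>pos. om (nht a))) * (\<Prod>a\<in>pos. om (nht a))
  = ((\<Prod>a\<in>pos. hf (nht a)) * (\<Prod>a\<in>pos - B. om (nht a - 1))) * (\<Prod>a\<in>pos. om (nht a))" by (simp only: mult_ac)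
 moreover have "(\<Prod>a\<in>pos. om (nht a)) \<noteq> 0" by (rule om_pos_nz[of pos nht], erule hp, rule finite_pos)
 ultimately show ?thesis by (rule fps_cancel[rotated])
qed

text \<open>Multiplied by \<open>om cnum ^ card B\<close>, Bott's formula is rewritten by
  \<open>height_product\<close> with \<open>G = om\<close>: the product over nonsimple roots is
  exchanged for a factor of each affine root \<open>1 - a\<close> with \<open>a\<close> positive,
  whose height is \<open>cnum - nht a\<close>.\<close>

lemma PA_eq: "PA * om cnum ^ card B = (\<Prod>a\<in>pos. hf (nht a)) * (\<Prod>a\<in>pos. hf (cnum - nht a))"
proof -
 let ?o = "\<Prod>a\<in>pos. om (nht a)" and ?c = "\<Prod>a\<in>pos. om (cnum - nht a)" and ?K = "\<Prod>a\<in>pos. hf (cnum - nht a)"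
  and ?E = "\<Prod>a\<in>pos - B. om (nht a - 1)" and ?H = "\<Prod>a\<in>pos. hf (nht a)"
 have hp: "0 < nht a" "0 < cnum - nht a" if "a \<in> pos" for a using nht_ge_1[OF that] nht_le[OF that] by (simp_all add: cnum_def)
 have nz1: "?o \<noteq> 0" by (rule om_pos_nz[of pos nht], erule hp(1), rule finite_pos)
 have nz2: "?c \<noteq> 0" by (rule om_pos_nz[of pos "\<lambda>a. cnum - nht a"], erule hp(2), rule finite_pos)
 have "?K * ?c = (\<Prod>a\<in>pos. om (cnum - nht a + 1))" by (rule hf_prod[OF hp(2)])
 then have "(?K * ?c) * ?o = ?c * ?E * om cnum ^ card B" using height_product[of om] by (simp only:)
 then have "(?K * ?o) * ?c = (?E * om cnum ^ card B) * ?c" by (simp only: mult_ac)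
 then have 1: "?K * ?o = ?E * om cnum ^ card B" by (rule fps_cancel[OF nz2])
 have "(PA * om cnum ^ card B) * ?o = (PA * ?o) * om cnum ^ card B" by (simp only: mult_ac)
 also have "\<dots> = ?H * (?E * om cnum ^ card B)" unfolding PA_om by (rule mult.assoc)
 also have "\<dots> = (?H * ?K) * ?o" unfolding 1[symmetric] by (rule mult.assoc[symmetric])
 finally show ?thesis by (rule fps_cancel[OF nz1])
qed

lemma nht_crd: assumes "a \<in> pos" shows "int (nht a) = (\<Sum>b\<in>B. crd a b)"
proof -
 have aR: "a \<in> R" by (rule pos_R[OF assms])
 have "real (nht a) = (\<Sum>b\<in>B. representation B a b)" unfolding nht[OF assms] by (rule ht_rep[OF R_spanB[OF aR]])
 also have "\<dots> = of_int (\<Sum>b\<in>B. crd a b)" by (simp add: crd[OF aR])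
 finally show ?thesis by (metis of_int_eq_iff of_int_of_nat_eq)
qed

section \<open>The alternating products\<close>

sublocale FN: affine_roots R B "R \<times> {0}" B "\<lambda>b. (b, 0)" "\<lambda>x. crd (fst x)"
proof unfold_locales
 show "finite B" by (rule finite_B)
 show "(b, 0) \<in> R \<times> {0}" if "b \<in> B" for b using that B_sub by auto
 show "fst x \<in> R" if "x \<in> R \<times> {0}" for x :: "'a \<times> int" using that by auto
 show "fst x = (\<Sum>i\<in>B. of_int (crd (fst x) i) *\<^sub>R fst (i, 0::int))" if "x \<in> R \<times> {0}" for x :: "'a \<times> int"
  using crd_expand[of "fst x"] that by auto
 show "snd x = (\<Sum>i\<in>B. crd (fst x) i * snd (i, 0))" if "x \<in> R \<times> {0}" for x :: "'a \<times> int" using that by auto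
 show "m i = 0" if "(\<Sum>i\<in>B. of_int (m i) *\<^sub>R fst (i, 0::int)) = 0" "(\<Sum>i\<in>B. m i * snd (i, 0)) = 0" "i \<in> B" for m :: "'a \<Rightarrow> int" and i
 proof -
  have "of_int (m i) = (0::real)"
   by (rule real_vector.independentD[OF indep finite_B subset_refl, of "\<lambda>b. of_int (m b)"]) (use that in simp_all)
  then show ?thesis by simp
 qed
 show "(\<forall>i\<in>B. 0 \<le> crd (fst x) i) \<or> (\<forall>i\<in>B. crd (fst x) i \<le> 0)" if "x \<in> R \<times> {0}" for x :: "'a \<times> int"
 proof -
  have xR: "fst x \<in> R" using that by auto
  show ?thesis using pos_or_neg[OF xR] pos_crd[OF xR] pos_crd[OF neg_R[OF xR]] crd_minus[OF xR] by auto
 qed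
 show "arefl x y \<in> R \<times> {0}" if "x \<in> R \<times> {0}" "y \<in> R \<times> {0}" for x y :: "'a \<times> int"
  using that refl_closed by (auto simp: arefl_def)
qed

text \<open>All parabolic subgroups, the whole group included, are covered by
  \<open>parabolic_poincare\<close>, so \<open>moebius_prod\<close> over supports applies
  directly.\<close>

lemma Alt_finite: "Alt weyl_gen B = (\<Prod>a\<in>{a \<in> pos. {b \<in> B. crd a b \<noteq> 0} = B}. hf (nht a))"
proof -
 have s: "FN.s = weyl_gen"
  by (simp add: FN.s_def aff_refl_aform aform_def root_refl_def weyl_gen_def fun_eq_iff inner_commute)
 have "0 \<le> crd a b" if "a \<in> pos" "b \<in> B" for a b using pos_crd[OF pos_R[OF that(1)]] that by simp
 moreover have "a \<in> pos" if "a \<in> R" "\<forall>b\<in>B. 0 \<le> crd a b" for a using pos_crd[OF that(1)] that(2) by simp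
 ultimately have ap: "FN.apos = (\<lambda>a. (a, 0)) ` pos" unfolding FN.apos_def using pos_R by auto
 have pc: "poincare FN.s B I = (\<Prod>x\<in>{x\<in>FN.apos. FN.sup x \<subseteq> I}. hf (nat (FN.aht x)))" if "I \<subseteq> B" for I
  by (rule FN.parabolic_poincare(1)[OF that]) (use indep that in \<open>simp_all add: real_vector.independent_mono inj_on_def\<close>)
 have "Alt FN.s B = (\<Prod>I\<in>Pow B. if even (card I + card B) then (\<Prod>x\<in>{x\<in>FN.apos. FN.sup x \<subseteq> I}. hf (nat (FN.aht x)))
   else inverse (\<Prod>x\<in>{x\<in>FN.apos. FN.sup x \<subseteq> I}. hf (nat (FN.aht x))))"
  unfolding Alt_def by (rule prod.cong) (simp_all add: pc)
 also have "\<dots> = (\<Prod>x\<in>{x\<in>FN.apos. FN.sup x = B}. hf (nat (FN.aht x)))"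
 proof (rule moebius_prod[OF finite_B])
  show "finite FN.apos" unfolding ap by simp
  show "FN.sup x \<subseteq> B" for x by (auto simp: FN.sup_def)
  show "hf (nat (FN.aht x)) * inverse (hf (nat (FN.aht x))) = 1" if "x \<in> FN.apos" for x
   by (rule hf_unit) (use FN.apos_zero[OF that] in simp)
 qed
 also have "{x\<in>FN.apos. FN.sup x = B} = (\<lambda>a. (a, 0)) ` {a \<in> pos. {b \<in> B. crd a b \<noteq> 0} = B}"
  unfolding ap FN.sup_def by auto
 also have "(\<Prod>x\<in>(\<lambda>a. (a, 0)) ` {a \<in> pos. {b \<in> B. crd a b \<noteq> 0} = B}. hf (nat (FN.aht x)))
  = (\<Prod>a\<in>{a \<in> pos. {b \<in> B. crd a b \<noteq> 0} = B}. hf (nht a))"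
 proof (subst prod.reindex)
  show "inj_on (\<lambda>a. (a, 0)) {a \<in> pos. {b \<in> B. crd a b \<noteq> 0} = B}" by (simp add: inj_on_def)
  show "prod ((\<lambda>x. hf (nat (FN.aht x))) \<circ> (\<lambda>a. (a, 0))) {a \<in> pos. {b \<in> B. crd a b \<noteq> 0} = B}
   = (\<Prod>a\<in>{a \<in> pos. {b \<in> B. crd a b \<noteq> 0} = B}. hf (nht a))"
   by (rule prod.cong) (simp_all add: FN.aht_def nht_crd[symmetric])
 qed
 finally show ?thesis unfolding s .
qed

text \<open>Every simple root has a positive coefficient in \<open>theta\<close>, so
  \<open>- theta\<close> is outside the span of any set of simple roots that misses one.\<close>

lemma aff_proper_independent:
 assumes I: "I \<subseteq> aff_simple B" "I \<noteq> aff_simple B"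
 shows "independent ((\<lambda>i. fst (afi i)) ` I)" "inj_on (\<lambda>i. fst (afi i)) I"
proof -
 define J where "J = {b \<in> B. Some b \<in> I}"
 have JB: "J \<subseteq> B" by (auto simp: J_def)
 have iJ: "independent J" using indep JB by (rule real_vector.independent_mono)
 have tJ: "- theta \<notin> span J" if N: "None \<in> I"
 proof
  assume t: "- theta \<in> span J"
  have "\<exists>b\<in>B. b \<notin> J"
  proof (rule ccontr)
   assume n: "\<not> ?thesis"
   then have "Some b \<in> I" if "b \<in> B" for b using that unfolding J_def by blast
   then have "aff_simple B \<subseteq> I" using N unfolding aff_simple_def by blast
   with I(1) have "I = aff_simple B" by (rule subset_antisym)
   with I(2) show False by (rule notE)
  qed
  then obtain b where b: "b \<in> B" "b \<notin> J" by (elim bexE)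
  have "representation B (- theta) = representation J (- theta)" by (rule real_vector.representation_extend[OF indep t JB])
  then have "representation B (- theta) b = 0" using b(2) real_vector.representation_ne_zero[of J "- theta" b] by metis
  then have "representation B theta b = 0" using real_vector.representation_neg[OF indep R_spanB[OF theta_R]] by simp
  then have "crd theta b = 0" by (simp add: crd_def)
  then show False using crd_theta_pos[OF b(1)] by simp
 qed
 have im: "(\<lambda>i. fst (afi i)) ` I = (if None \<in> I then insert (- theta) J else J)"
 proof -
  let ?f = "\<lambda>i. fst (afi i)"
  show ?thesis
  proof (cases "None \<in> I")
   case True
   have "I = insert None (Some ` J)" using I(1) True unfolding aff_simple_def J_def by blast
   then have "?f ` I = ?f ` insert None (Some ` J)" by (rule arg_cong)
   also have "\<dots> = insert (- theta) J" by (simp add: afi_def image_image)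
   finally show ?thesis using True by simp
  next
   case False
   have "I = Some ` J" using I(1) False unfolding aff_simple_def J_def by blast
   then have "?f ` I = ?f ` Some ` J" by (rule arg_cong)
   also have "\<dots> = J" by (simp add: afi_def image_image)
   finally show ?thesis using False by simp
  qed
 qed
 show "independent ((\<lambda>i. fst (afi i)) ` I)"
  unfolding im using iJ tJ by (simp add: real_vector.independent_insertI)
 show "inj_on (\<lambda>i. fst (afi i)) I"
 proof (rule inj_onI)
  fix i j assume ij: "i \<in> I" "j \<in> I" "fst (afi i) = fst (afi j)"
  have ns: "- theta \<noteq> b" if "None \<in> I" "Some b \<in> I" for b
  proof
   assume e: "- theta = b"
   have "b \<in> J" using that(2) I(1) by (auto simp: aff_simple_def J_def)
   then have "- theta \<in> span J" unfolding e by (rule span_base)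
   then show False using tJ[OF that(1)] by contradiction
  qed
  show "i = j"
  proof (cases i)
   case None
   then show ?thesis using ij ns by (cases j) (auto simp: afi_def)
  next
   case (Some b)
   show ?thesis
   proof (cases j)
    case None
    then have "- theta = b" using ij Some by (simp add: afi_def)
    then show ?thesis using ns[of b] ij None Some by simp
   qed (use ij Some in \<open>simp add: afi_def\<close>)
  qed
 qed
qed

text \<open>By \<open>PA_eq\<close> the full series has a factor \<open>hf\<close> for each affine
  root \<open>a\<close> and \<open>1 - a\<close> with \<open>a\<close> positive. The proper
  parabolic subgroups remove exactly the roots in \<open>X\<close>, those that lack some simple
  affine root in their support, and what is left are the \<open>1 - a\<close> of full
  support.\<close>

lemma Alt_affine:
 "Alt AF.s (aff_simple B) * om cnum ^ card B = (\<Prod>a\<in>{a \<in> pos. AF.sup (- a, 1) = aff_simple B}. hf (cnum - nht a))"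
proof -
 let ?S = "aff_simple B"
 have finS: "finite ?S" by (rule AF.finite_S)
 define X where "X = {x \<in> AF.apos. AF.sup x \<noteq> ?S}"
 let ?N = "{a \<in> pos. AF.sup (- a, 1) \<noteq> ?S}" and ?Y = "{a \<in> pos. AF.sup (- a, 1) = ?S}"
 define i0 :: "'a \<Rightarrow> 'a \<times> int" where "i0 a = (a, 0)" for a
 define i1 :: "'a \<Rightarrow> 'a \<times> int" where "i1 a = (- a, 1)" for a
 have ch1: "ch (- a) = 1" if "a \<in> pos" for a using neg_notin_pos[OF that] by (simp add: ch_def)
 \<comment> \<open>A missing simple root is either \<open>None\<close>, which gives the positive
   roots themselves, or some \<open>b\<close> with \<open>k * crd theta b = - crd a b\<close>; as
   the coefficients of \<open>a\<close> are bounded by those of \<open>theta\<close>, a positive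
   \<open>k\<close> is then 1.\<close>
 have X: "X = i0 ` pos \<union> i1 ` ?N"
 proof (intro equalityI subsetI)
  fix x assume x: "x \<in> X"
  obtain a k where xa: "x = (a, k)" by (cases x)
  have xp: "(a, k) \<in> AF.apos" and xs: "AF.sup (a, k) \<noteq> ?S" using x unfolding X_def xa by simp_all
  have aR: "a \<in> R" using AF.apos_\<Phi>[OF xp] by simp
  have ck: "ch a \<le> k" using xp unfolding apos_iff[OF aR] .
  show "x \<in> i0 ` pos \<union> i1 ` ?N"
  proof (cases "k = 0")
   case True
   then have "a \<in> pos" using ck by (simp add: ch_def split: if_splits)
   then show ?thesis unfolding xa True i0_def by blast
  next
   case False
   have k1: "1 \<le> k" using ck False by (simp add: ch_def split: if_splits)
   have "\<exists>i\<in>?S. acf (a, k) i = 0"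
   proof (rule ccontr)
    assume "\<not> ?thesis"
    then have "AF.sup (a, k) = ?S" unfolding AF.sup_def by blast
    with xs show False by (rule notE)
   qed
   then obtain i where i: "i \<in> ?S" "acf (a, k) i = 0" by (elim bexE)
   have "\<exists>b\<in>B. k * crd theta b + crd a b = 0"
   proof (cases i)
    case None
    then show ?thesis using i(2) False by (simp add: acf_def)
   next
    case (Some b)
    then have "b \<in> B" using i(1) by (auto simp: aff_simple_def)
    then show ?thesis using i(2) Some by (intro bexI[of _ b]) (simp_all add: acf_def)
   qed
   then obtain b where b: "b \<in> B" "k * crd theta b + crd a b = 0" by (elim bexE)
   have t: "0 < crd theta b" by (rule crd_theta_pos[OF b(1)])
   have "k * crd theta b \<le> 1 * crd theta b" using b(2) crd_le(2)[OF aR b(1)] by simp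
   then have "k \<le> 1" using t by (simp add: mult_le_cancel_right)
   then have k: "k = 1" using k1 by simp
   have "crd a b < 0" using b(2) t unfolding k by simp
   then have "a \<notin> pos" using pos_crd[OF aR] b(1) by force
   then have p: "- a \<in> pos" using notin_pos[OF aR] by simp
   have "x = i1 (- a)" unfolding xa k i1_def by simp
   moreover have "- a \<in> ?N" using p xs unfolding k by simp
   ultimately show ?thesis by blast
  qed
 next
  fix x assume "x \<in> i0 ` pos \<union> i1 ` ?N"
  then show "x \<in> X"
  proof
   assume "x \<in> i0 ` pos"
   then obtain a where a: "x = (a, 0)" "a \<in> pos" unfolding i0_def by (elim imageE)
   have 1: "(a, 0) \<in> AF.apos" unfolding apos_iff[OF pos_R[OF a(2)]] using a(2) by (simp add: ch_def)
   have "None \<notin> AF.sup (a, 0)" by (simp add: AF.sup_def acf_def)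
   moreover have "None \<in> ?S" by (simp add: aff_simple_def)
   ultimately have "AF.sup (a, 0) \<noteq> ?S" by metis
   then show "x \<in> X" using 1 unfolding X_def a(1) by simp
  next
   assume "x \<in> i1 ` ?N"
   then obtain a where a: "x = (- a, 1)" "a \<in> ?N" unfolding i1_def by (elim imageE)
   have p: "a \<in> pos" using a(2) by simp
   have "(- a, 1) \<in> AF.apos" unfolding apos_iff[OF neg_R[OF pos_R[OF p]]] using ch1[OF p] by simp
   then show "x \<in> X" using a unfolding X_def by simp
  qed
 qed
 have finX: "finite X" unfolding X by simp
 let ?f = "\<lambda>x. hf (nat (AF.aht x))"
 have unit: "?f x * inverse (?f x) = 1" if "x \<in> X" for x
  by (rule hf_unit) (use AF.apos_zero[of x] that in \<open>simp add: X_def\<close>)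
 let ?p = "\<lambda>I. \<Prod>x\<in>{x\<in>X. AF.sup x \<subseteq> I}. ?f x"
 let ?r = "\<Prod>I\<in>Pow ?S - {?S}. if even (card I + card ?S) then ?p I else inverse (?p I)"
 have supS: "AF.sup x \<subseteq> ?S" for x by (auto simp: AF.sup_def)
 have pc: "poincare AF.s ?S I = ?p I" if I: "I \<in> Pow ?S - {?S}" for I
 proof -
  have I': "I \<subseteq> ?S" "I \<noteq> ?S" using I by auto
  have "poincare AF.s ?S I = (\<Prod>x\<in>{x\<in>AF.apos. AF.sup x \<subseteq> I}. ?f x)"
   by (rule AF.parabolic_poincare(1)[OF I'(1) aff_proper_independent[OF I']])
  also have "{x\<in>AF.apos. AF.sup x \<subseteq> I} = {x\<in>X. AF.sup x \<subseteq> I}"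
  proof -
   have "AF.sup x \<noteq> ?S" if "AF.sup x \<subseteq> I" for x
   proof
    assume "AF.sup x = ?S"
    with that have "?S \<subseteq> I" by simp
    with I'(1) have "I = ?S" by (rule subset_antisym)
    with I'(2) show False by (rule notE)
   qed
   then show ?thesis unfolding X_def by blast
  qed
  finally show ?thesis .
 qed
 have A: "Alt AF.s ?S = PA * ?r"
  unfolding Alt_factor[OF finS] by (rule arg_cong2[where f = "(*)", OF refl prod.cong]) (simp_all only: pc)
 have "(\<Prod>I\<in>Pow ?S. if even (card I + card ?S) then ?p I else inverse (?p I)) = (\<Prod>x\<in>{x\<in>X. AF.sup x = ?S}. ?f x)"
  by (rule moebius_prod[OF finS finX supS unit])
 moreover have "{x\<in>X. AF.sup x = ?S} = {}" by (auto simp: X_def)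
 \<comment> \<open>No element of \<open>X\<close> has full support, so the inversion over
   \<open>X\<close> ends in an empty product. Hence the proper parabolic subgroups together
   contribute the inverse of the product over all of \<open>X\<close>.\<close>
 ultimately have m1: "(\<Prod>I\<in>Pow ?S. if even (card I + card ?S) then ?p I else inverse (?p I)) = 1" by (simp only: prod.empty)
 have "(\<Prod>I\<in>Pow ?S. if even (card I + card ?S) then ?p I else inverse (?p I)) = ?p ?S * ?r"
 proof -
  have f: "finite (Pow ?S)" "?S \<in> Pow ?S" and ev: "even (card ?S + card ?S)" using finS by simp_all
  show ?thesis
   using prod.remove[OF f, of "\<lambda>I. if even (card I + card ?S) then ?p I else inverse (?p I)"]
   unfolding if_P[OF ev] .
 qed
 then have R1: "?p ?S * ?r = 1" using m1 by simp
 have "{x\<in>X. AF.sup x \<subseteq> ?S} = X" using supS by auto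
 then have pX: "?p ?S = prod ?f X" by (simp only:)
 have aht0: "nat (AF.aht (i0 a)) = nht a" if "a \<in> pos" for a
  unfolding AF.aht_def sum_aff_simple[OF finite_B] i0_def by (simp add: acf_def nht_crd[OF that, symmetric])
 have aht1: "nat (AF.aht (i1 a)) = cnum - nht a" if a: "a \<in> pos" for a
 proof -
  have "AF.aht (i1 a) = 1 + (\<Sum>b\<in>B. crd theta b + crd (- a) b)"
   unfolding AF.aht_def sum_aff_simple[OF finite_B] i1_def by (simp add: acf_def)
  also have "\<dots> = 1 + int (nht theta) - int (nht a)"
   unfolding nht_crd[OF a] nht_crd[OF highest_pos[OF theta]] by (simp add: crd_minus[OF pos_R[OF a]] sum_subtractf)
  finally show ?thesis using nht_le[OF a] by (simp add: cnum_def)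
 qed
 have inj: "inj_on i0 pos" "inj_on i1 ?N" by (simp_all add: i0_def i1_def inj_on_def)
 have "prod ?f X = prod ?f (i0 ` pos) * prod ?f (i1 ` ?N)"
  unfolding X by (rule prod.union_disjoint) (auto simp: i0_def i1_def)
 also have "prod ?f (i0 ` pos) = (\<Prod>a\<in>pos. hf (nht a))"
  unfolding prod.reindex[OF inj(1)] comp_def by (rule prod.cong) (simp_all only: aht0)
 also have "prod ?f (i1 ` ?N) = (\<Prod>a\<in>?N. hf (cnum - nht a))"
  unfolding prod.reindex[OF inj(2)] comp_def by (rule prod.cong) (simp_all add: aht1)
 finally have pX': "?p ?S = (\<Prod>a\<in>pos. hf (nht a)) * (\<Prod>a\<in>?N. hf (cnum - nht a))" unfolding pX .
 have split: "(\<Prod>a\<in>pos. hf (cnum - nht a)) = (\<Prod>a\<in>?Y. hf (cnum - nht a)) * (\<Prod>a\<in>?N. hf (cnum - nht a))"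
 proof -
  have "pos = ?Y \<union> ?N" by blast
  then have "(\<Prod>a\<in>pos. hf (cnum - nht a)) = (\<Prod>a\<in>?Y \<union> ?N. hf (cnum - nht a))" by (rule arg_cong)
  also have "\<dots> = (\<Prod>a\<in>?Y. hf (cnum - nht a)) * (\<Prod>a\<in>?N. hf (cnum - nht a))" by (rule prod.union_disjoint) auto
  finally show ?thesis .
 qed
 let ?K = "\<Prod>a\<in>?Y. hf (cnum - nht a)"
 have "Alt AF.s ?S * om cnum ^ card B = (PA * om cnum ^ card B) * ?r" unfolding A by (simp only: mult_ac)
 also have "\<dots> = ?K * (?p ?S * ?r)" unfolding PA_eq split pX' by (simp only: mult_ac)
 also have "\<dots> = ?K" unfolding R1 by simp
 finally show ?thesis .
qed

end

section \<open>The formulas in their stated form\<close>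

context spanning_roots
begin

lemma main_formulas:
 "Alt weyl_gen B = (\<Prod>a\<in>{a\<in>pos_roots R B. supp B a = B}.
   (1 - fps_X ^ nat (Defs.ht B a + 1)) * inverse (1 - fps_X ^ nat (Defs.ht B a)))"
 "Alt (aff_gen R B) (aff_simple B) = inverse ((1 - fps_X ^ coxeter_number B) ^ card B) *
   (\<Prod>a\<in>{a\<in>pos_roots R B. aff_supp R B (- a, 1) = aff_simple B}.
    (1 - fps_X ^ nat (int (coxeter_number B) - Defs.ht B a + 1)) * inverse (1 - fps_X ^ nat (int (coxeter_number B) - Defs.ht B a)))"
proof -
 have co: "Defs.coeff B a b = crd a b" for a b by (simp add: coeff_def crd_def)
 have p: "pos_roots R B = pos" unfolding pos_roots_def co using pos_crd pos_R by auto
 have sp: "supp B a = {b \<in> B. crd a b \<noteq> 0}" for a by (simp add: supp_def co)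
 have h: "Defs.ht B a = int (nht a)" if "a \<in> pos" for a by (simp add: Defs.ht_def co nht_crd[OF that])
 have hr: "highest_root R B = theta"
 proof -
  have iff: "is_highest t \<longleftrightarrow> t \<in> R \<and> (\<forall>a\<in>R. \<forall>b\<in>B. Defs.coeff B a b \<le> Defs.coeff B t b)" for t
   unfolding is_highest_def co
  proof (rule conj_cong[OF refl], intro ball_cong refl)
   fix a b assume "t \<in> R" "a \<in> R"
   then show "(representation B a b \<le> representation B t b) = (crd a b \<le> crd t b)"
    using crd[of a b] crd[of t b] by (metis of_int_le_iff)
  qed
  have "is_highest = (\<lambda>t. t \<in> R \<and> (\<forall>a\<in>R. \<forall>b\<in>B. Defs.coeff B a b \<le> Defs.coeff B t b))" by (rule ext) (rule iff)
  then show ?thesis unfolding highest_root_def theta_def by (simp only:)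
 qed
 have gen: "aff_gen R B = AF.s"
  by (rule ext) (simp add: aff_gen_def AF.s_def afi_def hr split: option.split)
 have as: "aff_supp R B x = AF.sup x" for x
  unfolding aff_supp_def AF.sup_def
  by (rule Collect_cong, rule conj_cong[OF refl]) (cases x, simp add: aff_coeff_def acf_def co hr split: option.split)
 show "Alt weyl_gen B = (\<Prod>a\<in>{a\<in>pos_roots R B. supp B a = B}.
   (1 - fps_X ^ nat (Defs.ht B a + 1)) * inverse (1 - fps_X ^ nat (Defs.ht B a)))"
  unfolding Alt_finite p sp
 proof (rule prod.cong[OF refl])
  fix a assume "a \<in> {a \<in> pos. {b \<in> B. crd a b \<noteq> 0} = B}"
  then have a: "a \<in> pos" by simp
  have "nat (int (nht a) + 1) = nht a + 1" by simp
  then show "hf (nht a) = (1 - fps_X ^ nat (Defs.ht B a + 1)) * inverse (1 - fps_X ^ nat (Defs.ht B a))"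
   unfolding h[OF a] hf_def om_def by simp
 qed
 have c0: "0 < cnum" by (simp add: cnum_def)
 have u: "om cnum ^ card B * inverse (om cnum ^ card B) = 1"
  by (rule inverse_mult_eq_1') (simp add: fps_nth_power_0 om_nth_0[OF c0])
 have "Alt AF.s (aff_simple B) = (Alt AF.s (aff_simple B) * om cnum ^ card B) * inverse (om cnum ^ card B)"
  unfolding mult.assoc u by simp
 also have "\<dots> = inverse (om cnum ^ card B) * (\<Prod>a\<in>{a \<in> pos. AF.sup (- a, 1) = aff_simple B}. hf (cnum - nht a))"
  unfolding Alt_affine by (rule mult.commute)
 also have "(\<Prod>a\<in>{a \<in> pos. AF.sup (- a, 1) = aff_simple B}. hf (cnum - nht a))
  = (\<Prod>a\<in>{a \<in> pos. AF.sup (- a, 1) = aff_simple B}. (1 - fps_X ^ nat (int cnum - Defs.ht B a + 1)) * inverse (1 - fps_X ^ nat (int cnum - Defs.ht B a)))"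
 proof (rule prod.cong[OF refl])
  fix a assume "a \<in> {a \<in> pos. AF.sup (- a, 1) = aff_simple B}"
  then have a: "a \<in> pos" by simp
  have "nht a \<le> cnum" using nht_le[OF a] by (simp add: cnum_def)
  then have "nat (int cnum - int (nht a) + 1) = cnum - nht a + 1" "nat (int cnum - int (nht a)) = cnum - nht a" by simp_all
  then show "hf (cnum - nht a) = (1 - fps_X ^ nat (int cnum - Defs.ht B a + 1)) * inverse (1 - fps_X ^ nat (int cnum - Defs.ht B a))"
   unfolding h[OF a] hf_def om_def by (simp only:)
 qed
 finally show "Alt (aff_gen R B) (aff_simple B) = inverse ((1 - fps_X ^ coxeter_number B) ^ card B) *
   (\<Prod>a\<in>{a\<in>pos_roots R B. aff_supp R B (- a, 1) = aff_simple B}.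
    (1 - fps_X ^ nat (int (coxeter_number B) - Defs.ht B a + 1)) * inverse (1 - fps_X ^ nat (int (coxeter_number B) - Defs.ht B a)))"
  unfolding gen p as coxeter_number_eq om_def .
qed

end

theorem theorem5p3:
 fixes R B :: "'a::euclidean_space set"
 assumes "root_system R" and "reduced R" and "irreducible_rs R" and "is_base R B"
 shows "(Alt weyl_gen B =
     (\<Prod>a\<in>{a\<in>pos_roots R B. supp B a = B}.
       (1 - fps_X ^ nat (ht B a + 1)) * inverse (1 - fps_X ^ nat (ht B a)))) \<and>
    Alt (aff_gen R B) (aff_simple B) =
     inverse ((1 - fps_X ^ coxeter_number B) ^ DIM('a)) *
     (\<Prod>a\<in>{a\<in>pos_roots R B. aff_supp R B (- a, 1) = aff_simple B}.
       (1 - fps_X ^ nat (int (coxeter_number B) - ht B a + 1)) *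
       inverse (1 - fps_X ^ nat (int (coxeter_number B) - ht B a)))"
proof -
 note rs = assms(1)[unfolded root_system_def]
 have fin: "finite R" and z: "0 \<notin> R" and sp: "span R = UNIV" using rs by simp_all
 have rc: "root_refl a ` R = R" if "a \<in> R" for a using rs that by simp
 have ci: "(2 * (b \<bullet> a)) / (a \<bullet> a) \<in> \<int>" if "a \<in> R" "b \<in> R" for a b using rs that by simp
 note base = assms(4)[unfolded is_base_def]
 have B: "B \<subseteq> R" "independent B" using base by simp_all
 have ex: "\<exists>c::'a \<Rightarrow> int. a = (\<Sum>b\<in>B. of_int (c b) *\<^sub>R b) \<and> ((\<forall>b\<in>B. c b \<ge> 0) \<or> (\<forall>b\<in>B. c b \<le> 0))" if "a \<in> R" for a
  by (rule bspec[OF conjunct2[OF conjunct2[OF base]] that])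
 have finB: "finite B" by (rule finite_subset[OF B(1) fin])
 have RB: "R \<subseteq> span B"
 proof
  fix a assume "a \<in> R"
  from ex[OF this] obtain c :: "'a \<Rightarrow> int" where c: "a = (\<Sum>b\<in>B. of_int (c b) *\<^sub>R b)" by (elim exE conjE)
  show "a \<in> span B" unfolding c by (intro span_sum span_mul span_base)
 qed
 \<comment> \<open>A Euclidean space has positive dimension, so the empty set cannot span
   it.\<close>
 have ne: "R \<noteq> {}"
 proof
  assume "R = {}"
  then have "(UNIV :: 'a set) = {0}" using sp by simp
  moreover obtain b :: 'a where "b \<in> Basis" using nonempty_Basis by blast
  ultimately show False using nonzero_Basis by blast
 qed
 have full: "span B = UNIV"
 proof -
  have "span R \<subseteq> span B" by (rule span_minimal[OF RB subspace_span])
  then show ?thesis unfolding sp by blast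
 qed
 interpret spanning_roots R B
 proof unfold_locales
  show "root_refl a x \<in> R" if "a \<in> R" "x \<in> R" for a x using rc[OF that(1)] that(2) by blast
  show "cartan a b \<in> \<int>" if "a \<in> R" "b \<in> R" for a b unfolding cartan_def by (rule ci[OF that(2,1)])
  show "c = 1 \<or> c = -1" if "a \<in> R" "c *\<^sub>R a \<in> R" for a c using assms(2) that unfolding reduced_def by blast
  show "(\<forall>b\<in>B. 0 \<le> representation B a b) \<or> (\<forall>b\<in>B. representation B a b \<le> 0)" if a: "a \<in> R" for a
  proof -
   from ex[OF a] obtain c :: "'a \<Rightarrow> int" where c: "a = (\<Sum>b\<in>B. of_int (c b) *\<^sub>R b)" "(\<forall>b\<in>B. c b \<ge> 0) \<or> (\<forall>b\<in>B. c b \<le> 0)" by (elim exE conjE)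
   have "(\<Sum>b\<in>B. (representation B a b - of_int (c b)) *\<^sub>R b) = 0"
    using real_vector.sum_representation_eq[OF B(2) subsetD[OF RB a] finB subset_refl] c(1)
    by (simp add: scaleR_left_diff_distrib sum_subtractf)
   then have "representation B a b = of_int (c b)" if "b \<in> B" for b
    using real_vector.independentD[OF B(2) finB subset_refl, of "\<lambda>b. representation B a b - of_int (c b)" b] that by simp
   then show ?thesis using c(2) by simp
  qed
  show "finite R" "B \<subseteq> R" "independent B" "0 \<notin> R" "R \<subseteq> span B" "irreducible_rs R" "R \<noteq> {}" "span B = UNIV"
   by (rule fin B z RB assms(3) ne full)+
 qed
 have "dim (UNIV :: 'a set) = card B" by (rule dim_eq_card) (simp_all add: full B(2))
 then have d: "DIM('a) = card B" by simp
 show ?thesis unfolding d by (intro conjI main_formulas)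
qed

end
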